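(* Let $n\geq 2$. Then for every integer $N\geq 2n+4$, $$\mathcal{C}_N(S^n\times S^1)=\sqrt{\tfrac{3}{2}}.$$
   Context: $\mathbb{B}^N\subset\mathbb{R}^N$ denotes the closed unit ball. For a smooth manifold $X$ and a smooth immersion $f:X\to\mathbb{B}^N$ (i.e. an immersion into $\mathbb{R}^N$ with image in $\mathbb{B}^N$), let $\mathbf{A}$ be its (vector-valued) second fundamental form in $\mathbb{R}^N$. The maximal normal curvature of $f$ is $\mathfrak{c}(f):=\sup_{|u|=1}|\mathbf{A}(u,u)|$, where the supremum is over all tangent vectors $u$ to $X$ of unit length with respect to the pullback metric $g=f^*g_{\mathbb{R}^N}$. The minimal curvature invariant is $\mathcal{C}_N(X):=\inf \mathfrak{c}(f)$, the infimum being over all smooth immersions $f:X\to\mathbb{B}^N$. *)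

theory Defs
  imports "HOL-Analysis.Analysis"
begin

text \<open>Intended for open \<^term>\<open>S\<close> and finite-dimensional domains, where having all iterated
  directional derivatives up to order \<^term>\<open>k\<close>, each of them differentiable (continuous at the
  top order), is the usual notion of class \<open>C\<^sup>k\<close>.\<close>

primrec Ck_on :: "nat \<Rightarrow> 'a::real_normed_vector set \<Rightarrow> ('a \<Rightarrow> 'b::real_normed_vector) \<Rightarrow> bool" where
  "Ck_on 0 S f \<longleftrightarrow> continuous_on S f"
| "Ck_on (Suc k) S f \<longleftrightarrow>
     (\<forall>x\<in>S. f differentiable (at x)) \<and> (\<forall>v. Ck_on k S (\<lambda>x. frechet_derivative f (at x) v))"

definition smooth_on :: "'a::real_normed_vector set \<Rightarrow> ('a \<Rightarrow> 'b::real_normed_vector) \<Rightarrow> bool" where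
  "smooth_on S f \<longleftrightarrow> (\<forall>k. Ck_on k S f)"

text \<open>Below, \<^term>\<open>X\<close> is an embedded smooth submanifold (without boundary) of a Euclidean space,
  given as a set. A map on \<^term>\<open>X\<close> is smooth iff near every point it is the restriction of a
  smooth map on an open subset of the ambient space. No notion below depends on the values of
  \<^term>\<open>f\<close> outside \<^term>\<open>X\<close>.\<close>

definition local_smooth_extension ::
    "'a::euclidean_space set \<Rightarrow> ('a \<Rightarrow> 'b::euclidean_space) \<Rightarrow> 'a \<Rightarrow> 'a set \<Rightarrow> ('a \<Rightarrow> 'b) \<Rightarrow> bool" where
  "local_smooth_extension X f p W F \<longleftrightarrow>
     open W \<and> p \<in> W \<and> smooth_on W F \<and> (\<forall>q\<in>W \<inter> X. F q = f q)"

definition smooth_map_on :: "'a::euclidean_space set \<Rightarrow> ('a \<Rightarrow> 'b::euclidean_space) \<Rightarrow> bool" where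
  "smooth_map_on X f \<longleftrightarrow> (\<forall>p\<in>X. \<exists>W F. local_smooth_extension X f p W F)"

definition tangent_space :: "'a::euclidean_space set \<Rightarrow> 'a \<Rightarrow> 'a set" where
  "tangent_space X p =
     {v. \<exists>\<gamma> e. e > 0 \<and> smooth_on {-e<..<e} \<gamma> \<and> \<gamma> ` {-e<..<e} \<subseteq> X \<and> \<gamma> 0 = p \<and>
             (\<gamma> has_vector_derivative v) (at (0::real))}"

text \<open>For \<^term>\<open>u\<close> tangent to \<^term>\<open>X\<close> at \<^term>\<open>p\<close>, the derivative of a local extension in
  direction \<^term>\<open>u\<close> does not depend on the extension.\<close>

definition differential ::
    "'a::euclidean_space set \<Rightarrow> ('a \<Rightarrow> 'b::euclidean_space) \<Rightarrow> 'a \<Rightarrow> 'a \<Rightarrow> 'b" where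
  "differential X f p u =
     (THE w. \<exists>W F. local_smooth_extension X f p W F \<and> w = frechet_derivative F (at p) u)"

definition smooth_immersion_on :: "'a::euclidean_space set \<Rightarrow> ('a \<Rightarrow> 'b::euclidean_space) \<Rightarrow> bool" where
  "smooth_immersion_on X f \<longleftrightarrow>
     smooth_map_on X f \<and> (\<forall>p\<in>X. inj_on (differential X f p) (tangent_space X p))"

definition normal_component ::
    "'a::euclidean_space set \<Rightarrow> ('a \<Rightarrow> 'b::euclidean_space) \<Rightarrow> 'a \<Rightarrow> 'b \<Rightarrow> 'b" where
  "normal_component X f p w =
     (THE y. (\<forall>z \<in> differential X f p ` tangent_space X p. orthogonal z y) \<and>
             w - y \<in> differential X f p ` tangent_space X p)"

definition smooth_tangent_field :: "'a::euclidean_space set \<Rightarrow> ('a \<Rightarrow> 'a) \<Rightarrow> bool" where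
  "smooth_tangent_field X V \<longleftrightarrow> smooth_map_on X V \<and> (\<forall>q\<in>X. V q \<in> tangent_space X q)"

text \<open>The vector \<open>A(u, v)\<close> is the component normal to the immersion of the flat derivative
  \<open>D\<^sub>u (df V)\<close>, where \<^term>\<open>V\<close> is any smooth tangent field with value \<^term>\<open>v\<close> at \<^term>\<open>p\<close>;
  tensoriality makes this independent of \<^term>\<open>V\<close>.\<close>

definition second_fundamental_form ::
    "'a::euclidean_space set \<Rightarrow> ('a \<Rightarrow> 'b::euclidean_space) \<Rightarrow> 'a \<Rightarrow> 'a \<Rightarrow> 'a \<Rightarrow> 'b" where
  "second_fundamental_form X f p u v =
     (THE w. \<exists>V. smooth_tangent_field X V \<and> V p = v \<and>
        w = normal_component X f p (differential X (\<lambda>q. differential X f q (V q)) p u))"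

text \<open>The length of \<^term>\<open>u\<close> in the pullback metric is \<^term>\<open>norm (differential X f p u)\<close>.
  Extended reals make the supremum and infimum unconditional: an unbounded set of normal
  curvatures has supremum \<open>\<infinity>\<close>, and so has the infimum if no immersion exists.\<close>

definition max_normal_curvature ::
    "'a::euclidean_space set \<Rightarrow> ('a \<Rightarrow> 'b::euclidean_space) \<Rightarrow> ereal" where
  "max_normal_curvature X f =
     (SUP (p, u) \<in> {(p, u). p \<in> X \<and> u \<in> tangent_space X p \<and> norm (differential X f p u) = 1}.
        ereal (norm (second_fundamental_form X f p u u)))"

text \<open>The type argument is the target Euclidean space.\<close>

definition minimal_curvature :: "'b::euclidean_space itself \<Rightarrow> 'a::euclidean_space set \<Rightarrow> ereal" where
  "minimal_curvature _ X =
     (INF f \<in> {f :: 'a \<Rightarrow> 'b. smooth_immersion_on X f \<and> f ` X \<subseteq> cball 0 1}.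
        max_normal_curvature X f)"

end

theory Submission
  imports Defs
begin

text \<open>The upper bound is attained by \<open>(x, z) \<mapsto> (sqrt (2/3) z x, sqrt (1/3) z\<^sup>2)\<close> for \<open>x\<close> in the
  \<open>n\<close>-sphere and \<open>z\<close> in the complex unit circle.

  For the lower bound suppose that all normal curvatures of an immersion into the unit ball are at
  most \<open>\<kappa> < sqrt (3/2)\<close>, and let \<open>y\<close> be the position vector. A maximum principle bounds the tangential
  part of \<open>y\<close> by \<open>|P y|\<^sup>2 \<le> (1 - |y|\<^sup>2) / 2\<close>. With the Gauss equation and the parallelogram bound on
  \<open>A(t, e)\<close> this shows that the conformal metric \<open>exp (- 3 |y|\<^sup>2) |dy|\<^sup>2\<close> has sectional curvature bounded
  below by a positive multiple of \<open>3 - 2 \<kappa>\<^sup>2\<close>. This contradicts the theorem of Bonnet and Myers,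
  because the universal cover of the product with the circle contains arbitrarily long minimising
  geodesics.

  The Bonnet--Myers argument is carried out on polygonal chains with \<open>k\<close> edges that minimise a discrete
  conformal energy, so that compactness replaces the theory of geodesics. A single test field,
  transported along the chain, gives a second variation that is negative of order \<open>1 / k\<close>, up to an error of
  order \<open>1 / k\<^sup>2\<close>.
  Extending the immersion to be homogeneous of degree 0 in both factors turns its second fundamental
  form into the normal part of an ordinary second derivative.\<close>

section \<open>Quantities of a given order\<close>

text \<open>The induced metric is not enough: for it, the Gauss equation and the parallelogram bound
  only give sectional curvature at least \<open>- 2 \<kappa>\<^sup>2\<close>. What helps is that the
  image is bounded. The weight \<open>exp (- \<lambda> |y|\<^sup>2)\<close> brings in the Hessian of
  \<open>|y|\<^sup>2\<close>; completing the square in \<open>A t t + A e e\<close> then leaves, for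
  orthonormal \<open>t\<close>, \<open>e\<close> and up to a positive factor, at least \<open>2
  \<lambda> - (\<lambda>\<^sup>2 / 3) (|N|\<^sup>2 + 3 |P y|\<^sup>2) - 2 \<kappa>\<^sup>2\<close>
  with \<open>N = y - P y\<close>. The maximum principle says exactly that \<open>|N|\<^sup>2 + 3 |P
  y|\<^sup>2 = |y|\<^sup>2 + 2 |P y|\<^sup>2\<close> is at most 1, and
  \<open>2 \<lambda> - \<lambda>\<^sup>2 / 3\<close> has its maximum 3 at
  \<open>\<lambda> = 3\<close>: hence the exponent and the threshold. Chains have a price. An edge
  contributes only O(1/k^2) to the second variation, so every expansion must be correct up to
  O(1/k^3), uniformly in the chain, the edge and the test vector. This requires edge lengths
  comparable to 1/k, which minimality gives only indirectly, through approximate conservation of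
  speed.\<close>

locale scale =
  fixes I :: "'i set" and h :: "'i \<Rightarrow> real"
  assumes h_nonneg: "i \<in> I \<Longrightarrow> 0 \<le> h i" and h_le_1: "i \<in> I \<Longrightarrow> h i \<le> 1"
begin

text \<open>Big O with a single constant for the whole index set. The indices range over chains,
  edges and even test vectors at once, which is how uniformity is obtained; \<open>h \<le> 1\<close>
  allows an order to be weakened.\<close>

definition ord :: "nat \<Rightarrow> ('i \<Rightarrow> 'v::real_normed_vector) \<Rightarrow> bool" where
  "ord j f \<longleftrightarrow> (\<exists>C\<ge>0. \<forall>i\<in>I. norm (f i) \<le> C * h i ^ j)"

lemma ordI:
  assumes "\<And>i. i \<in> I \<Longrightarrow> norm (f i) \<le> C * h i ^ j"
  shows "ord j f"
proof -
  have "norm (f i) \<le> max 0 C * h i ^ j" if "i \<in> I" for i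
    using assms[OF that] mult_right_mono[of C "max 0 C" "h i ^ j"] h_nonneg[OF that] by force
  thus ?thesis unfolding ord_def by (intro exI[of _ "max 0 C"]) auto
qed

lemma ordE:
  assumes "ord j f"
  obtains C where "C \<ge> 0" "\<And>i. i \<in> I \<Longrightarrow> norm (f i) \<le> C * h i ^ j"
  using assms unfolding ord_def by blast

lemma ord_by:
  assumes "ord j g" "n \<le> j" "\<And>i. i \<in> I \<Longrightarrow> f i = g i"
  shows "ord n f"
proof -
  from ordE[OF assms(1)] obtain C where C: "C \<ge> 0" "\<And>i. i \<in> I \<Longrightarrow> norm (g i) \<le> C * h i ^ j"
    by metis
  show ?thesis
  proof (rule ordI)
    fix i assume i: "i \<in> I"
    have "C * h i ^ j \<le> C * h i ^ n"
      by (intro mult_left_mono power_decreasing assms h_nonneg h_le_1 i C)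
    thus "norm (f i) \<le> C * h i ^ n" using C(2)[OF i] assms(3)[OF i] by simp
  qed
qed

lemma ord_le: "ord j f \<Longrightarrow> n \<le> j \<Longrightarrow> ord n f"
  by (rule ord_by) auto

lemma ord_norm_mono:
  assumes "ord j g" "\<And>i. i \<in> I \<Longrightarrow> norm (f i) \<le> norm (g i)"
  shows "ord j f"
  using assms unfolding ord_def by (meson order_trans)

lemma ord_add:
  assumes "ord j f" "ord j g"
  shows "ord j (\<lambda>i. f i + g i)"
proof -
  from ordE[OF assms(1)] obtain C where C: "\<And>i. i \<in> I \<Longrightarrow> norm (f i) \<le> C * h i ^ j" by metis
  from ordE[OF assms(2)] obtain D where D: "\<And>i. i \<in> I \<Longrightarrow> norm (g i) \<le> D * h i ^ j" by metis
  show ?thesis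
    by (rule ordI[of _ "C + D"])
       (use C D in \<open>auto simp: distrib_right intro!: norm_triangle_le add_mono\<close>)
qed

lemma ord_uminus: "ord j f \<Longrightarrow> ord j (\<lambda>i. - f i)"
  by (simp add: ord_def)

lemma ord_diff: "ord j f \<Longrightarrow> ord j g \<Longrightarrow> ord j (\<lambda>i. f i - g i)"
  using ord_add[OF _ ord_uminus] by fastforce

lemma ord_const: "ord 0 (\<lambda>_. c)"
  by (rule ordI[of _ "norm c"]) simp

lemma ord_prod:
  assumes "ord j f" "ord l g" "\<And>i. i \<in> I \<Longrightarrow> norm (p i) \<le> c * (norm (f i) * norm (g i))"
  shows "ord (j + l) p"
proof -
  from ordE[OF assms(1)] obtain C where
    C: "C \<ge> 0" "\<And>i. i \<in> I \<Longrightarrow> norm (f i) \<le> C * h i ^ j" by metis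
  from ordE[OF assms(2)] obtain D where
    D: "D \<ge> 0" "\<And>i. i \<in> I \<Longrightarrow> norm (g i) \<le> D * h i ^ l" by metis
  show ?thesis
  proof (rule ordI)
    fix i assume i: "i \<in> I"
    have "norm (p i) \<le> \<bar>c\<bar> * (norm (f i) * norm (g i))"
      using assms(3)[OF i] by (meson abs_ge_self mult_nonneg_nonneg mult_right_mono norm_ge_zero order_trans)
    also have "\<dots> \<le> \<bar>c\<bar> * ((C * h i ^ j) * (D * h i ^ l))"
      by (intro mult_left_mono mult_mono C D i mult_nonneg_nonneg zero_le_power h_nonneg) auto
    finally show "norm (p i) \<le> (\<bar>c\<bar> * C * D) * h i ^ (j + l)"
      by (simp add: power_add ac_simps)
  qed
qed

lemma ord_scaleR: "ord j f \<Longrightarrow> ord l g \<Longrightarrow> ord (j + l) (\<lambda>i. f i *\<^sub>R g i)"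
  by (rule ord_prod[where c = 1]) auto

lemma ord_mult:
  fixes f g :: "'i \<Rightarrow> real"
  shows "ord j f \<Longrightarrow> ord l g \<Longrightarrow> ord (j + l) (\<lambda>i. f i * g i)"
  by (rule ord_prod[where c = 1]) (auto simp: abs_mult)

lemma ord_inner: "ord j f \<Longrightarrow> ord l g \<Longrightarrow> ord (j + l) (\<lambda>i. f i \<bullet> g i)"
  by (rule ord_prod[where c = 1]) (auto simp: Cauchy_Schwarz_ineq2)

lemma ord_cmult: "ord j f \<Longrightarrow> ord j (\<lambda>i. (c::real) * f i)"
  using ord_mult[OF ord_const] by fastforce

lemma ord_cscaleR: "ord j f \<Longrightarrow> ord j (\<lambda>i. (c::real) *\<^sub>R f i)"
  using ord_scaleR[OF ord_const] by fastforce

lemma ord_norm: "ord j f \<Longrightarrow> ord j (\<lambda>i. norm (f i))"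
  by (simp add: ord_def)

lemma ord_power2_norm: "ord j f \<Longrightarrow> ord (2 * j) (\<lambda>i. (norm (f i))\<^sup>2)"
  unfolding power2_eq_square mult_2 by (intro ord_mult ord_norm)

lemma ord_exp_bounded:
  assumes "ord 0 f"
  shows "ord 0 (\<lambda>i. exp (f i :: real))"
proof -
  from ordE[OF assms] obtain C where C: "\<And>i. i \<in> I \<Longrightarrow> norm (f i) \<le> C * h i ^ 0" by metis
  show ?thesis by (rule ordI[of _ "exp C"]) (use C in force)
qed

end

text \<open>A bound for all real \<open>d\<close>, so that exponentials can be expanded without
  assuming the exponent small. The estimate \<open>exp d - 1 \<le> d * exp d\<close> is
  \<open>1 - d \<le> exp (- d)\<close> multiplied by \<open>exp d\<close>.\<close>

lemma exp_minus_one_minus_bound: "\<bar>exp d - 1 - d\<bar> \<le> d\<^sup>2 * exp \<bar>d\<bar>" for d :: real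
proof -
  have 1: "0 \<le> exp d - 1 - d" using exp_ge_add_one_self[of d] by linarith
  have "exp d * (1 - d) \<le> exp d * exp (- d)"
    by (intro mult_left_mono) (use exp_ge_add_one_self[of "- d"] in auto)
  hence 2: "exp d - 1 \<le> d * exp d" by (simp add: exp_minus algebra_simps)
  have "exp d - 1 - d \<le> d * (exp d - 1)" using 2 by (simp add: algebra_simps)
  also have "\<dots> \<le> d\<^sup>2 * exp \<bar>d\<bar>"
  proof (cases "d \<ge> 0")
    case True
    have "d * (exp d - 1) \<le> d * (d * exp d)" by (intro mult_left_mono 2 True)
    thus ?thesis using True by (simp add: power2_eq_square)
  next
    case False
    hence "d * (exp d - 1) \<le> d * d"
      by (intro mult_left_mono_neg) (use exp_ge_add_one_self[of d] False in linarith)+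
    also have "\<dots> \<le> d\<^sup>2 * exp \<bar>d\<bar>" by (simp add: power2_eq_square mult_le_cancel_left1)
    finally show ?thesis .
  qed
  finally show ?thesis using 1 by linarith
qed

context scale
begin

lemma ord_exp:
  assumes "ord j f"
  shows "ord (2 * j) (\<lambda>i. exp (f i :: real) - 1 - f i)"
proof -
  have 0: "ord 0 (\<lambda>i. exp \<bar>f i\<bar>)"
    using ord_exp_bounded[OF ord_norm[OF ord_le[OF assms le0]]] by simp
  have "ord (2 * j) (\<lambda>i. (norm (f i))\<^sup>2 * exp \<bar>f i\<bar>)"
    using ord_mult[OF ord_power2_norm[OF assms] 0] by simp
  thus ?thesis
    by (rule ord_norm_mono) (use exp_minus_one_minus_bound in \<open>auto simp: abs_mult\<close>)
qed

end

section \<open>Three consecutive vertices of a discrete geodesic\<close>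

definition orth_proj :: "('v::euclidean_space \<Rightarrow> 'v) \<Rightarrow> bool" where
  "orth_proj P \<longleftrightarrow> linear P \<and> (\<forall>x. P (P x) = P x) \<and> (\<forall>x z. P x \<bullet> z = x \<bullet> P z)"

text \<open>\<open>P\<close> is the projection to a tangent space and \<open>A\<close> the second fundamental form there, extended by
  \<open>A u v = A (P u) (P v)\<close>.\<close>

definition normal_form :: "real \<Rightarrow> ('v::euclidean_space \<Rightarrow> 'v) \<Rightarrow> ('v \<Rightarrow> 'v \<Rightarrow> 'v) \<Rightarrow> bool" where
  "normal_form \<kappa> P A \<longleftrightarrow> bilinear A \<and> (\<forall>u v. A u v = A v u) \<and> (\<forall>u v. P (A u v) = 0) \<and>
     (\<forall>u v. A (P u) v = A u v) \<and> (\<forall>v. norm (A v v) \<le> \<kappa> * (norm (P v))\<^sup>2)"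

context
  fixes P :: "'v::euclidean_space \<Rightarrow> 'v"
  assumes P: "orth_proj P"
begin

lemma orth_proj_linear: "linear P"
  and orth_proj_idem: "P (P x) = P x"
  and orth_proj_self_adjoint: "P x \<bullet> z = x \<bullet> P z"
  using P by (auto simp: orth_proj_def)

lemma orth_proj_norm_sq: "(norm (P x))\<^sup>2 = P x \<bullet> x"
  by (metis orth_proj_idem orth_proj_self_adjoint power2_norm_eq_inner)

lemma orth_proj_norm_le: "norm (P x) \<le> norm x"
proof -
  have "norm (P x) * norm (P x) \<le> norm (P x) * norm x"
    using orth_proj_norm_sq[of x] Cauchy_Schwarz_ineq2[of "P x" x] by (simp add: power2_eq_square)
  thus ?thesis by (cases "norm (P x) = 0") (auto simp: mult_le_cancel_left)
qed

lemma orth_proj_inner_compl: "P x \<bullet> (z - P z) = 0"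
  by (metis cancel_comm_monoid_add_class.diff_cancel inner_commute inner_diff_left orth_proj_idem
      orth_proj_self_adjoint)

lemma orth_proj_pythagoras: "(norm x)\<^sup>2 = (norm (P x))\<^sup>2 + (norm (x - P x))\<^sup>2"
proof -
  have "(norm (P x + (x - P x)))\<^sup>2 = (norm (P x))\<^sup>2 + (norm (x - P x))\<^sup>2"
    by (rule norm_add_Pythagorean) (simp add: orthogonal_def orth_proj_inner_compl)
  thus ?thesis by simp
qed

lemma orth_proj_compl_norm_le: "norm (x - P x) \<le> norm x"
proof -
  have "(norm (x - P x))\<^sup>2 \<le> (norm x)\<^sup>2" using orth_proj_pythagoras[of x] by simp
  thus ?thesis by (rule power2_le_imp_le) simp
qed

end

context
  fixes \<kappa> :: real and P :: "'v::euclidean_space \<Rightarrow> 'v" and A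
  assumes A: "normal_form \<kappa> P A" and P: "orth_proj P" and \<kappa>: "\<kappa> \<ge> 0"
begin

lemma normal_form_sym: "A u v = A v u"
  and normal_form_bilinear: "bilinear A"
  and normal_form_normal: "P (A u v) = 0"
  and normal_form_tangential: "A (P u) v = A u v"
  and normal_form_bound: "norm (A v v) \<le> \<kappa> * (norm (P v))\<^sup>2"
  using A by (auto simp: normal_form_def)

lemmas normal_form_simps =
  bilinear_ladd[OF normal_form_bilinear] bilinear_radd[OF normal_form_bilinear]
  bilinear_lsub[OF normal_form_bilinear] bilinear_rsub[OF normal_form_bilinear]
  bilinear_lmul[OF normal_form_bilinear] bilinear_rmul[OF normal_form_bilinear]
  bilinear_lneg[OF normal_form_bilinear] bilinear_rneg[OF normal_form_bilinear]
  bilinear_lzero[OF normal_form_bilinear] bilinear_rzero[OF normal_form_bilinear]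

text \<open>Polarisation together with the parallelogram law: for unit vectors the squared diagonals
  add up to 4, which cancels the factor 4 of the polarisation and keeps the constant
  \<open>\<kappa>\<close>.\<close>

lemma normal_form_norm_le: "norm (A u v) \<le> \<kappa> * norm u * norm v"
proof -
  have sq: "norm (A w w) \<le> \<kappa> * (norm w)\<^sup>2" for w
    by (rule order_trans[OF normal_form_bound])
       (intro mult_left_mono power_mono orth_proj_norm_le[OF P] \<kappa> norm_ge_zero)
  have unit: "norm (A x z) \<le> \<kappa>" if "norm x = 1" "norm z = 1" for x z
  proof -
    have "4 *\<^sub>R A x z = A (x + z) (x + z) - A (x - z) (x - z)"
      unfolding normal_form_simps normal_form_sym[of z x]
      by (rule euclidean_eqI) (simp add: inner_simps)
    hence "4 * norm (A x z) \<le> norm (A (x + z) (x + z)) + norm (A (x - z) (x - z))"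
      by (metis norm_scaleR abs_numeral norm_triangle_ineq4)
    also have "\<dots> \<le> \<kappa> * ((norm (x + z))\<^sup>2 + (norm (x - z))\<^sup>2)"
      using sq[of "x + z"] sq[of "x - z"] by (simp add: distrib_left)
    also have "(norm (x + z))\<^sup>2 + (norm (x - z))\<^sup>2 = 2 * (norm x)\<^sup>2 + 2 * (norm z)\<^sup>2"
      by (simp add: power2_norm_eq_inner algebra_simps)
    finally show ?thesis using that by simp
  qed
  show ?thesis
  proof (cases "u = 0 \<or> v = 0")
    case True
    thus ?thesis by (auto simp: normal_form_simps)
  next
    case False
    have "norm (A ((1 / norm u) *\<^sub>R u) ((1 / norm v) *\<^sub>R v)) \<le> \<kappa>"
      by (rule unit) (use False in auto)
    thus ?thesis using False by (simp add: normal_form_simps field_simps)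
  qed
qed

end

context scale
begin

lemma ord_proj:
  "ord j f \<Longrightarrow> (\<And>i. i \<in> I \<Longrightarrow> orth_proj (P i)) \<Longrightarrow> ord j (\<lambda>i. P i (f i))"
  by (rule ord_norm_mono) (auto intro: orth_proj_norm_le)

lemma ord_proj_compl:
  "ord j f \<Longrightarrow> (\<And>i. i \<in> I \<Longrightarrow> orth_proj (P i)) \<Longrightarrow> ord j (\<lambda>i. f i - P i (f i))"
  by (rule ord_norm_mono) (auto intro: orth_proj_compl_norm_le)

lemma ord_normal_form:
  assumes "ord j f" "ord l g" "\<kappa> \<ge> 0"
    and "\<And>i. i \<in> I \<Longrightarrow> orth_proj (P i)" "\<And>i. i \<in> I \<Longrightarrow> normal_form \<kappa> (P i) (A i)"
  shows "ord (j + l) (\<lambda>i. A i (f i) (g i))"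
  by (rule ord_prod[OF assms(1,2), where c = \<kappa>])
     (simp add: normal_form_norm_le[OF assms(5,4,3)] flip: mult.assoc)

end

text \<open>The conformal factor \<open>exp (- 3 |y|\<^sup>2)\<close>, averaged geometrically over both ends of an edge.\<close>

definition conf_weight :: "'v::euclidean_space \<Rightarrow> 'v \<Rightarrow> real" where
  "conf_weight y z = exp (- (3/2) * ((norm y)\<^sup>2 + (norm z)\<^sup>2))"

lemma conf_weight_pos: "conf_weight y z > 0"
  by (simp add: conf_weight_def)

text \<open>Up to the factor \<open>- 2\<close>, the gradient with respect to \<open>y\<close> of the energy of the edges \<open>x y\<close> and \<open>y z\<close>.\<close>

definition el_vector :: "'v::euclidean_space \<Rightarrow> 'v \<Rightarrow> 'v \<Rightarrow> 'v" where
  "el_vector x y z = conf_weight y z *\<^sub>R (z - y) - conf_weight x y *\<^sub>R (y - x)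
     + ((3/2) * (conf_weight y z * (norm (z - y))\<^sup>2 + conf_weight x y * (norm (y - x))\<^sup>2)) *\<^sub>R y"

text \<open>At the vertex \<open>y\<close> the incoming edge is \<open>u\<close> and the outgoing
  edge is \<open>v\<close>. Both are chords of a submanifold, so the normal part is half the second
  fundamental form; seen from \<open>y\<close> the incoming chord is \<open>- u\<close>, which
  explains the opposite sign in \<open>Nu\<close>. Criticality of the energy enters through
  \<open>el\<close>.\<close>

locale triple = scale I h for I :: "'i set" and h +
  fixes \<kappa> :: real and x y z :: "'i \<Rightarrow> 'v::euclidean_space" and P :: "'i \<Rightarrow> 'v \<Rightarrow> 'v" and A :: "'i \<Rightarrow> 'v \<Rightarrow> 'v \<Rightarrow> 'v"
    and u v
  assumes \<kappa>: "\<kappa> \<ge> 0"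
    and P: "i \<in> I \<Longrightarrow> orth_proj (P i)" and A: "i \<in> I \<Longrightarrow> normal_form \<kappa> (P i) (A i)"
    and y_le: "i \<in> I \<Longrightarrow> norm (y i) \<le> 1"
    and u_def: "u = (\<lambda>i. y i - x i)" and v_def: "v = (\<lambda>i. z i - y i)"
    and u: "ord 1 u" and v: "ord 1 v"
    and Nv: "ord 3 (\<lambda>i. (v i - P i (v i)) - (1/2) *\<^sub>R A i (v i) (v i))"
    and Nu: "ord 3 (\<lambda>i. (u i - P i (u i)) + (1/2) *\<^sub>R A i (u i) (u i))"
    and el: "i \<in> I \<Longrightarrow> P i (el_vector (x i) (y i) (z i)) = 0"
begin

definition "gu = (\<lambda>i. conf_weight (x i) (y i))"
definition "gv = (\<lambda>i. conf_weight (y i) (z i))"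
definition "D = (\<lambda>i. v i - u i)"

lemma y: "ord 0 y"
  by (rule ordI[of _ 1]) (use y_le in auto)

lemma P_lin: "i \<in> I \<Longrightarrow> linear (P i)"
  using P orth_proj_linear by auto

lemmas P_simps = linear_add[OF P_lin] linear_diff[OF P_lin] linear_scale[OF P_lin] linear_0[OF P_lin]

lemmas A_simps = normal_form_simps[OF A P \<kappa>]

lemma g0: "ord 0 gu" "ord 0 gv" "ord 0 (\<lambda>i. 1 / gv i)"
proof -
  have x: "ord 0 x" by (rule ord_by[OF ord_diff[OF y ord_le[OF u]]]) (auto simp: u_def)
  have z: "ord 0 z" by (rule ord_by[OF ord_add[OF y ord_le[OF v]]]) (auto simp: v_def)
  have sq: "ord 0 (\<lambda>i. (norm (w i))\<^sup>2)" if "ord 0 w" for w :: "'i \<Rightarrow> 'v"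
    using ord_power2_norm[OF that] by simp
  show "ord 0 gu" unfolding gu_def conf_weight_def
    by (intro ord_exp_bounded ord_cmult ord_add sq x y)
  show "ord 0 gv" unfolding gv_def conf_weight_def
    by (intro ord_exp_bounded ord_cmult ord_add sq z y)
  have "ord 0 (\<lambda>i. exp (3/2 * ((norm (y i))\<^sup>2 + (norm (z i))\<^sup>2)))"
    by (intro ord_exp_bounded ord_cmult ord_add sq z y)
  thus "ord 0 (\<lambda>i. 1 / gv i)"
    by (rule ord_by) (auto simp: gv_def conf_weight_def exp_minus field_simps)
qed

lemma weight_diff: "ord 2 (\<lambda>i. gv i - gu i - gv i * (- 3 * ((u i + v i) \<bullet> y i)))"
proof -
  \<comment> \<open>\<open>d\<close> is exactly the logarithm of \<open>gv i / gu i\<close>, because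
    \<open>|z|\<^sup>2 - |x|\<^sup>2 = (z - x) \<bullet> (z + x)\<close> with
    \<open>z - x = u + v\<close> and \<open>z + x = 2 y + v - u\<close>.\<close>
  define d where "d = (\<lambda>i. - 3 * ((u i + v i) \<bullet> y i) - (3/2) * ((u i + v i) \<bullet> (v i - u i)))"
  have d1: "ord 1 d"
    unfolding d_def
    by (intro ord_diff ord_cmult ord_by[OF ord_inner[OF ord_add[OF u v] y]]
        ord_by[OF ord_inner[OF ord_add[OF u v] ord_diff[OF v u]]]) auto
  have gu: "gu i = gv i * exp (- d i)" if "i \<in> I" for i
  proof -
    have zx: "z i = y i + v i" "x i = y i - u i" by (auto simp: u_def v_def)
    show ?thesis
      unfolding zx gu_def gv_def conf_weight_def d_def exp_add[symmetric] power2_norm_eq_inner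
      by (simp add: inner_commute algebra_simps)
  qed
  have "ord (2 * 1) (\<lambda>i. exp (- d i) - 1 - (- d i))"
    by (intro ord_exp ord_uminus d1)
  from ord_mult[OF g0(2) this]
  have 1: "ord 2 (\<lambda>i. gv i * (exp (- d i) - 1 - (- d i)))" by (rule ord_le) simp
  have 2: "ord 2 (\<lambda>i. gv i * (- (3/2) * ((u i + v i) \<bullet> (v i - u i))))"
    by (rule ord_le[OF ord_mult[OF g0(2) ord_cmult[OF ord_inner[OF ord_add[OF u v] ord_diff[OF v u]]]]]) auto
  show ?thesis
    by (rule ord_by[OF ord_diff[OF 2 1]]) (auto simp: gu d_def algebra_simps)
qed

lemma weight_diff1: "ord 1 (\<lambda>i. gv i - gu i)"
proof -
  have 1: "ord 1 (\<lambda>i. gv i * (- 3 * ((u i + v i) \<bullet> y i)))"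
    by (rule ord_le[OF ord_mult[OF g0(2) ord_cmult[OF ord_inner[OF ord_add[OF u v] y]]]]) auto
  show ?thesis
    by (rule ord_by[OF ord_add[OF ord_le[OF weight_diff, of 1] 1]]) auto
qed

definition "w = (\<lambda>i. gv i * (norm (v i))\<^sup>2 + gu i * (norm (u i))\<^sup>2)"

lemma w: "ord 2 w"
  unfolding w_def
  by (rule ord_by[OF ord_add[OF ord_mult[OF g0(2) ord_power2_norm[OF v]] ord_mult[OF g0(1) ord_power2_norm[OF u]]]]) auto

lemma el_eq: "el_vector (x i) (y i) (z i) = gv i *\<^sub>R v i - gu i *\<^sub>R u i + ((3/2) * w i) *\<^sub>R y i"
proof -
  have "y i - x i = u i" "z i - y i = v i" by (simp_all add: u_def v_def)
  thus ?thesis by (simp add: el_vector_def w_def gv_def gu_def)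
qed

text \<open>The second difference \<open>D = z - 2 y + x\<close> has its normal part prescribed by
  the submanifold; the tangential part is determined by the Euler--Lagrange equation, which is
  solved for it here.\<close>

lemma PD_eq:
  assumes "i \<in> I"
  shows "P i (D i) = (1 / gv i) *\<^sub>R (- ((3/2) * w i) *\<^sub>R P i (y i) - (gv i - gu i) *\<^sub>R P i (u i))"
proof -
  have g: "gv i \<noteq> 0" using conf_weight_pos[of "y i" "z i"] by (simp add: gv_def)
  have "gv i *\<^sub>R P i (v i) - gu i *\<^sub>R P i (u i) + ((3/2) * w i) *\<^sub>R P i (y i) = 0"
    using el[OF assms] unfolding el_eq by (simp add: P_simps[OF assms])
  moreover have "gv i *\<^sub>R P i (D i) - (- ((3/2) * w i) *\<^sub>R P i (y i) - (gv i - gu i) *\<^sub>R P i (u i))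
      = gv i *\<^sub>R P i (v i) - gu i *\<^sub>R P i (u i) + ((3/2) * w i) *\<^sub>R P i (y i)"
    unfolding D_def P_simps[OF assms] by (rule euclidean_eqI) (simp add: inner_simps algebra_simps)
  ultimately have "gv i *\<^sub>R P i (D i) = - ((3/2) * w i) *\<^sub>R P i (y i) - (gv i - gu i) *\<^sub>R P i (u i)"
    by simp
  hence "(1 / gv i) *\<^sub>R (gv i *\<^sub>R P i (D i)) = (1 / gv i) *\<^sub>R (- ((3/2) * w i) *\<^sub>R P i (y i) - (gv i - gu i) *\<^sub>R P i (u i))"
    by simp
  thus ?thesis using g by simp
qed

lemma N2: "ord 2 (\<lambda>i. v i - P i (v i))" "ord 2 (\<lambda>i. u i - P i (u i))"
proof -
  have "ord 2 (\<lambda>i. (1/2) *\<^sub>R A i (v i) (v i))" "ord 2 (\<lambda>i. (1/2) *\<^sub>R A i (u i) (u i))"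
    using ord_cscaleR[OF ord_normal_form[OF v v \<kappa> P A]]
      ord_cscaleR[OF ord_normal_form[OF u u \<kappa> P A]] by (auto simp: numeral_2_eq_2)
  from ord_add[OF ord_le[OF Nv, of 2] this(1)] ord_diff[OF ord_le[OF Nu, of 2] this(2)]
  show "ord 2 (\<lambda>i. v i - P i (v i))" "ord 2 (\<lambda>i. u i - P i (u i))" by auto
qed

lemma PD: "ord 2 (\<lambda>i. P i (D i))"
proof -
  have "ord 2 (\<lambda>i. - ((3/2) * w i) *\<^sub>R P i (y i))"
    by (rule ord_le[OF ord_scaleR[OF ord_uminus[OF ord_cmult[OF w]] ord_proj[OF y P]]]) auto
  moreover have "ord 2 (\<lambda>i. (gv i - gu i) *\<^sub>R P i (u i))"
    by (rule ord_le[OF ord_scaleR[OF weight_diff1 ord_proj[OF u P]]]) auto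
  ultimately have "ord 2 (\<lambda>i. - ((3/2) * w i) *\<^sub>R P i (y i) - (gv i - gu i) *\<^sub>R P i (u i))"
    by (rule ord_diff)
  from ord_scaleR[OF g0(3) this] show ?thesis
    by (rule ord_by) (auto simp: PD_eq)
qed

lemma D: "ord 2 D"
  by (rule ord_by[OF ord_add[OF PD ord_diff[OF N2(1) N2(2)]]]) (auto simp: D_def P_simps)

lemma A_diff: "ord 3 (\<lambda>i. A i (v i) (v i) - A i (u i) (u i))"
proof -
  have "ord 3 (\<lambda>i. A i (D i) (v i))" "ord 3 (\<lambda>i. A i (u i) (D i))"
    by (rule ord_le[OF ord_normal_form[OF D v \<kappa> P A]] ord_le[OF ord_normal_form[OF u D \<kappa> P A]]; simp)+
  from ord_add[OF this] show ?thesis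
    by (rule ord_by) (auto simp: D_def A_simps)
qed

lemma ND: "ord 3 (\<lambda>i. D i - P i (D i) - A i (v i) (v i))"
  by (rule ord_by[OF ord_diff[OF ord_diff[OF Nv Nu] ord_cscaleR[OF A_diff, of "1/2"]]])
     (auto simp: D_def P_simps inner_simps field_simps intro!: euclidean_eqI[where 'a = 'v])

text \<open>The quadratic normal parts of the two edges have opposite signs and cancel up to
  \<open>A_diff\<close>, so the symmetric difference \<open>z - x\<close> is tangent to one order
  more than either edge.\<close>

lemma N_sum: "ord 3 (\<lambda>i. (u i + v i) - P i (u i + v i))"
  by (rule ord_by[OF ord_add[OF ord_add[OF Nv Nu] ord_cscaleR[OF A_diff, of "1/2"]]])
     (auto simp: P_simps inner_simps field_simps intro!: euclidean_eqI[where 'a = 'v])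

lemma el2: "ord 2 (\<lambda>i. el_vector (x i) (y i) (z i))"
proof -
  have 1: "ord 2 (\<lambda>i. gv i *\<^sub>R D i)" by (rule ord_le[OF ord_scaleR[OF g0(2) D]]) auto
  have 2: "ord 2 (\<lambda>i. (gv i - gu i) *\<^sub>R u i)"
    by (rule ord_le[OF ord_scaleR[OF weight_diff1 u]]) auto
  have 3: "ord 2 (\<lambda>i. ((3/2) * w i) *\<^sub>R y i)"
    by (rule ord_le[OF ord_scaleR[OF ord_cmult[OF w] y]]) auto
  show ?thesis
    by (rule ord_by[OF ord_add[OF ord_add[OF 1 2] 3]]) (auto simp: el_eq D_def algebra_simps)
qed

text \<open>Approximate conservation of speed. Pairing the discrete Euler--Lagrange equation with the
  symmetric difference gains one order over pairing it with a one-sided difference.\<close>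

lemma energy_diff: "ord 4 (\<lambda>i. gv i * (norm (v i))\<^sup>2 - gu i * (norm (u i))\<^sup>2)"
proof -
  have 1: "ord 4 (\<lambda>i. el_vector (x i) (y i) (z i) \<bullet> (u i + v i))"
  proof (rule ord_by[OF ord_inner[OF el2 N_sum]])
    fix i assume i: "i \<in> I"
    have "el_vector (x i) (y i) (z i) \<bullet> P i (u i + v i) = 0"
      using el[OF i] orth_proj_self_adjoint[OF P[OF i]] by (metis inner_zero_left)
    thus "el_vector (x i) (y i) (z i) \<bullet> (u i + v i) =
        el_vector (x i) (y i) (z i) \<bullet> (u i + v i - P i (u i + v i))"
      by (simp add: inner_diff_right)
  qed simp
  have 2: "ord 4 (\<lambda>i. (gv i - gu i - gv i * (- 3 * ((u i + v i) \<bullet> y i))) * (u i \<bullet> v i))"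
    by (rule ord_le[OF ord_mult[OF weight_diff ord_inner[OF u v]]]) auto
  \<comment> \<open>Once the leading change of the weight is inserted, the terms with
    \<open>(u + v) \<bullet> y\<close> combine by \<open>2 gv (u \<bullet> v) - w = - gv |D|\<^sup>2
    + (gv - gu) |u|\<^sup>2\<close>, which has order 3 although each summand on the left has order
    2.\<close>
  have 3: "ord 3 (\<lambda>i. (3/2) * (gv i * (norm (D i))\<^sup>2 - (gv i - gu i) * (norm (u i))\<^sup>2))"
    by (intro ord_cmult ord_diff ord_by[OF ord_mult[OF g0(2) ord_power2_norm[OF D]]]
       ord_by[OF ord_mult[OF weight_diff1 ord_power2_norm[OF u]]]) auto
  have 4: "ord 4 (\<lambda>i. ((3/2) * (gv i * (norm (D i))\<^sup>2 - (gv i - gu i) * (norm (u i))\<^sup>2)) * ((u i + v i) \<bullet> y i))"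
    by (rule ord_le[OF ord_mult[OF 3 ord_inner[OF ord_add[OF u v] y]]]) auto
  show ?thesis
    by (rule ord_by[OF ord_diff[OF ord_diff[OF 1 2] 4]])
       (auto simp: el_eq w_def D_def power2_norm_eq_inner inner_commute algebra_simps)
qed

text \<open>This is the geodesic equation of the conformal metric. For
  \<open>exp (2 \<phi>) |dy|\<^sup>2\<close> with \<open>\<phi> = - (3/2) |y|\<^sup>2\<close> a
  geodesic has tangential acceleration \<open>- 2 d\<phi>(v) v + |v|\<^sup>2 grad \<phi>\<close>,
  and \<open>grad \<phi> = - 3 P y\<close>. By \<open>energy_diff\<close> the energies of both edges
  can be replaced by that of \<open>v\<close>.\<close>

lemma PD_expansion:
  "ord 3 (\<lambda>i. P i (D i) - ((6 * (v i \<bullet> y i)) *\<^sub>R P i (v i) - (3 * (norm (v i))\<^sup>2) *\<^sub>R P i (y i)))"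
proof -
  have 1: "ord 4 (\<lambda>i. ((3/2) * (gv i * (norm (v i))\<^sup>2 - gu i * (norm (u i))\<^sup>2)) *\<^sub>R P i (y i))"
    by (rule ord_le[OF ord_scaleR[OF ord_cmult[OF energy_diff] ord_proj[OF y P]]]) auto
  have 2: "ord 3 (\<lambda>i. (gv i - gu i - gv i * (- 3 * ((u i + v i) \<bullet> y i))) *\<^sub>R P i (u i))"
    by (rule ord_le[OF ord_scaleR[OF weight_diff ord_proj[OF u P]]]) auto
  have 3: "ord 3 (\<lambda>i. (gv i * (3 * (D i \<bullet> y i))) *\<^sub>R P i (u i))"
    by (rule ord_le[OF ord_scaleR[OF ord_mult[OF g0(2) ord_cmult[OF ord_inner[OF D y]]] ord_proj[OF u P]]]) auto
  have 4: "ord 3 (\<lambda>i. (gv i * (6 * (v i \<bullet> y i))) *\<^sub>R P i (D i))"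
    by (rule ord_le[OF ord_scaleR[OF ord_mult[OF g0(2) ord_cmult[OF ord_inner[OF v y]]] PD]]) auto
  have 5: "ord 3 (\<lambda>i. ((3/2) * (gv i * (norm (v i))\<^sup>2 - gu i * (norm (u i))\<^sup>2)) *\<^sub>R P i (y i)
     - (gv i - gu i - gv i * (- 3 * ((u i + v i) \<bullet> y i))) *\<^sub>R P i (u i)
     - (gv i * (3 * (D i \<bullet> y i))) *\<^sub>R P i (u i) - (gv i * (6 * (v i \<bullet> y i))) *\<^sub>R P i (D i))"
    by (intro ord_diff ord_le[OF 1] 2 3 4) simp
  show ?thesis
  proof (rule ord_by[OF ord_scaleR[OF g0(3) 5]])
    fix i assume i: "i \<in> I"
    have g: "gv i \<noteq> 0" using conf_weight_pos[of "y i" "z i"] by (simp add: gv_def)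
    have "((6 * (v i \<bullet> y i)) *\<^sub>R P i (v i) - (3 * (norm (v i))\<^sup>2) *\<^sub>R P i (y i)) =
       (1 / gv i) *\<^sub>R ((gv i * (6 * (v i \<bullet> y i))) *\<^sub>R P i (v i) - (gv i * (3 * (norm (v i))\<^sup>2)) *\<^sub>R P i (y i))"
      using g by (simp add: algebra_simps)
    hence "P i (D i) - ((6 * (v i \<bullet> y i)) *\<^sub>R P i (v i) - (3 * (norm (v i))\<^sup>2) *\<^sub>R P i (y i)) =
       (1 / gv i) *\<^sub>R ((- ((3/2) * w i) *\<^sub>R P i (y i) - (gv i - gu i) *\<^sub>R P i (u i))
       - ((gv i * (6 * (v i \<bullet> y i))) *\<^sub>R P i (v i) - (gv i * (3 * (norm (v i))\<^sup>2)) *\<^sub>R P i (y i)))"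
      using PD_eq[OF i] by (simp add: scaleR_diff_right)
    also have "(- ((3/2) * w i) *\<^sub>R P i (y i) - (gv i - gu i) *\<^sub>R P i (u i))
       - ((gv i * (6 * (v i \<bullet> y i))) *\<^sub>R P i (v i) - (gv i * (3 * (norm (v i))\<^sup>2)) *\<^sub>R P i (y i)) =
       ((3/2) * (gv i * (norm (v i))\<^sup>2 - gu i * (norm (u i))\<^sup>2)) *\<^sub>R P i (y i)
     - (gv i - gu i - gv i * (- 3 * ((u i + v i) \<bullet> y i))) *\<^sub>R P i (u i)
     - (gv i * (3 * (D i \<bullet> y i))) *\<^sub>R P i (u i) - (gv i * (6 * (v i \<bullet> y i))) *\<^sub>R P i (D i)"
      unfolding P_simps[OF i] D_def w_def
      by (rule euclidean_eqI) (simp add: inner_simps algebra_simps)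
    finally show "P i (D i) - ((6 * (v i \<bullet> y i)) *\<^sub>R P i (v i) - (3 * (norm (v i))\<^sup>2) *\<^sub>R P i (y i)) =
       (1 / gv i) *\<^sub>R (((3/2) * (gv i * (norm (v i))\<^sup>2 - gu i * (norm (u i))\<^sup>2)) *\<^sub>R P i (y i)
     - (gv i - gu i - gv i * (- 3 * ((u i + v i) \<bullet> y i))) *\<^sub>R P i (u i)
     - (gv i * (3 * (D i \<bullet> y i))) *\<^sub>R P i (u i) - (gv i * (6 * (v i \<bullet> y i))) *\<^sub>R P i (D i))" .
  qed simp
qed

text \<open>By \<open>el\<close> the vector is normal, so only normal parts survive:
  \<open>A v v\<close> from the second difference, and a multiple of the normal part of
  \<open>y\<close> from the weight, in which \<open>energy_diff\<close> again merges the two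
  edges.\<close>

lemma el_expansion:
  "ord 3 (\<lambda>i. el_vector (x i) (y i) (z i) -
     gv i *\<^sub>R (A i (v i) (v i) + (3 * (norm (v i))\<^sup>2) *\<^sub>R (y i - P i (y i))))"
proof -
  have 1: "ord 3 (\<lambda>i. gv i *\<^sub>R (D i - P i (D i) - A i (v i) (v i)))"
    by (rule ord_le[OF ord_scaleR[OF g0(2) ND]]) auto
  have 2: "ord 3 (\<lambda>i. (gv i - gu i) *\<^sub>R (u i - P i (u i)))"
    by (rule ord_le[OF ord_scaleR[OF weight_diff1 N2(2)]]) auto
  have 3: "ord 4 (\<lambda>i. ((3/2) * (gv i * (norm (v i))\<^sup>2 - gu i * (norm (u i))\<^sup>2)) *\<^sub>R (y i - P i (y i)))"
    by (rule ord_le[OF ord_scaleR[OF ord_cmult[OF energy_diff] ord_proj_compl[OF y P]]]) auto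
  show ?thesis
  proof (rule ord_by[OF ord_diff[OF ord_add[OF 1 2] ord_le[OF 3, of 3]]])
    fix i assume i: "i \<in> I"
    have "el_vector (x i) (y i) (z i) = el_vector (x i) (y i) (z i) - P i (el_vector (x i) (y i) (z i))"
      using el[OF i] by simp
    also have "\<dots> = gv i *\<^sub>R (D i - P i (D i)) + (gv i - gu i) *\<^sub>R (u i - P i (u i)) + ((3/2) * w i) *\<^sub>R (y i - P i (y i))"
      unfolding el_eq P_simps[OF i] D_def
      by (rule euclidean_eqI) (simp add: inner_simps algebra_simps)
    finally have eq: "el_vector (x i) (y i) (z i) = \<dots>" .
    show "el_vector (x i) (y i) (z i) -
     gv i *\<^sub>R (A i (v i) (v i) + (3 * (norm (v i))\<^sup>2) *\<^sub>R (y i - P i (y i))) = gv i *\<^sub>R (D i - P i (D i) - A i (v i) (v i)) + (gv i - gu i) *\<^sub>R (u i - P i (u i)) - ((3/2) * (gv i * (norm (v i))\<^sup>2 - gu i * (norm (u i))\<^sup>2)) *\<^sub>R (y i - P i (y i))"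
      unfolding eq w_def by (rule euclidean_eqI) (simp add: inner_simps algebra_simps)
  qed auto
qed

end

context scale
begin

text \<open>Division by a square costs two orders, provided the divisor is not much smaller than
  \<open>h\<close>. This is the place where lower bounds for edge lengths are needed.\<close>

lemma ord_divide_sq:
  fixes f :: "'i \<Rightarrow> real"
  assumes "ord (Suc (Suc j)) f" "c > 0" "\<And>i. i \<in> I \<Longrightarrow> h i > 0" "\<And>i. i \<in> I \<Longrightarrow> c * h i \<le> t i"
  shows "ord j (\<lambda>i. f i / (t i)\<^sup>2)"
proof -
  from ordE[OF assms(1)] obtain C where
    C: "C \<ge> 0" "\<And>i. i \<in> I \<Longrightarrow> norm (f i) \<le> C * h i ^ Suc (Suc j)" by metis
  show ?thesis
  proof (rule ordI[of _ "C / c\<^sup>2"])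
    fix i assume i: "i \<in> I"
    have h: "h i > 0" using assms(3) i .
    have "norm (f i / (t i)\<^sup>2) = norm (f i) / (t i)\<^sup>2" by simp
    also have "\<dots> \<le> (C * h i ^ Suc (Suc j)) / (c * h i)\<^sup>2"
      by (intro frac_le C i power_mono assms) (use h assms(2) C(1) in auto)
    also have "\<dots> = C / c\<^sup>2 * h i ^ j"
      using h assms(2) by (simp add: power2_eq_square field_simps)
    finally show "norm (f i / (t i)\<^sup>2) \<le> C / c\<^sup>2 * h i ^ j" .
  qed
qed

end

section \<open>Transport of an orthogonal field along a chain\<close>

text \<open>One step of discrete parallel transport for the conformal metric, from \<open>y\<close>
  to the next vertex \<open>y'\<close>: project \<open>e\<close> to the tangent space there
  (\<open>z\<close>), remove the component along the projected next edge \<open>t\<close> (giving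
  \<open>w\<close>), and normalise at the end. No connection is introduced; the conformal correction
  term comes out of the bending of the chain.\<close>

locale transport = scale I h for I :: "'i set" and h +
  fixes \<kappa> :: real and y v e y' v' :: "'i \<Rightarrow> 'v::euclidean_space"
    and P P' :: "'i \<Rightarrow> 'v \<Rightarrow> 'v" and A A' :: "'i \<Rightarrow> 'v \<Rightarrow> 'v \<Rightarrow> 'v" and c C :: real
  assumes \<kappa>: "\<kappa> \<ge> 0"
    and P: "i \<in> I \<Longrightarrow> orth_proj (P i)" and A: "i \<in> I \<Longrightarrow> normal_form \<kappa> (P i) (A i)"
    and P': "i \<in> I \<Longrightarrow> orth_proj (P' i)" and A': "i \<in> I \<Longrightarrow> normal_form \<kappa> (P' i) (A' i)"
    and y_le: "i \<in> I \<Longrightarrow> norm (y i) \<le> 1" and y': "y' = (\<lambda>i. y i + v i)"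
    and v: "ord 1 v" and v': "ord 1 v'"
    and D': "ord 2 (\<lambda>i. v' i - v i)"
    and PD': "ord 3 (\<lambda>i. P' i (v' i - v i) -
      ((6 * (v' i \<bullet> y' i)) *\<^sub>R P' i (v' i) - (3 * (norm (v' i))\<^sup>2) *\<^sub>R P' i (y' i)))"
    and Nv: "ord 2 (\<lambda>i. v i - P i (v i))" and Nv': "ord 2 (\<lambda>i. v' i - P' i (v' i))"
    and backw: "\<And>i a. i \<in> I \<Longrightarrow> P i a = a \<Longrightarrow>
      norm (a - P' i a - A' i (- v i) a) \<le> C * (norm (v i))\<^sup>2 * norm a"
    and forw: "\<And>i a. i \<in> I \<Longrightarrow> P' i a = a \<Longrightarrow>
      norm (a - P i a - A i (v i) a) \<le> C * (norm (v i))\<^sup>2 * norm a"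
    and C: "C \<ge> 0"
    and e: "i \<in> I \<Longrightarrow> P i (e i) = e i" "i \<in> I \<Longrightarrow> norm (e i) = 1" "i \<in> I \<Longrightarrow> e i \<bullet> v i = 0"
    and c: "c > 0" "i \<in> I \<Longrightarrow> h i > 0" "i \<in> I \<Longrightarrow> c * h i \<le> norm (P' i (v' i))"
begin

definition "z = (\<lambda>i. P' i (e i))"
definition "t = (\<lambda>i. P' i (v' i))"
definition "w = (\<lambda>i. z i - ((z i \<bullet> t i) / (norm (t i))\<^sup>2) *\<^sub>R t i)"

lemma w_tangent: "i \<in> I \<Longrightarrow> P' i (w i) = w i"
  unfolding w_def z_def t_def
  by (simp add: linear_diff[OF orth_proj_linear[OF P']] linear_scale[OF orth_proj_linear[OF P']]
      orth_proj_idem[OF P'])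

lemma w_inner_v': "i \<in> I \<Longrightarrow> w i \<bullet> v' i = 0"
proof -
  assume i: "i \<in> I"
  have "t i \<noteq> 0" using c(1,2,3) i unfolding t_def by (metis mult_pos_pos norm_zero not_less)
  hence "w i \<bullet> t i = 0"
    by (simp add: w_def inner_diff_left power2_norm_eq_inner)
  thus ?thesis
    using orth_proj_self_adjoint[OF P'[OF i], of "w i" "v' i"] w_tangent[OF i] by (simp add: t_def)
qed

lemma y: "ord 0 y"
  by (rule ordI[of _ 1]) (use y_le in auto)

lemma y'0: "ord 0 y'"
  unfolding y' by (rule ord_add[OF y ord_le[OF v]]) simp

lemma e0: "ord 0 e"
  by (rule ordI[of _ 1]) (use e in auto)

lemma z0: "ord 0 z"
  unfolding z_def by (rule ord_proj[OF e0 P'])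

lemma step_bound:
  assumes "ord j f" "\<And>i. i \<in> I \<Longrightarrow> norm (g i) \<le> C * (norm (v i))\<^sup>2 * norm (f i)"
  shows "ord (2 + j) g"
proof -
  have "ord (2 * 1 + j) g"
    by (rule ord_prod[OF ord_power2_norm[OF v] assms(1), where c = C]) (use assms(2) in \<open>simp add: mult.assoc\<close>)
  thus ?thesis by simp
qed

lemma Ne: "ord 1 (\<lambda>i. e i - z i)"
proof -
  have 1: "ord 2 (\<lambda>i. e i - z i - A' i (- v i) (e i))"
    by (rule ord_le[OF step_bound[OF e0]]) (auto simp: z_def intro: backw e)
  have 2: "ord 1 (\<lambda>i. A' i (- v i) (e i))"
    by (rule ord_le[OF ord_normal_form[OF ord_uminus[OF v] e0 \<kappa> P' A']]) auto
  show ?thesis by (rule ord_by[OF ord_add[OF ord_le[OF 1, of 1] 2]]) auto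
qed

lemma Ne_inner: "i \<in> I \<Longrightarrow> e i \<bullet> (a - P' i a) = (e i - z i) \<bullet> (a - P' i a)"
  using orth_proj_inner_compl[OF P', of i "e i" a] by (simp add: z_def inner_diff_left)

text \<open>Since \<open>e\<close> is orthogonal to \<open>v\<close>, only the change
  \<open>v' - v\<close> of the edge contributes. The errors pair the normal part of
  \<open>e\<close>, of order 1, with normal parts of order 2.\<close>

lemma zt: "ord 3 (\<lambda>i. z i \<bullet> t i - z i \<bullet> P' i (v' i - v i))"
proof -
  have "ord 3 (\<lambda>i. (e i - z i) \<bullet> (v' i - P' i (v' i)))"
    "ord 3 (\<lambda>i. (e i - z i) \<bullet> ((v' i - v i) - P' i (v' i - v i)))"
    by (rule ord_le[OF ord_inner[OF Ne Nv']] ord_le[OF ord_inner[OF Ne ord_proj_compl[OF D' P']]]; simp)+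
  from ord_diff[OF this(2,1)] show ?thesis
  proof (rule ord_by)
    fix i assume i: "i \<in> I"
    have "z i \<bullet> P' i a = e i \<bullet> P' i a" for a
      using orth_proj_self_adjoint[OF P'[OF i], of "e i" "P' i a"] orth_proj_idem[OF P'[OF i], of a]
      by (simp add: z_def)
    thus "z i \<bullet> t i - z i \<bullet> P' i (v' i - v i) =
         (e i - z i) \<bullet> (v' i - v i - P' i (v' i - v i)) - (e i - z i) \<bullet> (v' i - P' i (v' i))"
      unfolding Ne_inner[OF i, symmetric] using e(3)[OF i] by (simp add: t_def inner_diff_right)
  qed simp
qed

lemma zt2: "ord 2 (\<lambda>i. z i \<bullet> t i)"
proof -
  have "ord 2 (\<lambda>i. z i \<bullet> P' i (v' i - v i))"
    by (rule ord_le[OF ord_inner[OF z0 ord_proj[OF D' P']]]) auto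
  from ord_add[OF ord_le[OF zt, of 2] this] show ?thesis by simp
qed

lemma vsq: "ord 3 (\<lambda>i. (norm (v' i))\<^sup>2 - (norm (v i))\<^sup>2)"
proof -
  have "ord 3 (\<lambda>i. (v' i - v i) \<bullet> (v' i + v i))"
    by (rule ord_le[OF ord_inner[OF D' ord_add[OF v' v]]]) simp
  thus ?thesis
    by (rule ord_by) (auto simp: power2_norm_eq_inner inner_diff_left inner_diff_right inner_add_right inner_commute)
qed

text \<open>The discrete geodesic equation is inserted for the change of the edge. Its term along
  \<open>v'\<close> gets the factor \<open>z \<bullet> t\<close>, already of order 2, and is
  negligible; what remains is the term with the gradient \<open>P y\<close>.\<close>

lemma zt_expansion: "ord 3 (\<lambda>i. z i \<bullet> t i + 3 * (norm (v i))\<^sup>2 * (e i \<bullet> y i))"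
proof -
  have 1: "ord 3 (\<lambda>i. z i \<bullet> (P' i (v' i - v i) -
      ((6 * (v' i \<bullet> y' i)) *\<^sub>R P' i (v' i) - (3 * (norm (v' i))\<^sup>2) *\<^sub>R P' i (y' i))))"
    by (rule ord_le[OF ord_inner[OF z0 PD']]) simp
  have 2: "ord 3 (\<lambda>i. 6 * (v' i \<bullet> y' i) * (z i \<bullet> t i))"
    by (rule ord_le[OF ord_mult[OF ord_cmult[OF ord_inner[OF v' y'0]] zt2]]) simp
  have 3: "ord 3 (\<lambda>i. 3 * ((norm (v' i))\<^sup>2 - (norm (v i))\<^sup>2) * (z i \<bullet> y' i))"
    by (rule ord_le[OF ord_mult[OF ord_cmult[OF vsq] ord_inner[OF z0 y'0]]]) simp
  have "ord 1 (\<lambda>i. z i \<bullet> v i - (e i - z i) \<bullet> y i)"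
    by (rule ord_diff[OF ord_le[OF ord_inner[OF z0 v]] ord_le[OF ord_inner[OF Ne y]]]) auto
  from ord_mult[OF ord_cmult[OF ord_power2_norm[OF v]] this]
  have 4: "ord 3 (\<lambda>i. 3 * (norm (v i))\<^sup>2 * (z i \<bullet> v i - (e i - z i) \<bullet> y i))"
    by (rule ord_le) simp
  show ?thesis
  proof (rule ord_by[OF ord_add[OF zt ord_diff[OF ord_add[OF 1 2] ord_add[OF 3 4]]]])
    fix i assume i: "i \<in> I"
    have "z i \<bullet> P' i (y' i) = z i \<bullet> y' i"
      using orth_proj_self_adjoint[OF P'[OF i], of "z i" "y' i"] orth_proj_idem[OF P'[OF i]]
      by (simp add: z_def)
    thus "z i \<bullet> t i + 3 * (norm (v i))\<^sup>2 * (e i \<bullet> y i) =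
         z i \<bullet> t i - z i \<bullet> P' i (v' i - v i) +
         (z i \<bullet>
          (P' i (v' i - v i) -
           ((6 * (v' i \<bullet> y' i)) *\<^sub>R P' i (v' i) - (3 * (norm (v' i))\<^sup>2) *\<^sub>R P' i (y' i))) +
          6 * (v' i \<bullet> y' i) * (z i \<bullet> t i) -
          (3 * ((norm (v' i))\<^sup>2 - (norm (v i))\<^sup>2) * (z i \<bullet> y' i) +
           3 * (norm (v i))\<^sup>2 * (z i \<bullet> v i - (e i - z i) \<bullet> y i)))"
      unfolding inner_diff_right inner_scaleR_right t_def
      by (simp add: y' inner_add_right inner_diff_left algebra_simps)
  qed simp
qed

lemma t1: "ord 1 t"
  unfolding t_def by (rule ord_proj[OF v' P'])

lemma t_v: "ord 2 (\<lambda>i. t i - v i)"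
  by (rule ord_by[OF ord_diff[OF D' Nv']]) (auto simp: t_def)

lemma tsq: "ord 3 (\<lambda>i. (norm (t i))\<^sup>2 - (norm (v i))\<^sup>2)"
proof -
  have "ord 3 (\<lambda>i. (t i - v i) \<bullet> (t i + v i))"
    by (rule ord_le[OF ord_inner[OF t_v ord_add[OF t1 v]]]) simp
  thus ?thesis
    by (rule ord_by) (auto simp: power2_norm_eq_inner inner_diff_left inner_diff_right inner_add_right inner_commute)
qed

lemma t_pos: "i \<in> I \<Longrightarrow> norm (t i) > 0"
  using c by (metis mult_pos_pos order_less_le_trans t_def)

text \<open>The Gram--Schmidt coefficient of \<open>z\<close> along \<open>t\<close> tends to
  \<open>- 3 (e \<bullet> y)\<close>. Removing that component therefore adds
  \<open>3 (e \<bullet> y) v\<close>, which is the Christoffel term of the conformal metric.\<close>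

lemma coeff: "ord 1 (\<lambda>i. (z i \<bullet> t i) / (norm (t i))\<^sup>2 + 3 * (e i \<bullet> y i))"
proof -
  have 1: "ord 3 (\<lambda>i. 3 * ((norm (t i))\<^sup>2 - (norm (v i))\<^sup>2) * (e i \<bullet> y i))"
    by (rule ord_le[OF ord_mult[OF ord_cmult[OF tsq] ord_inner[OF e0 y]]]) simp
  have "ord 3 (\<lambda>i. z i \<bullet> t i + 3 * (norm (t i))\<^sup>2 * (e i \<bullet> y i))"
    by (rule ord_by[OF ord_add[OF zt_expansion 1]]) (auto simp: algebra_simps)
  hence "ord 1 (\<lambda>i. (z i \<bullet> t i + 3 * (norm (t i))\<^sup>2 * (e i \<bullet> y i)) / (norm (t i))\<^sup>2)"
    by (intro ord_divide_sq[OF _ c(1)]) (use c in \<open>auto simp: t_def numeral_3_eq_3\<close>)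
  thus ?thesis
    by (rule ord_by) (use t_pos in \<open>auto simp: field_simps\<close>)
qed

lemma w_expansion1: "ord 2 (\<lambda>i. w i - z i - (3 * (e i \<bullet> y i)) *\<^sub>R v i)"
proof -
  have 1: "ord 2 (\<lambda>i. ((z i \<bullet> t i) / (norm (t i))\<^sup>2 + 3 * (e i \<bullet> y i)) *\<^sub>R t i)"
    by (rule ord_le[OF ord_scaleR[OF coeff t1]]) simp
  have 2: "ord 2 (\<lambda>i. (3 * (e i \<bullet> y i)) *\<^sub>R (t i - v i))"
    by (rule ord_le[OF ord_scaleR[OF ord_cmult[OF ord_inner[OF e0 y]] t_v]]) simp
  show ?thesis
    by (rule ord_by[OF ord_diff[OF 2 1]]) (auto simp: w_def algebra_simps)
qed

text \<open>Projection and orthogonalisation both shorten the vector by Pythagoras: the squared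
  length drops by \<open>|e - z|\<^sup>2\<close> and by
  \<open>(z \<bullet> t)\<^sup>2 / |t|\<^sup>2\<close>, each of order 2. Hence normalising does not
  disturb a second-order expansion.\<close>

lemma w_norm: "ord 2 (\<lambda>i. (norm (w i))\<^sup>2 - 1)"
proof -
  have 1: "ord 2 (\<lambda>i. (norm (e i - z i))\<^sup>2)"
    using ord_power2_norm[OF Ne] by simp
  have "ord 4 (\<lambda>i. (z i \<bullet> t i) * (z i \<bullet> t i))"
    by (rule ord_le[OF ord_mult[OF zt2 zt2]]) simp
  hence 2: "ord 2 (\<lambda>i. ((z i \<bullet> t i) * (z i \<bullet> t i)) / (norm (t i))\<^sup>2)"
    by (intro ord_divide_sq[OF _ c(1)]) (use c in \<open>auto simp: t_def eval_nat_numeral\<close>)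
  show ?thesis
  proof (rule ord_by[OF ord_uminus[OF ord_add[OF 1 2]]])
    fix i assume i: "i \<in> I"
    have "(norm (z i))\<^sup>2 + (norm (e i - z i))\<^sup>2 = 1"
      using orth_proj_pythagoras[OF P'[OF i], of "e i"] e(2)[OF i] by (simp add: z_def)
    moreover have "(norm (w i))\<^sup>2 = (norm (z i))\<^sup>2 - ((z i \<bullet> t i) * (z i \<bullet> t i)) / (norm (t i))\<^sup>2"
    proof -
      have t: "t i \<bullet> t i \<noteq> 0" using t_pos[OF i] by auto
      show ?thesis
        unfolding power2_norm_eq_inner w_def
        using t by (simp add: inner_diff_left inner_diff_right inner_commute field_simps)
    qed
    ultimately show "(norm (w i))\<^sup>2 - 1 =
         - ((norm (e i - z i))\<^sup>2 + z i \<bullet> t i * (z i \<bullet> t i) / (norm (t i))\<^sup>2)" by simp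
  qed simp
qed

lemma w_minus_e: "ord 1 (\<lambda>i. w i - e i)"
proof -
  have "ord 1 (\<lambda>i. (3 * (e i \<bullet> y i)) *\<^sub>R v i)"
    by (rule ord_le[OF ord_scaleR[OF ord_cmult[OF ord_inner[OF e0 y]] v]]) simp
  from ord_diff[OF ord_add[OF ord_le[OF w_expansion1, of 1] this] Ne] show ?thesis
    by (rule ord_by) auto
qed

lemma w0: "ord 0 w"
  by (rule ord_by[OF ord_add[OF e0 ord_le[OF w_minus_e]]]) auto

text \<open>The vector \<open>e - z\<close> has size O(h) and is normal at the next vertex, while
  the two tangent spaces differ by O(h). With \<open>x = P (e - z)\<close> this becomes
  \<open>|x|\<^sup>2 = (e - z) \<bullet> x = (e - z) \<bullet> (x - P' x)\<close>, a product of two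
  small factors times \<open>|x|\<close>.\<close>

lemma PNe: "ord 2 (\<lambda>i. P i (e i - z i))"
proof -
  have "ord 0 v" by (rule ord_le[OF v]) simp
  then obtain M where M: "M \<ge> 0" "\<And>i. i \<in> I \<Longrightarrow> norm (v i) \<le> M"
    by (auto elim!: ordE)
  have "ord (1 + 1) (\<lambda>i. P i (e i - z i))"
  proof (rule ord_prod[OF v Ne, where c = "C * M + \<kappa>"])
    fix i assume i: "i \<in> I"
    define x where "x = P i (e i - z i)"
    have Px: "P i x = x" using orth_proj_idem[OF P[OF i]] by (simp add: x_def)
    have "norm (x - P' i x) \<le> norm (x - P' i x - A' i (- v i) x) + norm (A' i (- v i) x)"
      by (metis diff_add_cancel norm_triangle_ineq)
    also have "\<dots> \<le> C * (norm (v i))\<^sup>2 * norm x + \<kappa> * norm (v i) * norm x"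
      using backw[OF i Px] normal_form_norm_le[OF A'[OF i] P'[OF i] \<kappa>, of "- v i" x]
      by (simp add: add_mono)
    also have "C * (norm (v i))\<^sup>2 * norm x \<le> C * (M * norm (v i)) * norm x"
      using M(2)[OF i] C by (intro mult_right_mono mult_left_mono) (auto simp: power2_eq_square intro: mult_right_mono)
    finally have 1: "norm (x - P' i x) \<le> (C * M + \<kappa>) * norm (v i) * norm x"
      by (simp add: algebra_simps)
    have "norm x * norm x = (e i - z i) \<bullet> x"
      unfolding x_def using orth_proj_norm_sq[OF P[OF i], of "e i - z i"]
      by (simp add: power2_eq_square inner_commute)
    also have "\<dots> = (e i - z i) \<bullet> (x - P' i x)"
      using orth_proj_inner_compl[OF P'[OF i], of x "e i"] by (simp add: z_def inner_commute inner_diff_right)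
    also have "\<dots> \<le> norm (e i - z i) * norm (x - P' i x)" by (rule norm_cauchy_schwarz)
    also have "\<dots> \<le> norm (e i - z i) * ((C * M + \<kappa>) * norm (v i) * norm x)"
      by (intro mult_left_mono 1) simp
    finally have "norm x * norm x \<le> ((C * M + \<kappa>) * (norm (v i) * norm (e i - z i))) * norm x"
      by (simp add: ac_simps)
    thus "norm (P i (e i - z i)) \<le> (C * M + \<kappa>) * (norm (v i) * norm (e i - z i))"
      unfolding x_def[symmetric] using M(1) C \<kappa> by (cases "norm x = 0") (auto simp: mult_le_cancel_right)
  qed
  thus ?thesis by (rule ord_le) simp
qed

text \<open>The normal part at \<open>y\<close> is \<open>A v w\<close> by \<open>forw\<close>, the
  tangential part comes from \<open>w_expansion1\<close> and \<open>PNe\<close>. In the limit the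
  covariant derivative of \<open>e\<close> along \<open>v\<close> is
  \<open>3 (e \<bullet> y) v\<close>, which says that \<open>exp ((3/2) |y|\<^sup>2) e\<close> is
  parallel for the conformal metric.\<close>

lemma w_expansion: "ord 2 (\<lambda>i. w i - e i - A i (v i) (e i) - (3 * (e i \<bullet> y i)) *\<^sub>R v i)"
proof -
  note lin = linear_add[OF orth_proj_linear[OF P]] linear_diff[OF orth_proj_linear[OF P]]
    linear_scale[OF orth_proj_linear[OF P]]
  have 1: "ord 2 (\<lambda>i. w i - P i (w i) - A i (v i) (w i))"
    by (rule ord_le[OF step_bound[OF w0]]) (auto intro: forw w_tangent)
  have 2: "ord 2 (\<lambda>i. A i (v i) (w i - e i))"
    by (rule ord_le[OF ord_normal_form[OF v w_minus_e \<kappa> P A]]) auto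
  have 3: "ord 2 (\<lambda>i. (3 * (e i \<bullet> y i)) *\<^sub>R (v i - P i (v i)))"
    by (rule ord_le[OF ord_scaleR[OF ord_cmult[OF ord_inner[OF e0 y]] Nv]]) simp
  show ?thesis
  proof (rule ord_by[OF ord_add[OF ord_diff[OF ord_add[OF 1 2] 3]
        ord_diff[OF ord_proj[OF w_expansion1 P] PNe]]])
    fix i assume i: "i \<in> I"
    show "w i - e i - A i (v i) (e i) - (3 * (e i \<bullet> y i)) *\<^sub>R v i =
         w i - P i (w i) - A i (v i) (w i) + A i (v i) (w i - e i) -
         (3 * (e i \<bullet> y i)) *\<^sub>R (v i - P i (v i)) +
         (P i (w i - z i - (3 * (e i \<bullet> y i)) *\<^sub>R v i) - P i (e i - z i))"
      unfolding lin[OF i] e(1)[OF i] normal_form_simps[OF A[OF i] P[OF i] \<kappa>]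
      by (rule euclidean_eqI) (simp add: inner_simps algebra_simps)
  qed auto
qed

lemma normalized_expansion:
  "ord 2 (\<lambda>i. (1 / norm (w i)) *\<^sub>R w i - e i - A i (v i) (e i) - (3 * (e i \<bullet> y i)) *\<^sub>R v i)"
proof -
  have "ord 2 (\<lambda>i. (1 / norm (w i)) *\<^sub>R w i - w i)"
  proof (rule ord_norm_mono[OF w_norm])
    fix i
    have "norm ((1 / norm (w i)) *\<^sub>R w i - w i) \<le> \<bar>(norm (w i))\<^sup>2 - 1\<bar>"
    proof (cases "w i = 0")
      case False
      have "(1 / norm (w i)) *\<^sub>R w i - w i = ((1 - norm (w i)) / norm (w i)) *\<^sub>R w i"
        using False by (simp add: scaleR_diff_left diff_divide_distrib)
      hence "norm ((1 / norm (w i)) *\<^sub>R w i - w i) = \<bar>norm (w i) - 1\<bar>"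
        using False by simp
      also have "\<dots> \<le> \<bar>norm (w i) - 1\<bar> * \<bar>norm (w i) + 1\<bar>"
        by (simp add: mult_le_cancel_left1)
      also have "\<dots> = \<bar>(norm (w i))\<^sup>2 - 1\<bar>"
        unfolding abs_mult[symmetric] by (simp add: power2_eq_square algebra_simps)
      finally show ?thesis .
    qed simp
    thus "norm ((1 / norm (w i)) *\<^sub>R w i - w i) \<le> norm ((norm (w i))\<^sup>2 - 1)" by simp
  qed
  from ord_add[OF this w_expansion] show ?thesis by (rule ord_by) auto
qed

end

section \<open>Second variation along an edge\<close>

text \<open>Half the second derivative at \<open>s = 0\<close> of the energy of the edge from \<open>y + s V\<close> to \<open>z + s W\<close>.\<close>

definition edge_form :: "'v::euclidean_space \<Rightarrow> 'v \<Rightarrow> 'v \<Rightarrow> 'v \<Rightarrow> real" where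
  "edge_form y z V W = (1/2) * conf_weight y z *
     ((9 * (y \<bullet> V + z \<bullet> W)\<^sup>2 - 3 * ((norm V)\<^sup>2 + (norm W)\<^sup>2)) * (norm (z - y))\<^sup>2
      - 12 * (y \<bullet> V + z \<bullet> W) * ((z - y) \<bullet> (W - V)) + 2 * (norm (W - V))\<^sup>2)"

locale edge = scale I h for I :: "'i set" and h +
  fixes \<kappa> :: real and y v e e' :: "'i \<Rightarrow> 'v::euclidean_space" and \<xi> \<xi>' :: "'i \<Rightarrow> real"
    and P :: "'i \<Rightarrow> 'v \<Rightarrow> 'v" and A :: "'i \<Rightarrow> 'v \<Rightarrow> 'v \<Rightarrow> 'v"
  assumes \<kappa>: "\<kappa> \<ge> 0"
    and P: "i \<in> I \<Longrightarrow> orth_proj (P i)" and A: "i \<in> I \<Longrightarrow> normal_form \<kappa> (P i) (A i)"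
    and y_le: "i \<in> I \<Longrightarrow> norm (y i) \<le> 1"
    and v: "ord 1 v" and Nv: "ord 2 (\<lambda>i. v i - P i (v i))"
    and e: "i \<in> I \<Longrightarrow> P i (e i) = e i" "i \<in> I \<Longrightarrow> norm (e i) = 1" "i \<in> I \<Longrightarrow> e i \<bullet> v i = 0"
    and e': "ord 2 (\<lambda>i. e' i - e i - A i (v i) (e i) - (3 * (e i \<bullet> y i)) *\<^sub>R v i)"
    and \<xi>: "ord 0 \<xi>" and \<delta>: "ord 1 (\<lambda>i. \<xi>' i - \<xi> i)"
begin

definition "\<psi> = (\<lambda>i. exp ((3/2) * (norm (y i))\<^sup>2))"
definition "V = (\<lambda>i. (\<xi> i * \<psi> i) *\<^sub>R e i)"
definition "W = (\<lambda>i. (\<xi>' i * exp ((3/2) * (norm (y i + v i))\<^sup>2)) *\<^sub>R e' i)"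
definition "q = (\<lambda>i. (norm (v i))\<^sup>2)"
definition "g = (\<lambda>i. conf_weight (y i) (y i + v i))"
definition "G = (\<lambda>i. exp ((3/2) * ((norm (y i + v i))\<^sup>2 - (norm (y i))\<^sup>2)))"
definition "E = (\<lambda>i. A i (v i) (e i) + (3 * (e i \<bullet> y i)) *\<^sub>R v i)"
text \<open>Leading part of the increment \<open>W - V\<close> divided by \<open>\<psi>\<close>: the
  change of the cut-off, the change of \<open>\<psi>\<close>, and the transport increment
  \<open>E\<close> of the frame.\<close>

definition "B = (\<lambda>i. (\<xi>' i - \<xi> i + \<xi> i * (3 * (y i \<bullet> v i))) *\<^sub>R e i + \<xi> i *\<^sub>R E i)"

lemma y: "ord 0 y"
  by (rule ordI[of _ 1]) (use y_le in auto)

lemma e0: "ord 0 e"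
  by (rule ordI[of _ 1]) (use e in auto)

lemma q2: "ord 2 q"
  unfolding q_def by (rule ord_le[OF ord_power2_norm[OF v]]) simp

lemma yv: "ord 1 (\<lambda>i. 3 * (y i \<bullet> v i))"
  by (rule ord_le[OF ord_cmult[OF ord_inner[OF y v]]]) simp

lemma Ave: "ord 1 (\<lambda>i. A i (v i) (e i))"
  by (rule ord_le[OF ord_normal_form[OF v e0 \<kappa> P A]]) auto

lemma E: "ord 1 E"
  unfolding E_def
  by (rule ord_add[OF Ave ord_le[OF ord_scaleR[OF ord_cmult[OF ord_inner[OF e0 y]] v]]]) simp

lemma e'_E: "ord 2 (\<lambda>i. e' i - e i - E i)"
  by (rule ord_by[OF e']) (auto simp: E_def)

lemma \<xi>': "ord 0 \<xi>'"
  by (rule ord_by[OF ord_add[OF \<xi> ord_le[OF \<delta>]]]) auto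

lemma e'0: "ord 0 e'"
  by (rule ord_by[OF ord_add[OF ord_le[OF e'_E, of 0] ord_add[OF e0 ord_le[OF E]]]]) auto

lemma exponent: "ord 1 (\<lambda>i. (3/2) * ((norm (y i + v i))\<^sup>2 - (norm (y i))\<^sup>2))"
  by (rule ord_by[OF ord_add[OF yv ord_cmult[OF ord_le[OF q2], of 1 "3/2"]]])
     (auto simp: q_def power2_norm_eq_inner inner_add_left inner_add_right inner_commute algebra_simps)

lemma G: "ord 2 (\<lambda>i. G i - 1 - 3 * (y i \<bullet> v i))"
  by (rule ord_by[OF ord_add[OF ord_le[OF ord_exp[OF exponent], of 2] ord_cmult[OF q2, of "3/2"]]])
     (auto simp: G_def q_def power2_norm_eq_inner inner_add_left inner_add_right inner_commute algebra_simps)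

lemma g\<psi>: "ord 1 (\<lambda>i. g i * (\<psi> i)\<^sup>2 - 1)"
proof -
  have f: "ord 1 (\<lambda>i. - ((3/2) * ((norm (y i + v i))\<^sup>2 - (norm (y i))\<^sup>2)))"
    by (rule ord_uminus[OF exponent])
  have "g i * (\<psi> i)\<^sup>2 = exp (- ((3/2) * ((norm (y i + v i))\<^sup>2 - (norm (y i))\<^sup>2)))" for i
    unfolding g_def \<psi>_def conf_weight_def power2_eq_square exp_add[symmetric]
    by (simp add: algebra_simps)
  thus ?thesis
    by (intro ord_by[OF ord_add[OF ord_le[OF ord_exp[OF f], of 1] f]]) auto
qed

lemma \<psi>0: "ord 0 \<psi>" "ord 0 g"
proof -
  have sq: "ord 0 (\<lambda>i. (norm (w i))\<^sup>2)" if "ord 0 w" for w :: "'i \<Rightarrow> 'v"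
    using ord_power2_norm[OF that] by simp
  show "ord 0 \<psi>" unfolding \<psi>_def by (intro ord_exp_bounded ord_cmult sq y)
  show "ord 0 g" unfolding g_def conf_weight_def
    by (intro ord_exp_bounded ord_cmult ord_add sq y ord_le[OF v]) simp
qed

lemma V0: "ord 0 V"
  unfolding V_def by (rule ord_le[OF ord_scaleR[OF ord_mult[OF \<xi> \<psi>0(1)] e0]]) simp

lemma B1: "ord 1 B"
  unfolding B_def
  by (intro ord_add ord_le[OF ord_scaleR[OF ord_add[OF \<delta> ord_le[OF ord_mult[OF \<xi> yv]]] e0]]
     ord_le[OF ord_scaleR[OF \<xi> E]]) auto

lemma remainder: "ord 2 (\<lambda>i. W i - V i - \<psi> i *\<^sub>R B i)"
proof -
  have 1: "ord 2 (\<lambda>i. (\<xi>' i * (G i - 1 - 3 * (y i \<bullet> v i))) *\<^sub>R e' i)"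
    by (rule ord_le[OF ord_scaleR[OF ord_mult[OF \<xi>' G] e'0]]) simp
  have "ord 0 (\<lambda>i. 1 + 3 * (y i \<bullet> v i))"
    by (intro ord_add ord_const ord_le[OF yv]) simp
  hence 2: "ord 2 (\<lambda>i. (\<xi>' i * (1 + 3 * (y i \<bullet> v i))) *\<^sub>R (e' i - e i - E i))"
    by (intro ord_le[OF ord_scaleR[OF ord_mult[OF \<xi>'] e'_E]]) auto
  have 3: "ord 2 (\<lambda>i. (\<xi> i * (3 * (y i \<bullet> v i))) *\<^sub>R E i)"
    by (rule ord_le[OF ord_scaleR[OF ord_mult[OF \<xi> yv] E]]) simp
  have "ord 1 (\<lambda>i. E i + (3 * (y i \<bullet> v i)) *\<^sub>R e i + (3 * (y i \<bullet> v i)) *\<^sub>R E i)"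
    by (intro ord_add E ord_le[OF ord_scaleR[OF yv e0]] ord_le[OF ord_scaleR[OF yv E]]) auto
  hence 4: "ord 2 (\<lambda>i. (\<xi>' i - \<xi> i) *\<^sub>R (E i + (3 * (y i \<bullet> v i)) *\<^sub>R e i + (3 * (y i \<bullet> v i)) *\<^sub>R E i))"
    by (intro ord_le[OF ord_scaleR[OF \<delta>]]) auto
  have W: "W i = (\<xi>' i * (\<psi> i * G i)) *\<^sub>R e' i" for i
    unfolding W_def \<psi>_def G_def exp_add[symmetric] by (simp add: algebra_simps)
  show ?thesis
  proof (rule ord_by[OF ord_scaleR[OF \<psi>0(1) ord_add[OF ord_add[OF 1 2] ord_add[OF 3 4]]]])
    fix i
    show "W i - V i - \<psi> i *\<^sub>R B i =
         \<psi> i *\<^sub>R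
         ((\<xi>' i * (G i - 1 - 3 * (y i \<bullet> v i))) *\<^sub>R e' i +
          (\<xi>' i * (1 + 3 * (y i \<bullet> v i))) *\<^sub>R (e' i - e i - E i) +
          ((\<xi> i * (3 * (y i \<bullet> v i))) *\<^sub>R E i +
           (\<xi>' i - \<xi> i) *\<^sub>R (E i + (3 * (y i \<bullet> v i)) *\<^sub>R e i + (3 * (y i \<bullet> v i)) *\<^sub>R E i)))"
      unfolding W V_def B_def
      by (rule euclidean_eqI) (simp add: inner_simps algebra_simps)
  qed simp
qed

lemma \<psi>B: "ord 1 (\<lambda>i. \<psi> i *\<^sub>R B i)"
  by (rule ord_le[OF ord_scaleR[OF \<psi>0(1) B1]]) simp

lemma WV: "ord 1 (\<lambda>i. W i - V i)"
  by (rule ord_by[OF ord_add[OF ord_le[OF remainder, of 1] \<psi>B]]) auto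

lemma W0: "ord 0 W"
  by (rule ord_by[OF ord_add[OF V0 ord_le[OF WV]]]) auto

text \<open>The vector \<open>A v e\<close> is normal and therefore sees only the normal part of
  \<open>v\<close>, which is itself of order 2.\<close>

lemma Ave_v: "ord 3 (\<lambda>i. A i (v i) (e i) \<bullet> v i)"
proof (rule ord_by[OF ord_inner[OF Ave Nv]])
  fix i assume i: "i \<in> I"
  have "A i (v i) (e i) \<bullet> P i (v i) = P i (A i (v i) (e i)) \<bullet> v i"
    using orth_proj_self_adjoint[OF P[OF i]] by simp
  thus "A i (v i) (e i) \<bullet> v i = A i (v i) (e i) \<bullet> (v i - P i (v i))"
    using normal_form_normal[OF A[OF i] P[OF i] \<kappa>] by (simp add: inner_diff_right)
qed simp

lemma Ave_e: "i \<in> I \<Longrightarrow> A i (v i) (e i) \<bullet> e i = 0"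
  using orth_proj_self_adjoint[OF P, of i "A i (v i) (e i)" "e i"]
    normal_form_normal[OF A P \<kappa>] e(1) by simp

lemma vB: "ord 3 (\<lambda>i. v i \<bullet> B i - 3 * \<xi> i * (e i \<bullet> y i) * q i)"
  by (rule ord_by[OF ord_mult[OF \<xi> Ave_v]])
     (auto simp: B_def E_def q_def inner_simps e inner_commute[of "v _" "e _"] power2_norm_eq_inner
      inner_commute[of "v _" "A _ _ _"] algebra_simps)

lemma Bsq: "ord 3 (\<lambda>i. (norm (B i))\<^sup>2 - ((\<xi>' i - \<xi> i + \<xi> i * (3 * (y i \<bullet> v i)))\<^sup>2
     + (\<xi> i)\<^sup>2 * ((norm (A i (v i) (e i)))\<^sup>2 + 9 * (e i \<bullet> y i)\<^sup>2 * q i)))"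
proof -
  have "ord 3 (\<lambda>i. 6 * (\<xi> i * \<xi> i * (e i \<bullet> y i) * (A i (v i) (e i) \<bullet> v i)))"
    by (intro ord_cmult ord_le[OF ord_mult[OF ord_mult[OF ord_mult[OF \<xi> \<xi>] ord_inner[OF e0 y]] Ave_v]]) simp
  thus ?thesis
  proof (rule ord_by)
    fix i assume i: "i \<in> I"
    have ee: "e i \<bullet> e i = 1" using e(2)[OF i] by (simp add: norm_eq_1)
    have z: "v i \<bullet> e i = 0" "e i \<bullet> v i = 0" "e i \<bullet> A i (v i) (e i) = 0" "A i (v i) (e i) \<bullet> e i = 0"
      using e(3)[OF i] Ave_e[OF i] by (auto simp: inner_commute)
    show "(norm (B i))\<^sup>2 - ((\<xi>' i - \<xi> i + \<xi> i * (3 * (y i \<bullet> v i)))\<^sup>2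
       + (\<xi> i)\<^sup>2 * ((norm (A i (v i) (e i)))\<^sup>2 + 9 * (e i \<bullet> y i)\<^sup>2 * q i)) =
       6 * (\<xi> i * \<xi> i * (e i \<bullet> y i) * (A i (v i) (e i) \<bullet> v i))"
      unfolding B_def E_def q_def power2_norm_eq_inner
      by (simp add: inner_add_left inner_add_right ee z inner_commute[of "v i" "A i (v i) (e i)"] power2_eq_square algebra_simps)
  qed simp
qed

definition "bracket = (\<lambda>i. (\<xi>' i - \<xi> i + \<xi> i * (3 * (y i \<bullet> v i)))\<^sup>2
    + (\<xi> i)\<^sup>2 * ((norm (A i (v i) (e i)))\<^sup>2 - 3 * q i - 9 * (e i \<bullet> y i)\<^sup>2 * q i))"

lemma bracket: "ord 2 bracket"
proof -
  have "ord 1 (\<lambda>i. \<xi>' i - \<xi> i + \<xi> i * (3 * (y i \<bullet> v i)))"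
    by (intro ord_add \<delta> ord_le[OF ord_mult[OF \<xi> yv]]) simp
  from ord_mult[OF this this] have 1: "ord 2 (\<lambda>i. (\<xi>' i - \<xi> i + \<xi> i * (3 * (y i \<bullet> v i)))\<^sup>2)"
    unfolding power2_eq_square by (rule ord_le) simp
  have 2: "ord 2 (\<lambda>i. (norm (A i (v i) (e i)))\<^sup>2)"
    by (rule ord_le[OF ord_power2_norm[OF Ave]]) simp
  have 3: "ord 2 (\<lambda>i. 9 * (e i \<bullet> y i)\<^sup>2 * q i)"
    unfolding power2_eq_square
    by (rule ord_le[OF ord_mult[OF ord_cmult[OF ord_mult[OF ord_inner[OF e0 y] ord_inner[OF e0 y]]] q2]]) simp
  have 4: "ord 0 (\<lambda>i. (\<xi> i)\<^sup>2)" unfolding power2_eq_square by (rule ord_le[OF ord_mult[OF \<xi> \<xi>]]) simp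
  show ?thesis unfolding bracket_def
    by (intro ord_add 1 ord_le[OF ord_mult[OF 4 ord_diff[OF ord_diff[OF 2 ord_cmult[OF q2]] 3]]]) simp
qed

text \<open>The weight of the edge cancels \<open>\<psi>\<^sup>2\<close> up to first order, and
  \<open>bracket\<close> has order 2. The coefficient \<open>- 9\<close> of
  \<open>(e \<bullet> y)\<^sup>2\<close> arises as \<open>18 - 36 + 9\<close>: from the squared
  first derivative of the weight, from its product with the derivative of the squared length, and
  from \<open>|B|\<^sup>2\<close>. The term \<open>- 3 q\<close> is the second derivative of the
  exponent.\<close>

lemma edge_form_expansion: "ord 3 (\<lambda>i. edge_form (y i) (y i + v i) (V i) (W i) - bracket i)"
proof -
  let ?s = "\<lambda>i. y i \<bullet> (W i - V i) + v i \<bullet> W i"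
  have s: "ord 1 ?s"
    by (intro ord_add ord_le[OF ord_inner[OF y WV]] ord_le[OF ord_inner[OF v W0]]) auto
  have yV: "ord 0 (\<lambda>i. y i \<bullet> V i)" by (rule ord_le[OF ord_inner[OF y V0]]) simp
  have vd: "ord 2 (\<lambda>i. v i \<bullet> (W i - V i))" by (rule ord_le[OF ord_inner[OF v WV]]) simp
  have s_eq: "y i \<bullet> V i + (y i + v i) \<bullet> W i = 2 * (y i \<bullet> V i) + ?s i" for i
    by (simp add: inner_simps)
  have sq_s: "ord 1 (\<lambda>i. (y i \<bullet> V i + (y i + v i) \<bullet> W i)\<^sup>2 - 4 * (y i \<bullet> V i)\<^sup>2)"
  proof -
    have "ord 0 (\<lambda>i. 4 * (y i \<bullet> V i) + ?s i)" by (intro ord_add ord_cmult yV ord_le[OF s]) simp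
    from ord_mult[OF s this] show ?thesis
      by (rule ord_by) (auto simp: s_eq power2_eq_square algebra_simps)
  qed
  have sq_W: "ord 1 (\<lambda>i. (norm (W i))\<^sup>2 - (norm (V i))\<^sup>2)"
    by (rule ord_by[OF ord_inner[OF WV ord_add[OF W0 V0]]])
       (auto simp: power2_norm_eq_inner inner_simps inner_commute)
  have 1: "ord 3 (\<lambda>i. (9 * ((y i \<bullet> V i + (y i + v i) \<bullet> W i)\<^sup>2 - 4 * (y i \<bullet> V i)\<^sup>2)
       - 3 * ((norm (W i))\<^sup>2 - (norm (V i))\<^sup>2)) * q i)"
    by (rule ord_le[OF ord_mult[OF ord_diff[OF ord_cmult[OF sq_s] ord_cmult[OF sq_W]] q2]]) simp
  have 2: "ord 3 (\<lambda>i. 12 * (?s i * (v i \<bullet> (W i - V i))))"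
    by (rule ord_le[OF ord_cmult[OF ord_mult[OF s vd]]]) simp
  have 3: "ord 3 (\<lambda>i. 24 * ((y i \<bullet> V i) * (v i \<bullet> (W i - V i - \<psi> i *\<^sub>R B i))))"
    by (rule ord_le[OF ord_cmult[OF ord_mult[OF yV ord_inner[OF v remainder]]]]) simp
  have 4: "ord 3 (\<lambda>i. 24 * ((y i \<bullet> V i) * (\<psi> i * (v i \<bullet> B i - 3 * \<xi> i * (e i \<bullet> y i) * q i))))"
    by (rule ord_le[OF ord_cmult[OF ord_mult[OF yV ord_mult[OF \<psi>0(1) vB]]]]) simp
  have 5: "ord 3 (\<lambda>i. 2 * ((W i - V i - \<psi> i *\<^sub>R B i) \<bullet> (W i - V i + \<psi> i *\<^sub>R B i)))"
    by (rule ord_le[OF ord_cmult[OF ord_inner[OF remainder ord_add[OF WV \<psi>B]]]]) simp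
  have 6: "ord 3 (\<lambda>i. 2 * (\<psi> i * \<psi> i * ((norm (B i))\<^sup>2 - ((\<xi>' i - \<xi> i + \<xi> i * (3 * (y i \<bullet> v i)))\<^sup>2
     + (\<xi> i)\<^sup>2 * ((norm (A i (v i) (e i)))\<^sup>2 + 9 * (e i \<bullet> y i)\<^sup>2 * q i)))))"
    by (rule ord_le[OF ord_cmult[OF ord_mult[OF ord_mult[OF \<psi>0(1) \<psi>0(1)] Bsq]]]) simp
  have 7: "ord 3 (\<lambda>i. (g i * (\<psi> i)\<^sup>2 - 1) * bracket i)"
    by (rule ord_le[OF ord_mult[OF g\<psi> bracket]]) simp
  have 8: "ord 3 (\<lambda>i. (1/2) * (g i * ((9 * ((y i \<bullet> V i + (y i + v i) \<bullet> W i)\<^sup>2 - 4 * (y i \<bullet> V i)\<^sup>2)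
       - 3 * ((norm (W i))\<^sup>2 - (norm (V i))\<^sup>2)) * q i
       - 12 * (?s i * (v i \<bullet> (W i - V i)))
       - 24 * ((y i \<bullet> V i) * (v i \<bullet> (W i - V i - \<psi> i *\<^sub>R B i)))
       - 24 * ((y i \<bullet> V i) * (\<psi> i * (v i \<bullet> B i - 3 * \<xi> i * (e i \<bullet> y i) * q i)))
       + 2 * ((W i - V i - \<psi> i *\<^sub>R B i) \<bullet> (W i - V i + \<psi> i *\<^sub>R B i))
       + 2 * (\<psi> i * \<psi> i * ((norm (B i))\<^sup>2 - ((\<xi>' i - \<xi> i + \<xi> i * (3 * (y i \<bullet> v i)))\<^sup>2
     + (\<xi> i)\<^sup>2 * ((norm (A i (v i) (e i)))\<^sup>2 + 9 * (e i \<bullet> y i)\<^sup>2 * q i)))))))"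
    by (rule ord_le[OF ord_cmult[OF ord_mult[OF \<psi>0(2) ord_add[OF ord_add[OF ord_diff[OF ord_diff[OF ord_diff[OF 1 2] 3] 4] 5] 6]]]]) simp
  show ?thesis
  proof (rule ord_by[OF ord_add[OF 8 7]])
    fix i assume i: "i \<in> I"
    define yV where "yV = y i \<bullet> V i"
    define s where "s = ?s i"
    define vD where "vD = v i \<bullet> (W i - V i)"
    define vB' where "vB' = v i \<bullet> B i"
    define a where "a = e i \<bullet> y i"
    define D2 where "D2 = (norm (W i - V i))\<^sup>2"
    define B2 where "B2 = (norm (B i))\<^sup>2"
    define X where "X = (norm (A i (v i) (e i)))\<^sup>2"
    define Y where "Y = \<xi>' i - \<xi> i + \<xi> i * (3 * (y i \<bullet> v i))"
    define NV where "NV = (norm (V i))\<^sup>2"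
    define NW where "NW = (norm (W i))\<^sup>2"
    have yV_eq: "yV = \<xi> i * \<psi> i * a"
      by (simp add: yV_def V_def a_def inner_commute)
    have NV_eq: "NV = (\<xi> i * \<psi> i)\<^sup>2"
      using e(2)[OF i] by (simp add: NV_def V_def power_mult_distrib)
    have 1: "v i \<bullet> (W i - V i - \<psi> i *\<^sub>R B i) = vD - \<psi> i * vB'"
      by (simp add: vD_def vB'_def inner_diff_right)
    have 2: "(W i - V i - \<psi> i *\<^sub>R B i) \<bullet> (W i - V i + \<psi> i *\<^sub>R B i) = D2 - (\<psi> i)\<^sup>2 * B2"
      unfolding D2_def B2_def power2_norm_eq_inner
      by (simp add: inner_simps inner_commute power2_eq_square algebra_simps)
    have "edge_form (y i) (y i + v i) (V i) (W i) = (1/2) * g i *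
      ((9 * (2 * yV + s)\<^sup>2 - 3 * (NV + NW)) * q i - 12 * (2 * yV + s) * vD + 2 * D2)"
      unfolding edge_form_def s_eq by (simp add: g_def q_def yV_def s_def vD_def NV_def NW_def D2_def)
    thus "edge_form (y i) (y i + v i) (V i) (W i) - bracket i =
        (1/2) * (g i * ((9 * ((y i \<bullet> V i + (y i + v i) \<bullet> W i)\<^sup>2 - 4 * (y i \<bullet> V i)\<^sup>2)
       - 3 * ((norm (W i))\<^sup>2 - (norm (V i))\<^sup>2)) * q i
       - 12 * (?s i * (v i \<bullet> (W i - V i)))
       - 24 * ((y i \<bullet> V i) * (v i \<bullet> (W i - V i - \<psi> i *\<^sub>R B i)))
       - 24 * ((y i \<bullet> V i) * (\<psi> i * (v i \<bullet> B i - 3 * \<xi> i * (e i \<bullet> y i) * q i)))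
       + 2 * ((W i - V i - \<psi> i *\<^sub>R B i) \<bullet> (W i - V i + \<psi> i *\<^sub>R B i))
       + 2 * (\<psi> i * \<psi> i * ((norm (B i))\<^sup>2 - ((\<xi>' i - \<xi> i + \<xi> i * (3 * (y i \<bullet> v i)))\<^sup>2
     + (\<xi> i)\<^sup>2 * ((norm (A i (v i) (e i)))\<^sup>2 + 9 * (e i \<bullet> y i)\<^sup>2 * q i)))))) +
       (g i * (\<psi> i)\<^sup>2 - 1) * bracket i"
      unfolding s_eq 1 2 bracket_def
      unfolding yV_def[symmetric] s_def[symmetric] vD_def[symmetric] vB'_def[symmetric] a_def[symmetric]
        D2_def[symmetric] B2_def[symmetric] X_def[symmetric] Y_def[symmetric] NV_def[symmetric] NW_def[symmetric]
      unfolding yV_eq NV_eq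
      by (simp add: power2_eq_square field_simps)
  qed simp
qed

text \<open>The left-hand side is the contribution of one edge to the second variation of the discrete
  conformal energy; the exponential factor \<open>\<psi>\<close> in \<open>V\<close> cancels the conformal weight to leading order.\<close>

lemma second_variation_expansion:
  assumes S: "ord 3 (\<lambda>i. S i - g i *\<^sub>R (A i (v i) (v i) + (3 * (norm (v i))\<^sup>2) *\<^sub>R (y i - P i (y i))))"
  shows "ord 3 (\<lambda>i. edge_form (y i) (y i + v i) (V i) (W i) - A i (V i) (V i) \<bullet> S i
    - ((\<xi>' i - \<xi> i)\<^sup>2 + 6 * (y i \<bullet> v i) * \<xi> i * (\<xi>' i - \<xi> i)
      + (\<xi> i)\<^sup>2 * (9 * (y i \<bullet> v i)\<^sup>2 + (norm (A i (v i) (e i)))\<^sup>2 - A i (v i) (v i) \<bullet> A i (e i) (e i)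
         - 3 * (norm (v i))\<^sup>2 * (1 + y i \<bullet> A i (e i) (e i)) - 9 * (e i \<bullet> y i)\<^sup>2 * (norm (v i))\<^sup>2)))"
proof -
  let ?K = "\<lambda>i. A i (v i) (v i) \<bullet> A i (e i) (e i) + 3 * q i * (y i \<bullet> A i (e i) (e i))"
  have Aee: "ord 0 (\<lambda>i. A i (e i) (e i))"
    by (rule ord_le[OF ord_normal_form[OF e0 e0 \<kappa> P A]]) auto
  have Avv: "ord 2 (\<lambda>i. A i (v i) (v i))"
    by (rule ord_le[OF ord_normal_form[OF v v \<kappa> P A]]) auto
  have K: "ord 2 ?K"
    by (intro ord_add ord_le[OF ord_inner[OF Avv Aee]]
        ord_le[OF ord_mult[OF ord_cmult[OF q2] ord_inner[OF y Aee]]]) auto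
  have xi2: "ord 0 (\<lambda>i. (\<xi> i)\<^sup>2)" unfolding power2_eq_square by (rule ord_le[OF ord_mult[OF \<xi> \<xi>]]) simp
  have 1: "ord 3 (\<lambda>i. (\<xi> i)\<^sup>2 * ((g i * (\<psi> i)\<^sup>2 - 1) * ?K i))"
    by (rule ord_le[OF ord_mult[OF xi2 ord_mult[OF g\<psi> K]]]) simp
  have "ord 0 (\<lambda>i. A i (V i) (V i))"
    by (rule ord_le[OF ord_normal_form[OF V0 V0 \<kappa> P A]]) auto
  from ord_inner[OF this S]
  have 2: "ord 3 (\<lambda>i. A i (V i) (V i) \<bullet> (S i - g i *\<^sub>R (A i (v i) (v i) + (3 * (norm (v i))\<^sup>2) *\<^sub>R (y i - P i (y i)))))"
    by (rule ord_le) simp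
  show ?thesis
  proof (rule ord_by[OF ord_diff[OF edge_form_expansion ord_add[OF 1 2]]])
    fix i assume i: "i \<in> I"
    have "A i (e i) (e i) \<bullet> P i (y i) = 0"
      using orth_proj_self_adjoint[OF P[OF i], of "A i (e i) (e i)" "y i"]
        normal_form_normal[OF A[OF i] P[OF i] \<kappa>] by simp
    hence Ny: "A i (e i) (e i) \<bullet> (A i (v i) (v i) + (3 * (norm (v i))\<^sup>2) *\<^sub>R (y i - P i (y i))) = ?K i"
      by (simp add: inner_simps q_def inner_commute)
    have AV: "A i (V i) (V i) = ((\<xi> i)\<^sup>2 * (\<psi> i)\<^sup>2) *\<^sub>R A i (e i) (e i)"
      unfolding V_def normal_form_simps[OF A[OF i] P[OF i] \<kappa>] by (simp add: power2_eq_square ac_simps)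
    have "A i (V i) (V i) \<bullet> (g i *\<^sub>R (A i (v i) (v i) + (3 * (norm (v i))\<^sup>2) *\<^sub>R (y i - P i (y i)))) =
      (\<xi> i)\<^sup>2 * (g i * (\<psi> i)\<^sup>2) * ?K i"
      unfolding AV inner_scaleR_left inner_scaleR_right Ny by simp
    thus "edge_form (y i) (y i + v i) (V i) (W i) - A i (V i) (V i) \<bullet> S i
    - ((\<xi>' i - \<xi> i)\<^sup>2 + 6 * (y i \<bullet> v i) * \<xi> i * (\<xi>' i - \<xi> i)
      + (\<xi> i)\<^sup>2 * (9 * (y i \<bullet> v i)\<^sup>2 + (norm (A i (v i) (e i)))\<^sup>2 - A i (v i) (v i) \<bullet> A i (e i) (e i)
         - 3 * (norm (v i))\<^sup>2 * (1 + y i \<bullet> A i (e i) (e i)) - 9 * (e i \<bullet> y i)\<^sup>2 * (norm (v i))\<^sup>2)) =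
      edge_form (y i) (y i + v i) (V i) (W i) - bracket i
      - ((\<xi> i)\<^sup>2 * ((g i * (\<psi> i)\<^sup>2 - 1) * ?K i)
       + A i (V i) (V i) \<bullet> (S i - g i *\<^sub>R (A i (v i) (v i) + (3 * (norm (v i))\<^sup>2) *\<^sub>R (y i - P i (y i)))))"
      unfolding inner_diff_right bracket_def q_def
      by (simp add: power2_eq_square algebra_simps)
  qed simp
qed

end

text \<open>Positivity of the curvature of the conformal metric in the plane of \<open>t\<close> and \<open>e\<close>: by the Gauss
  equation the first two terms are minus the extrinsic curvature, and the others come from the
  Hessian \<open>|t|\<^sup>2 + y \<bullet> A t t\<close> and the gradient \<open>P y\<close> of \<open>|y|\<^sup>2 / 2\<close>.\<close>

lemma curvature_estimate:
  fixes t e y :: "'v::euclidean_space"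
  assumes P: "orth_proj P" and A: "normal_form \<kappa> P A" and \<kappa>: "\<kappa> \<ge> 0"
    and t: "P t = t" and e: "P e = e" "norm e = 1" "e \<bullet> t = 0"
    and y: "(norm (P y))\<^sup>2 \<le> (1 - (norm y)\<^sup>2) / 2"
  shows "(norm (A t e))\<^sup>2 - A t t \<bullet> A e e - 6 * (norm t)\<^sup>2 - 3 * (y \<bullet> A t t)
      - 3 * (norm t)\<^sup>2 * (y \<bullet> A e e) + 9 * (norm t)\<^sup>2 * (norm (P y))\<^sup>2 \<le> (2 * \<kappa>\<^sup>2 - 3) * (norm t)\<^sup>2"
proof (cases "t = 0")
  case True
  thus ?thesis by (simp add: normal_form_simps[OF A P \<kappa>])
next
  case False
  define \<tau> where "\<tau> = norm t"
  have \<tau>: "\<tau> > 0" using False by (simp add: \<tau>_def)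
  define a where "a = A t t"
  define c where "c = \<tau>\<^sup>2 *\<^sub>R A e e"
  define d where "d = A t e"
  note As = normal_form_simps[OF A P \<kappa>]
  have Plin: "linear P" by (rule orth_proj_linear[OF P])
  \<comment> \<open>The test vectors \<open>t + \<tau> e\<close> and \<open>t - \<tau> e\<close>
    have squared length \<open>2 \<tau>\<^sup>2\<close>. Adding the two squared bounds removes the
    mixed product and gives \<open>par\<close>, which controls \<open>|a + c|\<close> and
    \<open>|d|\<close> simultaneously.\<close>
  have pm: "norm (a + c + (2 * s * \<tau>) *\<^sub>R d) \<le> 2 * \<kappa> * \<tau>\<^sup>2" if s: "s = 1 \<or> s = - 1" for s :: real
  proof -
    define w where "w = t + (s * \<tau>) *\<^sub>R e"
    have ss: "s * s = 1" using s by auto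
    have Aw: "A w w = a + c + (2 * s * \<tau>) *\<^sub>R d"
      unfolding w_def As a_def c_def d_def normal_form_sym[OF A P \<kappa>, of e t]
      using ss by (auto intro!: euclidean_eqI[where 'a = 'v] simp: inner_simps power2_eq_square algebra_simps)
    have Pw: "P w = w" unfolding w_def by (simp add: linear_add[OF Plin] linear_scale[OF Plin] t e)
    have "(norm w)\<^sup>2 = 2 * \<tau>\<^sup>2"
    proof -
      have "e \<bullet> e = 1" "t \<bullet> t = \<tau>\<^sup>2" "t \<bullet> e = 0"
        using e by (auto simp: \<tau>_def norm_eq_1 power2_norm_eq_inner inner_commute)
      hence "w \<bullet> w = \<tau>\<^sup>2 + s * s * \<tau>\<^sup>2"
        unfolding w_def using e(3) by (simp add: inner_simps power2_eq_square)
      thus ?thesis using ss by (simp add: power2_norm_eq_inner)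
    qed
    thus ?thesis using normal_form_bound[OF A P \<kappa>, of w] unfolding Aw Pw by simp
  qed
  have "(norm (a + c + (2 * s * \<tau>) *\<^sub>R d))\<^sup>2 \<le> (2 * \<kappa> * \<tau>\<^sup>2)\<^sup>2" if "s = 1 \<or> s = - 1" for s :: real
    by (intro power_mono pm that) simp
  from this[of 1] this[of "-1"]
  have par: "(norm (a + c))\<^sup>2 + 4 * \<tau>\<^sup>2 * (norm d)\<^sup>2 \<le> 4 * \<kappa>\<^sup>2 * \<tau>\<^sup>2 * \<tau>\<^sup>2"
    unfolding power2_norm_eq_inner
    by (simp add: inner_simps inner_commute power2_eq_square algebra_simps)
  have na: "norm a \<le> \<kappa> * \<tau>\<^sup>2" using normal_form_bound[OF A P \<kappa>, of t] t by (simp add: a_def \<tau>_def)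
  have nc: "norm c \<le> \<kappa> * \<tau>\<^sup>2"
    using normal_form_bound[OF A P \<kappa>, of e] e mult_left_mono[of "norm (A e e)" \<kappa> "\<tau>\<^sup>2"] by (simp add: c_def mult.commute)
  have nac: "(norm a)\<^sup>2 + (norm c)\<^sup>2 \<le> 2 * \<kappa>\<^sup>2 * \<tau>\<^sup>2 * \<tau>\<^sup>2"
    using power_mono[OF na, of 2] power_mono[OF nc, of 2] by (simp add: power2_eq_square algebra_simps)
  define N where "N = y - P y"
  have "P (a + c) = 0"
    unfolding a_def c_def by (simp add: linear_add[OF Plin] linear_scale[OF Plin] normal_form_normal[OF A P \<kappa>])
  hence yN: "y \<bullet> (a + c) = N \<bullet> (a + c)"
    using orth_proj_self_adjoint[OF P, of y "a + c"] by (simp add: N_def inner_diff_left)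
  \<comment> \<open>Completing the square. The available coefficient 3/4 of
    \<open>|a + c|\<^sup>2\<close> is 1/4 from \<open>par\<close> plus 1/2 from writing
    \<open>a \<bullet> c\<close> through norms in \<open>ac\<close>.\<close>
  have sq: "- 3 * \<tau>\<^sup>2 * (N \<bullet> (a + c)) - (3/4) * (norm (a + c))\<^sup>2 \<le> 3 * \<tau>\<^sup>2 * \<tau>\<^sup>2 * (norm N)\<^sup>2"
  proof -
    have "0 \<le> (norm ((2 * \<tau>\<^sup>2) *\<^sub>R N + (a + c)))\<^sup>2" by simp
    also have "\<dots> = 4 * \<tau>\<^sup>2 * \<tau>\<^sup>2 * (norm N)\<^sup>2 + 4 * \<tau>\<^sup>2 * (N \<bullet> (a + c)) + (norm (a + c))\<^sup>2"
      unfolding power2_norm_eq_inner by (simp add: inner_simps inner_commute algebra_simps)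
    finally show ?thesis by (simp add: algebra_simps)
  qed
  \<comment> \<open>By Pythagoras the left side is \<open>3 |y|\<^sup>2 + 6 |P y|\<^sup>2\<close>,
    exactly the combination bounded by the hypothesis on \<open>P y\<close>.\<close>
  have pyth: "3 * (norm N)\<^sup>2 + 9 * (norm (P y))\<^sup>2 \<le> 3"
    using orth_proj_pythagoras[OF P, of y] y unfolding N_def by (simp add: field_simps)
  have ac: "a \<bullet> c = ((norm (a + c))\<^sup>2 - (norm a)\<^sup>2 - (norm c)\<^sup>2) / 2"
    unfolding power2_norm_eq_inner by (simp add: inner_simps inner_commute)
  have "\<tau>\<^sup>2 * (norm d)\<^sup>2 - a \<bullet> c - 6 * \<tau>\<^sup>2 * \<tau>\<^sup>2 - 3 * \<tau>\<^sup>2 * (y \<bullet> (a + c)) + 9 * \<tau>\<^sup>2 * \<tau>\<^sup>2 * (norm (P y))\<^sup>2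
     \<le> 2 * \<kappa>\<^sup>2 * \<tau>\<^sup>2 * \<tau>\<^sup>2 - 6 * \<tau>\<^sup>2 * \<tau>\<^sup>2 + (\<tau>\<^sup>2 * \<tau>\<^sup>2) * (3 * (norm N)\<^sup>2 + 9 * (norm (P y))\<^sup>2)"
    unfolding ac yN using par nac sq by (simp add: algebra_simps diff_divide_distrib add_divide_distrib)
  also have "\<dots> \<le> 2 * \<kappa>\<^sup>2 * \<tau>\<^sup>2 * \<tau>\<^sup>2 - 6 * \<tau>\<^sup>2 * \<tau>\<^sup>2 + (\<tau>\<^sup>2 * \<tau>\<^sup>2) * 3"
    by (intro add_left_mono mult_left_mono pyth) simp
  also have "\<dots> = \<tau>\<^sup>2 * ((2 * \<kappa>\<^sup>2 - 3) * \<tau>\<^sup>2)" by (simp add: algebra_simps)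
  also have "\<tau>\<^sup>2 * (norm d)\<^sup>2 - a \<bullet> c - 6 * \<tau>\<^sup>2 * \<tau>\<^sup>2 - 3 * \<tau>\<^sup>2 * (y \<bullet> (a + c)) + 9 * \<tau>\<^sup>2 * \<tau>\<^sup>2 * (norm (P y))\<^sup>2
    = \<tau>\<^sup>2 * ((norm (A t e))\<^sup>2 - A t t \<bullet> A e e - 6 * (norm t)\<^sup>2 - 3 * (y \<bullet> A t t)
      - 3 * (norm t)\<^sup>2 * (y \<bullet> A e e) + 9 * (norm t)\<^sup>2 * (norm (P y))\<^sup>2)"
    unfolding a_def c_def d_def \<tau>_def by (simp add: inner_simps algebra_simps)
  finally show ?thesis using \<tau> by (simp add: mult_le_cancel_left_pos \<tau>_def)
qed

text \<open>Neighbours differ by at most \<open>c * m\<^sup>2\<close>, where \<open>m\<close> is the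
  maximum. If \<open>m\<close> is at most \<open>1 / (2 c k)\<close>, the drift over all
  \<open>k\<close> places is at most \<open>m / 2\<close>. Otherwise the values stay above
  \<open>m / 2\<close> on a run of more than \<open>1 / (2 c m)\<close> places near the maximum, so
  that their sum is at least \<open>1 / (4 c)\<close>; this exceeds \<open>M / k\<close> for large
  \<open>k\<close>.\<close>

lemma nearly_constant:
  fixes B :: "nat \<Rightarrow> real"
  assumes k: "k > 0" and B: "\<And>i. i < k \<Longrightarrow> B i \<ge> 0" and c: "c > 0"
    and step: "\<And>i. Suc i < k \<Longrightarrow> \<bar>B (Suc i) - B i\<bar> \<le> c * (max (B i) (B (Suc i)))\<^sup>2"
    and sum: "(\<Sum>i<k. B i) \<le> M / real k" and large: "real k > 4 * c * M"
  obtains m where "\<And>i. i < k \<Longrightarrow> m / 2 \<le> B i" "\<And>i. i < k \<Longrightarrow> B i \<le> m" "m \<le> 2 * M / (real k)\<^sup>2"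
proof -
  define m where "m = Max (B ` {..<k})"
  have fin: "finite (B ` {..<k})" "B ` {..<k} \<noteq> {}" using k by auto
  have le_m: "B i \<le> m" if "i < k" for i unfolding m_def using fin that by auto
  from Max_in[OF fin] obtain j where j: "j < k" "B j = m" unfolding m_def by auto
  have m0: "m \<ge> 0" using B[OF j(1)] j(2) by simp
  have step': "\<bar>B (Suc i) - B i\<bar> \<le> c * m\<^sup>2" if "Suc i < k" for i
  proof -
    have "max (B i) (B (Suc i)) \<le> m" "0 \<le> max (B i) (B (Suc i))"
      using le_m[of i] le_m[of "Suc i"] B[of i] that by auto
    hence "c * (max (B i) (B (Suc i)))\<^sup>2 \<le> c * m\<^sup>2"
      using c by (intro mult_left_mono power_mono) auto
    thus ?thesis using step[OF that] by linarith
  qed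
  have up: "\<bar>B (i + n) - B i\<bar> \<le> real n * (c * m\<^sup>2)" if "i + n < k" for i n
    using that
  proof (induction n)
    case (Suc n)
    thus ?case using step'[of "i + n"] by (simp add: algebra_simps)
  qed simp
  have dist: "B i \<ge> m - real r * (c * m\<^sup>2)" if "i < k" "i \<le> j + r" "j \<le> i + r" for i r
  proof (cases "i \<le> j")
    case True
    have "\<bar>B j - B i\<bar> \<le> real (j - i) * (c * m\<^sup>2)" using up[of i "j - i"] True j by simp
    also have "\<dots> \<le> real r * (c * m\<^sup>2)" using that c by (intro mult_right_mono) auto
    finally show ?thesis using j(2) by linarith
  next
    case False
    have "\<bar>B i - B j\<bar> \<le> real (i - j) * (c * m\<^sup>2)" using up[of j "i - j"] False that by simp
    also have "\<dots> \<le> real r * (c * m\<^sup>2)" using that c by (intro mult_right_mono) auto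
    finally show ?thesis using j(2) by linarith
  qed
  show thesis
  proof (cases "c * m * real k \<le> 1 / 2")
    case True
    have low: "m / 2 \<le> B i" if "i < k" for i
    proof -
      have "real k * (c * m\<^sup>2) = m * (c * m * real k)" by (simp add: power2_eq_square)
      also have "\<dots> \<le> m * (1 / 2)" by (intro mult_left_mono True m0)
      finally show ?thesis using dist[of i k] that j by simp
    qed
    have "real k * (m / 2) = (\<Sum>i<k. m / 2)" by simp
    also have "\<dots> \<le> (\<Sum>i<k. B i)" by (intro sum_mono low) simp
    finally have "real k * (m / 2) \<le> M / real k" using sum by linarith
    hence "m \<le> 2 * M / (real k)\<^sup>2" using k by (simp add: field_simps power2_eq_square)
    with low le_m that show ?thesis by blast
  next
    case False
    hence m: "m > 0" using m0 by (cases "m = 0") auto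
    define r where "r = nat \<lfloor>1 / (2 * c * m)\<rfloor>"
    have r1: "real r \<le> 1 / (2 * c * m)" unfolding r_def using c m by (intro of_nat_floor) simp
    have r2: "1 / (2 * c * m) < real r + 1" unfolding r_def using c m by linarith
    have "1 / (2 * c * m) < real k" using False c m by (simp add: field_simps)
    hence "r < k" using r1 by linarith
    \<comment> \<open>Start of a run of \<open>r + 1\<close> indices that contains \<open>j\<close>
      and is pushed back, if necessary, to end within the chain.\<close>
    define s where "s = min j (k - 1 - r)"
    have low: "m / 2 \<le> B i" if "i \<in> {s..s + r}" for i
    proof -
      have "i < k" "i \<le> j + r" "j \<le> i + r" using that \<open>r < k\<close> j(1) unfolding s_def by auto
      from dist[OF this] have "m - real r * (c * m\<^sup>2) \<le> B i" .
      moreover have "real r * (c * m\<^sup>2) \<le> (1 / (2 * c * m)) * (c * m\<^sup>2)"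
        using r1 c by (intro mult_right_mono) auto
      moreover have "(1 / (2 * c * m)) * (c * m\<^sup>2) = m / 2"
        using c m by (simp add: power2_eq_square)
      ultimately show ?thesis by linarith
    qed
    have sub: "{s..s + r} \<subseteq> {..<k}" using \<open>r < k\<close> unfolding s_def by auto
    have "1 / (4 * c) \<le> (real r + 1) * (m / 2)"
    proof -
      have "1 / (4 * c) = (1 / (2 * c * m)) * (m / 2)" using m by simp
      also have "\<dots> \<le> (real r + 1) * (m / 2)" using r2 m by (intro mult_right_mono) auto
      finally show ?thesis .
    qed
    also have "\<dots> = (\<Sum>i\<in>{s..s + r}. m / 2)" by simp
    also have "\<dots> \<le> (\<Sum>i\<in>{s..s + r}. B i)" by (intro sum_mono low)
    also have "\<dots> \<le> (\<Sum>i<k. B i)" by (intro sum_mono2 sub) (use B in auto)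
    also have "\<dots> \<le> M / real k" by (rule sum)
    finally have "real k \<le> 4 * c * M" using c k by (simp add: field_simps)
    thus ?thesis using large by simp
  qed
qed

lemma sum_by_parts:
  fixes r s :: "nat \<Rightarrow> real"
  shows "(\<Sum>i<Suc n. (r (Suc i) - r i) * (s (Suc i) - s i)) =
    (r (Suc n) - r n) * s (Suc n) - (r 1 - r 0) * s 0
     - (\<Sum>i<n. s (Suc i) * (r (Suc (Suc i)) - 2 * r (Suc i) + r i))"
  by (induction n) (simp_all add: algebra_simps)

section \<open>Long critical chains\<close>

text \<open>A sequence of critical chains, the \<open>l\<close>-th having \<open>8 l\<close> edges. \<open>N_next\<close> and \<open>N_prev\<close> expand an edge
  in the tangent space of either end; \<open>T_next\<close> and \<open>T_prev\<close> compare neighbouring tangent spaces.\<close>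

locale chains =
  fixes \<kappa> C M L :: real and y :: "nat \<Rightarrow> nat \<Rightarrow> 'v::euclidean_space"
    and P :: "nat \<Rightarrow> nat \<Rightarrow> 'v \<Rightarrow> 'v" and A :: "nat \<Rightarrow> nat \<Rightarrow> 'v \<Rightarrow> 'v \<Rightarrow> 'v" and d and l0 :: nat
  assumes \<kappa>: "\<kappa> \<ge> 0" "2 * \<kappa>\<^sup>2 < 3" and C: "C \<ge> 0" and L: "L > 0" "256 * exp 3 < (3 - 2 * \<kappa>\<^sup>2) * L\<^sup>2"
    and l0: "l0 > 0"
    and P: "l0 \<le> l \<Longrightarrow> i \<le> 8 * l \<Longrightarrow> orth_proj (P l i)"
    and A: "l0 \<le> l \<Longrightarrow> i \<le> 8 * l \<Longrightarrow> normal_form \<kappa> (P l i) (A l i)"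
    and y: "l0 \<le> l \<Longrightarrow> i \<le> 8 * l \<Longrightarrow> norm (y l i) \<le> 1"
    and Py: "l0 \<le> l \<Longrightarrow> i \<le> 8 * l \<Longrightarrow> (norm (P l i (y l i)))\<^sup>2 \<le> (1 - (norm (y l i))\<^sup>2) / 2"
    and d_def: "d = (\<lambda>l i. y l (Suc i) - y l i)"
    and N_next: "l0 \<le> l \<Longrightarrow> i < 8 * l \<Longrightarrow>
      norm (d l i - P l i (d l i) - (1/2) *\<^sub>R A l i (d l i) (d l i)) \<le> C * norm (d l i) ^ 3"
    and N_prev: "l0 \<le> l \<Longrightarrow> i < 8 * l \<Longrightarrow>
      norm (d l i - P l (Suc i) (d l i) + (1/2) *\<^sub>R A l (Suc i) (d l i) (d l i)) \<le> C * norm (d l i) ^ 3"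
    and T_next: "l0 \<le> l \<Longrightarrow> i < 8 * l \<Longrightarrow> P l i a = a \<Longrightarrow>
      norm (a - P l (Suc i) a - A l (Suc i) (- d l i) a) \<le> C * (norm (d l i))\<^sup>2 * norm a"
    and T_prev: "l0 \<le> l \<Longrightarrow> i < 8 * l \<Longrightarrow> P l (Suc i) a = a \<Longrightarrow>
      norm (a - P l i a - A l i (d l i) a) \<le> C * (norm (d l i))\<^sup>2 * norm a"
    and el: "l0 \<le> l \<Longrightarrow> Suc i < 8 * l \<Longrightarrow> P l (Suc i) (el_vector (y l i) (y l (Suc i)) (y l (Suc (Suc i)))) = 0"
    and second_variation: "l0 \<le> l \<Longrightarrow> (\<And>i. i \<le> 8 * l \<Longrightarrow> P l i (V i) = V i) \<Longrightarrow> V 0 = 0 \<Longrightarrow> V (8 * l) = 0 \<Longrightarrow>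
      0 \<le> (\<Sum>i<8 * l. edge_form (y l i) (y l (Suc i)) (V i) (V (Suc i)))
        - (\<Sum>i<8 * l - 1. A l (Suc i) (V (Suc i)) (V (Suc i)) \<bullet> el_vector (y l i) (y l (Suc i)) (y l (Suc (Suc i))))"
    and energy: "l0 \<le> l \<Longrightarrow> (\<Sum>i<8 * l. conf_weight (y l i) (y l (Suc i)) * (norm (d l i))\<^sup>2) \<le> M / real (8 * l)"
    and length: "l0 \<le> l \<Longrightarrow> L \<le> (\<Sum>i<8 * l. norm (d l i))"
    and perp: "l0 \<le> l \<Longrightarrow> \<exists>e. P l 0 e = e \<and> norm e = 1 \<and> e \<bullet> a = 0"
begin

section \<open>Lengths of the edges\<close>

lemma weight_bounds:
  assumes "l0 \<le> l" "i < 8 * l"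
  shows "exp (- 3) \<le> conf_weight (y l i) (y l (Suc i))" "conf_weight (y l i) (y l (Suc i)) \<le> 1"
proof -
  have "(norm (y l i))\<^sup>2 \<le> 1" "(norm (y l (Suc i)))\<^sup>2 \<le> 1"
    using y[of l i] y[of l "Suc i"] assms by (auto intro: power_le_one)
  thus "exp (- 3) \<le> conf_weight (y l i) (y l (Suc i))" "conf_weight (y l i) (y l (Suc i)) \<le> 1"
    unfolding conf_weight_def by (auto intro: add_nonneg_nonneg)
qed

definition "B l i = conf_weight (y l i) (y l (Suc i)) * (norm (d l i))\<^sup>2"

lemma B_bounds:
  assumes "l0 \<le> l" "i < 8 * l"
  shows "B l i \<ge> 0" "(norm (d l i))\<^sup>2 \<le> exp 3 * B l i" "B l i \<le> (norm (d l i))\<^sup>2"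
proof -
  show "B l i \<ge> 0" using weight_bounds[OF assms] by (simp add: B_def conf_weight_pos less_imp_le)
  have "exp (- 3) * (norm (d l i))\<^sup>2 \<le> B l i"
    unfolding B_def by (intro mult_right_mono weight_bounds assms) simp
  thus "(norm (d l i))\<^sup>2 \<le> exp 3 * B l i" by (simp add: exp_minus field_simps)
  show "B l i \<le> (norm (d l i))\<^sup>2"
    unfolding B_def using mult_right_mono[OF weight_bounds(2)[OF assms], of "(norm (d l i))\<^sup>2"] by simp
qed

text \<open>The scale is left open because two are used: the local edge length, as long as no
  uniform bound is known, and \<open>1 / (8 l)\<close> afterwards.\<close>

lemma triple_ords:
  fixes I :: "(nat \<times> nat) set"
  assumes "scale I h" and I: "\<And>l i. (l, i) \<in> I \<Longrightarrow> l0 \<le> l \<and> Suc i < 8 * l"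
    and bound: "\<And>l i. (l, i) \<in> I \<Longrightarrow> norm (d l i) \<le> K * h (l, i) \<and> norm (d l (Suc i)) \<le> K * h (l, i)"
  shows "triple I h \<kappa> (\<lambda>p. y (fst p) (snd p)) (\<lambda>p. y (fst p) (Suc (snd p))) (\<lambda>p. y (fst p) (Suc (Suc (snd p))))
     (\<lambda>p. P (fst p) (Suc (snd p))) (\<lambda>p. A (fst p) (Suc (snd p))) (\<lambda>p. d (fst p) (snd p)) (\<lambda>p. d (fst p) (Suc (snd p)))"
proof -
  interpret scale I h by fact
  have u: "ord 1 (\<lambda>p. d (fst p) (snd p))" and v: "ord 1 (\<lambda>p. d (fst p) (Suc (snd p)))"
    by (auto intro!: ordI[of _ K] dest: bound)
  have cube: "ord 3 g" if "ord 1 f" "\<And>i. i \<in> I \<Longrightarrow> norm (g i) \<le> C * norm (f i) ^ 3"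
    for f g :: "nat \<times> nat \<Rightarrow> 'v"
  proof -
    have "ord 3 (\<lambda>i. C * (norm (f i) * (norm (f i) * norm (f i))))"
      by (rule ord_le[OF ord_cmult[OF ord_mult[OF ord_norm[OF that(1)]
            ord_mult[OF ord_norm[OF that(1)] ord_norm[OF that(1)]]]]]) simp
    thus ?thesis
      by (rule ord_norm_mono) (use that(2) C in \<open>auto simp: power3_eq_cube abs_mult mult.assoc\<close>)
  qed
  have I': "l0 \<le> fst p" "Suc (snd p) < 8 * fst p" "snd p < 8 * fst p" "Suc (snd p) \<le> 8 * fst p" if "p \<in> I" for p
    using I[of "fst p" "snd p"] that by auto
  show ?thesis
    by unfold_locales
      (rule \<kappa> u v refl ext cube[OF v] cube[OF u] P A y el N_next N_prev I' | assumption | simp add: d_def)+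
qed

text \<open>In the scale of the edges themselves, \<open>energy_diff\<close> says that the energies
  of adjacent edges differ by a multiple of their squares. This is the input of
  \<open>nearly_constant\<close>, which makes all edge energies comparable; total energy then bounds
  the edges from above and total length bounds them from below.\<close>

lemma steps_uniform:
  obtains l1 K where "l0 \<le> l1" "K > 0"
    "\<And>l i. l1 \<le> l \<Longrightarrow> i < 8 * l \<Longrightarrow> norm (d l i) \<le> K * (1 / real (8 * l))"
    "\<And>l i. l1 \<le> l \<Longrightarrow> i < 8 * l \<Longrightarrow> (exp (- 3) * L\<^sup>2 / 2) * (1 / real (8 * l))\<^sup>2 \<le> (norm (d l i))\<^sup>2"
proof -
  have M0: "M \<ge> 0"
  proof -
    have "0 \<le> (\<Sum>i<8 * l0. B l0 i)" by (intro sum_nonneg B_bounds) auto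
    also have "\<dots> \<le> M / real (8 * l0)" using energy[of l0] by (simp add: B_def)
    finally show ?thesis using l0 by (simp add: field_simps)
  qed
  obtain l' :: nat where l': "exp 3 * M \<le> real l'" using real_arch_simple by blast
  define l1 where "l1 = max l0 l'"
  have small: "norm (d l i) \<le> 1" if "l1 \<le> l" "i < 8 * l" for l i
  proof -
    have l: "l0 \<le> l" "l > 0" using that l0 by (auto simp: l1_def)
    have "B l i \<le> (\<Sum>i<8 * l. B l i)"
      by (rule member_le_sum) (use that B_bounds l in auto)
    also have "\<dots> \<le> M / real (8 * l)" using energy[of l] l by (simp add: B_def)
    finally have "(norm (d l i))\<^sup>2 \<le> exp 3 * (M / real (8 * l))"
      using B_bounds(2)[OF l(1) that(2)] mult_left_mono[of "B l i" "M / real (8 * l)" "exp 3"] by simp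
    also have "\<dots> \<le> 1"
    proof -
      have "real l' \<le> real l" using that by (simp add: l1_def)
      hence "exp 3 * M \<le> real (8 * l)" using l' by linarith
      thus ?thesis using l by (simp add: field_simps)
    qed
    finally show ?thesis by (simp add: power_le_one_iff abs_square_le_1)
  qed
  define I where "I = {(l, i). l1 \<le> l \<and> Suc i < 8 * l}"
  \<comment> \<open>No relation between edge length and the number of edges is available yet, so the
    longer of the two adjacent edges serves as scale; \<open>small\<close> ensures that it is at
    most 1.\<close>
  define h where "h = (\<lambda>(l, i). max (norm (d l i)) (norm (d l (Suc i))))"
  have sc: "scale I h"
    by unfold_locales (auto simp: I_def h_def le_max_iff_disj intro!: small)
  have Il: "l0 \<le> l \<and> Suc i < 8 * l" if "(l, i) \<in> I" for l i
    using that by (auto simp: I_def l1_def)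
  have hb: "norm (d l i) \<le> 1 * h (l, i) \<and> norm (d l (Suc i)) \<le> 1 * h (l, i)" if "(l, i) \<in> I" for l i
    by (simp add: h_def)
  interpret T: triple I h \<kappa> "\<lambda>p. y (fst p) (snd p)" "\<lambda>p. y (fst p) (Suc (snd p))" "\<lambda>p. y (fst p) (Suc (Suc (snd p)))"
     "\<lambda>p. P (fst p) (Suc (snd p))" "\<lambda>p. A (fst p) (Suc (snd p))" "\<lambda>p. d (fst p) (snd p)" "\<lambda>p. d (fst p) (Suc (snd p))"
    by (rule triple_ords[OF sc Il hb])
  obtain D where D: "D \<ge> 0" "\<And>p. p \<in> I \<Longrightarrow> norm (T.gv p * (norm (d (fst p) (Suc (snd p))))\<^sup>2 - T.gu p * (norm (d (fst p) (snd p)))\<^sup>2) \<le> D * h p ^ 4"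
    by (rule T.ordE[OF T.energy_diff], rule that)
  define c where "c = (D + 1) * (exp 3)\<^sup>2"
  have c: "c > 0" using D(1) by (simp add: c_def)
  have step: "\<bar>B l (Suc i) - B l i\<bar> \<le> c * (max (B l i) (B l (Suc i)))\<^sup>2" if "l1 \<le> l" "Suc i < 8 * l" for l i
  proof -
    have l: "l0 \<le> l" using that by (simp add: l1_def)
    have p: "(l, i) \<in> I" using that by (auto simp: I_def)
    have "\<bar>B l (Suc i) - B l i\<bar> \<le> D * h (l, i) ^ 4"
      using D(2)[OF p] by (simp add: T.gv_def T.gu_def B_def)
    also have "h (l, i) ^ 4 = ((h (l, i))\<^sup>2)\<^sup>2" by simp
    also have "D * ((h (l, i))\<^sup>2)\<^sup>2 \<le> (D + 1) * (exp 3 * max (B l i) (B l (Suc i)))\<^sup>2"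
    proof (intro mult_mono power_mono)
      have "(norm (d l i))\<^sup>2 \<le> exp 3 * max (B l i) (B l (Suc i))"
        "(norm (d l (Suc i)))\<^sup>2 \<le> exp 3 * max (B l i) (B l (Suc i))"
        using B_bounds(2)[OF l, of i] B_bounds(2)[OF l, of "Suc i"] that
        by (auto intro: order_trans mult_left_mono)
      thus "(h (l, i))\<^sup>2 \<le> exp 3 * max (B l i) (B l (Suc i))" unfolding h_def by (cases "norm (d l i) \<le> norm (d l (Suc i))") (simp_all add: max_absorb1 max_absorb2)
    qed (use D(1) in auto)
    finally show ?thesis by (simp add: c_def power_mult_distrib ac_simps)
  qed
  obtain l'' :: nat where l'': "4 * c * M \<le> real l''" using real_arch_simple by blast
  define l2 where "l2 = max l1 l''"
  have main: "(exp (- 3) * L\<^sup>2 / 2) * (1 / real (8 * l))\<^sup>2 \<le> (norm (d l i))\<^sup>2 \<and>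
      (norm (d l i))\<^sup>2 \<le> (2 * exp 3 * M) * (1 / real (8 * l))\<^sup>2" if l2: "l2 \<le> l" and i: "i < 8 * l" for l i
  proof -
    have l: "l0 \<le> l" "l1 \<le> l" "l > 0" using l2 l0 by (auto simp: l2_def l1_def)
    have "real l'' \<le> real l" using l2 by (simp add: l2_def)
    moreover have "real l < real (8 * l)" using l by simp
    ultimately have large: "real (8 * l) > 4 * c * M" using l'' by linarith
    have sumB: "(\<Sum>i<8 * l. B l i) \<le> M / real (8 * l)" using energy[OF l(1)] by (simp add: B_def)
    obtain m where m: "\<And>i. i < 8 * l \<Longrightarrow> m / 2 \<le> B l i" "\<And>i. i < 8 * l \<Longrightarrow> B l i \<le> m" "m \<le> 2 * M / (real (8 * l))\<^sup>2"
      using nearly_constant[OF _ B_bounds(1)[OF l(1)] c step[OF l(2)] sumB large] l by auto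
    \<comment> \<open>Cauchy--Schwarz turns the lower bound for the length into one for the largest
      edge energy \<open>m\<close>, and every edge has at least half of it.\<close>
    have "L\<^sup>2 \<le> (\<Sum>i<8 * l. norm (d l i))\<^sup>2"
      using length[OF l(1)] L by (intro power_mono) auto
    also have "\<dots> \<le> (\<Sum>i<8 * l. (norm (d l i))\<^sup>2) * real (8 * l)"
      using sum_squared_le_sum_of_squares[of "\<lambda>i. norm (d l i)" "{..<8 * l}"] by (simp add: mult.commute)
    also have "\<dots> \<le> (\<Sum>i<8 * l. exp 3 * m) * real (8 * l)"
      by (intro mult_right_mono sum_mono order_trans[OF B_bounds(2)[OF l(1)]] mult_left_mono m) auto
    finally have "L\<^sup>2 \<le> exp 3 * m * (real (8 * l))\<^sup>2" by (simp add: power2_eq_square algebra_simps)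
    hence "(exp (- 3) * L\<^sup>2 / 2) * (1 / real (8 * l))\<^sup>2 \<le> m / 2"
      using l by (simp add: exp_minus field_simps power2_eq_square)
    also have "\<dots> \<le> (norm (d l i))\<^sup>2" using m(1)[OF i] B_bounds(3)[OF l(1) i] by simp
    finally have 1: "(exp (- 3) * L\<^sup>2 / 2) * (1 / real (8 * l))\<^sup>2 \<le> (norm (d l i))\<^sup>2" .
    have "(norm (d l i))\<^sup>2 \<le> exp 3 * (2 * M / (real (8 * l))\<^sup>2)"
      by (intro order_trans[OF B_bounds(2)[OF l(1) i]] mult_left_mono order_trans[OF m(2)[OF i] m(3)]) simp
    with 1 show ?thesis by (simp add: power2_eq_square mult.commute[of M])
  qed
  show thesis
  proof (rule that)
    show "l0 \<le> l2" by (simp add: l2_def l1_def)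
    show "sqrt (2 * exp 3 * M) + 1 > 0" using M0 by (simp add: add_nonneg_pos)
    fix l i assume l: "l2 \<le> l" "i < 8 * l"
    show "(exp (- 3) * L\<^sup>2 / 2) * (1 / real (8 * l))\<^sup>2 \<le> (norm (d l i))\<^sup>2" using main[OF l] by blast
    have "norm (d l i) \<le> sqrt ((2 * exp 3 * M) * (1 / real (8 * l))\<^sup>2)"
      using main[OF l] by (intro real_le_rsqrt) auto
    also have "\<dots> = sqrt (2 * exp 3 * M) * (1 / real (8 * l))"
      by (simp add: real_sqrt_mult real_sqrt_divide)
    also have "\<dots> \<le> (sqrt (2 * exp 3 * M) + 1) * (1 / real (8 * l))"
      by (intro mult_right_mono) auto
    finally show "norm (d l i) \<le> (sqrt (2 * exp 3 * M) + 1) * (1 / real (8 * l))" .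
  qed
qed

end

lemma ord_reindex:
  assumes "scale I h" "scale J (\<lambda>p. h (\<pi> p))" "\<And>p. p \<in> J \<Longrightarrow> \<pi> p \<in> I" "scale.ord I h j f"
  shows "scale.ord J (\<lambda>p. h (\<pi> p)) j (\<lambda>p. f (\<pi> p))"
  using assms(3,4) unfolding scale.ord_def[OF assms(1)] scale.ord_def[OF assms(2)] by blast

context chains
begin

text \<open>An edge is tangent up to second order, so for large \<open>l\<close> its normal part
  costs at most half of the squared length \<open>exp (- 3) * L\<^sup>2 / 2\<close> per squared
  scale. The root of the other half is the constant \<open>exp (- 3/2) * L / 2\<close>.\<close>

lemma tangential_lower:
  obtains l1 K where "l0 \<le> l1" "K > 0"
    "\<And>l i. l1 \<le> l \<Longrightarrow> i < 8 * l \<Longrightarrow> norm (d l i) \<le> K * (1 / real (8 * l))"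
    "\<And>l i. l1 \<le> l \<Longrightarrow> i < 8 * l \<Longrightarrow> norm (d l i - P l i (d l i)) \<le> K * (1 / real (8 * l))\<^sup>2"
    "\<And>l i. l1 \<le> l \<Longrightarrow> i < 8 * l \<Longrightarrow> exp (- 3/2) * L / 2 * (1 / real (8 * l)) \<le> norm (P l i (d l i))"
proof -
  obtain l1 K where l1: "l0 \<le> l1" and K: "K > 0"
    and up: "\<And>l i. l1 \<le> l \<Longrightarrow> i < 8 * l \<Longrightarrow> norm (d l i) \<le> K * (1 / real (8 * l))"
    and low: "\<And>l i. l1 \<le> l \<Longrightarrow> i < 8 * l \<Longrightarrow> (exp (- 3) * L\<^sup>2 / 2) * (1 / real (8 * l))\<^sup>2 \<le> (norm (d l i))\<^sup>2"
    using steps_uniform by metis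
  define K' where "K' = K + C * K ^ 3 + \<kappa> * K\<^sup>2"
  have K': "K \<le> K'" "K' > 0"
    using K C \<kappa> by (auto simp: K'_def add_pos_nonneg)
  have N: "norm (d l i - P l i (d l i)) \<le> K' * (1 / real (8 * l))\<^sup>2" if l: "l1 \<le> l" "i < 8 * l" for l i
  proof -
    define h where "h = 1 / real (8 * l)"
    have h: "0 < h" "h \<le> 1" using that by (auto simp: h_def)
    have up': "norm (d l i) \<le> K * h" using up[OF l] by (simp add: h_def)
    have l': "l0 \<le> l" "i \<le> 8 * l" using l l1 by auto
    have half: "norm ((1/2) *\<^sub>R A l i (d l i) (d l i)) \<le> norm (A l i (d l i) (d l i))"
      using norm_ge_zero[of "A l i (d l i) (d l i)"] unfolding norm_scaleR by linarith
    have "norm (d l i - P l i (d l i)) \<le> norm (d l i - P l i (d l i) - (1/2) *\<^sub>R A l i (d l i) (d l i)) + norm ((1/2) *\<^sub>R A l i (d l i) (d l i))"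
      by (metis diff_add_cancel norm_triangle_ineq)
    also have "\<dots> \<le> C * norm (d l i) ^ 3 + \<kappa> * norm (d l i) * norm (d l i)"
      using N_next[OF l'(1) l(2)] normal_form_norm_le[OF A[OF l'] P[OF l'] \<kappa>(1), of "d l i" "d l i"]
      by (intro add_mono order_trans[OF half])
    also have "\<dots> \<le> C * (K * h) ^ 3 + \<kappa> * (K * h) * (K * h)"
      using C \<kappa> up' K h by (intro add_mono mult_mono power_mono mult_nonneg_nonneg) auto
    also have "\<dots> = (C * K ^ 3 * h + \<kappa> * K\<^sup>2) * h\<^sup>2" by (simp add: power2_eq_square power3_eq_cube algebra_simps)
    also have "\<dots> \<le> K' * h\<^sup>2"
      using C K h mult_left_mono[of h 1 "C * K ^ 3"] by (intro mult_right_mono) (auto simp: K'_def)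
    finally show ?thesis by (simp add: h_def)
  qed
  obtain l' :: nat where l': "4 * K'\<^sup>2 / (exp (- 3) * L\<^sup>2) \<le> real l'" using real_arch_simple by blast
  show thesis
  proof (rule that[of "max l1 l'" K'])
    fix l i assume l: "max l1 l' \<le> l" "i < 8 * l"
    define h where "h = 1 / real (8 * l)"
    have h: "0 < h" "h \<le> 1" "h \<le> 1 / real l" using l by (auto simp: h_def field_simps)
    have l': "l1 \<le> l" "real l' \<le> real l" "l0 \<le> l" "l > 0" using l l1 by auto
    show "norm (d l i) \<le> K' * (1 / real (8 * l))"
      using up[OF l'(1) l(2)] K'(1) mult_right_mono[OF K'(1), of "1 / real (8 * l)"] by simp
    show "norm (d l i - P l i (d l i)) \<le> K' * (1 / real (8 * l))\<^sup>2" by (rule N[OF l'(1) l(2)])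
    have "(norm (d l i - P l i (d l i)))\<^sup>2 \<le> (K' * h\<^sup>2)\<^sup>2"
      using N[OF l'(1) l(2)] by (intro power_mono) (auto simp: h_def)
    also have "\<dots> = K'\<^sup>2 * h\<^sup>2 * h\<^sup>2" by (simp add: power2_eq_square)
    also have "\<dots> \<le> (exp (- 3) * L\<^sup>2 / 4) * h\<^sup>2"
    proof (rule mult_right_mono)
      have "4 * K'\<^sup>2 / (exp (- 3) * L\<^sup>2) \<le> real l" using \<open>_ \<le> real l'\<close> l'(2) by linarith
      hence *: "K'\<^sup>2 * (1 / real l) \<le> exp (- 3) * L\<^sup>2 / 4" using L l'(4) by (simp add: field_simps)
      have "h\<^sup>2 \<le> 1 / real l"
        using h mult_mono[of h "1 / real l" h 1] by (simp add: power2_eq_square)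
      thus "K'\<^sup>2 * h\<^sup>2 \<le> exp (- 3) * L\<^sup>2 / 4"
        by (intro order_trans[OF mult_left_mono *]) simp_all
    qed simp
    finally have "(exp (- 3/2) * L / 2 * h)\<^sup>2 \<le> (norm (P l i (d l i)))\<^sup>2"
      using orth_proj_pythagoras[OF P[of l i], of "d l i"] low[OF l'(1) l(2)] l l'
      by (simp add: power_mult_distrib power_divide h_def exp_double[symmetric])
    thus "exp (- 3/2) * L / 2 * (1 / real (8 * l)) \<le> norm (P l i (d l i))"
      unfolding h_def by (rule power2_le_imp_le) simp
  qed (use l1 K' in auto)
qed

section \<open>A transported frame along each chain\<close>

lemma scale_inverse:
  assumes "\<And>p. p \<in> I \<Longrightarrow> l0 \<le> f p"
  shows "scale I (\<lambda>p. 1 / real (8 * f p))"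
  by unfold_locales (use assms l0 in \<open>force simp: divide_le_eq_1\<close>)+

text \<open>The frame is built by recursion along the chain, so the one-step constant must hold for
  every admissible vector and not for a field given in advance. For this reason the order calculus
  runs over the triples \<open>(l, i, e)\<close> in \<open>J\<close>, and the field is chosen only
  afterwards.\<close>

lemma transported_frames:
  obtains l1 e D where "l0 \<le> l1"
    "\<And>l i. l1 \<le> l \<Longrightarrow> i < 8 * l \<Longrightarrow> P l i (e l i) = e l i \<and> norm (e l i) = 1 \<and> e l i \<bullet> d l i = 0"
    "\<And>l i. l1 \<le> l \<Longrightarrow> Suc i < 8 * l \<Longrightarrow>
      norm (e l (Suc i) - e l i - A l i (d l i) (e l i) - (3 * (e l i \<bullet> y l i)) *\<^sub>R d l i) \<le> D * (1 / real (8 * l))\<^sup>2"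
proof -
  obtain l1 K where l1: "l0 \<le> l1" and K: "K > 0"
    and up: "\<And>l i. l1 \<le> l \<Longrightarrow> i < 8 * l \<Longrightarrow> norm (d l i) \<le> K * (1 / real (8 * l))"
    and N: "\<And>l i. l1 \<le> l \<Longrightarrow> i < 8 * l \<Longrightarrow> norm (d l i - P l i (d l i)) \<le> K * (1 / real (8 * l))\<^sup>2"
    and low: "\<And>l i. l1 \<le> l \<Longrightarrow> i < 8 * l \<Longrightarrow> exp (- 3/2) * L / 2 * (1 / real (8 * l)) \<le> norm (P l i (d l i))"
    using tangential_lower by metis
  define I where "I = {(l, i). l1 \<le> l \<and> Suc i < 8 * l}"
  define valid where "valid = (\<lambda>l i e. P l i e = e \<and> norm e = 1 \<and> e \<bullet> d l i = 0)"
  define J where "J = {(l, i, e). l1 \<le> l \<and> Suc i < 8 * l \<and> valid l i e}"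
  have scI: "scale I (\<lambda>p. 1 / real (8 * fst p))"
    by (rule scale_inverse) (use l1 in \<open>auto simp: I_def\<close>)
  have scJ: "scale J (\<lambda>p. 1 / real (8 * fst p))"
    by (rule scale_inverse) (use l1 in \<open>auto simp: J_def\<close>)
  have I0: "l0 \<le> l \<and> Suc i < 8 * l" if "(l, i) \<in> I" for l i using that l1 by (auto simp: I_def)
  have hb: "norm (d l i) \<le> K * (1 / real (8 * fst (l, i))) \<and> norm (d l (Suc i)) \<le> K * (1 / real (8 * fst (l, i)))"
    if "(l, i) \<in> I" for l i
    using that up by (auto simp: I_def)
  interpret T: triple I "\<lambda>p. 1 / real (8 * fst p)" \<kappa> "\<lambda>p. y (fst p) (snd p)" "\<lambda>p. y (fst p) (Suc (snd p))" "\<lambda>p. y (fst p) (Suc (Suc (snd p)))"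
     "\<lambda>p. P (fst p) (Suc (snd p))" "\<lambda>p. A (fst p) (Suc (snd p))" "\<lambda>p. d (fst p) (snd p)" "\<lambda>p. d (fst p) (Suc (snd p))"
    by (rule triple_ords[OF scI I0 hb])
  interpret J: scale J "\<lambda>p. 1 / real (8 * fst p)" by (rule scJ)
  have JI: "(fst p, fst (snd p)) \<in> I" if "p \<in> J" for p using that by (auto simp: I_def J_def)
  have re: "T.ord j f \<Longrightarrow> J.ord j (\<lambda>p. f (fst p, fst (snd p)))" for j and f :: "_ \<Rightarrow> 'v"
    using ord_reindex[OF scI _ JI, where j = j and f = f] scJ by simp
  have J': "l0 \<le> fst p" "l1 \<le> fst p" "Suc (fst (snd p)) < 8 * fst p" "fst (snd p) < 8 * fst p" "fst (snd p) \<le> 8 * fst p"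
     "Suc (fst (snd p)) \<le> 8 * fst p" if "p \<in> J" for p
    using that l1 by (auto simp: J_def)
  interpret R: transport J "\<lambda>p. 1 / real (8 * fst p)" \<kappa> "\<lambda>p. y (fst p) (fst (snd p))" "\<lambda>p. d (fst p) (fst (snd p))"
    "\<lambda>p. snd (snd p)" "\<lambda>p. y (fst p) (Suc (fst (snd p)))" "\<lambda>p. d (fst p) (Suc (fst (snd p)))"
    "\<lambda>p. P (fst p) (fst (snd p))" "\<lambda>p. P (fst p) (Suc (fst (snd p)))"
    "\<lambda>p. A (fst p) (fst (snd p))" "\<lambda>p. A (fst p) (Suc (fst (snd p)))" "exp (- 3/2) * L / 2" C
  proof unfold_locales
    show "J.ord 1 (\<lambda>p. d (fst p) (fst (snd p)))" "J.ord 1 (\<lambda>p. d (fst p) (Suc (fst (snd p))))"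
      by (rule J.ordI[where C = K], unfold power_one_right, intro up J', assumption+)+
    show "J.ord 2 (\<lambda>i. d (fst i) (Suc (fst (snd i))) - d (fst i) (fst (snd i)))"
      using re[OF T.D] by (simp add: T.D_def)
    show "J.ord 3
     (\<lambda>i. P (fst i) (Suc (fst (snd i))) (d (fst i) (Suc (fst (snd i))) - d (fst i) (fst (snd i))) -
           ((6 * (d (fst i) (Suc (fst (snd i))) \<bullet> y (fst i) (Suc (fst (snd i))))) *\<^sub>R
            P (fst i) (Suc (fst (snd i))) (d (fst i) (Suc (fst (snd i)))) -
            (3 * (norm (d (fst i) (Suc (fst (snd i)))))\<^sup>2) *\<^sub>R
            P (fst i) (Suc (fst (snd i))) (y (fst i) (Suc (fst (snd i))))))"
      using re[OF T.PD_expansion] by (simp add: T.D_def)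
    show "J.ord 2 (\<lambda>i. d (fst i) (fst (snd i)) - P (fst i) (fst (snd i)) (d (fst i) (fst (snd i))))"
      "J.ord 2 (\<lambda>i. d (fst i) (Suc (fst (snd i))) - P (fst i) (Suc (fst (snd i))) (d (fst i) (Suc (fst (snd i)))))"
      by (rule J.ordI[where C = K], intro N J', assumption+)+
    show "(\<lambda>p. y (fst p) (Suc (fst (snd p)))) = (\<lambda>i. y (fst i) (fst (snd i)) + d (fst i) (fst (snd i)))"
      by (simp add: d_def)
    show "P (fst p) (fst (snd p)) (snd (snd p)) = snd (snd p)" "norm (snd (snd p)) = 1" "snd (snd p) \<bullet> d (fst p) (fst (snd p)) = 0"
      if "p \<in> J" for p using that by (auto simp: J_def valid_def)
    show "0 < 1 / real (8 * fst p)" if "p \<in> J" for p using J'(1)[OF that] l0 by simp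
    show "0 < exp (- 3 / 2) * L / 2" using L by simp
    show "exp (- 3 / 2) * L / 2 * (1 / real (8 * fst i)) \<le> norm (P (fst i) (Suc (fst (snd i))) (d (fst i) (Suc (fst (snd i)))))"
      if "i \<in> J" for i by (intro low J' that)
  qed (rule \<kappa> C P A y T_next T_prev J' | assumption)+
  obtain D1 where D1: "D1 \<ge> 0" "\<And>p. p \<in> J \<Longrightarrow> norm ((norm (R.w p))\<^sup>2 - 1) \<le> D1 * (1 / real (8 * fst p)) ^ 2"
    by (rule J.ordE[OF R.w_norm], rule that)
  obtain D where D: "D \<ge> 0" "\<And>p. p \<in> J \<Longrightarrow> norm ((1 / norm (R.w p)) *\<^sub>R R.w p - snd (snd p) - A (fst p) (fst (snd p)) (d (fst p) (fst (snd p))) (snd (snd p))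
     - (3 * (snd (snd p) \<bullet> y (fst p) (fst (snd p)))) *\<^sub>R d (fst p) (fst (snd p))) \<le> D * (1 / real (8 * fst p)) ^ 2"
    by (rule J.ordE[OF R.normalized_expansion], rule that)
  obtain l' :: nat where l': "D1 \<le> real l'" using real_arch_simple by blast
  define l2 where "l2 = max l1 l'"
  have l2: "l1 \<le> l" "l0 \<le> l" "l > 0" if "l2 \<le> l" for l using that l1 l0 by (auto simp: l2_def)
  have next_ex: "\<exists>e'. valid l (Suc i) e' \<and>
      norm (e' - e - A l i (d l i) e - (3 * (e \<bullet> y l i)) *\<^sub>R d l i) \<le> D * (1 / real (8 * l))\<^sup>2"
    if l: "l2 \<le> l" and i: "Suc i < 8 * l" and e: "valid l i e" for l i e
  proof -
    have p: "(l, i, e) \<in> J" using l2[OF l] i e by (simp add: J_def)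
    have w: "R.w (l, i, e) \<noteq> 0"
    proof
      assume "R.w (l, i, e) = 0"
      hence "1 \<le> D1 * (1 / real (8 * l))\<^sup>2" using D1(2)[OF p] by simp
      also have "\<dots> \<le> real l * (1 / real (8 * l))\<^sup>2"
        using l' l by (intro mult_right_mono) (auto simp: l2_def)
      also have "\<dots> < 1" using l2[OF l] by (simp add: power2_eq_square field_simps)
      finally show False by simp
    qed
    have lin: "linear (P l (Suc i))" by (intro orth_proj_linear P) (use l2[OF l] i in auto)
    have "valid l (Suc i) ((1 / norm (R.w (l, i, e))) *\<^sub>R R.w (l, i, e))"
      using w R.w_tangent[OF p] R.w_inner_v'[OF p] by (simp add: valid_def linear_scale[OF lin])
    thus ?thesis using D(2)[OF p] by auto
  qed
  have "\<exists>f. \<forall>i. (i < 8 * l \<longrightarrow> valid l i (f i)) \<and> (Suc i < 8 * l \<longrightarrow>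
      norm (f (Suc i) - f i - A l i (d l i) (f i) - (3 * (f i \<bullet> y l i)) *\<^sub>R d l i) \<le> D * (1 / real (8 * l))\<^sup>2)"
    if l: "l2 \<le> l" for l
  proof -
    have "\<exists>f. \<forall>i. (i < 8 * l \<longrightarrow> valid l i (f i)) \<and> (Suc i < 8 * l \<longrightarrow> valid l (Suc i) (f (Suc i)) \<and>
        norm (f (Suc i) - f i - A l i (d l i) (f i) - (3 * (f i \<bullet> y l i)) *\<^sub>R d l i) \<le> D * (1 / real (8 * l))\<^sup>2)"
    proof (rule dependent_nat_choice)
      show "\<exists>x. 0 < 8 * l \<longrightarrow> valid l 0 x"
        using perp[of l "d l 0"] l2[OF l] by (auto simp: valid_def)
      show "\<exists>x'. (Suc i < 8 * l \<longrightarrow> valid l (Suc i) x') \<and> (Suc i < 8 * l \<longrightarrow> valid l (Suc i) x' \<and>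
        norm (x' - x - A l i (d l i) x - (3 * (x \<bullet> y l i)) *\<^sub>R d l i) \<le> D * (1 / real (8 * l))\<^sup>2)"
        if "i < 8 * l \<longrightarrow> valid l i x" for x i
        using next_ex[OF l, of i x] that by auto
    qed
    thus ?thesis by blast
  qed
  then obtain e where e: "\<And>l i. l2 \<le> l \<Longrightarrow> (i < 8 * l \<longrightarrow> valid l i (e l i)) \<and> (Suc i < 8 * l \<longrightarrow>
      norm (e l (Suc i) - e l i - A l i (d l i) (e l i) - (3 * (e l i \<bullet> y l i)) *\<^sub>R d l i) \<le> D * (1 / real (8 * l))\<^sup>2)"
    by metis
  show thesis
    by (rule that[of l2 e D]) (use e l2 in \<open>auto simp: valid_def\<close>)
qed

end

text \<open>The second derivative of \<open>|y|\<^sup>2 / 2\<close> along a curve is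
  \<open>|v|\<^sup>2\<close> plus \<open>y\<close> times the acceleration; the normal acceleration
  is \<open>A v v\<close> by \<open>ND\<close>, the tangential one is given by the geodesic equation
  \<open>PD_expansion\<close>.\<close>

lemma (in triple) second_difference:
  "ord 3 (\<lambda>i. (norm (z i))\<^sup>2 / 2 - 2 * ((norm (y i))\<^sup>2 / 2) + (norm (x i))\<^sup>2 / 2
    - ((norm (v i))\<^sup>2 + y i \<bullet> A i (v i) (v i) + 6 * (v i \<bullet> y i)\<^sup>2 - 3 * (norm (v i))\<^sup>2 * (norm (P i (y i)))\<^sup>2))"
proof -
  have 1: "ord 3 (\<lambda>i. y i \<bullet> (D i - P i (D i) - A i (v i) (v i)))"
    by (rule ord_le[OF ord_inner[OF y ND]]) simp
  have 2: "ord 3 (\<lambda>i. y i \<bullet> (P i (D i) - ((6 * (v i \<bullet> y i)) *\<^sub>R P i (v i) - (3 * (norm (v i))\<^sup>2) *\<^sub>R P i (y i))))"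
    by (rule ord_le[OF ord_inner[OF y PD_expansion]]) simp
  have 3: "ord 3 (\<lambda>i. (6 * (v i \<bullet> y i)) * (y i \<bullet> (v i - P i (v i))))"
    by (rule ord_le[OF ord_mult[OF ord_cmult[OF ord_inner[OF v y]] ord_inner[OF y N2(1)]]]) simp
  have 4: "ord 3 (\<lambda>i. (1/2) * (D i \<bullet> (u i + v i)))"
    by (rule ord_le[OF ord_cmult[OF ord_inner[OF D ord_add[OF u v]]]]) simp
  show ?thesis
  proof (rule ord_by[OF ord_diff[OF ord_diff[OF ord_add[OF 1 2] 3] 4]])
    fix i assume i: "i \<in> I"
    have zx: "z i = y i + v i" "x i = y i - u i" by (auto simp: u_def v_def)
    have Py: "y i \<bullet> P i (y i) = (norm (P i (y i)))\<^sup>2"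
      using orth_proj_norm_sq[OF P[OF i]] by (simp add: inner_commute)
    show "(norm (z i))\<^sup>2 / 2 - 2 * ((norm (y i))\<^sup>2 / 2) + (norm (x i))\<^sup>2 / 2
    - ((norm (v i))\<^sup>2 + y i \<bullet> A i (v i) (v i) + 6 * (v i \<bullet> y i)\<^sup>2 - 3 * (norm (v i))\<^sup>2 * (norm (P i (y i)))\<^sup>2) =
     y i \<bullet> (D i - P i (D i) - A i (v i) (v i)) +
     y i \<bullet> (P i (D i) - ((6 * (v i \<bullet> y i)) *\<^sub>R P i (v i) - (3 * (norm (v i))\<^sup>2) *\<^sub>R P i (y i)))
     - (6 * (v i \<bullet> y i)) * (y i \<bullet> (v i - P i (v i))) - (1/2) * (D i \<bullet> (u i + v i))"
      unfolding zx D_def inner_diff_right[of "y i"] inner_scaleR_right Py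
      unfolding power2_norm_eq_inner
      by (simp add: inner_simps inner_commute power2_eq_square field_simps)
  qed auto
qed

context chains
begin

text \<open>A tent function with \<open>\<xi> l 0 = \<xi> l (8 * l - 1) = 0\<close>: the field \<open>e\<close> is only defined at the initial
  vertices of edges, so the variation already stops one vertex before the last.\<close>

definition "\<xi> l i = real (min i (8 * l - 1 - i)) / real (8 * l)"

lemma \<xi>_bounds: "0 \<le> \<xi> l i" "l > 0 \<Longrightarrow> \<xi> l i \<le> 1" "l > 0 \<Longrightarrow> \<bar>\<xi> l (Suc i) - \<xi> l i\<bar> \<le> 1 / real (8 * l)"
proof -
  show "0 \<le> \<xi> l i" by (simp add: \<xi>_def)
  assume l: "l > 0"
  have "min i (8 * l - 1 - i) \<le> 8 * l" by simp
  hence "real (min i (8 * l - 1 - i)) \<le> real (8 * l)" by (rule of_nat_mono)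
  thus "\<xi> l i \<le> 1" using l unfolding \<xi>_def by (simp add: divide_le_eq_1)
  have "\<bar>real (min (Suc i) (8 * l - 1 - Suc i)) - real (min i (8 * l - 1 - i))\<bar> \<le> 1"
    by (auto simp: min_def)
  thus "\<bar>\<xi> l (Suc i) - \<xi> l i\<bar> \<le> 1 / real (8 * l)"
    unfolding \<xi>_def diff_divide_distrib[symmetric] abs_divide by (simp add: divide_right_mono)
qed

text \<open>The value at \<open>i = 0\<close>, where the chain has no preceding vertex, is the leading term of
  \<open>el_vector\<close>; it makes the edge expansion hold at the first edge as well.\<close>

definition "el_at l i = (case i of 0 \<Rightarrow> conf_weight (y l 0) (y l 1) *\<^sub>R
      (A l 0 (d l 0) (d l 0) + (3 * (norm (d l 0))\<^sup>2) *\<^sub>R (y l 0 - P l 0 (y l 0)))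
    | Suc j \<Rightarrow> el_vector (y l j) (y l (Suc j)) (y l (Suc (Suc j))))"

definition V :: "(nat \<Rightarrow> nat \<Rightarrow> 'v) \<Rightarrow> nat \<Rightarrow> nat \<Rightarrow> 'v" where
  "V e l i = (\<xi> l i * exp ((3/2) * (norm (y l i))\<^sup>2)) *\<^sub>R e l i"

text \<open>The coefficient of the squared cut-off in \<open>second_variation_expansion\<close>.
  Only after subtraction of three times the second difference of \<open>r\<close> can it be compared
  with a curvature.\<close>

definition "Z e l i = 9 * (y l i \<bullet> d l i)\<^sup>2 + (norm (A l i (d l i) (e l i)))\<^sup>2
    - A l i (d l i) (d l i) \<bullet> A l i (e l i) (e l i)
    - 3 * (norm (d l i))\<^sup>2 * (1 + y l i \<bullet> A l i (e l i) (e l i)) - 9 * (e l i \<bullet> y l i)\<^sup>2 * (norm (d l i))\<^sup>2"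

definition "r l i = (norm (y l i))\<^sup>2 / 2"

lemma expansions:
  obtains l1 e K D where "l0 \<le> l1" "K > 0" "D \<ge> 0"
    "\<And>l i. l1 \<le> l \<Longrightarrow> i < 8 * l \<Longrightarrow> norm (d l i) \<le> K * (1 / real (8 * l))"
    "\<And>l i. l1 \<le> l \<Longrightarrow> i < 8 * l \<Longrightarrow> norm (d l i - P l i (d l i)) \<le> K * (1 / real (8 * l))\<^sup>2"
    "\<And>l i. l1 \<le> l \<Longrightarrow> i < 8 * l \<Longrightarrow> exp (- 3/2) * L / 2 * (1 / real (8 * l)) \<le> norm (P l i (d l i))"
    "\<And>l i. l1 \<le> l \<Longrightarrow> i < 8 * l \<Longrightarrow> P l i (e l i) = e l i \<and> norm (e l i) = 1 \<and> e l i \<bullet> d l i = 0"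
    "\<And>l i. l1 \<le> l \<Longrightarrow> Suc i < 8 * l \<Longrightarrow> edge_form (y l i) (y l (Suc i)) (V e l i) (V e l (Suc i))
       - A l i (V e l i) (V e l i) \<bullet> el_at l i
     \<le> (\<xi> l (Suc i) - \<xi> l i)\<^sup>2 + 6 * (y l i \<bullet> d l i) * \<xi> l i * (\<xi> l (Suc i) - \<xi> l i) + (\<xi> l i)\<^sup>2 * Z e l i + D * (1 / real (8 * l)) ^ 3"
    "\<And>l i. l1 \<le> l \<Longrightarrow> Suc i < 8 * l \<Longrightarrow>
       (norm (d l (Suc i)))\<^sup>2 + y l (Suc i) \<bullet> A l (Suc i) (d l (Suc i)) (d l (Suc i)) + 6 * (d l (Suc i) \<bullet> y l (Suc i))\<^sup>2
          - 3 * (norm (d l (Suc i)))\<^sup>2 * (norm (P l (Suc i) (y l (Suc i))))\<^sup>2 - D * (1 / real (8 * l)) ^ 3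
       \<le> r l (Suc (Suc i)) - 2 * r l (Suc i) + r l i"
proof -
  obtain l1 K where l1: "l0 \<le> l1" and K: "K > 0"
    and up: "\<And>l i. l1 \<le> l \<Longrightarrow> i < 8 * l \<Longrightarrow> norm (d l i) \<le> K * (1 / real (8 * l))"
    and N: "\<And>l i. l1 \<le> l \<Longrightarrow> i < 8 * l \<Longrightarrow> norm (d l i - P l i (d l i)) \<le> K * (1 / real (8 * l))\<^sup>2"
    and low: "\<And>l i. l1 \<le> l \<Longrightarrow> i < 8 * l \<Longrightarrow> exp (- 3/2) * L / 2 * (1 / real (8 * l)) \<le> norm (P l i (d l i))"
    using tangential_lower by metis
  obtain l2 e De where l2: "l0 \<le> l2"
    and e: "\<And>l i. l2 \<le> l \<Longrightarrow> i < 8 * l \<Longrightarrow> P l i (e l i) = e l i \<and> norm (e l i) = 1 \<and> e l i \<bullet> d l i = 0"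
    and e_step: "\<And>l i. l2 \<le> l \<Longrightarrow> Suc i < 8 * l \<Longrightarrow>
      norm (e l (Suc i) - e l i - A l i (d l i) (e l i) - (3 * (e l i \<bullet> y l i)) *\<^sub>R d l i) \<le> De * (1 / real (8 * l))\<^sup>2"
    using transported_frames by metis
  define l3 where "l3 = max l1 l2"
  define I where "I = {(l, i). l3 \<le> l \<and> Suc i < 8 * l}"
  have I': "l0 \<le> fst p" "l1 \<le> fst p" "l2 \<le> fst p" "Suc (snd p) < 8 * fst p" "snd p < 8 * fst p" "snd p \<le> 8 * fst p"
     "Suc (snd p) \<le> 8 * fst p" "fst p > 0" if "p \<in> I" for p
    using that l1 l2 l0 by (auto simp: I_def l3_def)
  have sc: "scale I (\<lambda>p. 1 / real (8 * fst p))"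
    by (rule scale_inverse) (rule I')
  have I0: "l0 \<le> l \<and> Suc i < 8 * l" if "(l, i) \<in> I" for l i using I'[OF that] by auto
  have hb: "norm (d l i) \<le> K * (1 / real (8 * fst (l, i))) \<and> norm (d l (Suc i)) \<le> K * (1 / real (8 * fst (l, i)))"
    if "(l, i) \<in> I" for l i
    using I'[OF that] up by auto
  interpret T: triple I "\<lambda>p. 1 / real (8 * fst p)" \<kappa> "\<lambda>p. y (fst p) (snd p)" "\<lambda>p. y (fst p) (Suc (snd p))" "\<lambda>p. y (fst p) (Suc (Suc (snd p)))"
     "\<lambda>p. P (fst p) (Suc (snd p))" "\<lambda>p. A (fst p) (Suc (snd p))" "\<lambda>p. d (fst p) (snd p)" "\<lambda>p. d (fst p) (Suc (snd p))"
    by (rule triple_ords[OF sc I0 hb])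
  interpret E: edge I "\<lambda>p. 1 / real (8 * fst p)" \<kappa> "\<lambda>p. y (fst p) (snd p)" "\<lambda>p. d (fst p) (snd p)"
    "\<lambda>p. e (fst p) (snd p)" "\<lambda>p. e (fst p) (Suc (snd p))" "\<lambda>p. \<xi> (fst p) (snd p)" "\<lambda>p. \<xi> (fst p) (Suc (snd p))"
    "\<lambda>p. P (fst p) (snd p)" "\<lambda>p. A (fst p) (snd p)"
  proof unfold_locales
    show "T.ord 1 (\<lambda>p. d (fst p) (snd p))"
      by (rule T.ordI[where C = K], unfold power_one_right, intro up I', assumption+)
    show "T.ord 2 (\<lambda>i. d (fst i) (snd i) - P (fst i) (snd i) (d (fst i) (snd i)))"
      by (rule T.ordI[where C = K], intro N I', assumption+)
    show "T.ord 2 (\<lambda>i. e (fst i) (Suc (snd i)) - e (fst i) (snd i) - A (fst i) (snd i) (d (fst i) (snd i)) (e (fst i) (snd i)) -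
        (3 * (e (fst i) (snd i) \<bullet> y (fst i) (snd i))) *\<^sub>R d (fst i) (snd i))"
      by (rule T.ordI[where C = De], intro e_step I', assumption+)
    show "T.ord 0 (\<lambda>p. \<xi> (fst p) (snd p))"
    proof (rule T.ordI[where C = 1])
      fix p assume "p \<in> I"
      from I'(8)[OF this] show "norm (\<xi> (fst p) (snd p)) \<le> 1 * (1 / real (8 * fst p)) ^ 0"
        using \<xi>_bounds(1,2)[of "fst p" "snd p"] by simp
    qed
    show "T.ord 1 (\<lambda>p. \<xi> (fst p) (Suc (snd p)) - \<xi> (fst p) (snd p))"
    proof (rule T.ordI[where C = 1])
      fix p assume "p \<in> I"
      from I'(8)[OF this] show "norm (\<xi> (fst p) (Suc (snd p)) - \<xi> (fst p) (snd p)) \<le> 1 * (1 / real (8 * fst p)) ^ 1"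
        using \<xi>_bounds(3)[of "fst p" "snd p"] by simp
    qed
    show "P (fst p) (snd p) (e (fst p) (snd p)) = e (fst p) (snd p)" "norm (e (fst p) (snd p)) = 1"
      "e (fst p) (snd p) \<bullet> d (fst p) (snd p) = 0" if "p \<in> I" for p
      using e[OF I'(3)[OF that] I'(5)[OF that]] by auto
  qed (rule \<kappa> P A y I' | assumption)+
  obtain D1 where D1: "D1 \<ge> 0" "\<And>p. p \<in> I \<Longrightarrow> norm (el_vector (y (fst p) (snd p)) (y (fst p) (Suc (snd p))) (y (fst p) (Suc (Suc (snd p)))) -
     T.gv p *\<^sub>R (A (fst p) (Suc (snd p)) (d (fst p) (Suc (snd p))) (d (fst p) (Suc (snd p))) +
     (3 * (norm (d (fst p) (Suc (snd p))))\<^sup>2) *\<^sub>R (y (fst p) (Suc (snd p)) - P (fst p) (Suc (snd p)) (y (fst p) (Suc (snd p)))))) \<le> D1 * (1 / real (8 * fst p)) ^ 3"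
    by (rule T.ordE[OF T.el_expansion], rule that)
  have dy: "y l i + d l i = y l (Suc i)" for l i by (simp add: d_def)
  have S: "T.ord 3 (\<lambda>p. el_at (fst p) (snd p) - E.g p *\<^sub>R (A (fst p) (snd p) (d (fst p) (snd p)) (d (fst p) (snd p)) +
     (3 * (norm (d (fst p) (snd p)))\<^sup>2) *\<^sub>R (y (fst p) (snd p) - P (fst p) (snd p) (y (fst p) (snd p)))))"
  proof (rule T.ordI[where C = D1])
    fix p assume p: "p \<in> I"
    show "norm (el_at (fst p) (snd p) - E.g p *\<^sub>R (A (fst p) (snd p) (d (fst p) (snd p)) (d (fst p) (snd p)) +
     (3 * (norm (d (fst p) (snd p)))\<^sup>2) *\<^sub>R (y (fst p) (snd p) - P (fst p) (snd p) (y (fst p) (snd p))))) \<le> D1 * (1 / real (8 * fst p)) ^ 3"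
    proof (cases "snd p")
      case 0
      thus ?thesis using D1(1) by (simp add: el_at_def E.g_def dy)
    next
      case (Suc j)
      have "(fst p, j) \<in> I" using p Suc by (auto simp: I_def)
      from D1(2)[OF this] show ?thesis unfolding Suc by (simp add: el_at_def E.g_def T.gv_def dy Suc)
    qed
  qed
  obtain D2 where D2: "D2 \<ge> 0" "\<And>p. p \<in> I \<Longrightarrow> norm (edge_form (y (fst p) (snd p)) (y (fst p) (snd p) + d (fst p) (snd p)) (E.V p) (E.W p) -
     A (fst p) (snd p) (E.V p) (E.V p) \<bullet> el_at (fst p) (snd p)
     - ((\<xi> (fst p) (Suc (snd p)) - \<xi> (fst p) (snd p))\<^sup>2 + 6 * (y (fst p) (snd p) \<bullet> d (fst p) (snd p)) * \<xi> (fst p) (snd p) * (\<xi> (fst p) (Suc (snd p)) - \<xi> (fst p) (snd p))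
      + (\<xi> (fst p) (snd p))\<^sup>2 * (9 * (y (fst p) (snd p) \<bullet> d (fst p) (snd p))\<^sup>2 + (norm (A (fst p) (snd p) (d (fst p) (snd p)) (e (fst p) (snd p))))\<^sup>2
       - A (fst p) (snd p) (d (fst p) (snd p)) (d (fst p) (snd p)) \<bullet> A (fst p) (snd p) (e (fst p) (snd p)) (e (fst p) (snd p))
         - 3 * (norm (d (fst p) (snd p)))\<^sup>2 * (1 + y (fst p) (snd p) \<bullet> A (fst p) (snd p) (e (fst p) (snd p)) (e (fst p) (snd p))) - 9 * (e (fst p) (snd p) \<bullet> y (fst p) (snd p))\<^sup>2 * (norm (d (fst p) (snd p)))\<^sup>2)))
     \<le> D2 * (1 / real (8 * fst p)) ^ 3"
    by (rule T.ordE[OF E.second_variation_expansion[OF S]], rule that)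
  obtain D3 where D3: "D3 \<ge> 0" "\<And>p. p \<in> I \<Longrightarrow> norm ((norm (y (fst p) (Suc (Suc (snd p)))))\<^sup>2 / 2 - 2 * ((norm (y (fst p) (Suc (snd p))))\<^sup>2 / 2) + (norm (y (fst p) (snd p)))\<^sup>2 / 2
    - ((norm (d (fst p) (Suc (snd p))))\<^sup>2 + y (fst p) (Suc (snd p)) \<bullet> A (fst p) (Suc (snd p)) (d (fst p) (Suc (snd p))) (d (fst p) (Suc (snd p))) + 6 * (d (fst p) (Suc (snd p)) \<bullet> y (fst p) (Suc (snd p)))\<^sup>2
     - 3 * (norm (d (fst p) (Suc (snd p))))\<^sup>2 * (norm (P (fst p) (Suc (snd p)) (y (fst p) (Suc (snd p)))))\<^sup>2)) \<le> D3 * (1 / real (8 * fst p)) ^ 3"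
    by (rule T.ordE[OF T.second_difference], rule that)
  show thesis
  proof (rule that[of l3 K "max D2 D3" e])
    fix l i assume l: "l3 \<le> l" "Suc i < 8 * l"
    hence p: "(l, i) \<in> I" by (simp add: I_def)
    have D: "D2 * (1 / real (8 * l)) ^ 3 \<le> max D2 D3 * (1 / real (8 * l)) ^ 3"
      "D3 * (1 / real (8 * l)) ^ 3 \<le> max D2 D3 * (1 / real (8 * l)) ^ 3"
      by (intro mult_right_mono; simp)+
    have EV: "E.V (l, i) = V e l i" "E.W (l, i) = V e l (Suc i)"
      by (simp_all add: E.V_def E.W_def V_def E.\<psi>_def dy)
    show "edge_form (y l i) (y l (Suc i)) (V e l i) (V e l (Suc i)) - A l i (V e l i) (V e l i) \<bullet> el_at l i
     \<le> (\<xi> l (Suc i) - \<xi> l i)\<^sup>2 + 6 * (y l i \<bullet> d l i) * \<xi> l i * (\<xi> l (Suc i) - \<xi> l i) + (\<xi> l i)\<^sup>2 * Z e l i + max D2 D3 * (1 / real (8 * l)) ^ 3"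
      using D2(2)[OF p] D(1) unfolding EV fst_conv snd_conv dy Z_def real_norm_def by linarith
    show "(norm (d l (Suc i)))\<^sup>2 + y l (Suc i) \<bullet> A l (Suc i) (d l (Suc i)) (d l (Suc i)) + 6 * (d l (Suc i) \<bullet> y l (Suc i))\<^sup>2
          - 3 * (norm (d l (Suc i)))\<^sup>2 * (norm (P l (Suc i) (y l (Suc i))))\<^sup>2 - max D2 D3 * (1 / real (8 * l)) ^ 3
       \<le> r l (Suc (Suc i)) - 2 * r l (Suc i) + r l i"
      using D3(2)[OF p] D(2) unfolding fst_conv snd_conv r_def real_norm_def by linarith
  qed (use l1 K D2 D3 up N low e in \<open>auto simp: l3_def\<close>)
qed

section \<open>The second variation in the direction of the test field\<close>

lemma V_zero: "\<xi> l i = 0 \<Longrightarrow> V e l i = 0"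
  by (simp add: V_def)

text \<open>The field vanishes at the vertices \<open>0\<close>, \<open>8 l - 1\<close> and
  \<open>8 l\<close>. Thus the last edge drops out, and the vertex terms can be attached to the
  initial vertices of the remaining edges; the additional term at index 0 carries the factor
  \<open>A l 0 0 0 = 0\<close>.\<close>

lemma second_variation_V:
  assumes l: "l0 \<le> l" and e: "\<And>i. i < 8 * l \<Longrightarrow> P l i (e l i) = e l i"
  shows "0 \<le> (\<Sum>i<8 * l - 1. edge_form (y l i) (y l (Suc i)) (V e l i) (V e l (Suc i)) - A l i (V e l i) (V e l i) \<bullet> el_at l i)"
proof -
  have "l > 0" using l l0 by simp
  then obtain m where m: "8 * l = Suc (Suc m)" by (metis One_nat_def Suc_pred less_Suc0 mult_eq_1_iff nat_0_less_mult_iff neq0_conv not0_implies_Suc numeral_eq_one_iff semiring_norm(85) zero_less_numeral)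
  have end0: "V e l (Suc m) = 0" "V e l (Suc (Suc m)) = 0" "V e l 0 = 0"
    by (auto intro!: V_zero simp: \<xi>_def m)
  have A0: "A l i 0 0 = 0" if "i \<le> 8 * l" for i
    using normal_form_simps[OF A[OF l that] P[OF l that] \<kappa>(1)] by simp
  have tang: "P l i (V e l i) = V e l i" if "i \<le> 8 * l" for i
  proof (cases "i < 8 * l")
    case True
    thus ?thesis using linear_scale[OF orth_proj_linear[OF P[OF l that]]] e by (simp add: V_def)
  next
    case False
    hence "i = Suc (Suc m)" using that m by simp
    thus ?thesis using end0 linear_0[OF orth_proj_linear[OF P[OF l that]]] by simp
  qed
  have "0 \<le> (\<Sum>i<8 * l. edge_form (y l i) (y l (Suc i)) (V e l i) (V e l (Suc i)))
        - (\<Sum>i<8 * l - 1. A l (Suc i) (V e l (Suc i)) (V e l (Suc i)) \<bullet> el_vector (y l i) (y l (Suc i)) (y l (Suc (Suc i))))"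
    by (rule second_variation[OF l tang]) (use end0 m in auto)
  also have "(\<Sum>i<8 * l. edge_form (y l i) (y l (Suc i)) (V e l i) (V e l (Suc i))) =
      (\<Sum>i<Suc m. edge_form (y l i) (y l (Suc i)) (V e l i) (V e l (Suc i)))"
    unfolding m using end0 by (simp add: edge_form_def)
  also have "(\<Sum>i<8 * l - 1. A l (Suc i) (V e l (Suc i)) (V e l (Suc i)) \<bullet> el_vector (y l i) (y l (Suc i)) (y l (Suc (Suc i)))) =
     (\<Sum>i<m. A l (Suc i) (V e l (Suc i)) (V e l (Suc i)) \<bullet> el_at l (Suc i))"
    unfolding m using end0 A0[of "Suc m"] m by (simp add: el_at_def)
  also have "\<dots> = (\<Sum>i<Suc m. A l i (V e l i) (V e l i) \<bullet> el_at l i)"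
    unfolding sum.lessThan_Suc_shift using end0 A0[of 0] by simp
  finally show ?thesis unfolding sum_subtractf m by simp
qed

text \<open>Up to the small normal part of the edge, the left side is minus the curvature term of
  \<open>curvature_estimate\<close>, minus two nonnegative terms. One of these is
  \<open>9 (d \<bullet> y)\<^sup>2\<close>, left over from \<open>9 - 18\<close>; the other contains
  \<open>(e \<bullet> y)\<^sup>2\<close>. Both have the favourable sign and are dropped.\<close>

lemma index_estimate:
  assumes l: "l0 \<le> l" and i: "i < 8 * l"
    and h: "h = 1 / real (8 * l)" and K: "K \<ge> 0"
    and N: "norm (d l i - P l i (d l i)) \<le> K * h\<^sup>2"
    and e: "P l i (e l i) = e l i" "norm (e l i) = 1" "e l i \<bullet> d l i = 0"
  shows "Z e l i - 3 * ((norm (d l i))\<^sup>2 + y l i \<bullet> A l i (d l i) (d l i) + 6 * (d l i \<bullet> y l i)\<^sup>2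
       - 3 * (norm (d l i))\<^sup>2 * (norm (P l i (y l i)))\<^sup>2)
    \<le> (2 * \<kappa>\<^sup>2 - 3) * (norm (P l i (d l i)))\<^sup>2 + (3 * \<kappa> + 9) * K\<^sup>2 * h ^ 3"
proof -
  have l': "i \<le> 8 * l" using i by simp
  note PP = P[OF l l'] and AA = A[OF l l']
  define t where "t = P l i (d l i)"
  have t: "P l i t = t" by (simp add: t_def orth_proj_idem[OF PP])
  have At: "A l i (d l i) w = A l i t w" "A l i w (d l i) = A l i w t" for w
    using normal_form_tangential[OF AA PP \<kappa>(1)] normal_form_sym[OF AA PP \<kappa>(1)] by (metis t_def)+
  have et: "e l i \<bullet> t = 0" using orth_proj_self_adjoint[OF PP, of "e l i" "d l i"] e by (simp add: t_def)
  have q: "(norm (d l i))\<^sup>2 = (norm t)\<^sup>2 + (norm (d l i - t))\<^sup>2"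
    using orth_proj_pythagoras[OF PP, of "d l i"] by (simp add: t_def)
  have hb: "0 < h" "h \<le> 1" using i by (auto simp: h)
  have "(norm (d l i - t))\<^sup>2 \<le> (K * h\<^sup>2)\<^sup>2" using N by (intro power_mono) (auto simp: t_def)
  also have "\<dots> = (K\<^sup>2 * h ^ 3) * h" by (simp add: power2_eq_square power3_eq_cube)
  also have "\<dots> \<le> K\<^sup>2 * h ^ 3" using hb mult_left_mono[of h 1 "K\<^sup>2 * h ^ 3"] by simp
  finally have q': "(norm (d l i - t))\<^sup>2 \<le> K\<^sup>2 * h ^ 3" .
  have yl: "norm (y l i) \<le> 1" by (rule y[OF l l'])
  have "\<bar>y l i \<bullet> A l i (e l i) (e l i)\<bar> \<le> norm (y l i) * norm (A l i (e l i) (e l i))"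
    by (rule Cauchy_Schwarz_ineq2)
  also have "\<dots> \<le> 1 * \<kappa>"
    using normal_form_bound[OF AA PP \<kappa>(1), of "e l i"] e yl by (intro mult_mono) auto
  finally have yA: "\<bar>y l i \<bullet> A l i (e l i) (e l i)\<bar> \<le> \<kappa>" by simp
  have "(norm (P l i (y l i)))\<^sup>2 \<le> 1"
    by (rule order_trans[OF Py[OF l l']]) (simp add: divide_le_eq order_trans[OF _ zero_le_power2])
  hence "- 6 - 3 * (y l i \<bullet> A l i (e l i) (e l i)) + 9 * (norm (P l i (y l i)))\<^sup>2 \<le> 3 * \<kappa> + 9"
    using yA by linarith
  hence "(norm (d l i - t))\<^sup>2 * (- 6 - 3 * (y l i \<bullet> A l i (e l i) (e l i)) + 9 * (norm (P l i (y l i)))\<^sup>2)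
      \<le> (norm (d l i - t))\<^sup>2 * (3 * \<kappa> + 9)"
    by (intro mult_left_mono) auto
  also have "\<dots> \<le> (K\<^sup>2 * h ^ 3) * (3 * \<kappa> + 9)" using \<kappa>(1) by (intro mult_right_mono q') auto
  finally have 1: "(norm (d l i - t))\<^sup>2 * (- 6 - 3 * (y l i \<bullet> A l i (e l i) (e l i)) + 9 * (norm (P l i (y l i)))\<^sup>2)
      \<le> (3 * \<kappa> + 9) * K\<^sup>2 * h ^ 3" by (simp add: ac_simps)
  have 2: "(norm (A l i t (e l i)))\<^sup>2 - A l i t t \<bullet> A l i (e l i) (e l i) - 6 * (norm t)\<^sup>2 - 3 * (y l i \<bullet> A l i t t)
      - 3 * (norm t)\<^sup>2 * (y l i \<bullet> A l i (e l i) (e l i)) + 9 * (norm t)\<^sup>2 * (norm (P l i (y l i)))\<^sup>2 \<le> (2 * \<kappa>\<^sup>2 - 3) * (norm t)\<^sup>2"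
    by (rule curvature_estimate[OF PP AA \<kappa>(1) t e(1,2) et Py[OF l l']])
  have 3: "0 \<le> 9 * (e l i \<bullet> y l i)\<^sup>2 * (norm (d l i))\<^sup>2 + 9 * (d l i \<bullet> y l i)\<^sup>2" by simp
  have "Z e l i - 3 * ((norm (d l i))\<^sup>2 + y l i \<bullet> A l i (d l i) (d l i) + 6 * (d l i \<bullet> y l i)\<^sup>2
       - 3 * (norm (d l i))\<^sup>2 * (norm (P l i (y l i)))\<^sup>2) =
     ((norm (A l i t (e l i)))\<^sup>2 - A l i t t \<bullet> A l i (e l i) (e l i) - 6 * (norm t)\<^sup>2 - 3 * (y l i \<bullet> A l i t t)
      - 3 * (norm t)\<^sup>2 * (y l i \<bullet> A l i (e l i) (e l i)) + 9 * (norm t)\<^sup>2 * (norm (P l i (y l i)))\<^sup>2)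
     + (norm (d l i - t))\<^sup>2 * (- 6 - 3 * (y l i \<bullet> A l i (e l i) (e l i)) + 9 * (norm (P l i (y l i)))\<^sup>2)
     - (9 * (e l i \<bullet> y l i)\<^sup>2 * (norm (d l i))\<^sup>2 + 9 * (d l i \<bullet> y l i)\<^sup>2)"
    unfolding Z_def At inner_commute[of "y l i" "d l i"] q by (simp add: algebra_simps)
  thus ?thesis using 1 2 3 unfolding t_def[symmetric] by linarith
qed

text \<open>With \<open>h = 1 / (8 l)\<close> the squared increments of the cut-off add up to at
  most \<open>h\<close>, whereas curvature contributes a negative multiple of \<open>h\<close> that
  grows with \<open>L\<^sup>2\<close>. The mixed term
  \<open>6 (y \<bullet> d) \<xi> \<delta>\<close> has only the order of these and must be integrated
  by parts; this supplies the missing Hessian terms of the conformal curvature.\<close>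

lemma no_long_critical_chains: False
proof -
  obtain l1 e K D where l1: "l0 \<le> l1" and K: "K > 0" and D: "D \<ge> 0"
    and up: "\<And>l i. l1 \<le> l \<Longrightarrow> i < 8 * l \<Longrightarrow> norm (d l i) \<le> K * (1 / real (8 * l))"
    and N: "\<And>l i. l1 \<le> l \<Longrightarrow> i < 8 * l \<Longrightarrow> norm (d l i - P l i (d l i)) \<le> K * (1 / real (8 * l))\<^sup>2"
    and low: "\<And>l i. l1 \<le> l \<Longrightarrow> i < 8 * l \<Longrightarrow> exp (- 3/2) * L / 2 * (1 / real (8 * l)) \<le> norm (P l i (d l i))"
    and e: "\<And>l i. l1 \<le> l \<Longrightarrow> i < 8 * l \<Longrightarrow> P l i (e l i) = e l i \<and> norm (e l i) = 1 \<and> e l i \<bullet> d l i = 0"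
    and edge: "\<And>l i. l1 \<le> l \<Longrightarrow> Suc i < 8 * l \<Longrightarrow> edge_form (y l i) (y l (Suc i)) (V e l i) (V e l (Suc i))
       - A l i (V e l i) (V e l i) \<bullet> el_at l i
     \<le> (\<xi> l (Suc i) - \<xi> l i)\<^sup>2 + 6 * (y l i \<bullet> d l i) * \<xi> l i * (\<xi> l (Suc i) - \<xi> l i) + (\<xi> l i)\<^sup>2 * Z e l i + D * (1 / real (8 * l)) ^ 3"
    and sec: "\<And>l i. l1 \<le> l \<Longrightarrow> Suc i < 8 * l \<Longrightarrow>
       (norm (d l (Suc i)))\<^sup>2 + y l (Suc i) \<bullet> A l (Suc i) (d l (Suc i)) (d l (Suc i)) + 6 * (d l (Suc i) \<bullet> y l (Suc i))\<^sup>2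
          - 3 * (norm (d l (Suc i)))\<^sup>2 * (norm (P l (Suc i) (y l (Suc i))))\<^sup>2 - D * (1 / real (8 * l)) ^ 3
       \<le> r l (Suc (Suc i)) - 2 * r l (Suc i) + r l i"
    by (rule expansions, rule that)
  \<comment> \<open>The net gain per \<open>h\<close>: the curvature term less 1 for the squared
    increments of the tent function. It is positive by the choice of \<open>L\<close>.\<close>
  define \<eta> where "\<eta> = (3 - 2 * \<kappa>\<^sup>2) * (exp (- 3) * L\<^sup>2) / 256 - 1"
  have \<eta>: "\<eta> > 0" using L(2) by (simp add: \<eta>_def exp_minus field_simps)
  define F where "F = D + (3 * K + 5 * K\<^sup>2) + (3 * \<kappa> + 9) * K\<^sup>2 + 3 * D"
  have main: "\<eta> \<le> F * (1 / real (8 * l))" if l: "l1 \<le> l" for l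
  proof -
    have l': "l0 \<le> l" "l > 0" using l l1 l0 by auto
    define h where "h = 1 / real (8 * l)"
    have h: "0 < h" "h \<le> 1" using l' by (auto simp: h_def)
    obtain m where m: "8 * l = Suc (Suc m)" using l'(2)
      by (metis One_nat_def Suc_pred less_Suc0 mult_eq_1_iff nat_0_less_mult_iff neq0_conv not0_implies_Suc numeral_eq_one_iff semiring_norm(85) zero_less_numeral)
    define s where "s = (\<lambda>i. (\<xi> l i)\<^sup>2)"
    define \<delta> where "\<delta> = (\<lambda>i. \<xi> l (Suc i) - \<xi> l i)"
    have \<delta>: "\<bar>\<delta> i\<bar> \<le> h" for i using \<xi>_bounds(3)[OF l'(2)] by (simp add: \<delta>_def h_def)
    have x01: "0 \<le> \<xi> l i" "\<xi> l i \<le> 1" for i using \<xi>_bounds l' by auto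
    have s01: "0 \<le> s i" "s i \<le> 1" for i using x01[of i] by (auto simp: s_def power_le_one)
    have s0: "s 0 = 0" "s (Suc m) = 0" using m by (auto simp: s_def \<xi>_def)
    have \<delta>2: "(\<delta> i)\<^sup>2 \<le> h\<^sup>2" for i using power_mono[OF \<delta>[of i], of 2] by simp
    \<comment> \<open>The increments of \<open>r = |y|\<^sup>2 / 2\<close> and
      \<open>s = \<xi>\<^sup>2\<close> are \<open>y \<bullet> d + |d|\<^sup>2 / 2\<close> and
      \<open>2 \<xi> \<delta> + \<delta>\<^sup>2\<close>, so three times their product is the mixed
      term up to third order.\<close>
    have cross: "6 * (y l i \<bullet> d l i) * \<xi> l i * \<delta> i \<le> 3 * ((r l (Suc i) - r l i) * (s (Suc i) - s i)) + (3 * K + 5 * K\<^sup>2) * h ^ 3"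
      if i: "i < 8 * l" for i
    proof -
      define q where "q = (norm (d l i))\<^sup>2"
      have dh: "norm (d l i) \<le> K * h" using up[OF l i] by (simp add: h_def)
      have q: "0 \<le> q" "q \<le> K\<^sup>2 * h\<^sup>2" using power_mono[OF dh, of 2] by (auto simp: q_def power_mult_distrib)
      have rr: "r l (Suc i) - r l i = y l i \<bullet> d l i + q / 2"
        unfolding r_def q_def d_def power2_norm_eq_inner by (simp add: inner_simps inner_commute field_simps)
      have ss: "s (Suc i) - s i = 2 * \<xi> l i * \<delta> i + (\<delta> i)\<^sup>2"
        by (simp add: s_def \<delta>_def power2_eq_square algebra_simps)
      have "\<bar>y l i \<bullet> d l i\<bar> \<le> norm (y l i) * norm (d l i)" by (rule Cauchy_Schwarz_ineq2)
      also have "\<dots> \<le> 1 * (K * h)" using y[OF l'(1), of i] i dh by (intro mult_mono) auto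
      finally have yd: "\<bar>y l i \<bullet> d l i\<bar> \<le> K * h" by simp
      have "\<bar>(y l i \<bullet> d l i) * (\<delta> i)\<^sup>2\<bar> \<le> (K * h) * h\<^sup>2"
        unfolding abs_mult using yd \<delta>2 by (intro mult_mono) auto
      hence 1: "- ((y l i \<bullet> d l i) * (\<delta> i)\<^sup>2) \<le> K * h ^ 3" by (simp add: power2_eq_square power3_eq_cube)
      have "\<bar>\<xi> l i * \<delta> i\<bar> \<le> 1 * h"
        unfolding abs_mult using x01[of i] \<delta>[of i] by (intro mult_mono) auto
      hence "\<bar>q * (\<xi> l i * \<delta> i)\<bar> \<le> (K\<^sup>2 * h\<^sup>2) * h"
        unfolding abs_mult using q h by (intro mult_mono) auto
      hence 2: "- (q * (\<xi> l i * \<delta> i)) \<le> K\<^sup>2 * h ^ 3" by (simp add: power2_eq_square power3_eq_cube)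
      have 3: "0 \<le> q * (\<delta> i)\<^sup>2" "0 \<le> K\<^sup>2 * h ^ 3" using q h by auto
      have "3 * ((r l (Suc i) - r l i) * (s (Suc i) - s i)) = 6 * (y l i \<bullet> d l i) * \<xi> l i * \<delta> i
          + 3 * ((y l i \<bullet> d l i) * (\<delta> i)\<^sup>2) + 3 * (q * (\<xi> l i * \<delta> i)) + (3/2) * (q * (\<delta> i)\<^sup>2)"
        unfolding rr ss by (simp add: field_simps)
      moreover have "(3 * K + 5 * K\<^sup>2) * h ^ 3 = 3 * (K * h ^ 3) + 5 * (K\<^sup>2 * h ^ 3)" by (simp add: algebra_simps)
      ultimately show ?thesis using 1 2 3 by linarith
    qed
    define W where "W = (\<lambda>i. s i * Z e l i)"
    have "0 \<le> (\<Sum>i<Suc m. edge_form (y l i) (y l (Suc i)) (V e l i) (V e l (Suc i)) - A l i (V e l i) (V e l i) \<bullet> el_at l i)"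
      using second_variation_V[OF l'(1), of e] e[OF l] m by simp
    also have "\<dots> \<le> (\<Sum>i<Suc m. h\<^sup>2 + 3 * ((r l (Suc i) - r l i) * (s (Suc i) - s i)) + W i + (D + (3 * K + 5 * K\<^sup>2)) * h ^ 3)"
    proof (rule sum_mono)
      fix i assume i: "i \<in> {..<Suc m}"
      hence "Suc i < 8 * l" "i < 8 * l" using m by auto
      note bounds = edge[OF l this(1)] cross[OF this(2)] \<delta>2[of i]
      have fold: "(\<xi> l i)\<^sup>2 = s i" "\<xi> l (Suc i) - \<xi> l i = \<delta> i" by (simp_all add: s_def \<delta>_def)
      show "edge_form (y l i) (y l (Suc i)) (V e l i) (V e l (Suc i)) - A l i (V e l i) (V e l i) \<bullet> el_at l i
         \<le> h\<^sup>2 + 3 * ((r l (Suc i) - r l i) * (s (Suc i) - s i)) + W i + (D + (3 * K + 5 * K\<^sup>2)) * h ^ 3"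
        using bounds unfolding fold h_def[symmetric] W_def distrib_right[of D] by linarith
    qed
    also have "\<dots> = real (Suc m) * (h\<^sup>2 + (D + (3 * K + 5 * K\<^sup>2)) * h ^ 3)
        + 3 * (\<Sum>i<Suc m. (r l (Suc i) - r l i) * (s (Suc i) - s i)) + (\<Sum>i<Suc m. W i)"
      unfolding sum.distrib sum_distrib_left[symmetric] by (simp add: algebra_simps)
    also have "(\<Sum>i<Suc m. W i) = (\<Sum>i<m. W (Suc i))"
      unfolding sum.lessThan_Suc_shift by (simp add: W_def s0)
    \<comment> \<open>Boundary terms are absent because \<open>s\<close> vanishes at both
      \<open>0\<close> and \<open>Suc m = 8 l - 1\<close>.\<close>
    also have "(\<Sum>i<Suc m. (r l (Suc i) - r l i) * (s (Suc i) - s i)) =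
        - (\<Sum>i<m. s (Suc i) * (r l (Suc (Suc i)) - 2 * r l (Suc i) + r l i))"
      unfolding sum_by_parts s0 by simp
    also have "real (Suc m) * (h\<^sup>2 + (D + (3 * K + 5 * K\<^sup>2)) * h ^ 3)
        + 3 * - (\<Sum>i<m. s (Suc i) * (r l (Suc (Suc i)) - 2 * r l (Suc i) + r l i)) + (\<Sum>i<m. W (Suc i))
      = real (Suc m) * (h\<^sup>2 + (D + (3 * K + 5 * K\<^sup>2)) * h ^ 3)
        + (\<Sum>i<m. s (Suc i) * (Z e l (Suc i) - 3 * (r l (Suc (Suc i)) - 2 * r l (Suc i) + r l i)))"
    proof -
      have "s (Suc i) * (Z e l (Suc i) - 3 * (r l (Suc (Suc i)) - 2 * r l (Suc i) + r l i)) =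
          W (Suc i) - 3 * (s (Suc i) * (r l (Suc (Suc i)) - 2 * r l (Suc i) + r l i))" for i
        by (simp add: W_def algebra_simps)
      thus ?thesis unfolding sum_subtractf by (simp add: sum_subtractf sum_distrib_left)
    qed
    also have "(\<Sum>i<m. s (Suc i) * (Z e l (Suc i) - 3 * (r l (Suc (Suc i)) - 2 * r l (Suc i) + r l i)))
      \<le> (\<Sum>i<m. (2 * \<kappa>\<^sup>2 - 3) * (s (Suc i) * (norm (P l (Suc i) (d l (Suc i))))\<^sup>2) + ((3 * \<kappa> + 9) * K\<^sup>2 + 3 * D) * h ^ 3)"
    proof (rule sum_mono)
      fix i assume "i \<in> {..<m}"
      hence i: "Suc i < 8 * l" using m by auto
      let ?t = "norm (P l (Suc i) (d l (Suc i)))"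
      have "Z e l (Suc i) - 3 * (r l (Suc (Suc i)) - 2 * r l (Suc i) + r l i) \<le> (2 * \<kappa>\<^sup>2 - 3) * ?t\<^sup>2 + ((3 * \<kappa> + 9) * K\<^sup>2 * h ^ 3 + 3 * (D * h ^ 3))"
      proof -
        have "P l (Suc i) (e l (Suc i)) = e l (Suc i)" "norm (e l (Suc i)) = 1" "e l (Suc i) \<bullet> d l (Suc i) = 0"
          using e[OF l i] by auto
        note 1 = index_estimate[OF l'(1) i h_def less_imp_le[OF K] N[OF l i, folded h_def], of e, OF this]
        have comb: "z - 3 * x \<le> u + w \<Longrightarrow> x - b \<le> c \<Longrightarrow> z - 3 * c \<le> u + (w + 3 * b)" for z x u w b c :: real
          by linarith
        show ?thesis by (rule comb[OF 1 sec[OF l i, folded h_def]])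
      qed
      hence "s (Suc i) * (Z e l (Suc i) - 3 * (r l (Suc (Suc i)) - 2 * r l (Suc i) + r l i))
        \<le> s (Suc i) * ((2 * \<kappa>\<^sup>2 - 3) * ?t\<^sup>2 + ((3 * \<kappa> + 9) * K\<^sup>2 * h ^ 3 + 3 * (D * h ^ 3)))"
        by (intro mult_left_mono s01)
      moreover have "s (Suc i) * ((3 * \<kappa> + 9) * K\<^sup>2 * h ^ 3 + 3 * (D * h ^ 3)) \<le> 1 * ((3 * \<kappa> + 9) * K\<^sup>2 * h ^ 3 + 3 * (D * h ^ 3))"
        using h D \<kappa>(1) by (intro mult_right_mono s01) auto
      ultimately show "s (Suc i) * (Z e l (Suc i) - 3 * (r l (Suc (Suc i)) - 2 * r l (Suc i) + r l i))
        \<le> (2 * \<kappa>\<^sup>2 - 3) * (s (Suc i) * ?t\<^sup>2) + ((3 * \<kappa> + 9) * K\<^sup>2 + 3 * D) * h ^ 3"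
        by (simp add: algebra_simps)
    qed
    also have "\<dots> = - (3 - 2 * \<kappa>\<^sup>2) * (\<Sum>i<m. s (Suc i) * (norm (P l (Suc i) (d l (Suc i))))\<^sup>2) + real m * (((3 * \<kappa> + 9) * K\<^sup>2 + 3 * D) * h ^ 3)"
      unfolding sum.distrib sum_distrib_left[symmetric] by simp
    also have "- (3 - 2 * \<kappa>\<^sup>2) * (\<Sum>i<m. s (Suc i) * (norm (P l (Suc i) (d l (Suc i))))\<^sup>2) \<le> - (3 - 2 * \<kappa>\<^sup>2) * (exp (- 3) * L\<^sup>2 * h / 256)"
    proof (rule mult_left_mono_neg)
      \<comment> \<open>The constant 256 is 4 * 16 * 4: only a quarter of the edges is used, there
        the squared cut-off is at least 1/16, and the squared tangential edge length is at least
        \<open>exp (- 3) * L\<^sup>2 * h\<^sup>2 / 4\<close>. A number of edges divisible by 8 keeps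
        these ranges integral.\<close>
      have "exp (- 3) * L\<^sup>2 * h / 256 = real (2 * l) * ((1/4)\<^sup>2 * (exp (- 3/2) * L / 2 * h)\<^sup>2)"
        using l'(2) by (simp add: h_def power2_eq_square exp_double[symmetric] flip: exp_add)
      also have "\<dots> = (\<Sum>i\<in>{2 * l..<4 * l}. (1/4)\<^sup>2 * (exp (- 3/2) * L / 2 * h)\<^sup>2)" by simp
      also have "\<dots> \<le> (\<Sum>i\<in>{2 * l..<4 * l}. s (Suc i) * (norm (P l (Suc i) (d l (Suc i))))\<^sup>2)"
      proof (intro sum_mono mult_mono)
        fix i assume i: "i \<in> {2 * l..<4 * l}"
        have "2 * l \<le> min (Suc i) (8 * l - 1 - Suc i)" using i l'(2) by auto
        hence "real (2 * l) \<le> real (min (Suc i) (8 * l - 1 - Suc i))" by (rule of_nat_mono)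
        hence "1 / 4 \<le> \<xi> l (Suc i)" using l'(2) by (simp add: \<xi>_def field_simps)
        thus "(1/4)\<^sup>2 \<le> s (Suc i)" unfolding s_def by (intro power_mono) auto
        show "(exp (- 3/2) * L / 2 * h)\<^sup>2 \<le> (norm (P l (Suc i) (d l (Suc i))))\<^sup>2"
          unfolding h_def by (intro power_mono low[OF l]) (use i l'(2) L in auto)
      qed (use s01 in auto)
      also have "\<dots> \<le> (\<Sum>i<m. s (Suc i) * (norm (P l (Suc i) (d l (Suc i))))\<^sup>2)"
        by (rule sum_mono2) (use m s01 in auto)
      finally show "exp (- 3) * L\<^sup>2 * h / 256 \<le> (\<Sum>i<m. s (Suc i) * (norm (P l (Suc i) (d l (Suc i))))\<^sup>2)" .
    qed (use \<kappa>(2) in simp)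
    finally have "0 \<le> real (Suc m) * (h\<^sup>2 + (D + (3 * K + 5 * K\<^sup>2)) * h ^ 3)
       + (- (3 - 2 * \<kappa>\<^sup>2) * (exp (- 3) * L\<^sup>2 * h / 256) + real m * (((3 * \<kappa> + 9) * K\<^sup>2 + 3 * D) * h ^ 3))" by simp
    also have "real (Suc m) * (h\<^sup>2 + (D + (3 * K + 5 * K\<^sup>2)) * h ^ 3) \<le> real (8 * l) * (h\<^sup>2 + (D + (3 * K + 5 * K\<^sup>2)) * h ^ 3)"
      using m h K D by (intro mult_right_mono) auto
    also have "real m * (((3 * \<kappa> + 9) * K\<^sup>2 + 3 * D) * h ^ 3) \<le> real (8 * l) * (((3 * \<kappa> + 9) * K\<^sup>2 + 3 * D) * h ^ 3)"
      using m h K D \<kappa>(1) by (intro mult_right_mono) auto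
    finally have fin: "0 \<le> (real (8 * l) * h) * (h + (D + (3 * K + 5 * K\<^sup>2)) * h\<^sup>2)
       + (- (3 - 2 * \<kappa>\<^sup>2) * (exp (- 3) * L\<^sup>2 * h / 256) + (real (8 * l) * h) * (((3 * \<kappa> + 9) * K\<^sup>2 + 3 * D) * h\<^sup>2))"
      by (simp add: power2_eq_square power3_eq_cube algebra_simps)
    have one: "real (8 * l) * h = 1" using l' by (simp add: h_def)
    have "0 \<le> h * (F * h - \<eta>)"
      using fin[unfolded one] unfolding F_def \<eta>_def by (simp add: power2_eq_square field_simps)
    hence "\<eta> \<le> F * h" using h(1) by (simp add: zero_le_mult_iff)
    thus ?thesis by (simp add: h_def)
  qed
  obtain n :: nat where n: "F / \<eta> < real n" using reals_Archimedean2 by blast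
  define l where "l = max l1 n"
  have l: "l1 \<le> l" "F / \<eta> < real l" "l > 0" using n l1 l0 by (auto simp: l_def)
  have "\<eta> * real (8 * l) \<le> F" using main[OF l(1)] l(3) by (simp add: field_simps)
  moreover have "F < \<eta> * real l" using l(2) \<eta> by (simp add: field_simps)
  moreover have "\<eta> * real l \<le> \<eta> * real (8 * l)" using \<eta> by simp
  ultimately show False by linarith
qed

end

section \<open>Smooth maps\<close>

lemma has_frechet_derivative:
  "f differentiable (at x) \<Longrightarrow> (f has_derivative frechet_derivative f (at x)) (at x)"
  by (simp add: frechet_derivative_works)

lemma frechet_derivative_linear:
  assumes "f differentiable (at x)"
  shows "linear (frechet_derivative f (at x))"
  using has_derivative_linear[OF has_frechet_derivative[OF assms]] .

lemma frechet_derivative_cong_open: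
  assumes "open S" "x \<in> S" "\<And>y. y \<in> S \<Longrightarrow> f y = g y"
  shows "frechet_derivative f (at x) = frechet_derivative g (at x)"
proof -
  have "(f has_derivative D) (at x) \<longleftrightarrow> (g has_derivative D) (at x)" for D
    using assms has_derivative_transform_within_open by metis
  thus ?thesis unfolding frechet_derivative_def by simp
qed

lemma Ck_on_cong:
  assumes "open S" "\<And>x. x \<in> S \<Longrightarrow> f x = g x" "Ck_on k S f"
  shows "Ck_on k S g"
  using assms(2,3)
proof (induction k arbitrary: f g)
  case 0
  thus ?case by (metis (no_types, lifting) Ck_on.simps(1) continuous_on_cong)
next
  case (Suc k)
  have "\<forall>x\<in>S. g differentiable (at x)"
    using Suc.prems assms(1) unfolding differentiable_def Ck_on.simps
    by (metis has_derivative_transform_within_open)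
  moreover have "Ck_on k S (\<lambda>x. frechet_derivative g (at x) v)" for v
  proof (rule Suc.IH)
    show "Ck_on k S (\<lambda>x. frechet_derivative f (at x) v)" using Suc.prems by simp
    show "frechet_derivative f (at x) v = frechet_derivative g (at x) v" if "x \<in> S" for x
      using frechet_derivative_cong_open[OF assms(1) that, of f g] Suc.prems(1) by simp
  qed
  ultimately show ?case by simp
qed

lemma Ck_on_SucI:
  assumes "open S" "\<And>x. x \<in> S \<Longrightarrow> (f has_derivative D x) (at x)" "\<And>v. Ck_on k S (\<lambda>x. D x v)"
  shows "Ck_on (Suc k) S f"
proof -
  have "D x = frechet_derivative f (at x)" if "x \<in> S" for x
    using assms(2)[OF that] by (rule frechet_derivative_at)
  thus ?thesis
    using assms by (auto simp: differentiable_def intro!: Ck_on_cong[OF assms(1) _ assms(3)])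
qed

lemma Ck_on_continuous: "Ck_on k S f \<Longrightarrow> continuous_on S f"
proof (cases k)
  case (Suc j)
  assume "Ck_on k S f"
  hence "\<forall>x\<in>S. f differentiable (at x)" using Suc by simp
  thus ?thesis by (meson continuous_at_imp_continuous_on differentiable_imp_continuous_within)
qed simp

lemma Ck_on_Suc_imp: "Ck_on (Suc k) S f \<Longrightarrow> Ck_on k S f"
proof (induction k arbitrary: f)
  case 0
  thus ?case using Ck_on_continuous[OF 0] by simp
next
  case (Suc k)
  thus ?case by (metis Ck_on.simps(2))
qed

lemma Ck_on_subset: "Ck_on k S f \<Longrightarrow> T \<subseteq> S \<Longrightarrow> Ck_on k T f"
  by (induction k arbitrary: f) (auto intro: continuous_on_subset)

lemma Ck_on_local:
  assumes "\<And>x. x \<in> S \<Longrightarrow> \<exists>W. open W \<and> x \<in> W \<and> Ck_on k W f"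
  shows "Ck_on k S f"
  using assms
proof (induction k arbitrary: f)
  case 0
  show ?case
  proof (simp, rule continuous_at_imp_continuous_on, rule)
    fix x assume "x \<in> S"
    from 0[OF this] obtain W where "open W" "x \<in> W" "continuous_on W f" by auto
    thus "isCont f x" by (simp add: continuous_on_eq_continuous_at)
  qed
next
  case (Suc k)
  show ?case
  proof (simp only: Ck_on.simps, intro conjI ballI allI)
    fix x assume "x \<in> S"
    from Suc.prems[OF this] show "f differentiable (at x)" by auto
  next
    fix v
    show "Ck_on k S (\<lambda>x. frechet_derivative f (at x) v)"
    proof (rule Suc.IH)
      fix x assume "x \<in> S"
      from Suc.prems[OF this] show "\<exists>W. open W \<and> x \<in> W \<and> Ck_on k W (\<lambda>x. frechet_derivative f (at x) v)" by auto
    qed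
  qed
qed

lemma Ck_on_const: "open S \<Longrightarrow> Ck_on k S (\<lambda>x. c)"
proof (induction k arbitrary: c)
  case (Suc k)
  show ?case
    by (rule Ck_on_SucI[OF Suc.prems, where D = "\<lambda>x v. 0"]) (auto intro: Suc)
qed simp

lemma Ck_on_linear:
  assumes "open S" "bounded_linear f"
  shows "Ck_on k S f"
proof (cases k)
  case 0
  thus ?thesis using assms(2) by (simp add: linear_continuous_on)
next
  case (Suc j)
  have "Ck_on (Suc j) S f"
    by (rule Ck_on_SucI[OF assms(1), where D = "\<lambda>x. f"])
       (auto intro!: Ck_on_const assms bounded_linear_imp_has_derivative)
  thus ?thesis using Suc by simp
qed

lemma Ck_on_add:
  assumes "open S" "Ck_on k S f" "Ck_on k S g"
  shows "Ck_on k S (\<lambda>x. f x + g x)"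
  using assms(2,3)
proof (induction k arbitrary: f g)
  case 0
  thus ?case by (auto intro: continuous_on_add)
next
  case (Suc k)
  show ?case
  proof (rule Ck_on_SucI[OF assms(1)])
    show "((\<lambda>x. f x + g x) has_derivative (\<lambda>v. frechet_derivative f (at x) v + frechet_derivative g (at x) v)) (at x)"
      if "x \<in> S" for x
      using Suc.prems that by (intro has_derivative_add has_frechet_derivative) auto
    show "Ck_on k S (\<lambda>x. frechet_derivative f (at x) v + frechet_derivative g (at x) v)" for v
      by (rule Suc.IH) (use Suc.prems in auto)
  qed
qed

lemma Ck_on_bilinear:
  assumes "open S" "bounded_bilinear bil" "Ck_on k S f" "Ck_on k S g"
  shows "Ck_on k S (\<lambda>x. bil (f x) (g x))"
  using assms(3,4)
proof (induction k arbitrary: f g)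
  case 0
  thus ?case by (auto intro: bounded_bilinear.continuous_on[OF assms(2)])
next
  case (Suc k)
  show ?case
  proof (rule Ck_on_SucI[OF assms(1)])
    show "((\<lambda>x. bil (f x) (g x)) has_derivative
        (\<lambda>v. bil (f x) (frechet_derivative g (at x) v) + bil (frechet_derivative f (at x) v) (g x))) (at x)"
      if "x \<in> S" for x
      using Suc.prems that by (intro bounded_bilinear.FDERIV[OF assms(2)] has_frechet_derivative) auto
    show "Ck_on k S (\<lambda>x. bil (f x) (frechet_derivative g (at x) v) + bil (frechet_derivative f (at x) v) (g x))" for v
      using Suc.prems by (intro Ck_on_add[OF assms(1)] Suc.IH[OF Ck_on_Suc_imp] Suc.IH[OF _ Ck_on_Suc_imp]) auto
  qed
qed

lemmas Ck_on_scaleR = Ck_on_bilinear[OF _ bounded_bilinear_scaleR]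
  and Ck_on_inner = Ck_on_bilinear[OF _ bounded_bilinear_inner]
  and Ck_on_mult = Ck_on_bilinear[OF _ bounded_bilinear_mult]

lemma Ck_on_sum:
  assumes "open S" "finite I" "\<And>i. i \<in> I \<Longrightarrow> Ck_on k S (f i)"
  shows "Ck_on k S (\<lambda>x. \<Sum>i\<in>I. f i x)"
  using assms(2,3) by (induction I) (auto intro!: Ck_on_const Ck_on_add assms(1))

lemma frechet_derivative_expand:
  fixes v :: "'a::euclidean_space"
  assumes "f differentiable (at x)"
  shows "frechet_derivative f (at x) v = (\<Sum>b\<in>Basis. (v \<bullet> b) *\<^sub>R frechet_derivative f (at x) b)"
proof -
  note lin = frechet_derivative_linear[OF assms]
  have "frechet_derivative f (at x) v = frechet_derivative f (at x) (\<Sum>b\<in>Basis. (v \<bullet> b) *\<^sub>R b)"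
    by (simp add: euclidean_representation)
  thus ?thesis by (simp add: linear_sum[OF lin] linear_scale[OF lin])
qed

text \<open>\<open>Ck_on\<close> speaks of derivatives in fixed directions, whereas the chain rule
  evaluates the derivative of \<open>g\<close> in a direction that moves with \<open>x\<close>.
  Expanding this direction in the basis leaves products of functions covered by the induction
  hypothesis.\<close>

lemma Ck_on_compose:
  fixes f :: "'a::euclidean_space \<Rightarrow> 'b::euclidean_space" and g :: "'b \<Rightarrow> 'c::euclidean_space"
  assumes "open S" "open T" "f ` S \<subseteq> T" "Ck_on k S f" "Ck_on k T g"
  shows "Ck_on k S (\<lambda>x. g (f x))"
  using assms(4,5)
proof (induction k arbitrary: g)
  case 0
  thus ?case using assms(3) by (auto intro: continuous_on_compose2)
next
  case (Suc k)
  have g: "g differentiable (at (f x))" if "x \<in> S" for x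
    using Suc.prems(2) assms(3) that by auto
  show ?case
  proof (rule Ck_on_SucI[OF assms(1)])
    show "((\<lambda>x. g (f x)) has_derivative (\<lambda>v. \<Sum>b\<in>Basis. (frechet_derivative f (at x) v \<bullet> b) *\<^sub>R frechet_derivative g (at (f x)) b)) (at x)"
      if "x \<in> S" for x
    proof -
      have "((\<lambda>x. g (f x)) has_derivative (\<lambda>v. frechet_derivative g (at (f x)) (frechet_derivative f (at x) v))) (at x)"
        by (rule has_derivative_compose[where f = f]; rule has_frechet_derivative)
           (use Suc.prems g[OF that] that in auto)
      thus ?thesis by (simp add: frechet_derivative_expand[OF g[OF that], symmetric])
    qed
    show "Ck_on k S (\<lambda>x. \<Sum>b\<in>Basis. (frechet_derivative f (at x) v \<bullet> b) *\<^sub>R frechet_derivative g (at (f x)) b)" for v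
    proof (intro Ck_on_sum[OF assms(1)] Ck_on_scaleR[OF assms(1)] Ck_on_inner[OF assms(1)] Ck_on_const[OF assms(1)])
      fix b :: 'b
      show "Ck_on k S (\<lambda>x. frechet_derivative f (at x) v)" using Suc.prems by simp
      show "Ck_on k S (\<lambda>x. frechet_derivative g (at (f x)) b)"
        by (rule Suc.IH[OF Ck_on_Suc_imp[OF Suc.prems(1)]]) (use Suc.prems(2) in simp)
    qed simp
  qed
qed

lemma smooth_onD: "smooth_on S f \<Longrightarrow> Ck_on k S f"
  by (simp add: smooth_on_def)

lemma smooth_on_differentiable: "smooth_on S f \<Longrightarrow> x \<in> S \<Longrightarrow> f differentiable (at x)"
  using smooth_onD[of S f "Suc 0"] by auto

lemma smooth_on_derivative:
  assumes "smooth_on S f"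
  shows "smooth_on S (\<lambda>x. frechet_derivative f (at x) v)"
  unfolding smooth_on_def
proof
  fix k
  show "Ck_on k S (\<lambda>x. frechet_derivative f (at x) v)" using smooth_onD[OF assms, of "Suc k"] by simp
qed

lemma smooth_on_continuous: "smooth_on S f \<Longrightarrow> continuous_on S f"
  using smooth_onD Ck_on_continuous by blast

lemma smooth_on_cong:
  "open S \<Longrightarrow> (\<And>x. x \<in> S \<Longrightarrow> f x = g x) \<Longrightarrow> smooth_on S f \<Longrightarrow> smooth_on S g"
  unfolding smooth_on_def using Ck_on_cong by blast

lemma smooth_on_subset: "smooth_on S f \<Longrightarrow> T \<subseteq> S \<Longrightarrow> smooth_on T f"
  unfolding smooth_on_def using Ck_on_subset by blast

lemma smooth_on_local:
  assumes "\<And>x. x \<in> S \<Longrightarrow> \<exists>W. open W \<and> x \<in> W \<and> smooth_on W f"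
  shows "smooth_on S f"
  unfolding smooth_on_def
proof (intro allI Ck_on_local)
  fix k x assume "x \<in> S"
  from assms[OF this] obtain W where "open W" "x \<in> W" "smooth_on W f" by blast
  thus "\<exists>W. open W \<and> x \<in> W \<and> Ck_on k W f" using smooth_onD by blast
qed

lemma smooth_on_const: "open S \<Longrightarrow> smooth_on S (\<lambda>x. c)"
  by (simp add: smooth_on_def Ck_on_const)

lemma smooth_on_linear: "open S \<Longrightarrow> bounded_linear f \<Longrightarrow> smooth_on S f"
  by (simp add: smooth_on_def Ck_on_linear)

lemma smooth_on_add: "open S \<Longrightarrow> smooth_on S f \<Longrightarrow> smooth_on S g \<Longrightarrow> smooth_on S (\<lambda>x. f x + g x)"
  by (simp add: smooth_on_def Ck_on_add)

lemma smooth_on_scaleR: "open S \<Longrightarrow> smooth_on S f \<Longrightarrow> smooth_on S g \<Longrightarrow> smooth_on S (\<lambda>x. f x *\<^sub>R g x)"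
  by (simp add: smooth_on_def Ck_on_scaleR)

lemma smooth_on_mult:
  fixes f g :: "_ \<Rightarrow> real"
  shows "open S \<Longrightarrow> smooth_on S f \<Longrightarrow> smooth_on S g \<Longrightarrow> smooth_on S (\<lambda>x. f x * g x)"
  by (simp add: smooth_on_def Ck_on_mult)

lemma smooth_on_inner: "open S \<Longrightarrow> smooth_on S f \<Longrightarrow> smooth_on S g \<Longrightarrow> smooth_on S (\<lambda>x. f x \<bullet> g x)"
  by (simp add: smooth_on_def Ck_on_inner)

lemma smooth_on_sum:
  "open S \<Longrightarrow> finite I \<Longrightarrow> (\<And>i. i \<in> I \<Longrightarrow> smooth_on S (f i)) \<Longrightarrow> smooth_on S (\<lambda>x. \<Sum>i\<in>I. f i x)"
  by (simp add: smooth_on_def Ck_on_sum)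

lemma smooth_on_compose:
  fixes f :: "'a::euclidean_space \<Rightarrow> 'b::euclidean_space" and g :: "'b \<Rightarrow> 'c::euclidean_space"
  shows "open S \<Longrightarrow> open T \<Longrightarrow> f ` S \<subseteq> T \<Longrightarrow> smooth_on S f \<Longrightarrow> smooth_on T g \<Longrightarrow> smooth_on S (\<lambda>x. g (f x))"
  by (simp add: smooth_on_def Ck_on_compose)

lemma smooth_on_linear_compose:
  fixes f :: "'a::euclidean_space \<Rightarrow> 'b::euclidean_space" and g :: "'b \<Rightarrow> 'c::euclidean_space"
  shows "open S \<Longrightarrow> bounded_linear g \<Longrightarrow> smooth_on S f \<Longrightarrow> smooth_on S (\<lambda>x. g (f x))"
  by (rule smooth_on_compose[where T = UNIV]) (auto intro: smooth_on_linear)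

lemma smooth_on_Pair:
  fixes f :: "'a::euclidean_space \<Rightarrow> 'b::euclidean_space" and g :: "'a \<Rightarrow> 'c::euclidean_space"
  assumes "open S" "smooth_on S f" "smooth_on S g"
  shows "smooth_on S (\<lambda>x. (f x, g x))"
proof -
  have "bounded_linear (\<lambda>x. (x, 0) :: 'b \<times> 'c)" "bounded_linear (\<lambda>x. (0, x) :: 'b \<times> 'c)"
    by (intro bounded_linear_Pair bounded_linear_ident bounded_linear_zero)+
  from smooth_on_add[OF assms(1) smooth_on_linear_compose[OF assms(1) this(1) assms(2)]
      smooth_on_linear_compose[OF assms(1) this(2) assms(3)]]
  show ?thesis by simp
qed

lemma smooth_on_powr: "smooth_on {0<..} (\<lambda>t::real. t powr a)"
proof -
  have "Ck_on k {0<..} (\<lambda>t::real. t powr a)" for k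
  proof (induction k arbitrary: a)
    case 0
    show ?case by (auto intro!: continuous_intros)
  next
    case (Suc k)
    show ?case
    proof (rule Ck_on_SucI)
      show "((\<lambda>t. t powr a) has_derivative (\<lambda>v. v *\<^sub>R (a *\<^sub>R (x powr (a - 1))))) (at x)" if "x \<in> {0<..}" for x :: real
        using has_real_derivative_powr[of x a] that
        by (auto simp: has_field_derivative_def mult.commute elim!: has_derivative_eq_rhs)
      show "Ck_on k {0<..} (\<lambda>x. v *\<^sub>R (a *\<^sub>R (x powr (a - 1))))" for v :: real
        by (intro Ck_on_scaleR Ck_on_const Suc) auto
    qed simp
  qed
  thus ?thesis by (simp add: smooth_on_def)
qed

text \<open>The norm enters through the power \<open>- 1/2\<close> of
  \<open>f x \<bullet> f x\<close>, so that smoothness of real powers on the positive axis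
  suffices.\<close>

lemma smooth_on_normalize:
  fixes f :: "'a::euclidean_space \<Rightarrow> 'b::euclidean_space"
  assumes "open S" "smooth_on S f" "\<And>x. x \<in> S \<Longrightarrow> f x \<noteq> 0"
  shows "smooth_on S (\<lambda>x. f x /\<^sub>R norm (f x))"
proof -
  have 1: "smooth_on S (\<lambda>x. (f x \<bullet> f x) powr (- 1/2))"
    by (rule smooth_on_compose[where T = "{0<..}"])
       (use assms smooth_on_powr in \<open>auto intro!: smooth_on_inner\<close>)
  have eq: "(f x \<bullet> f x) powr (- 1/2) = inverse (norm (f x))" if "x \<in> S" for x
  proof -
    have "(f x \<bullet> f x) powr (- 1/2) = inverse ((f x \<bullet> f x) powr (1/2))"
      by (metis minus_divide_left powr_minus)
    thus ?thesis by (simp add: powr_half_sqrt norm_eq_sqrt_inner)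
  qed
  show ?thesis
    by (rule smooth_on_cong[OF assms(1) _ smooth_on_scaleR[OF assms(1) 1 assms(2)]]) (simp add: eq[simplified])
qed

section \<open>Second fundamental form of immersed products of spheres\<close>

text \<open>Orthogonal projection, phrased with the same description operator as
  \<open>normal_component\<close> so that the two can be matched by unfolding.\<close>

definition sub_proj :: "'v::euclidean_space set \<Rightarrow> 'v \<Rightarrow> 'v" where
  "sub_proj S w = w - (THE y. (\<forall>z\<in>S. orthogonal z y) \<and> w - y \<in> S)"

context
  fixes S :: "'v::euclidean_space set"
  assumes S: "subspace S"
begin

lemma normal_part_ex1: "\<exists>!y. (\<forall>z\<in>S. orthogonal z y) \<and> w - y \<in> S"
proof (rule ex_ex1I)
  obtain a b where ab: "a \<in> span S" "\<And>z. z \<in> span S \<Longrightarrow> orthogonal b z" "w = a + b"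
    using orthogonal_subspace_decomp_exists[of S w] by metis
  show "\<exists>y. (\<forall>z\<in>S. orthogonal z y) \<and> w - y \<in> S"
    by (rule exI[of _ b]) (use ab S in \<open>auto simp: span_eq_iff[THEN iffD2] orthogonal_commute span_base\<close>)
next
  fix y y' assume y: "(\<forall>z\<in>S. orthogonal z y) \<and> w - y \<in> S" and y': "(\<forall>z\<in>S. orthogonal z y') \<and> w - y' \<in> S"
  have "(w - y') - (w - y) \<in> S" using y y' S by (blast intro: subspace_diff)
  hence "y - y' \<in> S" by simp
  hence "(y - y') \<bullet> y = 0" "(y - y') \<bullet> y' = 0" using y y' by (auto simp: orthogonal_def)
  hence "(y - y') \<bullet> (y - y') = 0" by (simp add: inner_diff_right)
  thus "y = y'" by simp
qed

lemma sub_proj_in: "sub_proj S w \<in> S"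
  and sub_proj_orthogonal: "z \<in> S \<Longrightarrow> z \<bullet> (w - sub_proj S w) = 0"
  using theI'[OF normal_part_ex1[of w]] by (auto simp: sub_proj_def orthogonal_def)

lemma sub_proj_unique:
  assumes "v \<in> S" "\<And>z. z \<in> S \<Longrightarrow> z \<bullet> (w - v) = 0"
  shows "sub_proj S w = v"
proof -
  have "(THE y. (\<forall>z\<in>S. orthogonal z y) \<and> w - y \<in> S) = w - v"
    by (rule the1_equality[OF normal_part_ex1]) (use assms in \<open>auto simp: orthogonal_def\<close>)
  thus ?thesis by (simp add: sub_proj_def)
qed

lemma sub_proj_id: "v \<in> S \<Longrightarrow> sub_proj S v = v"
  by (rule sub_proj_unique) auto

lemma sub_proj_linear: "linear (sub_proj S)"
proof (rule linearI)
  fix x y :: 'v and c :: real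
  show "sub_proj S (x + y) = sub_proj S x + sub_proj S y"
  proof (rule sub_proj_unique)
    show "z \<bullet> (x + y - (sub_proj S x + sub_proj S y)) = 0" if "z \<in> S" for z
      using sub_proj_orthogonal[OF that, of x] sub_proj_orthogonal[OF that, of y] by (simp add: inner_simps)
  qed (intro subspace_add S sub_proj_in)
  show "sub_proj S (c *\<^sub>R x) = c *\<^sub>R sub_proj S x"
  proof (rule sub_proj_unique)
    show "z \<bullet> (c *\<^sub>R x - c *\<^sub>R sub_proj S x) = 0" if "z \<in> S" for z
      using sub_proj_orthogonal[OF that, of x] by (simp add: inner_simps)
  qed (intro subspace_scale S sub_proj_in)
qed

lemma sub_proj_orth_proj: "orth_proj (sub_proj S)"
  unfolding orth_proj_def
proof (intro conjI allI sub_proj_linear sub_proj_id sub_proj_in)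
  fix x z
  have "sub_proj S x \<bullet> (z - sub_proj S z) = 0" "sub_proj S z \<bullet> (x - sub_proj S x) = 0"
    by (intro sub_proj_orthogonal sub_proj_in)+
  thus "sub_proj S x \<bullet> z = x \<bullet> sub_proj S z"
    by (simp add: inner_diff_right inner_commute)
qed

end

section \<open>The product of two unit spheres and its radial retraction\<close>

definition sphere2 :: "('a::euclidean_space \<times> 'b::euclidean_space) set" where
  "sphere2 = sphere 0 1 \<times> sphere 0 1"

definition dom2 :: "('a::euclidean_space \<times> 'b::euclidean_space) set" where
  "dom2 = {p. fst p \<noteq> 0 \<and> snd p \<noteq> 0}"

definition retr :: "'a::euclidean_space \<times> 'b::euclidean_space \<Rightarrow> 'a \<times> 'b" where
  "retr p = (fst p /\<^sub>R norm (fst p), snd p /\<^sub>R norm (snd p))"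

lemma sphere2_iff: "p \<in> sphere2 \<longleftrightarrow> norm (fst p) = 1 \<and> norm (snd p) = 1"
  by (cases p) (auto simp: sphere2_def)

lemma open_dom2: "open dom2"
  unfolding dom2_def by (intro open_Collect_conj open_Collect_neq continuous_intros)

lemma sphere2_subset: "sphere2 \<subseteq> dom2"
  by (auto simp: sphere2_iff dom2_def)

lemma retr_in: "p \<in> dom2 \<Longrightarrow> retr p \<in> sphere2"
  by (simp add: dom2_def sphere2_iff retr_def)

lemma retr_id: "p \<in> sphere2 \<Longrightarrow> retr p = p"
  by (simp add: sphere2_iff retr_def)

lemma smooth_on_retr: "smooth_on dom2 retr"
proof -
  have "smooth_on dom2 (\<lambda>p::'a \<times> 'b. (fst p /\<^sub>R norm (fst p), snd p /\<^sub>R norm (snd p)))"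
    by (intro smooth_on_Pair open_dom2 smooth_on_normalize smooth_on_linear bounded_linear_fst bounded_linear_snd)
       (auto simp: dom2_def)
  thus ?thesis by (simp add: retr_def[abs_def])
qed

text \<open>Constant along the rays of each factor separately. One extension thus serves all points
  of the product, and its derivative in any direction is the derivative in the tangential part of
  that direction.\<close>

definition hom_ext :: "('a::euclidean_space \<times> 'b::euclidean_space \<Rightarrow> 'v) \<Rightarrow> 'a \<times> 'b \<Rightarrow> 'v" where
  "hom_ext f p = f (retr p)"

lemma hom_ext_eq: "p \<in> sphere2 \<Longrightarrow> hom_ext f p = f p"
  by (simp add: hom_ext_def retr_id)

lemma smooth_hom_ext:
  fixes f :: "'a::euclidean_space \<times> 'b::euclidean_space \<Rightarrow> 'v::euclidean_space"
  assumes "smooth_map_on sphere2 f"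
  shows "smooth_on dom2 (hom_ext f)"
proof (rule smooth_on_local)
  fix p :: "'a \<times> 'b" assume p: "p \<in> dom2"
  obtain W F where "local_smooth_extension sphere2 f (retr p) W F"
    using assms retr_in[OF p] unfolding smooth_map_on_def by blast
  hence W: "open W" "retr p \<in> W" "smooth_on W F" "\<And>q. q \<in> W \<Longrightarrow> q \<in> sphere2 \<Longrightarrow> F q = f q"
    by (auto simp: local_smooth_extension_def)
  define V where "V = dom2 \<inter> retr -` W"
  have V: "open V"
    unfolding V_def using smooth_on_continuous[OF smooth_on_retr] open_dom2 W(1)
    by (metis continuous_open_preimage)
  have "smooth_on V (\<lambda>q. F (retr q))"
    by (rule smooth_on_compose[OF V W(1) _ smooth_on_subset[OF smooth_on_retr] W(3)]) (auto simp: V_def)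
  hence "smooth_on V (hom_ext f)"
    by (rule smooth_on_cong[OF V, rotated]) (auto simp: V_def hom_ext_def retr_in W(4))
  thus "\<exists>W. open W \<and> p \<in> W \<and> smooth_on W (hom_ext f)"
    using V p W(2) by (auto simp: V_def)
qed

lemma hom_ext_local_extension:
  assumes "smooth_map_on sphere2 f" "p \<in> sphere2"
  shows "local_smooth_extension sphere2 f p dom2 (hom_ext f)"
  using assms smooth_hom_ext sphere2_subset
  by (auto simp: local_smooth_extension_def open_dom2 hom_ext_eq)

lemma retr_line_derivative:
  fixes x u :: "'a::euclidean_space"
  assumes x: "norm x = 1" and u: "x \<bullet> u = 0"
  shows "((\<lambda>s. (x + s *\<^sub>R u) /\<^sub>R norm (x + s *\<^sub>R u)) has_vector_derivative u) (at 0)"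
proof -
  have n: "norm (x + s *\<^sub>R u) = sqrt (1 + s * s * (u \<bullet> u))" for s
    using x u by (simp add: norm_eq_sqrt_inner inner_simps inner_commute)
  have "((\<lambda>s. inverse (sqrt (1 + s * s * (u \<bullet> u))) *\<^sub>R (x + s *\<^sub>R u)) has_vector_derivative u) (at 0)"
    by (auto intro!: derivative_eq_intros)
  thus ?thesis by (simp add: n)
qed

text \<open>For the inclusion from right to left the curve is the retraction of the line
  \<open>p + s v\<close>; this line avoids zero in both factors because \<open>v\<close> is
  orthogonal to \<open>p\<close> in each of them.\<close>

lemma tangent_space_sphere2:
  fixes p :: "'a::euclidean_space \<times> 'b::euclidean_space"
  assumes p: "p \<in> sphere2"
  shows "tangent_space sphere2 p = {v. fst p \<bullet> fst v = 0 \<and> snd p \<bullet> snd v = 0}"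
proof (intro equalityI subsetI)
  fix v assume "v \<in> tangent_space sphere2 p"
  then obtain \<gamma> e where g: "e > 0" "\<gamma> ` {-e<..<e} \<subseteq> sphere2" "\<gamma> 0 = p"
      "(\<gamma> has_vector_derivative v) (at (0::real))"
    by (auto simp: tangent_space_def)
  have zero: "h 0 \<bullet> w = 0" if h: "(h has_vector_derivative w) (at (0::real))" "\<And>s. s \<in> {-e<..<e} \<Longrightarrow> h s \<bullet> h s = 1"
    for h :: "real \<Rightarrow> 'c::euclidean_space" and w
  proof -
    have "((\<lambda>s. h s \<bullet> h s) has_real_derivative (h 0 \<bullet> w + w \<bullet> h 0)) (at 0)"
      using bounded_bilinear.has_vector_derivative[OF bounded_bilinear_inner h(1) h(1)]
      by (simp add: has_real_derivative_iff_has_vector_derivative)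
    moreover have "((\<lambda>s. h s \<bullet> h s) has_real_derivative 0) (at 0)"
      by (rule has_field_derivative_transform_within_open[where f = "\<lambda>_. 1" and S = "{-e<..<e}"]) (use g(1) h(2) in auto)
    ultimately have "h 0 \<bullet> w + w \<bullet> h 0 = 0" by (rule DERIV_unique)
    thus ?thesis by (simp add: inner_commute)
  qed
  have sph: "fst (\<gamma> s) \<bullet> fst (\<gamma> s) = 1" "snd (\<gamma> s) \<bullet> snd (\<gamma> s) = 1" if "s \<in> {-e<..<e}" for s
    using g(2) that by (auto simp: sphere2_iff image_subset_iff norm_eq_1)
  have "((\<lambda>s. fst (\<gamma> s)) has_vector_derivative fst v) (at 0)" "((\<lambda>s. snd (\<gamma> s)) has_vector_derivative snd v) (at 0)"
    using g(4) bounded_linear.has_vector_derivative[OF bounded_linear_fst]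
      bounded_linear.has_vector_derivative[OF bounded_linear_snd] by blast+
  from zero[OF this(1) sph(1)] zero[OF this(2) sph(2)]
  show "v \<in> {v. fst p \<bullet> fst v = 0 \<and> snd p \<bullet> snd v = 0}" by (simp add: g(3))
next
  fix v assume "v \<in> {v. fst p \<bullet> fst v = 0 \<and> snd p \<bullet> snd v = 0}"
  hence v: "fst p \<bullet> fst v = 0" "snd p \<bullet> snd v = 0" by auto
  have p1: "norm (fst p) = 1" "norm (snd p) = 1" using p by (auto simp: sphere2_iff)
  have nz: "x + s *\<^sub>R u \<noteq> 0" if "norm x = 1" "x \<bullet> u = 0" for x u :: "'c::euclidean_space" and s :: real
  proof
    assume "x + s *\<^sub>R u = 0"
    hence "x \<bullet> (x + s *\<^sub>R u) = 0" by simp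
    thus False using that by (simp add: inner_simps norm_eq_1)
  qed
  have dom: "p + s *\<^sub>R v \<in> dom2" for s
    using nz[OF p1(1) v(1)] nz[OF p1(2) v(2)] by (simp add: dom2_def)
  define \<gamma> where "\<gamma> = (\<lambda>s. retr (p + s *\<^sub>R v))"
  have "smooth_on {-1<..<1} \<gamma>"
    unfolding \<gamma>_def
    by (rule smooth_on_compose[OF _ open_dom2 _ _ smooth_on_retr])
       (use dom in \<open>auto intro!: smooth_on_add[OF _ smooth_on_const smooth_on_linear[OF _ bounded_linear_scaleR_left]]\<close>)
  moreover have "\<gamma> ` {-1<..<1} \<subseteq> sphere2" using retr_in[OF dom] by (auto simp: \<gamma>_def)
  moreover have "\<gamma> 0 = p" using retr_id[OF p] by (simp add: \<gamma>_def)
  moreover have "(\<gamma> has_vector_derivative v) (at 0)"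
  proof -
    have "((\<lambda>s. ((fst p + s *\<^sub>R fst v) /\<^sub>R norm (fst p + s *\<^sub>R fst v), (snd p + s *\<^sub>R snd v) /\<^sub>R norm (snd p + s *\<^sub>R snd v)))
        has_vector_derivative (fst v, snd v)) (at 0)"
      by (intro has_vector_derivative_Pair retr_line_derivative p1 v)
    thus ?thesis by (simp add: \<gamma>_def retr_def)
  qed
  ultimately show "v \<in> tangent_space sphere2 p"
    unfolding tangent_space_def using zero_less_one by blast
qed

text \<open>Two local extensions agree along a curve in \<open>X\<close> with velocity
  \<open>v\<close>, hence so do their derivatives in direction \<open>v\<close>; this makes the
  description in \<open>differential\<close> well defined.\<close>

lemma differential_eq:
  fixes f :: "'a::euclidean_space \<Rightarrow> 'v::euclidean_space"
  assumes F: "local_smooth_extension X f p W F" and v: "v \<in> tangent_space X p"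
  shows "differential X f p v = frechet_derivative F (at p) v"
proof -
  have uniq: "frechet_derivative F (at p) v = frechet_derivative G (at p) v"
    if "local_smooth_extension X f p W F" "local_smooth_extension X f p V G" for W F V G
  proof -
    obtain \<gamma> e where g: "e > 0" "\<gamma> ` {-e<..<e} \<subseteq> X" "\<gamma> 0 = p"
      "(\<gamma> has_vector_derivative v) (at (0::real))"
      using v by (auto simp: tangent_space_def)
    have W: "open W" "p \<in> W" "smooth_on W F" "\<And>q. q \<in> W \<Longrightarrow> q \<in> X \<Longrightarrow> F q = f q"
      using that(1) by (auto simp: local_smooth_extension_def)
    have V: "open V" "p \<in> V" "smooth_on V G" "\<And>q. q \<in> V \<Longrightarrow> q \<in> X \<Longrightarrow> G q = f q"
      using that(2) by (auto simp: local_smooth_extension_def)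
    have chain: "((\<lambda>s. H (\<gamma> s)) has_vector_derivative frechet_derivative H (at p) v) (at 0)"
      if "smooth_on S H" "p \<in> S" for H :: "'a \<Rightarrow> 'v" and S
    proof -
      have H: "(H has_derivative frechet_derivative H (at p)) (at (\<gamma> 0))"
        using smooth_on_differentiable[OF that] by (simp add: g(3) has_frechet_derivative)
      from has_derivative_compose[OF g(4)[unfolded has_vector_derivative_def] H]
      show ?thesis
        by (simp add: has_vector_derivative_def linear_scale[OF frechet_derivative_linear[OF smooth_on_differentiable[OF that]]])
    qed
    have cont: "isCont \<gamma> 0" using g(4) by (rule has_vector_derivative_continuous)
    have "\<forall>\<^sub>F s in at 0. \<gamma> s \<in> W \<inter> V"
      using cont W V g(3) unfolding isCont_def by (intro topological_tendstoD) auto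
    moreover have "\<forall>\<^sub>F s in at 0. s \<in> {-e<..<e}" using g(1) by (intro eventually_at_in_open') auto
    ultimately have "\<forall>\<^sub>F s in at 0. F (\<gamma> s) = G (\<gamma> s)"
    proof eventually_elim
      case (elim s)
      hence "\<gamma> s \<in> X" using g(2) by auto
      thus ?case using elim W(4) V(4) by simp
    qed
    moreover have "F (\<gamma> 0) = G (\<gamma> 0)"
    proof -
      have "\<gamma> 0 \<in> X" using g(1,2) by (auto simp: image_subset_iff)
      thus ?thesis using W V g(3) by simp
    qed
    ultimately have "((\<lambda>s. G (\<gamma> s)) has_vector_derivative frechet_derivative F (at p) v) (at 0)"
      using has_derivative_transform_eventually[OF chain[OF W(3,2), unfolded has_vector_derivative_def]]
      by (auto simp: has_vector_derivative_def)
    thus ?thesis using vector_derivative_unique_at chain[OF V(3,2)] by blast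
  qed
  show ?thesis
    unfolding differential_def using F uniq by (intro the_equality) blast+
qed

section \<open>The second fundamental form as a normal part of a second derivative\<close>

abbreviation D1 :: "('a::euclidean_space \<Rightarrow> 'v::euclidean_space) \<Rightarrow> 'a \<Rightarrow> 'a \<Rightarrow> 'v" where
  "D1 F p u \<equiv> frechet_derivative F (at p) u"

abbreviation D2 :: "('a::euclidean_space \<Rightarrow> 'v::euclidean_space) \<Rightarrow> 'a \<Rightarrow> 'a \<Rightarrow> 'a \<Rightarrow> 'v" where
  "D2 F p u v \<equiv> D1 (\<lambda>q. D1 F q u) p v"

lemma D1_linear: "smooth_on S F \<Longrightarrow> p \<in> S \<Longrightarrow> linear (D1 F p)"
  by (rule frechet_derivative_linear[OF smooth_on_differentiable])

lemma D1_has_derivative: "smooth_on S F \<Longrightarrow> p \<in> S \<Longrightarrow> (F has_derivative D1 F p) (at p)"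
  by (rule has_frechet_derivative[OF smooth_on_differentiable])

lemma D1_curve:
  assumes "smooth_on S F" "c s \<in> S" "(c has_vector_derivative v) (at s)"
  shows "((\<lambda>s. F (c s)) has_vector_derivative D1 F (c s) v) (at s)"
  using has_derivative_compose[OF assms(3)[unfolded has_vector_derivative_def] D1_has_derivative[OF assms(1,2)]]
  by (simp add: has_vector_derivative_def linear_scale[OF D1_linear[OF assms(1,2)]])

lemma D2_linear1:
  assumes S: "open S" and F: "smooth_on S F" and p: "p \<in> S"
  shows "linear (\<lambda>u. D2 F p u v)"
proof (rule linearI)
  fix x y and c :: real
  have d: "(\<lambda>q. D1 F q u) differentiable (at p)" for u
    by (rule smooth_on_differentiable[OF smooth_on_derivative[OF F] p])
  have "D1 (\<lambda>q. D1 F q (x + y)) p = D1 (\<lambda>q. D1 F q x + D1 F q y) p"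
    by (rule frechet_derivative_cong_open[OF S p]) (simp add: linear_add[OF D1_linear[OF F]])
  also have "\<dots> = (\<lambda>v. D2 F p x v + D2 F p y v)"
    by (rule frechet_derivative_at[symmetric]) (intro has_derivative_add has_frechet_derivative d)
  finally show "D2 F p (x + y) v = D2 F p x v + D2 F p y v" by simp
  have "D1 (\<lambda>q. D1 F q (c *\<^sub>R x)) p = D1 (\<lambda>q. c *\<^sub>R D1 F q x) p"
    by (rule frechet_derivative_cong_open[OF S p]) (simp add: linear_scale[OF D1_linear[OF F]])
  also have "\<dots> = (\<lambda>v. c *\<^sub>R D2 F p x v)"
    by (rule frechet_derivative_at[symmetric]) (intro has_derivative_scaleR_right has_frechet_derivative d)
  finally show "D2 F p (c *\<^sub>R x) v = c *\<^sub>R D2 F p x v" by simp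
qed

lemma D2_linear2: "smooth_on S F \<Longrightarrow> p \<in> S \<Longrightarrow> linear (\<lambda>v. D2 F p u v)"
  by (rule D1_linear[OF smooth_on_derivative])

lemma hom_ext_scale:
  assumes "s > 0" "t > 0"
  shows "hom_ext f (s *\<^sub>R fst p, t *\<^sub>R snd p) = hom_ext f p"
  using assms by (simp add: hom_ext_def retr_def field_simps)

lemma D1_constant_curve:
  assumes F: "smooth_on S F" "p \<in> S" and const: "\<And>s. s > - 1 \<Longrightarrow> F (p + s *\<^sub>R v) = F p"
  shows "D1 F p v = 0"
proof -
  have "((\<lambda>s. p + s *\<^sub>R v) has_vector_derivative v) (at 0)"
    by (auto intro!: derivative_eq_intros)
  from D1_curve[OF F(1) _ this] F(2)
  have "((\<lambda>s. F (p + s *\<^sub>R v)) has_vector_derivative D1 F p v) (at 0)" by simp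
  moreover have "((\<lambda>s. F (p + s *\<^sub>R v)) has_vector_derivative 0) (at (0::real))"
    by (rule has_vector_derivative_transform_within_open[where f = "\<lambda>s. F p" and S = "{-1<..}"])
       (auto simp: const)
  ultimately show ?thesis by (rule vector_derivative_unique_at)
qed

lemma D1_hom_ext_radial:
  fixes f :: "'a::euclidean_space \<times> 'b::euclidean_space \<Rightarrow> 'v::euclidean_space"
  assumes F: "smooth_on dom2 (hom_ext f)" and p: "p \<in> dom2"
  shows "D1 (hom_ext f) p (a *\<^sub>R fst p, b *\<^sub>R snd p) = 0"
proof -
  have 1: "D1 (hom_ext f) p (fst p, 0) = 0"
  proof (rule D1_constant_curve[OF F p])
    fix s :: real assume s: "s > - 1"
    have "p + s *\<^sub>R (fst p, 0) = ((1 + s) *\<^sub>R fst p, 1 *\<^sub>R snd p)"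
      by (simp add: prod_eq_iff algebra_simps)
    thus "hom_ext f (p + s *\<^sub>R (fst p, 0)) = hom_ext f p"
      using hom_ext_scale[of "1 + s" 1 f p] s by simp
  qed
  have 2: "D1 (hom_ext f) p (0, snd p) = 0"
  proof (rule D1_constant_curve[OF F p])
    fix s :: real assume s: "s > - 1"
    have "p + s *\<^sub>R (0, snd p) = (1 *\<^sub>R fst p, (1 + s) *\<^sub>R snd p)"
      by (simp add: prod_eq_iff algebra_simps)
    thus "hom_ext f (p + s *\<^sub>R (0, snd p)) = hom_ext f p"
      using hom_ext_scale[of 1 "1 + s" f p] s by simp
  qed
  have "(a *\<^sub>R fst p, b *\<^sub>R snd p) = a *\<^sub>R (fst p, 0) + b *\<^sub>R (0, snd p)" by simp
  thus ?thesis
    by (simp only: linear_add[OF D1_linear[OF F p]] linear_scale[OF D1_linear[OF F p]] 1 2) simp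
qed

definition tang :: "'a::euclidean_space \<times> 'b::euclidean_space \<Rightarrow> 'a \<times> 'b \<Rightarrow> 'a \<times> 'b" where
  "tang p v = (fst v - (fst p \<bullet> fst v) *\<^sub>R fst p, snd v - (snd p \<bullet> snd v) *\<^sub>R snd p)"

lemma tang_in: "p \<in> sphere2 \<Longrightarrow> tang p v \<in> tangent_space sphere2 p"
  by (simp add: tangent_space_sphere2 tang_def sphere2_iff inner_diff_right norm_eq_1)

lemma tang_id: "p \<in> sphere2 \<Longrightarrow> v \<in> tangent_space sphere2 p \<Longrightarrow> tang p v = v"
  by (simp add: tangent_space_sphere2 tang_def)

lemma D1_tang:
  fixes f :: "'a::euclidean_space \<times> 'b::euclidean_space \<Rightarrow> 'v::euclidean_space"
  assumes F: "smooth_on dom2 (hom_ext f)" and p: "p \<in> dom2"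
  shows "D1 (hom_ext f) p (tang p v) = D1 (hom_ext f) p v"
proof -
  have "tang p v = v - ((fst p \<bullet> fst v) *\<^sub>R fst p, (snd p \<bullet> snd v) *\<^sub>R snd p)"
    by (simp add: tang_def prod_eq_iff)
  thus ?thesis
    by (simp only: linear_diff[OF D1_linear[OF F p]] D1_hom_ext_radial[OF F p]) simp
qed

definition tangent_image :: "('a::euclidean_space \<times> 'b::euclidean_space \<Rightarrow> 'v::euclidean_space) \<Rightarrow> 'a \<times> 'b \<Rightarrow> 'v set" where
  "tangent_image F p = range (D1 F p)"

lemma subspace_tangent_image: "smooth_on dom2 F \<Longrightarrow> p \<in> dom2 \<Longrightarrow> subspace (tangent_image F p)"
  unfolding tangent_image_def by (intro linear_subspace_image D1_linear[of dom2] subspace_UNIV)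

context
  fixes f :: "'a::euclidean_space \<times> 'b::euclidean_space \<Rightarrow> 'v::euclidean_space"
  assumes f: "smooth_map_on sphere2 f"
begin

private abbreviation "F \<equiv> hom_ext f"

lemma differential_sphere2:
  "p \<in> sphere2 \<Longrightarrow> v \<in> tangent_space sphere2 p \<Longrightarrow> differential sphere2 f p v = D1 F p v"
  by (rule differential_eq[OF hom_ext_local_extension[OF f]])

lemma differential_image:
  assumes p: "p \<in> sphere2"
  shows "differential sphere2 f p ` tangent_space sphere2 p = tangent_image F p"
proof -
  have p': "p \<in> dom2" using p sphere2_subset by auto
  have "differential sphere2 f p ` tangent_space sphere2 p = D1 F p ` tangent_space sphere2 p"
    by (rule image_cong) (auto simp: differential_sphere2[OF p])
  also have "\<dots> = range (D1 F p)"
    using tang_in[OF p] D1_tang[OF smooth_hom_ext[OF f] p'] by (metis (no_types, lifting) image_subset_iff rangeI subsetI subset_antisym UNIV_I image_eqI)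
  finally show ?thesis by (simp add: tangent_image_def)
qed

lemma normal_component_eq:
  assumes p: "p \<in> sphere2"
  shows "normal_component sphere2 f p w = w - sub_proj (tangent_image F p) w"
  unfolding normal_component_def sub_proj_def differential_image[OF p] by simp

text \<open>Differentiating \<open>D1 F q (V' q)\<close>, with \<open>V'\<close> an ambient
  extension of the field, gives \<open>D2 F p v u + D1 F p (D1 V' p u)\<close>. The second summand
  is tangent to the image, so the normal part depends only on the value \<open>v\<close>. That a
  field with this value exists is seen by projecting the constant vector \<open>v\<close> with
  \<open>tang\<close>.\<close>

lemma second_fundamental_form_eq:
  assumes p: "p \<in> sphere2" and u: "u \<in> tangent_space sphere2 p" and v: "v \<in> tangent_space sphere2 p"
  shows "second_fundamental_form sphere2 f p u v = D2 F p v u - sub_proj (tangent_image F p) (D2 F p v u)"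
proof -
  have p': "p \<in> dom2" using p sphere2_subset by auto
  have F: "smooth_on dom2 F" by (rule smooth_hom_ext[OF f])
  have sub: "subspace (tangent_image F p)" by (rule subspace_tangent_image[OF F p'])
  have sff: "normal_component sphere2 f p (differential sphere2 (\<lambda>q. differential sphere2 f q (V q)) p u)
      = D2 F p v u - sub_proj (tangent_image F p) (D2 F p v u)"
    if V: "smooth_tangent_field sphere2 V" "V p = v" for V
  proof -
    obtain W V' where W: "open W" "p \<in> W" "smooth_on W V'" "\<And>q. q \<in> W \<Longrightarrow> q \<in> sphere2 \<Longrightarrow> V' q = V q"
      using V(1) p unfolding smooth_tangent_field_def smooth_map_on_def local_smooth_extension_def by blast
    define S where "S = W \<inter> dom2"
    have S: "open S" "p \<in> S" "S \<subseteq> dom2" "S \<subseteq> W" using W open_dom2 p' by (auto simp: S_def)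
    note FS = smooth_on_subset[OF F S(3)] and VS = smooth_on_subset[OF W(3) S(4)]
    define H where "H = (\<lambda>q. \<Sum>b\<in>Basis. (V' q \<bullet> b) *\<^sub>R D1 F q b)"
    have H: "H q = D1 F q (V' q)" if "q \<in> S" for q
      unfolding H_def by (rule frechet_derivative_expand[symmetric, OF smooth_on_differentiable[OF FS that]])
    have ext: "local_smooth_extension sphere2 (\<lambda>q. differential sphere2 f q (V q)) p S H"
      unfolding local_smooth_extension_def
    proof (intro conjI ballI S)
      show "smooth_on S H" unfolding H_def
        by (intro smooth_on_sum smooth_on_scaleR smooth_on_inner smooth_on_const S(1) VS smooth_on_derivative[OF FS] finite_Basis)
      fix q assume q: "q \<in> S \<inter> sphere2"
      hence "V' q = V q" using W(4) S(4) by blast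
      moreover have "V q \<in> tangent_space sphere2 q" using V(1) q by (auto simp: smooth_tangent_field_def)
      ultimately show "H q = differential sphere2 f q (V q)"
        using q by (simp add: H differential_sphere2)
    qed
    have V'p: "V' p = v" using W(2,4) p V(2) by simp
    have "(H has_derivative (\<lambda>h. \<Sum>b\<in>Basis. (V' p \<bullet> b) *\<^sub>R D2 F p b h + (D1 V' p h \<bullet> b) *\<^sub>R D1 F p b)) (at p)"
      unfolding H_def
      by (intro has_derivative_sum has_derivative_scaleR has_derivative_inner_left D1_has_derivative[OF VS S(2)] D1_has_derivative[OF smooth_on_derivative[OF FS] S(2)])
    from fun_cong[OF frechet_derivative_at[OF this, symmetric], of u]
    have "D1 H p u = (\<Sum>b\<in>Basis. (V' p \<bullet> b) *\<^sub>R D2 F p b u) + (\<Sum>b\<in>Basis. (D1 V' p u \<bullet> b) *\<^sub>R D1 F p b)"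
      by (simp only: sum.distrib)
    also have "(\<Sum>b\<in>Basis. (D1 V' p u \<bullet> b) *\<^sub>R D1 F p b) = D1 F p (D1 V' p u)"
      by (rule frechet_derivative_expand[symmetric, OF smooth_on_differentiable[OF FS S(2)]])
    also have "(\<Sum>b\<in>Basis. (V' p \<bullet> b) *\<^sub>R D2 F p b u) = D2 F p v u"
    proof -
      note lin = D2_linear1[OF open_dom2 F p', of u]
      have "D2 F p v u = D2 F p (\<Sum>b\<in>Basis. (v \<bullet> b) *\<^sub>R b) u" by (simp add: euclidean_representation)
      thus ?thesis by (simp add: V'p linear_sum[OF lin] linear_scale[OF lin])
    qed
    finally have "differential sphere2 (\<lambda>q. differential sphere2 f q (V q)) p u = D2 F p v u + D1 F p (D1 V' p u)"
      using differential_eq[OF ext u] by simp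
    moreover have "sub_proj (tangent_image F p) (D1 F p (D1 V' p u)) = D1 F p (D1 V' p u)"
      by (rule sub_proj_id[OF sub]) (simp add: tangent_image_def)
    ultimately show ?thesis
      by (simp add: normal_component_eq[OF p] linear_add[OF sub_proj_linear[OF sub]])
  qed
  have "smooth_tangent_field sphere2 (\<lambda>q. tang q v)"
    unfolding smooth_tangent_field_def smooth_map_on_def local_smooth_extension_def
  proof (intro conjI ballI)
    fix q :: "'a \<times> 'b" assume "q \<in> sphere2"
    thus "tang q v \<in> tangent_space sphere2 q" by (rule tang_in)
    have sc: "smooth_on UNIV (\<lambda>q::'a \<times> 'b. (- 1) *\<^sub>R (h q :: 'c::euclidean_space))" if "smooth_on UNIV h" for h
      by (intro smooth_on_scaleR smooth_on_const that) auto
    have "smooth_on UNIV (\<lambda>q::'a \<times> 'b. (fst v + (- 1) *\<^sub>R ((fst q \<bullet> fst v) *\<^sub>R fst q), snd v + (- 1) *\<^sub>R ((snd q \<bullet> snd v) *\<^sub>R snd q)))"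
      by (intro smooth_on_Pair smooth_on_add sc smooth_on_const smooth_on_scaleR smooth_on_inner open_UNIV
          smooth_on_linear bounded_linear_fst bounded_linear_snd)
    hence "smooth_on UNIV (\<lambda>q. tang q v)" by (simp add: tang_def)
    thus "\<exists>W F. open W \<and> q \<in> W \<and> smooth_on W F \<and> (\<forall>r\<in>W \<inter> sphere2. F r = tang r v)"
      by (intro exI[of _ UNIV] exI[of _ "\<lambda>q. tang q v"]) auto
  qed
  note V0 = this tang_id[OF p v]
  show ?thesis
    unfolding second_fundamental_form_def
  proof (rule the_equality)
    show "\<exists>V. smooth_tangent_field sphere2 V \<and> V p = v \<and> D2 F p v u - sub_proj (tangent_image F p) (D2 F p v u) =
        normal_component sphere2 f p (differential sphere2 (\<lambda>q. differential sphere2 f q (V q)) p u)"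
      by (rule exI[of _ "\<lambda>q. tang q v"]) (simp add: V0 sff[OF V0])
    fix w assume "\<exists>V. smooth_tangent_field sphere2 V \<and> V p = v \<and>
        w = normal_component sphere2 f p (differential sphere2 (\<lambda>q. differential sphere2 f q (V q)) p u)"
    then obtain V where "smooth_tangent_field sphere2 V" "V p = v"
        "w = normal_component sphere2 f p (differential sphere2 (\<lambda>q. differential sphere2 f q (V q)) p u)" by blast
    thus "w = D2 F p v u - sub_proj (tangent_image F p) (D2 F p v u)" using sff by simp
  qed
qed

end

section \<open>The extremal immersion\<close>

lemma D1_along:
  assumes S: "open S" and F: "smooth_on S F" and c: "c s \<in> S"
    and c1: "(c has_vector_derivative c') (at s)" and w1: "(w has_vector_derivative w') (at s)"
  shows "((\<lambda>s. D1 F (c s) (w s)) has_vector_derivative D2 F (c s) (w s) c' + D1 F (c s) w') (at s)"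
proof -
  have ev: "\<forall>\<^sub>F t in at s. c t \<in> S"
    using has_vector_derivative_continuous[OF c1] S c
    unfolding isCont_def by (intro topological_tendstoD) auto
  have "((\<lambda>t. \<Sum>b\<in>Basis. (w t \<bullet> b) *\<^sub>R D1 F (c t) b) has_vector_derivative
      (\<Sum>b\<in>Basis. (w s \<bullet> b) *\<^sub>R D2 F (c s) b c' + (w' \<bullet> b) *\<^sub>R D1 F (c s) b)) (at s)"
  proof (intro has_vector_derivative_sum has_vector_derivative_scaleR)
    fix b :: 'a
    show "((\<lambda>t. w t \<bullet> b) has_field_derivative w' \<bullet> b) (at s)"
      unfolding has_real_derivative_iff_has_vector_derivative
      by (rule bounded_linear.has_vector_derivative[OF bounded_linear_inner_left w1])
    show "((\<lambda>t. D1 F (c t) b) has_vector_derivative D2 F (c s) b c') (at s)"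
      by (rule D1_curve[OF smooth_on_derivative[OF F] c c1])
  qed
  moreover have "(\<Sum>b\<in>Basis. (w s \<bullet> b) *\<^sub>R D2 F (c s) b c') = D2 F (c s) (w s) c'"
  proof -
    note lin = D2_linear1[OF S F c, of c']
    have "D2 F (c s) (w s) c' = D2 F (c s) (\<Sum>b\<in>Basis. (w s \<bullet> b) *\<^sub>R b) c'" by (simp add: euclidean_representation)
    thus ?thesis by (simp only: linear_sum[OF lin] linear_scale[OF lin])
  qed
  moreover have ex: "(\<Sum>b\<in>Basis. (w \<bullet> b) *\<^sub>R D1 F q b) = D1 F q w" if "q \<in> S" for w q
    by (rule frechet_derivative_expand[symmetric, OF smooth_on_differentiable[OF F that]])
  ultimately have "((\<lambda>t. \<Sum>b\<in>Basis. (w t \<bullet> b) *\<^sub>R D1 F (c t) b) has_vector_derivative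
      D2 F (c s) (w s) c' + D1 F (c s) w') (at s)"
    using c by (simp add: sum.distrib)
  thus ?thesis
    unfolding has_vector_derivative_def
    by (rule has_derivative_transform_eventually) (use ev c ex in \<open>auto elim!: eventually_mono\<close>)
qed

text \<open>If a product of great circles has squared speeds \<open>a\<close> and \<open>b\<close>
  in the factors, its image has squared speed \<open>(2/3) (a + 3 b)\<close> and squared
  acceleration \<open>(2/3) (a + 3 b)\<^sup>2\<close>. The squared coefficients 2/3 and 1/3 are
  those with sum 1 for which the quotient of acceleration and squared speed is the same in all
  directions; it equals \<open>sqrt (3/2)\<close>.\<close>

definition extremal :: "'a::euclidean_space \<times> (real ^ 2) \<Rightarrow> ('a \<times> 'a) \<times> (real \<times> real)" where
  "extremal p = (((sqrt (2/3) * (snd p $ 1)) *\<^sub>R fst p, (sqrt (2/3) * (snd p $ 2)) *\<^sub>R fst p),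
     (sqrt (1/3) * ((snd p $ 1)\<^sup>2 - (snd p $ 2)\<^sup>2), sqrt (1/3) * (2 * (snd p $ 1) * (snd p $ 2))))"

lemma norm_vec2: "(norm (z :: real ^ 2))\<^sup>2 = (z $ 1)\<^sup>2 + (z $ 2)\<^sup>2"
  unfolding power2_norm_eq_inner inner_vec_def sum_2 by (simp add: power2_eq_square)

lemma inner_vec2: "(w :: real ^ 2) \<bullet> z = w $ 1 * z $ 1 + w $ 2 * z $ 2"
  by (simp add: inner_vec_def sum_2)

lemma smooth_extremal: "smooth_on UNIV (extremal :: 'a::euclidean_space \<times> (real ^ 2) \<Rightarrow> _)"
proof -
  have nth: "smooth_on UNIV (\<lambda>p::'a \<times> (real ^ 2). snd p $ i)" for i
    by (intro smooth_on_linear open_UNIV bounded_linear_compose[OF bounded_linear_vec_nth bounded_linear_snd])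
  have "smooth_on UNIV (\<lambda>p::'a \<times> (real ^ 2). (((sqrt (2/3) * (snd p $ 1)) *\<^sub>R fst p, (sqrt (2/3) * (snd p $ 2)) *\<^sub>R fst p),
     (sqrt (1/3) * ((snd p $ 1) * (snd p $ 1) + (- 1) * ((snd p $ 2) * (snd p $ 2))), sqrt (1/3) * (2 * (snd p $ 1) * (snd p $ 2)))))"
    by (intro smooth_on_Pair smooth_on_scaleR smooth_on_mult smooth_on_add smooth_on_const open_UNIV nth
        smooth_on_linear bounded_linear_fst)
  thus ?thesis by (simp add: extremal_def[abs_def] power2_eq_square)
qed

lemma norm_sq_Pair: "(norm (a, b))\<^sup>2 = (norm a)\<^sup>2 + (norm b)\<^sup>2"
  by (simp add: norm_Pair)

lemma norm_extremal:
  assumes "p \<in> sphere2"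
  shows "norm (extremal p) = 1"
proof -
  have p: "norm (fst p) = 1" "(snd p $ 1)\<^sup>2 + (snd p $ 2)\<^sup>2 = 1"
    using assms norm_vec2[of "snd p"] by (auto simp: sphere2_iff)
  define a b where "a = snd p $ 1" and "b = snd p $ 2"
  have "(norm (extremal p))\<^sup>2 = (2/3) * (a\<^sup>2 + b\<^sup>2) + (1/3) * (a\<^sup>2 + b\<^sup>2)\<^sup>2"
    unfolding extremal_def norm_sq_Pair using p(1)
    by (simp add: power_mult_distrib power2_abs abs_mult a_def[symmetric] b_def[symmetric])
       (simp add: power2_eq_square field_simps)
  also have "\<dots> = 1" using p(2) by (simp add: a_def b_def)
  finally show ?thesis using power2_eq_imp_eq[of "norm (extremal p)" 1] by simp
qed

lemma extremal_curve:
  fixes X :: "real \<Rightarrow> 'a::euclidean_space" and Z :: "real \<Rightarrow> (real ^ 2)"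
  assumes X: "\<And>s. (X has_vector_derivative X1 s) (at s)" "(X1 has_vector_derivative X2) (at 0)"
    and Z: "\<And>s. (Z has_vector_derivative Z1 s) (at s)" "(Z1 has_vector_derivative Z2) (at 0)"
  defines "R \<equiv> \<lambda>s. ((sqrt (2/3) *\<^sub>R ((Z s $ 1) *\<^sub>R X1 s + (Z1 s $ 1) *\<^sub>R X s), sqrt (2/3) *\<^sub>R ((Z s $ 2) *\<^sub>R X1 s + (Z1 s $ 2) *\<^sub>R X s)),
      (sqrt (1/3) * (2 * (Z s $ 1 * Z1 s $ 1) - 2 * (Z s $ 2 * Z1 s $ 2)), sqrt (1/3) * (2 * (Z s $ 1 * Z1 s $ 2 + Z1 s $ 1 * Z s $ 2))))"
  shows "((\<lambda>s. extremal (X s, Z s)) has_vector_derivative R s) (at s)"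
    and "(R has_vector_derivative
      ((sqrt (2/3) *\<^sub>R ((Z 0 $ 1) *\<^sub>R X2 + (2 * Z1 0 $ 1) *\<^sub>R X1 0 + (Z2 $ 1) *\<^sub>R X 0), sqrt (2/3) *\<^sub>R ((Z 0 $ 2) *\<^sub>R X2 + (2 * Z1 0 $ 2) *\<^sub>R X1 0 + (Z2 $ 2) *\<^sub>R X 0)),
      (sqrt (1/3) * (2 * (Z 0 $ 1 * Z2 $ 1 + Z1 0 $ 1 * Z1 0 $ 1) - 2 * (Z 0 $ 2 * Z2 $ 2 + Z1 0 $ 2 * Z1 0 $ 2)),
       sqrt (1/3) * (2 * (Z 0 $ 1 * Z2 $ 2 + 2 * (Z1 0 $ 1 * Z1 0 $ 2) + Z2 $ 1 * Z 0 $ 2))))) (at 0)"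
proof -
  have nth: "((\<lambda>s. f s $ i) has_vector_derivative v $ i) F" if "(f has_vector_derivative v) F" for f :: "real \<Rightarrow> (real ^ 2)" and v i F
    by (rule bounded_linear.has_vector_derivative[OF bounded_linear_vec_nth that])
  note nth' = nth[unfolded has_real_derivative_iff_has_vector_derivative[symmetric]]
  have [derivative_intros]: "((\<lambda>s. Z s $ i) has_real_derivative (Z1 s $ i)) (at s)" for s i by (rule nth'[OF Z(1)])
  have [derivative_intros]: "((\<lambda>s. Z1 s $ i) has_real_derivative (Z2 $ i)) (at 0)" for i by (rule nth'[OF Z(2)])
  have sm: "((\<lambda>s. c *\<^sub>R h s) has_vector_derivative c *\<^sub>R h') F" if "(h has_vector_derivative h') F" for c h F and h' :: 'a
    by (rule bounded_linear.has_vector_derivative[OF bounded_linear_scaleR_right that])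
  have "((\<lambda>s. ((sqrt (2/3) *\<^sub>R ((Z s $ 1) *\<^sub>R X s), sqrt (2/3) *\<^sub>R ((Z s $ 2) *\<^sub>R X s)),
     (sqrt (1/3) * ((Z s $ 1)\<^sup>2 - (Z s $ 2)\<^sup>2), sqrt (1/3) * (2 * (Z s $ 1 * Z s $ 2))))) has_vector_derivative R s) (at s)"
    unfolding R_def
    by (intro has_vector_derivative_Pair sm has_vector_derivative_scaleR derivative_intros X
        has_real_derivative_iff_has_vector_derivative[THEN iffD1] DERIV_cmult)
       (auto intro!: derivative_eq_intros)
  thus "((\<lambda>s. extremal (X s, Z s)) has_vector_derivative R s) (at s)"
    by (simp add: extremal_def mult.assoc)
  show "(R has_vector_derivative
      ((sqrt (2/3) *\<^sub>R ((Z 0 $ 1) *\<^sub>R X2 + (2 * Z1 0 $ 1) *\<^sub>R X1 0 + (Z2 $ 1) *\<^sub>R X 0), sqrt (2/3) *\<^sub>R ((Z 0 $ 2) *\<^sub>R X2 + (2 * Z1 0 $ 2) *\<^sub>R X1 0 + (Z2 $ 2) *\<^sub>R X 0)),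
      (sqrt (1/3) * (2 * (Z 0 $ 1 * Z2 $ 1 + Z1 0 $ 1 * Z1 0 $ 1) - 2 * (Z 0 $ 2 * Z2 $ 2 + Z1 0 $ 2 * Z1 0 $ 2)),
       sqrt (1/3) * (2 * (Z 0 $ 1 * Z2 $ 2 + 2 * (Z1 0 $ 1 * Z1 0 $ 2) + Z2 $ 1 * Z 0 $ 2))))) (at 0)"
  proof -
    have scl: "((\<lambda>s. (Z s $ i) *\<^sub>R X1 s + (Z1 s $ i) *\<^sub>R X s) has_vector_derivative
         (Z 0 $ i) *\<^sub>R X2 + (2 * Z1 0 $ i) *\<^sub>R X1 0 + (Z2 $ i) *\<^sub>R X 0) (at 0)" for i
    proof -
      have "((\<lambda>s. (Z s $ i) *\<^sub>R X1 s + (Z1 s $ i) *\<^sub>R X s) has_vector_derivative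
         ((Z 0 $ i) *\<^sub>R X2 + (Z1 0 $ i) *\<^sub>R X1 0) + ((Z1 0 $ i) *\<^sub>R X1 0 + (Z2 $ i) *\<^sub>R X 0)) (at 0)"
        by (intro has_vector_derivative_add has_vector_derivative_scaleR derivative_intros X)
      moreover have "((Z 0 $ i) *\<^sub>R X2 + (Z1 0 $ i) *\<^sub>R X1 0) + ((Z1 0 $ i) *\<^sub>R X1 0 + (Z2 $ i) *\<^sub>R X 0) =
         (Z 0 $ i) *\<^sub>R X2 + (2 * Z1 0 $ i) *\<^sub>R X1 0 + (Z2 $ i) *\<^sub>R X 0"
        by (rule euclidean_eqI) (simp add: inner_simps)
      ultimately show ?thesis by simp
    qed
    show ?thesis
      unfolding R_def
      by (intro has_vector_derivative_Pair sm scl)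
         (auto intro!: derivative_eq_intros simp: has_real_derivative_iff_has_vector_derivative[symmetric])
  qed
qed

lemma great_circle:
  fixes x u :: "'a::euclidean_space"
  assumes x: "norm x = 1" and u: "x \<bullet> u = 0"
  obtains X X1 where "\<And>s. (X has_vector_derivative X1 s) (at s)" "(X1 has_vector_derivative (- (norm u)\<^sup>2) *\<^sub>R x) (at (0::real))"
    "X 0 = x" "X1 0 = u" "\<And>s. norm (X s) = 1"
proof -
  define a where "a = norm u"
  \<comment> \<open>For \<open>u = 0\<close> the inverse of 0 is 0, so \<open>w = 0\<close> and the
    curve below is constant.\<close>
  define w where "w = u /\<^sub>R a"
  have uw: "u = a *\<^sub>R w" by (cases "u = 0") (auto simp: w_def a_def)
  define X where "X = (\<lambda>s. cos (a * s) *\<^sub>R x + sin (a * s) *\<^sub>R w)"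
  define X1 where "X1 = (\<lambda>s. (- (a * sin (a * s))) *\<^sub>R x + (a * cos (a * s)) *\<^sub>R w)"
  show thesis
  proof (rule that)
    show "(X has_vector_derivative X1 s) (at s)" for s
      unfolding X_def X1_def by (auto intro!: derivative_eq_intros simp: mult.commute)
    show "(X1 has_vector_derivative (- (norm u)\<^sup>2) *\<^sub>R x) (at 0)"
      unfolding X1_def by (auto intro!: derivative_eq_intros simp: power2_eq_square a_def)
    show "X 0 = x" "X1 0 = u" using uw by (auto simp: X_def X1_def)
    fix s
    show "norm (X s) = 1"
    proof (cases "u = 0")
      case True
      thus ?thesis using x by (simp add: X_def a_def)
    next
      case False
      hence "w \<bullet> w = 1" "x \<bullet> w = 0" using u by (auto simp: w_def a_def power2_norm_eq_inner[symmetric] power2_eq_square)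
      moreover have "x \<bullet> x = 1" using x by (simp add: norm_eq_1)
      ultimately have "X s \<bullet> X s = (cos (a * s))\<^sup>2 + (sin (a * s))\<^sup>2"
        by (simp add: X_def inner_simps inner_commute power2_eq_square)
      thus ?thesis by (simp add: norm_eq_1)
    qed
  qed
qed

section \<open>Curvature of the extremal map in an arbitrary target of sufficient dimension\<close>

context
  fixes J :: "('a::euclidean_space \<times> 'a) \<times> (real \<times> real) \<Rightarrow> 'v::euclidean_space"
  assumes J: "linear J" "\<And>w. norm (J w) = norm w"
begin

definition "extremal_map p = J (extremal p)"

lemma smooth_extremal_map: "smooth_on UNIV extremal_map"
  unfolding extremal_map_def[abs_def]
  by (rule smooth_on_linear_compose[OF open_UNIV linear_conv_bounded_linear[THEN iffD1, OF J(1)] smooth_extremal])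

lemma smooth_map_extremal_map: "smooth_map_on sphere2 extremal_map"
  unfolding smooth_map_on_def local_smooth_extension_def
  using smooth_extremal_map by (intro ballI exI[of _ UNIV] exI[of _ extremal_map]) auto

text \<open>Along a great circle in each factor, the acceleration of the image differs from
  \<open>D2 F p v v\<close> by the tangent vector \<open>D1 F p c2\<close>. Both therefore have the
  same normal part, whose length is at most \<open>|W|\<close>; comparing \<open>|W|\<close> with
  the squared speed is a polynomial identity.\<close>

lemma extremal_map_forms:
  assumes p: "p \<in> sphere2" and v: "v \<in> tangent_space sphere2 p"
  shows "(norm (D1 (hom_ext extremal_map) p v))\<^sup>2 = (2/3) * ((norm (fst v))\<^sup>2 + 3 * (norm (snd v))\<^sup>2)"
    and "norm (second_fundamental_form sphere2 extremal_map p v v) \<le> sqrt (3/2) * (norm (D1 (hom_ext extremal_map) p v))\<^sup>2"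
proof -
  let ?F = "hom_ext extremal_map"
  have p': "p \<in> dom2" using p sphere2_subset by auto
  have F: "smooth_on dom2 ?F" by (rule smooth_hom_ext[OF smooth_map_extremal_map])
  define x z u w where "x = fst p" and "z = snd p" and "u = fst v" and "w = snd v"
  have xz: "norm x = 1" "norm z = 1" "x \<bullet> u = 0" "z \<bullet> w = 0"
    using p v by (auto simp: sphere2_iff tangent_space_sphere2[OF p] x_def z_def u_def w_def)
  obtain X X1 where X: "\<And>s. (X has_vector_derivative X1 s) (at s)" "(X1 has_vector_derivative (- (norm u)\<^sup>2) *\<^sub>R x) (at (0::real))"
    "X 0 = x" "X1 0 = u" "\<And>s. norm (X s) = 1"
    by (rule great_circle[OF xz(1,3)], rule that)
  obtain Z Z1 where Z: "\<And>s. (Z has_vector_derivative Z1 s) (at s)" "(Z1 has_vector_derivative (- (norm w)\<^sup>2) *\<^sub>R z) (at (0::real))"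
    "Z 0 = z" "Z1 0 = w" "\<And>s. norm (Z s) = 1"
    by (rule great_circle[OF xz(2,4)], rule that)
  define c where "c = (\<lambda>s. (X s, Z s))"
  define c1 where "c1 = (\<lambda>s. (X1 s, Z1 s))"
  define c2 where "c2 = ((- (norm u)\<^sup>2) *\<^sub>R x, (- (norm w)\<^sup>2) *\<^sub>R z)"
  have c1: "(c has_vector_derivative c1 s) (at s)" for s
    unfolding c_def c1_def by (intro has_vector_derivative_Pair X Z)
  have c2: "(c1 has_vector_derivative c2) (at 0)"
    unfolding c2_def c1_def by (intro has_vector_derivative_Pair X Z)
  have cs: "c s \<in> sphere2" for s using X(5) Z(5) by (simp add: sphere2_iff c_def)
  have cd: "c s \<in> dom2" for s using cs sphere2_subset by auto
  have c0: "c 0 = p" "c1 0 = v" by (auto simp: c_def c1_def X Z x_def z_def u_def w_def)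
  obtain R W where R: "\<And>s. ((\<lambda>s. extremal (c s)) has_vector_derivative R s) (at s)" "(R has_vector_derivative W) (at 0)"
    and R0: "R 0 = ((sqrt (2/3) *\<^sub>R ((z $ 1) *\<^sub>R u + (w $ 1) *\<^sub>R x), sqrt (2/3) *\<^sub>R ((z $ 2) *\<^sub>R u + (w $ 2) *\<^sub>R x)),
      (sqrt (1/3) * (2 * (z $ 1 * w $ 1) - 2 * (z $ 2 * w $ 2)), sqrt (1/3) * (2 * (z $ 1 * w $ 2 + w $ 1 * z $ 2))))"
    and W: "W = ((sqrt (2/3) *\<^sub>R ((z $ 1) *\<^sub>R ((- (norm u)\<^sup>2) *\<^sub>R x) + (2 * w $ 1) *\<^sub>R u + (((- (norm w)\<^sup>2) *\<^sub>R z) $ 1) *\<^sub>R x),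
        sqrt (2/3) *\<^sub>R ((z $ 2) *\<^sub>R ((- (norm u)\<^sup>2) *\<^sub>R x) + (2 * w $ 2) *\<^sub>R u + (((- (norm w)\<^sup>2) *\<^sub>R z) $ 2) *\<^sub>R x)),
      (sqrt (1/3) * (2 * (z $ 1 * ((- (norm w)\<^sup>2) *\<^sub>R z) $ 1 + w $ 1 * w $ 1) - 2 * (z $ 2 * ((- (norm w)\<^sup>2) *\<^sub>R z) $ 2 + w $ 2 * w $ 2)),
       sqrt (1/3) * (2 * (z $ 1 * ((- (norm w)\<^sup>2) *\<^sub>R z) $ 2 + 2 * (w $ 1 * w $ 2) + ((- (norm w)\<^sup>2) *\<^sub>R z) $ 1 * z $ 2))))"
    by (rule that, unfold c_def, rule extremal_curve(1)[OF X(1,2) Z(1,2)], rule extremal_curve(2)[OF X(1,2) Z(1,2)])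
       (simp_all only: X(3,4) Z(3,4))
  note bl = linear_conv_bounded_linear[THEN iffD1, OF J(1)]
  have DF: "D1 ?F (c s) (c1 s) = J (R s)" for s
  proof (rule vector_derivative_unique_at)
    show "((\<lambda>s. ?F (c s)) has_vector_derivative D1 ?F (c s) (c1 s)) (at s)"
      by (rule D1_curve[OF F cd c1])
    show "((\<lambda>s. ?F (c s)) has_vector_derivative J (R s)) (at s)"
      using bounded_linear.has_vector_derivative[OF bl R(1)] by (simp add: hom_ext_eq[OF cs] extremal_map_def)
  qed
  have "D2 ?F (c 0) (c1 0) (c1 0) + D1 ?F (c 0) c2 = J W"
    by (rule vector_derivative_unique_at[OF D1_along[OF open_dom2 F cd c1 c2]])
       (unfold DF, rule bounded_linear.has_vector_derivative[OF bl R(2)])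
  hence D2F: "D2 ?F p v v = J W - D1 ?F p c2" by (simp add: c0 algebra_simps)
  have sub: "subspace (tangent_image ?F p)" by (rule subspace_tangent_image[OF F p'])
  have "second_fundamental_form sphere2 extremal_map p v v = J W - sub_proj (tangent_image ?F p) (J W)"
    unfolding second_fundamental_form_eq[OF smooth_map_extremal_map p v v] D2F linear_diff[OF sub_proj_linear[OF sub]]
    using sub_proj_id[OF sub, of "D1 ?F p c2"] by (simp add: tangent_image_def)
  hence sff: "norm (second_fundamental_form sphere2 extremal_map p v v) \<le> norm W"
    using orth_proj_compl_norm_le[OF sub_proj_orth_proj[OF sub], of "J W"] J(2)[of W] by simp
  define a b where "a = (norm u)\<^sup>2" and "b = (norm w)\<^sup>2"
  \<comment> \<open>The coordinate of \<open>w\<close> along \<open>z\<close> rotated by a right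
    angle, so that two scalars \<open>a\<close> and \<open>\<beta>\<close> describe the tangent
    vector up to isometry.\<close>
  define \<beta> where "\<beta> = z $ 1 * w $ 2 - z $ 2 * w $ 1"
  have zz: "z $ 1 * z $ 1 + z $ 2 * z $ 2 = 1" using norm_vec2[of z] xz(2) by (simp add: power2_eq_square)
  have zw: "z $ 1 * w $ 1 + z $ 2 * w $ 2 = 0" using xz(4) by (simp add: inner_vec2)
  have w12: "w $ 1 = - \<beta> * z $ 2" "w $ 2 = \<beta> * z $ 1"
    using zz zw unfolding \<beta>_def by algebra+
  have b: "b = \<beta> * \<beta>"
    unfolding b_def norm_vec2 w12 using zz by algebra
  have uu: "u \<bullet> u = a" "x \<bullet> x = 1" "u \<bullet> x = 0" using xz by (auto simp: a_def power2_norm_eq_inner norm_eq_1 inner_commute)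
  have sq: "(sqrt (2/3))\<^sup>2 = 2/3" "(sqrt (1/3))\<^sup>2 = 1/3" by simp_all
  have comb: "(norm (s *\<^sub>R u + t *\<^sub>R x))\<^sup>2 = s * s * a + t * t" for s t :: real
    unfolding power2_norm_eq_inner using uu by (simp add: inner_simps inner_commute)
  have "(norm (R 0))\<^sup>2 = (2/3) * ((z $ 1 * z $ 1 * a + w $ 1 * w $ 1) + (z $ 2 * z $ 2 * a + w $ 2 * w $ 2))
     + (1/3) * ((2 * (z $ 1 * w $ 1) - 2 * (z $ 2 * w $ 2))\<^sup>2 + (2 * (z $ 1 * w $ 2 + w $ 1 * z $ 2))\<^sup>2)"
    unfolding R0 norm_sq_Pair norm_scaleR real_norm_def abs_mult power_mult_distrib power2_abs sq comb by (simp add: algebra_simps)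
  also have "\<dots> = (2/3) * (a + 3 * b)"
    unfolding w12 b using zz by algebra
  finally have nR: "(norm (R 0))\<^sup>2 = (2/3) * (a + 3 * b)" .
  have D1v: "D1 ?F p v = J (R 0)" using DF[of 0] by (simp add: c0)
  show 1: "(norm (D1 ?F p v))\<^sup>2 = (2/3) * ((norm (fst v))\<^sup>2 + 3 * (norm (snd v))\<^sup>2)"
    unfolding D1v J(2) nR by (simp add: a_def b_def u_def w_def)
  have "W = ((sqrt (2/3) *\<^sub>R ((2 * w $ 1) *\<^sub>R u + (- (a + b) * z $ 1) *\<^sub>R x), sqrt (2/3) *\<^sub>R ((2 * w $ 2) *\<^sub>R u + (- (a + b) * z $ 2) *\<^sub>R x)),
      (sqrt (1/3) * (2 * (w $ 1 * w $ 1 - b * z $ 1 * z $ 1) - 2 * (w $ 2 * w $ 2 - b * z $ 2 * z $ 2)),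
       sqrt (1/3) * (4 * (w $ 1 * w $ 2) - 4 * b * z $ 1 * z $ 2)))"
    unfolding W a_def[symmetric] b_def[symmetric] by (simp add: algebra_simps)
  hence "(norm W)\<^sup>2 = (2/3) * ((4 * w $ 1 * w $ 1 * a + ((a + b) * z $ 1)\<^sup>2) + (4 * w $ 2 * w $ 2 * a + ((a + b) * z $ 2)\<^sup>2))
     + (1/3) * ((2 * (w $ 1 * w $ 1 - b * z $ 1 * z $ 1) - 2 * (w $ 2 * w $ 2 - b * z $ 2 * z $ 2))\<^sup>2 + (4 * (w $ 1 * w $ 2) - 4 * b * z $ 1 * z $ 2)\<^sup>2)"
    unfolding norm_sq_Pair norm_scaleR real_norm_def abs_mult power_mult_distrib power2_abs sq comb
    by (simp only: norm_sq_Pair norm_scaleR real_norm_def abs_mult power_mult_distrib power2_abs sq comb) (simp add: power2_eq_square algebra_simps)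
  also have "\<dots> = (2/3) * (a + 3 * b)\<^sup>2"
    unfolding w12 b using zz by algebra
  finally have nW: "(norm W)\<^sup>2 = (2/3) * (a + 3 * b)\<^sup>2" .
  have "(norm W)\<^sup>2 = (sqrt (3/2) * (norm (D1 ?F p v))\<^sup>2)\<^sup>2"
    unfolding nW D1v J(2) nR power_mult_distrib by (simp add: power2_eq_square)
  hence "norm W = sqrt (3/2) * (norm (D1 ?F p v))\<^sup>2"
    by (rule power2_eq_imp_eq) auto
  with sff show "norm (second_fundamental_form sphere2 extremal_map p v v) \<le> sqrt (3/2) * (norm (D1 ?F p v))\<^sup>2" by simp
qed

lemma max_curvature_extremal_map: "max_normal_curvature sphere2 extremal_map \<le> ereal (sqrt (3/2))"
  unfolding max_normal_curvature_def
proof (rule SUP_least, clarify)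
  fix a b c d assume "(a, b) \<in> sphere2" "(c, d) \<in> tangent_space sphere2 (a, b)" "norm (differential sphere2 extremal_map (a, b) (c, d)) = 1"
  thus "ereal (norm (second_fundamental_form sphere2 extremal_map (a, b) (c, d) (c, d))) \<le> ereal (sqrt (3/2))"
    using extremal_map_forms(2)[of "(a, b)" "(c, d)"] differential_sphere2[OF smooth_map_extremal_map, of "(a, b)" "(c, d)"] by simp
qed

lemma immersion_extremal_map: "smooth_immersion_on sphere2 extremal_map"
  unfolding smooth_immersion_on_def
proof (intro conjI ballI smooth_map_extremal_map inj_onI)
  fix p :: "'a \<times> (real ^ 2)" and v w
  assume p: "p \<in> sphere2" and vw: "v \<in> tangent_space sphere2 p" "w \<in> tangent_space sphere2 p"
    and eq: "differential sphere2 extremal_map p v = differential sphere2 extremal_map p w"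
  have lin: "linear (D1 (hom_ext extremal_map) p)"
    by (rule D1_linear[OF smooth_hom_ext[OF smooth_map_extremal_map] subsetD[OF sphere2_subset p]])
  have "v - w \<in> tangent_space sphere2 p"
    using vw by (simp add: tangent_space_sphere2[OF p] inner_diff_right)
  from extremal_map_forms(1)[OF p this] eq
  have "(2/3) * ((norm (fst (v - w)))\<^sup>2 + 3 * (norm (snd (v - w)))\<^sup>2) = 0"
    by (simp add: differential_sphere2[OF smooth_map_extremal_map p] vw linear_diff[OF lin])
  hence "fst (v - w) = 0 \<and> snd (v - w) = 0"
    by (simp add: add_nonneg_eq_0_iff)
  thus "v = w" by (simp add: prod_eq_iff)
qed

lemma extremal_map_in_ball: "extremal_map ` sphere2 \<subseteq> cball 0 1"
proof (rule image_subsetI)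
  fix p :: "'a \<times> (real ^ 2)" assume "p \<in> sphere2"
  thus "extremal_map p \<in> cball 0 1" using norm_extremal[of p] J(2)[of "extremal p"] by (simp add: extremal_map_def)
qed

end

text \<open>The space containing the image of \<open>extremal\<close> has dimension
  \<open>2 * DIM('a) + 2\<close>, which is \<open>2 n + 4\<close> for an n-dimensional sphere; a
  linear isometry carries it into the target.\<close>

lemma minimal_curvature_le:
  assumes "DIM('v::euclidean_space) \<ge> 2 * DIM('a) + 2"
  shows "minimal_curvature TYPE('v) (sphere (0::'a::euclidean_space) 1 \<times> sphere (0::real ^ 2) 1) \<le> ereal (sqrt (3/2))"
proof -
  obtain J :: "('a \<times> 'a) \<times> (real \<times> real) \<Rightarrow> 'v" where J: "linear J" "\<And>w. norm (J w) = norm w"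
    using isometry_subset_subspace[of "UNIV :: (('a \<times> 'a) \<times> (real \<times> real)) set" "UNIV :: 'v set"] assms
    by (auto simp: dim_UNIV)
  have "minimal_curvature TYPE('v) (sphere2 :: ('a \<times> (real ^ 2)) set) \<le> max_normal_curvature sphere2 (extremal_map J)"
    unfolding minimal_curvature_def
    by (rule INF_lower) (use immersion_extremal_map[OF J] extremal_map_in_ball[OF J] in auto)
  also have "\<dots> \<le> ereal (sqrt (3/2))" by (rule max_curvature_extremal_map[OF J])
  finally show ?thesis by (simp add: sphere2_def)
qed

section \<open>Local geometry of an immersion of small curvature\<close>

lemma line_derivative: "((\<lambda>s. p + s *\<^sub>R v) has_vector_derivative v) (at s)"
  by (auto intro!: derivative_eq_intros)

lemma D2_second_difference:
  fixes F :: "'a::euclidean_space \<Rightarrow> 'v::euclidean_space"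
  assumes S: "open S" and F: "smooth_on S F"
    and h: "h > 0" and sub: "\<And>s t. 0 \<le> s \<Longrightarrow> s \<le> h \<Longrightarrow> 0 \<le> t \<Longrightarrow> t \<le> h \<Longrightarrow> p + s *\<^sub>R u + t *\<^sub>R v \<in> S"
  shows "\<exists>s t. 0 \<le> s \<and> s \<le> h \<and> 0 \<le> t \<and> t \<le> h \<and>
    (F (p + h *\<^sub>R u + h *\<^sub>R v) - F (p + h *\<^sub>R u) - F (p + h *\<^sub>R v) + F p) \<bullet> b
       = h * h * (D2 F (p + s *\<^sub>R u + t *\<^sub>R v) u v \<bullet> b)"
proof -
  define \<phi> where "\<phi> = (\<lambda>s. (F (p + s *\<^sub>R u + h *\<^sub>R v) - F (p + s *\<^sub>R u)) \<bullet> b)"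
  define \<phi>' where "\<phi>' = (\<lambda>s. (D1 F (p + s *\<^sub>R u + h *\<^sub>R v) u - D1 F (p + s *\<^sub>R u) u) \<bullet> b)"
  have lin1: "((\<lambda>s. p + s *\<^sub>R u + t *\<^sub>R v) has_vector_derivative u) (at s)" for s t
    by (auto intro!: derivative_eq_intros)
  have lin2: "((\<lambda>t. p + s *\<^sub>R u + t *\<^sub>R v) has_vector_derivative v) (at t)" for s t
    by (auto intro!: derivative_eq_intros)
  have in_S: "p + s *\<^sub>R u \<in> S" if "0 \<le> s" "s \<le> h" for s using sub[of s 0] that h by simp
  have "\<exists>s. 0 < s \<and> s < h \<and> \<phi> h - \<phi> 0 = (h - 0) * \<phi>' s"
  proof (rule MVT2[OF h])
    fix s assume s: "0 \<le> s" "s \<le> h"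
    have 1: "((\<lambda>s. F (p + s *\<^sub>R u + h *\<^sub>R v)) has_vector_derivative D1 F (p + s *\<^sub>R u + h *\<^sub>R v) u) (at s)"
      by (rule D1_curve[OF F _ lin1]) (use s h sub in auto)
    have 2: "((\<lambda>s. F (p + s *\<^sub>R u)) has_vector_derivative D1 F (p + s *\<^sub>R u) u) (at s)"
      by (rule D1_curve[OF F _ line_derivative]) (use s in_S in auto)
    show "DERIV \<phi> s :> \<phi>' s"
      unfolding \<phi>_def \<phi>'_def has_real_derivative_iff_has_vector_derivative
      by (intro bounded_linear.has_vector_derivative[OF bounded_linear_inner_left] has_vector_derivative_diff 1 2)
  qed
  then obtain s where s: "0 < s" "s < h" "\<phi> h - \<phi> 0 = h * \<phi>' s" by auto
  have "\<exists>t. 0 < t \<and> t < h \<and> D1 F (p + s *\<^sub>R u + h *\<^sub>R v) u \<bullet> b - D1 F (p + s *\<^sub>R u + 0 *\<^sub>R v) u \<bullet> b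
      = (h - 0) * (D2 F (p + s *\<^sub>R u + t *\<^sub>R v) u v \<bullet> b)"
  proof (rule MVT2[OF h])
    fix t assume t: "0 \<le> t" "t \<le> h"
    have "((\<lambda>t. D1 F (p + s *\<^sub>R u + t *\<^sub>R v) u) has_vector_derivative D2 F (p + s *\<^sub>R u + t *\<^sub>R v) u v) (at t)"
      by (rule D1_curve[OF smooth_on_derivative[OF F] _ lin2]) (use s t sub in auto)
    thus "DERIV (\<lambda>t. D1 F (p + s *\<^sub>R u + t *\<^sub>R v) u \<bullet> b) t :> D2 F (p + s *\<^sub>R u + t *\<^sub>R v) u v \<bullet> b"
      unfolding has_real_derivative_iff_has_vector_derivative
      by (rule bounded_linear.has_vector_derivative[OF bounded_linear_inner_left])
  qed
  then obtain t where t: "0 < t" "t < h" "\<phi>' s = h * (D2 F (p + s *\<^sub>R u + t *\<^sub>R v) u v \<bullet> b)"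
    by (auto simp: \<phi>'_def inner_diff_left)
  have "(F (p + h *\<^sub>R u + h *\<^sub>R v) - F (p + h *\<^sub>R u) - F (p + h *\<^sub>R v) + F p) \<bullet> b = \<phi> h - \<phi> 0"
    by (simp add: \<phi>_def inner_simps)
  also have "\<dots> = h * h * (D2 F (p + s *\<^sub>R u + t *\<^sub>R v) u v \<bullet> b)" unfolding s(3) t(3) by simp
  finally show ?thesis using s t by (intro exI[of _ s] exI[of _ t]) auto
qed

text \<open>Each mixed derivative, at some point near \<open>p\<close>, equals the same second
  difference divided by \<open>h * h\<close>; continuity of the second derivatives at
  \<open>p\<close> does the rest.\<close>

lemma D2_symmetric:
  fixes F :: "'a::euclidean_space \<Rightarrow> 'v::euclidean_space"
  assumes S: "open S" and F: "smooth_on S F" and p: "p \<in> S"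
  shows "D2 F p u v = D2 F p v u"
proof (rule euclidean_eqI)
  fix b :: 'v assume "b \<in> Basis"
  have "\<bar>D2 F p u v \<bullet> b - D2 F p v u \<bullet> b\<bar> \<le> \<epsilon>" if \<epsilon>: "\<epsilon> > 0" for \<epsilon>
  proof -
    have near: "\<forall>\<^sub>F q in nhds p. \<bar>D2 F q x y \<bullet> b - D2 F p x y \<bullet> b\<bar> < \<epsilon> / 2" for x y
    proof -
      have "isCont (\<lambda>q. D2 F q x y) p"
        using smooth_on_continuous[OF smooth_on_derivative[OF smooth_on_derivative[OF F]]] S p
        by (simp add: continuous_on_eq_continuous_at)
      hence "((\<lambda>q. D2 F q x y \<bullet> b) \<longlongrightarrow> D2 F p x y \<bullet> b) (nhds p)"
        using tendsto_at_iff_tendsto_nhds[of "\<lambda>q. D2 F q x y" p] by (intro tendsto_intros) (simp add: isCont_def)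
      from tendstoD[OF this, of "\<epsilon> / 2"] \<epsilon> show ?thesis by (simp add: dist_real_def)
    qed
    have "\<forall>\<^sub>F q in nhds p. q \<in> S" using S p by (rule eventually_nhds_in_open)
    with near[of u v] near[of v u] have "\<forall>\<^sub>F q in nhds p. q \<in> S \<and> \<bar>D2 F q u v \<bullet> b - D2 F p u v \<bullet> b\<bar> < \<epsilon> / 2 \<and> \<bar>D2 F q v u \<bullet> b - D2 F p v u \<bullet> b\<bar> < \<epsilon> / 2"
      by eventually_elim auto
    then obtain \<delta> where \<delta>: "\<delta> > 0" "\<And>q. dist q p < \<delta> \<Longrightarrow> q \<in> S \<and> \<bar>D2 F q u v \<bullet> b - D2 F p u v \<bullet> b\<bar> < \<epsilon> / 2 \<and> \<bar>D2 F q v u \<bullet> b - D2 F p v u \<bullet> b\<bar> < \<epsilon> / 2"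
      unfolding eventually_nhds_metric by blast
    define h where "h = \<delta> / (2 * (norm u + norm v + 1))"
    have n: "norm u + norm v + 1 > 0" by (simp add: add_nonneg_pos)
    have h: "h > 0" using \<delta>(1) n by (simp add: h_def)
    have close: "dist (p + s *\<^sub>R u + t *\<^sub>R v) p < \<delta>" if "0 \<le> s" "s \<le> h" "0 \<le> t" "t \<le> h" for s t
    proof -
      have "dist (p + s *\<^sub>R u + t *\<^sub>R v) p = norm (s *\<^sub>R u + t *\<^sub>R v)" by (simp add: dist_norm add.assoc)
      also have "\<dots> \<le> s * norm u + t * norm v" using norm_triangle_ineq[of "s *\<^sub>R u" "t *\<^sub>R v"] that by simp
      also have "\<dots> \<le> h * norm u + h * norm v" using that by (intro add_mono mult_right_mono) auto
      also have "\<dots> \<le> h * (norm u + norm v + 1)" using h by (simp add: algebra_simps)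
      also have "\<dots> = \<delta> / 2"
      proof -
        have "\<delta> / (2 * N) * N = \<delta> / 2" if "N > 0" for N :: real using that by simp
        from this[OF n] show ?thesis unfolding h_def .
      qed
      finally show ?thesis using \<delta>(1) by simp
    qed
    obtain s t where st: "0 \<le> s" "s \<le> h" "0 \<le> t" "t \<le> h"
      "(F (p + h *\<^sub>R u + h *\<^sub>R v) - F (p + h *\<^sub>R u) - F (p + h *\<^sub>R v) + F p) \<bullet> b = h * h * (D2 F (p + s *\<^sub>R u + t *\<^sub>R v) u v \<bullet> b)"
      using D2_second_difference[OF S F h, of p u v b] close \<delta>(2) by blast
    have close': "dist (p + t *\<^sub>R v + s *\<^sub>R u) p < \<delta>" if "0 \<le> s" "s \<le> h" "0 \<le> t" "t \<le> h" for s t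
      using close[OF that] by (simp add: ac_simps)
    obtain s' t' where st': "0 \<le> s'" "s' \<le> h" "0 \<le> t'" "t' \<le> h"
      "(F (p + h *\<^sub>R v + h *\<^sub>R u) - F (p + h *\<^sub>R v) - F (p + h *\<^sub>R u) + F p) \<bullet> b = h * h * (D2 F (p + s' *\<^sub>R v + t' *\<^sub>R u) v u \<bullet> b)"
      using D2_second_difference[OF S F h, of p v u b] close' \<delta>(2) by blast
    have "h * h * (D2 F (p + s *\<^sub>R u + t *\<^sub>R v) u v \<bullet> b) = h * h * (D2 F (p + s' *\<^sub>R v + t' *\<^sub>R u) v u \<bullet> b)"
      unfolding st(5)[symmetric] st'(5)[symmetric] by (simp add: inner_simps add.assoc add.commute[of "h *\<^sub>R v"])
    hence "D2 F (p + s *\<^sub>R u + t *\<^sub>R v) u v \<bullet> b = D2 F (p + s' *\<^sub>R v + t' *\<^sub>R u) v u \<bullet> b" using h by simp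
    moreover have "\<bar>D2 F (p + s *\<^sub>R u + t *\<^sub>R v) u v \<bullet> b - D2 F p u v \<bullet> b\<bar> < \<epsilon> / 2"
      using \<delta>(2)[OF close[OF st(1-4)]] by simp
    moreover have "\<bar>D2 F (p + s' *\<^sub>R v + t' *\<^sub>R u) v u \<bullet> b - D2 F p v u \<bullet> b\<bar> < \<epsilon> / 2"
      using \<delta>(2)[OF close'[OF st'(3,4,1,2)]] by simp
    ultimately show ?thesis by linarith
  qed
  hence "\<bar>D2 F p u v \<bullet> b - D2 F p v u \<bullet> b\<bar> \<le> 0" by (rule field_le_epsilon) simp
  thus "D2 F p u v \<bullet> b = D2 F p v u \<bullet> b" by simp
qed

lemma D1_bound:
  fixes G :: "'a::euclidean_space \<Rightarrow> 'v::euclidean_space"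
  assumes G: "smooth_on S G" and K: "compact K" "K \<subseteq> S"
  shows "\<exists>M\<ge>0. \<forall>q\<in>K. \<forall>u. norm (D1 G q u) \<le> M * norm u"
proof -
  have "\<exists>M\<ge>0. \<forall>q\<in>K. norm (D1 G q b) \<le> M" for b
  proof -
    have "continuous_on K (\<lambda>q. D1 G q b)"
      by (rule continuous_on_subset[OF smooth_on_continuous[OF smooth_on_derivative[OF G]] K(2)])
    from compact_imp_bounded[OF compact_continuous_image[OF this K(1)]]
    obtain M where "\<forall>q\<in>K. norm (D1 G q b) \<le> M" unfolding bounded_iff by auto
    thus ?thesis by (intro exI[of _ "max 0 M"]) (auto simp: le_max_iff_disj)
  qed
  then obtain M where M: "\<And>b. M b \<ge> 0" "\<And>b q. q \<in> K \<Longrightarrow> norm (D1 G q b) \<le> M b" by metis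
  show ?thesis
  proof (intro exI[of _ "\<Sum>b\<in>Basis. M b"] conjI ballI allI)
    show "0 \<le> (\<Sum>b\<in>Basis. M b)" by (intro sum_nonneg M)
    fix q u assume q: "q \<in> K"
    have "norm (D1 G q u) = norm (\<Sum>b\<in>Basis. (u \<bullet> b) *\<^sub>R D1 G q b)"
      using frechet_derivative_expand[OF smooth_on_differentiable[OF G]] q K(2) by (metis subsetD)
    also have "\<dots> \<le> (\<Sum>b\<in>Basis. norm u * M b)"
    proof (rule order_trans[OF norm_sum], rule sum_mono)
      fix b :: 'a assume b: "b \<in> Basis"
      show "norm ((u \<bullet> b) *\<^sub>R D1 G q b) \<le> norm u * M b"
        unfolding norm_scaleR by (intro mult_mono M(2)[OF q]) (simp_all add: Basis_le_norm[OF b])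
    qed
    finally show "norm (D1 G q u) \<le> (\<Sum>b\<in>Basis. M b) * norm u" by (simp add: sum_distrib_left mult.commute)
  qed
qed

lemma D2_bound:
  fixes G :: "'a::euclidean_space \<Rightarrow> 'v::euclidean_space"
  assumes S: "open S" and G: "smooth_on S G" and K: "compact K" "K \<subseteq> S"
  shows "\<exists>M\<ge>0. \<forall>q\<in>K. \<forall>u v. norm (D2 G q u v) \<le> M * norm u * norm v"
proof -
  have "\<exists>M\<ge>0. \<forall>q\<in>K. \<forall>v. norm (D2 G q b v) \<le> M * norm v" for b
    by (rule D1_bound[OF smooth_on_derivative[OF G] K])
  then obtain M where M: "\<And>b. M b \<ge> 0" "\<And>b q v. q \<in> K \<Longrightarrow> norm (D2 G q b v) \<le> M b * norm v" by metis
  show ?thesis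
  proof (intro exI[of _ "\<Sum>b\<in>Basis. M b"] conjI ballI allI)
    show "0 \<le> (\<Sum>b\<in>Basis. M b)" by (intro sum_nonneg M)
    fix q u v assume q: "q \<in> K"
    hence qS: "q \<in> S" using K by auto
    note lin = D2_linear1[OF S G qS, of v]
    have "D2 G q u v = D2 G q (\<Sum>b\<in>Basis. (u \<bullet> b) *\<^sub>R b) v" by (simp add: euclidean_representation)
    hence "norm (D2 G q u v) = norm (\<Sum>b\<in>Basis. (u \<bullet> b) *\<^sub>R D2 G q b v)"
      by (simp only: linear_sum[OF lin] linear_scale[OF lin])
    also have "\<dots> \<le> (\<Sum>b\<in>Basis. norm u * (M b * norm v))"
    proof (rule order_trans[OF norm_sum], rule sum_mono)
      fix b :: 'a assume b: "b \<in> Basis"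
      show "norm ((u \<bullet> b) *\<^sub>R D2 G q b v) \<le> norm u * (M b * norm v)"
        unfolding norm_scaleR by (intro mult_mono M(2)[OF q]) (simp_all add: Basis_le_norm[OF b])
    qed
    finally show "norm (D2 G q u v) \<le> (\<Sum>b\<in>Basis. M b) * norm u * norm v"
      by (simp add: sum_distrib_left sum_distrib_right ac_simps)
  qed
qed

lemma D3_bound:
  fixes G :: "'a::euclidean_space \<Rightarrow> 'v::euclidean_space"
  assumes S: "open S" and G: "smooth_on S G" and K: "compact K" "K \<subseteq> S"
  shows "\<exists>M\<ge>0. \<forall>q\<in>K. \<forall>u v w. norm (D2 (\<lambda>r. D1 G r u) q v w) \<le> M * norm u * norm v * norm w"
proof -
  have "\<exists>M\<ge>0. \<forall>q\<in>K. \<forall>v w. norm (D2 (\<lambda>r. D1 G r b) q v w) \<le> M * norm v * norm w" for b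
    by (rule D2_bound[OF S smooth_on_derivative[OF G] K])
  then obtain M where M: "\<And>b. M b \<ge> 0" "\<And>b q v w. q \<in> K \<Longrightarrow> norm (D2 (\<lambda>r. D1 G r b) q v w) \<le> M b * norm v * norm w" by metis
  show ?thesis
  proof (intro exI[of _ "\<Sum>b\<in>Basis. M b"] conjI ballI allI)
    show "0 \<le> (\<Sum>b\<in>Basis. M b)" by (intro sum_nonneg M)
    fix q u v w assume q: "q \<in> K"
    hence qS: "q \<in> S" using K by auto
    have d: "(\<lambda>r. D2 G r b v) differentiable (at q)" for b
      by (rule smooth_on_differentiable[OF smooth_on_derivative[OF smooth_on_derivative[OF G]] qS])
    have "D1 (\<lambda>r. D2 G r u v) q = D1 (\<lambda>r. \<Sum>b\<in>Basis. (u \<bullet> b) *\<^sub>R D2 G r b v) q"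
    proof (rule frechet_derivative_cong_open[OF S qS])
      fix r assume r: "r \<in> S"
      note lin = D2_linear1[OF S G r, of v]
      have "D2 G r u v = D2 G r (\<Sum>b\<in>Basis. (u \<bullet> b) *\<^sub>R b) v" by (simp add: euclidean_representation)
      thus "D2 G r u v = (\<Sum>b\<in>Basis. (u \<bullet> b) *\<^sub>R D2 G r b v)"
        by (simp only: linear_sum[OF lin] linear_scale[OF lin])
    qed
    also have "\<dots> = (\<lambda>w. \<Sum>b\<in>Basis. (u \<bullet> b) *\<^sub>R D1 (\<lambda>r. D2 G r b v) q w)"
      by (rule frechet_derivative_at[symmetric]) (intro has_derivative_sum has_derivative_scaleR_right has_frechet_derivative d)
    finally have "norm (D1 (\<lambda>r. D2 G r u v) q w) = norm (\<Sum>b\<in>Basis. (u \<bullet> b) *\<^sub>R D1 (\<lambda>r. D2 G r b v) q w)" by simp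
    also have "\<dots> \<le> (\<Sum>b\<in>Basis. norm u * (M b * norm v * norm w))"
    proof (rule order_trans[OF norm_sum], rule sum_mono)
      fix b :: 'a assume b: "b \<in> Basis"
      show "norm ((u \<bullet> b) *\<^sub>R D1 (\<lambda>r. D2 G r b v) q w) \<le> norm u * (M b * norm v * norm w)"
        unfolding norm_scaleR by (intro mult_mono M(2)[OF q]) (simp_all add: Basis_le_norm[OF b])
    qed
    finally show "norm (D2 (\<lambda>r. D1 G r u) q v w) \<le> (\<Sum>b\<in>Basis. M b) * norm u * norm v * norm w"
      by (simp add: sum_distrib_left sum_distrib_right ac_simps)
  qed
qed

lemma mean_value_bound:
  fixes g :: "real \<Rightarrow> 'v::euclidean_space"
  assumes "\<And>t. 0 \<le> t \<Longrightarrow> t \<le> 1 \<Longrightarrow> (g has_vector_derivative g' t) (at t)"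
    and "\<And>t. 0 \<le> t \<Longrightarrow> t \<le> 1 \<Longrightarrow> norm (g' t) \<le> B"
  shows "norm (g 1 - g 0) \<le> B"
proof -
  have B: "B \<ge> 0" using assms(2)[of 0] norm_ge_zero[of "g' 0"] by linarith
  have "norm (g 1 - g 0) \<le> B * norm (1 - 0 :: real)"
  proof (rule differentiable_bound[where S = "{0..1}" and f' = "\<lambda>t h. h *\<^sub>R g' t"])
    fix t :: real assume t: "t \<in> {0..1}"
    show "(g has_derivative (\<lambda>h. h *\<^sub>R g' t)) (at t within {0..1})"
      using assms(1)[of t] t by (auto simp: has_vector_derivative_def intro: has_derivative_at_withinI)
    show "onorm (\<lambda>h. h *\<^sub>R g' t) \<le> B"
    proof (rule onorm_bound[OF B])
      fix h :: real
      show "norm (h *\<^sub>R g' t) \<le> B * norm h"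
        using mult_right_mono[OF assms(2)[of t], of "\<bar>h\<bar>"] t by (simp add: mult.commute)
    qed
  qed auto
  thus ?thesis by simp
qed

text \<open>What the lower bound uses of an immersion. The curvature bound is homogeneous of degree
  2 in \<open>u\<close>, so that it applies to all tangent vectors and not just to unit
  ones.\<close>

locale core =
  fixes f :: "'a::euclidean_space \<times> 'b::euclidean_space \<Rightarrow> 'v::euclidean_space" and \<kappa> :: real and F
  assumes F_def: "F = hom_ext f" and F: "smooth_on dom2 F"
    and \<kappa>: "\<kappa> \<ge> 0" "2 * \<kappa>\<^sup>2 < 3"
    and ball: "\<And>p. p \<in> sphere2 \<Longrightarrow> norm (F p) \<le> 1"
    and inj: "\<And>p u. p \<in> sphere2 \<Longrightarrow> u \<in> tangent_space sphere2 p \<Longrightarrow> D1 F p u = 0 \<Longrightarrow> u = 0"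
    and curv: "\<And>p u. p \<in> sphere2 \<Longrightarrow> u \<in> tangent_space sphere2 p \<Longrightarrow>
      norm (D2 F p u u - sub_proj (tangent_image F p) (D2 F p u u)) \<le> \<kappa> * (norm (D1 F p u))\<^sup>2"
begin

abbreviation "Pr p \<equiv> sub_proj (tangent_image F p)"

lemma in_dom2: "p \<in> sphere2 \<Longrightarrow> p \<in> dom2"
  using sphere2_subset by auto

lemma lin1: "p \<in> dom2 \<Longrightarrow> linear (D1 F p)"
  by (rule D1_linear[OF F])

lemma lin2: "p \<in> dom2 \<Longrightarrow> linear (\<lambda>u. D2 F p u v)" "p \<in> dom2 \<Longrightarrow> linear (\<lambda>v. D2 F p u v)"
  by (rule D2_linear1[OF open_dom2 F], assumption) (rule D2_linear2[OF F])

lemma sub: "p \<in> dom2 \<Longrightarrow> subspace (tangent_image F p)"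
  by (rule subspace_tangent_image[OF F])

lemma Pr: "p \<in> dom2 \<Longrightarrow> orth_proj (Pr p)"
  by (rule sub_proj_orth_proj[OF sub])

lemma Pr_D1: "p \<in> dom2 \<Longrightarrow> Pr p (D1 F p u) = D1 F p u"
  by (rule sub_proj_id[OF sub]) (auto simp: tangent_image_def)

lemma F_tang: "p \<in> dom2 \<Longrightarrow> D1 F p (tang p v) = D1 F p v"
  using D1_tang[of f p v] F unfolding F_def by blast

lemma tangent_subspace: "p \<in> sphere2 \<Longrightarrow> subspace (tangent_space sphere2 p)"
  unfolding subspace_def by (auto simp: tangent_space_sphere2 inner_add_right)

text \<open>The tangent vector of the domain whose image is the tangential part of \<open>v\<close>.\<close>

definition "Lf p v = (THE u. u \<in> tangent_space sphere2 p \<and> D1 F p u = Pr p v)"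

lemma Lf_ex1:
  assumes p: "p \<in> sphere2"
  shows "\<exists>!u. u \<in> tangent_space sphere2 p \<and> D1 F p u = Pr p v"
proof (rule ex_ex1I)
  have "Pr p v \<in> tangent_image F p" by (rule sub_proj_in[OF sub[OF in_dom2[OF p]]])
  then obtain u where "Pr p v = D1 F p u" by (auto simp: tangent_image_def)
  thus "\<exists>u. u \<in> tangent_space sphere2 p \<and> D1 F p u = Pr p v"
    using F_tang[OF in_dom2[OF p], of u] tang_in[OF p, of u] by (intro exI[of _ "tang p u"]) auto
next
  fix u w assume u: "u \<in> tangent_space sphere2 p \<and> D1 F p u = Pr p v" and w: "w \<in> tangent_space sphere2 p \<and> D1 F p w = Pr p v"
  have "u - w = 0"
    by (rule inj[OF p]) (use u w in \<open>auto simp: linear_diff[OF lin1[OF in_dom2[OF p]]] intro: subspace_diff[OF tangent_subspace[OF p]]\<close>)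
  thus "u = w" by simp
qed

lemma Lf_tangent: "p \<in> sphere2 \<Longrightarrow> Lf p v \<in> tangent_space sphere2 p"
  and D1_Lf: "p \<in> sphere2 \<Longrightarrow> D1 F p (Lf p v) = Pr p v"
  using theI'[OF Lf_ex1[of p v]] by (auto simp: Lf_def)

lemma Lf_unique: "p \<in> sphere2 \<Longrightarrow> u \<in> tangent_space sphere2 p \<Longrightarrow> D1 F p u = Pr p v \<Longrightarrow> Lf p v = u"
  unfolding Lf_def by (rule the1_equality[OF Lf_ex1]) auto

lemma Lf_linear:
  assumes p: "p \<in> sphere2"
  shows "linear (Lf p)"
proof (rule linearI)
  note PL = orth_proj_linear[OF Pr[OF in_dom2[OF p]]] and L1 = lin1[OF in_dom2[OF p]]
  show "Lf p (x + y) = Lf p x + Lf p y" for x y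
    by (rule Lf_unique[OF p])
       (auto simp: linear_add[OF PL] linear_add[OF L1] D1_Lf[OF p] intro!: subspace_add[OF tangent_subspace[OF p]] Lf_tangent[OF p])
  show "Lf p (c *\<^sub>R x) = c *\<^sub>R Lf p x" for c x
    by (rule Lf_unique[OF p])
       (auto simp: linear_scale[OF PL] linear_scale[OF L1] D1_Lf[OF p] intro!: subspace_scale[OF tangent_subspace[OF p]] Lf_tangent[OF p])
qed

lemma Lf_D1: "p \<in> sphere2 \<Longrightarrow> u \<in> tangent_space sphere2 p \<Longrightarrow> Lf p (D1 F p u) = u"
  by (rule Lf_unique) (auto simp: Pr_D1 in_dom2)

lemma Lf_Pr: "p \<in> sphere2 \<Longrightarrow> Lf p (Pr p v) = Lf p v"
  by (rule Lf_unique) (auto simp: Lf_tangent D1_Lf orth_proj_idem[OF Pr] in_dom2)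

definition "Nr p v = v - Pr p v"

lemma Nr_linear: "p \<in> dom2 \<Longrightarrow> linear (Nr p)"
  unfolding Nr_def by (intro linear_compose_sub linear_ident orth_proj_linear Pr)

definition "Af p v w = Nr p (D2 F p (Lf p v) (Lf p w))"

lemma Af_normal_form:
  assumes p: "p \<in> sphere2"
  shows "normal_form \<kappa> (Pr p) (Af p)"
  unfolding normal_form_def
proof (intro conjI allI)
  note p' = in_dom2[OF p]
  note lins = linear_add[OF Lf_linear[OF p]] linear_scale[OF Lf_linear[OF p]]
    linear_add[OF lin2(1)[OF p']] linear_scale[OF lin2(1)[OF p']] linear_add[OF lin2(2)[OF p']] linear_scale[OF lin2(2)[OF p']]
    linear_add[OF Nr_linear[OF p']] linear_scale[OF Nr_linear[OF p']]
  show "bilinear (Af p)"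
    unfolding bilinear_def Af_def by (intro conjI allI linearI) (simp_all only: lins)
  show "Af p u v = Af p v u" for u v
    unfolding Af_def using D2_symmetric[OF open_dom2 F p'] by simp
  show "Pr p (Af p u v) = 0" for u v
    unfolding Af_def Nr_def
    by (simp add: linear_diff[OF orth_proj_linear[OF Pr[OF p']]] orth_proj_idem[OF Pr[OF p']])
  show "Af p (Pr p u) v = Af p u v" for u v
    unfolding Af_def Lf_Pr[OF p] ..
  show "norm (Af p v v) \<le> \<kappa> * (norm (Pr p v))\<^sup>2" for v
    using curv[OF p Lf_tangent[OF p, of v]] unfolding Af_def Nr_def by (simp only: D1_Lf[OF p])
qed

text \<open>With \<open>\<rho>\<close> the radial field, \<open>D1 F q (\<rho> q) = 0\<close> for
  all \<open>q\<close>. Differentiation in direction \<open>v\<close> gives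
  \<open>D2 F p (\<rho> p) v = - D1 F p (\<rho> v)\<close>, which is tangent to the image.\<close>

lemma Nr_D2_radial:
  assumes p: "p \<in> dom2"
  shows "Nr p (D2 F p (a *\<^sub>R fst p, b *\<^sub>R snd p) v) = 0"
proof -
  define \<rho> where "\<rho> = (\<lambda>q::'a \<times> 'b. (a *\<^sub>R fst q, b *\<^sub>R snd q))"
  have c: "((\<lambda>s. p + s *\<^sub>R v) has_vector_derivative v) (at 0)" by (rule line_derivative)
  have w: "((\<lambda>s. \<rho> (p + s *\<^sub>R v)) has_vector_derivative \<rho> v) (at 0)"
    unfolding \<rho>_def by (auto intro!: derivative_eq_intros simp: prod_eq_iff algebra_simps)
  have d: "((\<lambda>s. D1 F (p + s *\<^sub>R v) (\<rho> (p + s *\<^sub>R v))) has_vector_derivative D2 F p (\<rho> p) v + D1 F p (\<rho> v)) (at 0)"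
    using D1_along[OF open_dom2 F _ c w] p by simp
  have "\<forall>\<^sub>F s in at (0::real). p + s *\<^sub>R v \<in> dom2"
    using has_vector_derivative_continuous[OF c] open_dom2 p
    unfolding isCont_def by (intro topological_tendstoD) auto
  hence ev: "\<forall>\<^sub>F s in at (0::real). D1 F (p + s *\<^sub>R v) (\<rho> (p + s *\<^sub>R v)) = 0"
  proof eventually_elim
    case (elim s)
    thus ?case using D1_hom_ext_radial[of f "p + s *\<^sub>R v" a b] F unfolding F_def \<rho>_def by simp
  qed
  have z: "D1 F (p + 0 *\<^sub>R v) (\<rho> (p + 0 *\<^sub>R v)) = 0"
    using D1_hom_ext_radial[of f p a b] F p unfolding F_def \<rho>_def by simp
  have "((\<lambda>s::real. 0) has_vector_derivative D2 F p (\<rho> p) v + D1 F p (\<rho> v)) (at 0)"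
    using d unfolding has_vector_derivative_def
    by (rule has_derivative_transform_eventually) (use ev z in auto)
  hence "D2 F p (\<rho> p) v + D1 F p (\<rho> v) = 0"
    using vector_derivative_unique_at has_vector_derivative_const by blast
  hence "D2 F p (\<rho> p) v = D1 F p (- \<rho> v)"
    by (simp add: linear_neg[OF lin1[OF p]] eq_neg_iff_add_eq_0)
  hence "Nr p (D2 F p (\<rho> p) v) = 0" unfolding Nr_def by (simp only: Pr_D1[OF p] diff_self)
  thus ?thesis by (simp add: \<rho>_def)
qed

text \<open>The radial component is removed in the first slot, and by symmetry of second derivatives
  also in the second. Arbitrary directions are needed because increments \<open>p' - p\<close>
  between points of the product are not tangent.\<close>

lemma Nr_D2:
  assumes p: "p \<in> sphere2"
  shows "Nr p (D2 F p u v) = Af p (D1 F p u) (D1 F p v)"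
proof -
  note p' = in_dom2[OF p]
  have t: "D1 F p u = D1 F p (tang p u)" for u by (simp add: F_tang[OF p'])
  have dec: "u = tang p u + ((fst p \<bullet> fst u) *\<^sub>R fst p, (snd p \<bullet> snd u) *\<^sub>R snd p)" for u
    by (simp add: tang_def prod_eq_iff)
  have 1: "Nr p (D2 F p u v) = Nr p (D2 F p (tang p u) v)" for u v
    by (subst dec[of u])
       (simp only: linear_add[OF lin2(1)[OF p']] linear_add[OF Nr_linear[OF p']] Nr_D2_radial[OF p'] add_0_right)
  have "Nr p (D2 F p u v) = Nr p (D2 F p (tang p u) v)" by (rule 1)
  also have "\<dots> = Nr p (D2 F p v (tang p u))" using D2_symmetric[OF open_dom2 F p'] by simp
  also have "\<dots> = Nr p (D2 F p (tang p v) (tang p u))" by (rule 1)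
  also have "\<dots> = Nr p (D2 F p (tang p u) (tang p v))" using D2_symmetric[OF open_dom2 F p'] by simp
  also have "\<dots> = Af p (D1 F p u) (D1 F p v)"
    unfolding t[of u] t[of v] Af_def by (simp add: Lf_D1[OF p] tang_in[OF p])
  finally show ?thesis .
qed

section \<open>Constants from compactness, and the tangential part of the position vector\<close>

lemma compact_sphere2: "compact (sphere2 :: ('a \<times> 'b) set)"
  unfolding sphere2_def by (intro compact_Times compact_sphere)

lemma continuous_D1: "continuous_on (dom2 \<times> UNIV) (\<lambda>(p, u). D1 F p u)"
proof -
  have "continuous_on (dom2 \<times> UNIV) (\<lambda>z. \<Sum>b\<in>Basis. (snd z \<bullet> b) *\<^sub>R D1 F (fst z) b)"
  proof (intro continuous_on_sum continuous_intros)
    fix b :: "'a \<times> 'b"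
    show "continuous_on (dom2 \<times> UNIV) (\<lambda>z. D1 F (fst z) b)"
      by (rule continuous_on_compose2[OF smooth_on_continuous[OF smooth_on_derivative[OF F]] continuous_on_fst[OF continuous_on_id]]) auto
  qed
  moreover have "(\<Sum>b\<in>Basis. (snd z \<bullet> b) *\<^sub>R D1 F (fst z) b) = (case z of (p, u) \<Rightarrow> D1 F p u)" if "z \<in> dom2 \<times> UNIV" for z
    using frechet_derivative_expand[OF smooth_on_differentiable[OF F], of "fst z" "snd z"] that by auto
  ultimately show ?thesis by (rule continuous_on_eq)
qed

lemma closed_tangent: "closed {(p, u). p \<in> (sphere2 :: ('a \<times> 'b) set) \<and> u \<in> tangent_space sphere2 p}"
proof -
  have "{(p, u). p \<in> (sphere2 :: ('a \<times> 'b) set) \<and> u \<in> tangent_space sphere2 p} =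
     {z. norm (fst (fst z)) = 1 \<and> norm (snd (fst z)) = 1 \<and> fst (fst z) \<bullet> fst (snd z) = 0 \<and> snd (fst z) \<bullet> snd (snd z) = 0}"
    by (auto simp: tangent_space_sphere2 sphere2_iff)
  thus ?thesis by (simp only:) (intro closed_Collect_conj closed_Collect_eq continuous_intros)
qed

lemma compact_tangent: "compact {(p, u). p \<in> (sphere2 :: ('a \<times> 'b) set) \<and> u \<in> tangent_space sphere2 p \<and> norm u \<le> R}"
proof -
  have eq: "{(p, u). p \<in> (sphere2 :: ('a \<times> 'b) set) \<and> u \<in> tangent_space sphere2 p \<and> norm u \<le> R} =
    {(p, u). p \<in> (sphere2 :: ('a \<times> 'b) set) \<and> u \<in> tangent_space sphere2 p} \<inter> (sphere2 \<times> cball 0 R)"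
    by auto
  show ?thesis unfolding eq
    by (intro closed_Int_compact closed_tangent compact_Times compact_sphere2 compact_cball)
qed

text \<open>The norm of the differential is continuous and, by injectivity, nonzero on the compact
  unit tangent bundle.\<close>

lemma D1_lower: "\<exists>m>0. \<forall>p\<in>sphere2. \<forall>u\<in>tangent_space sphere2 p. m * norm u \<le> norm (D1 F p u)"
proof -
  define T where "T = {(p, u). p \<in> (sphere2 :: ('a \<times> 'b) set) \<and> u \<in> tangent_space sphere2 p \<and> norm u \<le> 1} \<inter> (UNIV \<times> sphere 0 1)"
  have T: "compact T" unfolding T_def by (intro compact_Int_closed compact_tangent closed_Times) auto
  have cont: "continuous_on T (\<lambda>z. norm (D1 F (fst z) (snd z)))"
  proof -
    have "T \<subseteq> dom2 \<times> UNIV"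
    proof
      fix z assume "z \<in> T"
      hence "fst z \<in> sphere2" by (auto simp: T_def)
      thus "z \<in> dom2 \<times> UNIV" by (simp add: mem_Times_iff in_dom2)
    qed
    from continuous_on_subset[OF continuous_D1 this] show ?thesis
      by (intro continuous_on_norm) (simp add: case_prod_beta')
  qed
  show ?thesis
  proof (cases "T = {}")
    case True
    have zero: "u = 0" if "p \<in> sphere2" "u \<in> tangent_space sphere2 p" for p u :: "'a \<times> 'b"
    proof (rule ccontr)
      assume "u \<noteq> 0"
      hence "(p, (1 / norm u) *\<^sub>R u) \<in> T"
        using that subspace_scale[OF tangent_subspace[OF that(1)] that(2)] by (auto simp: T_def)
      thus False using True by simp
    qed
    show ?thesis
    proof (intro exI[of _ 1] conjI ballI)
      fix p u :: "'a \<times> 'b" assume "p \<in> sphere2" "u \<in> tangent_space sphere2 p"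
      from zero[OF this] show "1 * norm u \<le> norm (D1 F p u)" by simp
    qed simp
  next
    case False
    obtain z where z: "z \<in> T" "\<And>w. w \<in> T \<Longrightarrow> norm (D1 F (fst z) (snd z)) \<le> norm (D1 F (fst w) (snd w))"
      using continuous_attains_inf[OF T False cont] by blast
    define m where "m = norm (D1 F (fst z) (snd z))"
    have "m > 0"
    proof -
      have "fst z \<in> sphere2" "snd z \<in> tangent_space sphere2 (fst z)" "norm (snd z) = 1" using z(1) by (auto simp: T_def)
      hence "D1 F (fst z) (snd z) \<noteq> 0" using inj by fastforce
      thus ?thesis by (simp add: m_def)
    qed
    moreover have "m * norm u \<le> norm (D1 F p u)" if p: "p \<in> sphere2" and u: "u \<in> tangent_space sphere2 p" for p u
    proof (cases "u = 0")
      case False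
      have "(p, (1 / norm u) *\<^sub>R u) \<in> T"
        using p u False subspace_scale[OF tangent_subspace[OF p] u] by (auto simp: T_def)
      from z(2)[OF this] have "m \<le> norm ((1 / norm u) *\<^sub>R D1 F p u)"
        by (simp add: m_def linear_scale[OF lin1[OF in_dom2[OF p]]])
      thus ?thesis using False by (simp add: field_simps)
    qed simp
    ultimately show ?thesis by blast
  qed
qed

text \<open>Maximum principle for \<open>|P y|\<^sup>2 + |y|\<^sup>2 / 2\<close>, where \<open>P y\<close> is the tangential part of the position
  vector: at a maximum, moving in the direction of \<open>P y\<close> shows that \<open>P y = 0\<close>. The auxiliary
  variable \<open>u\<close> makes the function smooth without differentiating the projection.\<close>

lemma tangential_part_bound:
  assumes p: "p \<in> sphere2"
  shows "(norm (Pr p (F p)))\<^sup>2 \<le> (1 - (norm (F p))\<^sup>2) / 2"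
proof -
  obtain m where m: "m > 0" "\<And>p u. p \<in> sphere2 \<Longrightarrow> u \<in> tangent_space sphere2 p \<Longrightarrow> m * norm u \<le> norm (D1 F p u)"
    using D1_lower by blast
  \<comment> \<open>For fixed \<open>p\<close> this equals
    \<open>|P y|\<^sup>2 + |y|\<^sup>2 / 2 - |P y - D1 F p u|\<^sup>2\<close>, so maximising over
    \<open>u\<close> produces the function of interest.\<close>
  define \<Theta> where "\<Theta> = (\<lambda>p u. 2 * (F p \<bullet> D1 F p u) - (norm (D1 F p u))\<^sup>2 + (norm (F p))\<^sup>2 / 2)"
  \<comment> \<open>Beyond the radius \<open>2 / m\<close> the vector \<open>D1 F p u\<close> is
    longer than 2, and then \<open>\<Theta>\<close> is below its value at \<open>u = 0\<close>, as
    the image lies in the unit ball. The maximum over this compact set is therefore global.\<close>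
  define T where "T = {(p, u). p \<in> (sphere2 :: ('a \<times> 'b) set) \<and> u \<in> tangent_space sphere2 p \<and> norm u \<le> 2 / m}"
  have T0: "(p, 0) \<in> T" if "p \<in> sphere2" for p
    using that m(1) by (auto simp: T_def subspace_0[OF tangent_subspace])
  have sub: "T \<subseteq> dom2 \<times> UNIV"
  proof
    fix z assume "z \<in> T"
    hence "fst z \<in> sphere2" by (auto simp: T_def)
    thus "z \<in> dom2 \<times> UNIV" by (simp add: mem_Times_iff in_dom2)
  qed
  have D1c: "continuous_on T (\<lambda>z. D1 F (fst z) (snd z))"
    using continuous_on_subset[OF continuous_D1 sub] by (simp add: case_prod_beta')
  have Fc: "continuous_on T (\<lambda>z. F (fst z))"
    by (rule continuous_on_compose2[OF smooth_on_continuous[OF F] continuous_on_fst[OF continuous_on_id]]) (use sub in auto)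
  have "continuous_on T (\<lambda>z. \<Theta> (fst z) (snd z))"
    unfolding \<Theta>_def by (intro continuous_intros D1c Fc) auto
  moreover have "compact T" unfolding T_def by (rule compact_tangent)
  moreover have "T \<noteq> {}" using T0[OF p] by auto
  ultimately obtain z where z: "z \<in> T" "\<And>w. w \<in> T \<Longrightarrow> \<Theta> (fst w) (snd w) \<le> \<Theta> (fst z) (snd z)"
    using continuous_attains_sup[of T "\<lambda>z. \<Theta> (fst z) (snd z)"] by blast
  define p0 u0 where "p0 = fst z" and "u0 = snd z"
  have pu: "p0 \<in> sphere2" "u0 \<in> tangent_space sphere2 p0" using z(1) by (auto simp: T_def p0_def u0_def)
  note p0 = in_dom2[OF pu(1)]
  have max: "\<Theta> q u \<le> \<Theta> p0 u0" if q: "q \<in> sphere2" for q u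
  proof -
    define w where "w = tang q u"
    have w: "w \<in> tangent_space sphere2 q" "\<Theta> q u = \<Theta> q w"
      using tang_in[OF q] by (simp_all add: w_def \<Theta>_def F_tang[OF in_dom2[OF q]])
    show ?thesis
    proof (cases "norm w \<le> 2 / m")
      case True
      hence "(q, w) \<in> T" using q w by (simp add: T_def)
      from z(2)[OF this] w(2) show ?thesis by (simp add: p0_def u0_def)
    next
      case False
      define n where "n = norm (D1 F q w)"
      have "2 < m * norm w" using False m(1) by (simp add: field_simps)
      hence n: "2 < n" using m(2)[OF q w(1)] by (simp add: n_def)
      have "F q \<bullet> D1 F q w \<le> norm (F q) * n" unfolding n_def by (rule norm_cauchy_schwarz)
      also have "\<dots> \<le> 1 * n" using ball[OF q] n by (intro mult_right_mono) auto
      finally have "2 * (F q \<bullet> D1 F q w) \<le> 2 * n" by simp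
      also have "\<dots> \<le> n * n" using n by (intro mult_right_mono) auto
      finally have "\<Theta> q w \<le> \<Theta> q 0"
        by (simp add: \<Theta>_def n_def power2_eq_square linear_0[OF lin1[OF in_dom2[OF q]]])
      moreover have "\<Theta> q 0 \<le> \<Theta> p0 u0" using z(2)[OF T0[OF q]] by (simp add: p0_def u0_def)
      ultimately show ?thesis using w(2) by simp
    qed
  qed
  have \<Theta>_Lf: "\<Theta> q (Lf q (F q)) = (norm (Pr q (F q)))\<^sup>2 + (norm (F q))\<^sup>2 / 2" if q: "q \<in> sphere2" for q
    unfolding \<Theta>_def D1_Lf[OF q] using orth_proj_norm_sq[OF Pr[OF in_dom2[OF q]], of "F q"] by (simp add: inner_commute)
  have Pu0: "D1 F p0 u0 = Pr p0 (F p0)"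
  proof -
    have "F p0 \<bullet> D1 F p0 u0 = Pr p0 (F p0) \<bullet> D1 F p0 u0"
      using orth_proj_self_adjoint[OF Pr[OF p0], of "F p0" "D1 F p0 u0"] Pr_D1[OF p0] by simp
    hence "\<Theta> p0 u0 = (norm (Pr p0 (F p0)))\<^sup>2 - (norm (Pr p0 (F p0) - D1 F p0 u0))\<^sup>2 + (norm (F p0))\<^sup>2 / 2"
      unfolding \<Theta>_def power2_norm_eq_inner by (simp add: inner_simps inner_commute)
    moreover have "\<Theta> p0 (Lf p0 (F p0)) \<le> \<Theta> p0 u0" by (rule max[OF pu(1)])
    ultimately have "(norm (Pr p0 (F p0) - D1 F p0 u0))\<^sup>2 \<le> 0" using \<Theta>_Lf[OF pu(1)] by simp
    thus ?thesis by simp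
  qed
  define P0 where "P0 = Pr p0 (F p0)"
  \<comment> \<open>The point moves along a curve with velocity \<open>u0\<close> while the second
    argument stays the fixed ambient vector \<open>u0\<close>. It need not remain tangent, since
    \<open>max\<close> holds for all vectors.\<close>
  have stationary: "2 * (P0 \<bullet> P0) + 2 * (F p0 \<bullet> D2 F p0 u0 u0) - 2 * (P0 \<bullet> D2 F p0 u0 u0) + F p0 \<bullet> P0 = 0"
  proof -
    obtain \<gamma> e where g: "e > 0" "\<gamma> ` {-e<..<e} \<subseteq> sphere2" "\<gamma> 0 = p0" "(\<gamma> has_vector_derivative u0) (at (0::real))"
      using pu(2) by (auto simp: tangent_space_def)
    have d1: "((\<lambda>s. F (\<gamma> s)) has_vector_derivative P0) (at 0)"
      using D1_curve[OF F _ g(4)] g(3) p0 Pu0 by (simp add: P0_def)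
    have d2: "((\<lambda>s. D1 F (\<gamma> s) u0) has_vector_derivative D2 F p0 u0 u0) (at 0)"
      using D1_curve[OF smooth_on_derivative[OF F] _ g(4)] g(3) p0 by simp
    have inner_d: "((\<lambda>s. a s \<bullet> b s) has_real_derivative (a 0 \<bullet> b' + a' \<bullet> b 0)) (at 0)"
      if "(a has_vector_derivative a') (at 0)" "(b has_vector_derivative b') (at (0::real))" for a b :: "real \<Rightarrow> 'v" and a' b'
      using bounded_bilinear.has_vector_derivative[OF bounded_bilinear_inner that]
      by (simp add: has_real_derivative_iff_has_vector_derivative)
    have "((\<lambda>s. 2 * (F (\<gamma> s) \<bullet> D1 F (\<gamma> s) u0) - D1 F (\<gamma> s) u0 \<bullet> D1 F (\<gamma> s) u0 + (F (\<gamma> s) \<bullet> F (\<gamma> s)) / 2) has_real_derivative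
        2 * (F (\<gamma> 0) \<bullet> D2 F p0 u0 u0 + P0 \<bullet> D1 F (\<gamma> 0) u0) - (D1 F (\<gamma> 0) u0 \<bullet> D2 F p0 u0 u0 + D2 F p0 u0 u0 \<bullet> D1 F (\<gamma> 0) u0)
        + (F (\<gamma> 0) \<bullet> P0 + P0 \<bullet> F (\<gamma> 0)) / 2) (at 0)"
      by (intro DERIV_add DERIV_diff DERIV_cmult DERIV_cdivide inner_d d1 d2)
    hence "((\<lambda>s. \<Theta> (\<gamma> s) u0) has_real_derivative
        2 * (F p0 \<bullet> D2 F p0 u0 u0 + P0 \<bullet> P0) - (P0 \<bullet> D2 F p0 u0 u0 + D2 F p0 u0 u0 \<bullet> P0)
        + (F p0 \<bullet> P0 + P0 \<bullet> F p0) / 2) (at 0)"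
      by (simp add: \<Theta>_def g(3) Pu0 P0_def power2_norm_eq_inner)
    moreover have "\<forall>s. \<bar>0 - s\<bar> < e \<longrightarrow> \<Theta> (\<gamma> s) u0 \<le> \<Theta> (\<gamma> 0) u0"
    proof (intro allI impI)
      fix s assume "\<bar>0 - s\<bar> < e"
      hence "s \<in> {-e<..<e}" by auto
      hence "\<gamma> s \<in> sphere2" using g(2) by blast
      thus "\<Theta> (\<gamma> s) u0 \<le> \<Theta> (\<gamma> 0) u0" unfolding g(3) by (rule max)
    qed
    ultimately have "2 * (F p0 \<bullet> D2 F p0 u0 u0 + P0 \<bullet> P0) - (P0 \<bullet> D2 F p0 u0 u0 + D2 F p0 u0 u0 \<bullet> P0)
        + (F p0 \<bullet> P0 + P0 \<bullet> F p0) / 2 = 0"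
      using DERIV_local_max g(1) by blast
    thus ?thesis by (simp add: inner_commute algebra_simps)
  qed
  have FP: "F p0 \<bullet> P0 = P0 \<bullet> P0"
    using orth_proj_norm_sq[OF Pr[OF p0], of "F p0"] by (simp add: P0_def inner_commute power2_norm_eq_inner)
  define NF where "NF = F p0 - P0"
  \<comment> \<open>Stationarity reads
    \<open>3 |P0|\<^sup>2 = - 2 NF \<bullet> D2 F p0 u0 u0\<close>. Only the normal part of the
    second derivative counts, so the right side is at most \<open>2 \<kappa> |P0|\<^sup>2\<close>,
    and \<open>\<kappa> < 3/2\<close>.\<close>
  have "P0 = 0"
  proof -
    let ?N = "D2 F p0 u0 u0 - Pr p0 (D2 F p0 u0 u0)"
    have "NF \<bullet> D2 F p0 u0 u0 = NF \<bullet> ?N"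
      using orth_proj_inner_compl[OF Pr[OF p0], of "D2 F p0 u0 u0" "F p0"] by (simp add: NF_def P0_def inner_diff_right inner_commute)
    moreover have "- (NF \<bullet> ?N) \<le> norm NF * norm ?N"
      using norm_cauchy_schwarz[of "- NF" ?N] by simp
    moreover have "norm NF * norm ?N \<le> 1 * (\<kappa> * (norm P0)\<^sup>2)"
    proof (intro mult_mono)
      show "norm NF \<le> 1"
        using orth_proj_compl_norm_le[OF Pr[OF p0], of "F p0"] ball[OF pu(1)] by (simp add: NF_def P0_def)
      show "norm ?N \<le> \<kappa> * (norm P0)\<^sup>2" using curv[OF pu] by (simp add: Pu0 P0_def)
    qed auto
    moreover have "3 * (P0 \<bullet> P0) + 2 * (NF \<bullet> D2 F p0 u0 u0) = 0"
      using stationary FP by (simp add: NF_def inner_diff_left)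
    ultimately have "3 * (norm P0)\<^sup>2 \<le> 2 * (\<kappa> * (norm P0)\<^sup>2)" unfolding power2_norm_eq_inner by linarith
    hence "(3 - 2 * \<kappa>) * (norm P0)\<^sup>2 \<le> 0" by (simp add: algebra_simps)
    moreover have "3 - 2 * \<kappa> > 0"
    proof (rule ccontr)
      assume "\<not> 3 - 2 * \<kappa> > 0"
      hence "(3/2) * (3/2) \<le> \<kappa> * \<kappa>" by (intro mult_mono) auto
      thus False using \<kappa>(2) by (simp add: power2_eq_square)
    qed
    ultimately have "(norm P0)\<^sup>2 \<le> 0" by (simp add: mult_le_0_iff)
    thus ?thesis by simp
  qed
  hence "\<Theta> p0 u0 = (norm (F p0))\<^sup>2 / 2" using Pu0 by (simp add: \<Theta>_def P0_def)
  also have "\<dots> \<le> 1 / 2" using ball[OF pu(1)] by (simp add: power_le_one)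
  finally have "\<Theta> p (Lf p (F p)) \<le> 1 / 2" using max[OF p] order_trans by blast
  thus ?thesis using \<Theta>_Lf[OF p] by (simp add: field_simps)
qed

lemma taylor:
  obtains M where "M > 0"
    "\<And>p u. p \<in> sphere2 \<Longrightarrow> norm (D1 F p u) \<le> M * norm u"
    "\<And>p \<delta> u. p \<in> sphere2 \<Longrightarrow> norm \<delta> \<le> 1/2 \<Longrightarrow> norm (D1 F (p + \<delta>) u - D1 F p u) \<le> M * norm u * norm \<delta>"
    "\<And>p \<delta> u. p \<in> sphere2 \<Longrightarrow> norm \<delta> \<le> 1/2 \<Longrightarrow> norm (D1 F (p + \<delta>) u - D1 F p u - D2 F p u \<delta>) \<le> M * norm u * (norm \<delta>)\<^sup>2"
    "\<And>p \<delta>. p \<in> sphere2 \<Longrightarrow> norm \<delta> \<le> 1/2 \<Longrightarrow> norm (F (p + \<delta>) - F p) \<le> M * norm \<delta>"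
    "\<And>p \<delta>. p \<in> sphere2 \<Longrightarrow> norm \<delta> \<le> 1/2 \<Longrightarrow> norm (F (p + \<delta>) - F p - D1 F p \<delta>) \<le> M * (norm \<delta>)\<^sup>2"
    "\<And>p \<delta>. p \<in> sphere2 \<Longrightarrow> norm \<delta> \<le> 1/2 \<Longrightarrow> norm (F (p + \<delta>) - F p - D1 F p \<delta> - (1/2) *\<^sub>R D2 F p \<delta> \<delta>) \<le> M * norm \<delta> ^ 3"
proof -
  \<comment> \<open>Compact, inside \<open>dom2\<close>, and containing every segment of length at
    most 1/2 that starts in the product of spheres.\<close>
  define K where "K = {p :: 'a \<times> 'b. 1/2 \<le> norm (fst p) \<and> norm (fst p) \<le> 2 \<and> 1/2 \<le> norm (snd p) \<and> norm (snd p) \<le> 2}"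
  have K: "compact K"
  proof -
    have "closed K" unfolding K_def by (intro closed_Collect_conj closed_Collect_le continuous_intros)
    moreover have "K \<subseteq> cball 0 2 \<times> cball 0 2" by (auto simp: K_def)
    ultimately show ?thesis by (metis compact_Int_closed compact_Times compact_cball inf.absorb_iff2 inf_commute)
  qed
  have KS: "K \<subseteq> dom2" by (auto simp: K_def dom2_def)
  obtain M1 where M1: "M1 \<ge> 0" "\<And>q u. q \<in> K \<Longrightarrow> norm (D1 F q u) \<le> M1 * norm u"
    using D1_bound[OF F K KS] by metis
  obtain M2 where M2: "M2 \<ge> 0" "\<And>q u v. q \<in> K \<Longrightarrow> norm (D2 F q u v) \<le> M2 * norm u * norm v"
    using D2_bound[OF open_dom2 F K KS] by metis
  obtain M3 where M3: "M3 \<ge> 0" "\<And>q u v w. q \<in> K \<Longrightarrow> norm (D2 (\<lambda>r. D1 F r u) q v w) \<le> M3 * norm u * norm v * norm w"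
    using D3_bound[OF open_dom2 F K KS] by metis
  define M where "M = M1 + M2 + M3 + 1"
  have M: "M > 0" "M1 \<le> M" "M2 \<le> M" "M3 \<le> M" using M1 M2 M3 by (auto simp: M_def)
  have seg: "p + t *\<^sub>R \<delta> \<in> K" if p: "p \<in> sphere2" and d: "norm \<delta> \<le> 1/2" and t: "0 \<le> t" "t \<le> 1" for p \<delta> t
  proof -
    have "t * norm \<delta> \<le> 1 * (1/2)" using d t by (intro mult_mono) auto
    moreover have "norm (fst \<delta>) \<le> norm \<delta>" "norm (snd \<delta>) \<le> norm \<delta>"
      using norm_fst_le[of "fst \<delta>" "snd \<delta>"] norm_snd_le[of "snd \<delta>" "fst \<delta>"] by simp_all
    ultimately have "norm (t *\<^sub>R fst \<delta>) \<le> 1/2" "norm (t *\<^sub>R snd \<delta>) \<le> 1/2"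
      using t mult_left_mono[of "norm (fst \<delta>)" "norm \<delta>" t] mult_left_mono[of "norm (snd \<delta>)" "norm \<delta>" t] by auto
    moreover have "\<bar>norm (fst p + t *\<^sub>R fst \<delta>) - norm (fst p)\<bar> \<le> norm (t *\<^sub>R fst \<delta>)"
      "\<bar>norm (snd p + t *\<^sub>R snd \<delta>) - norm (snd p)\<bar> \<le> norm (t *\<^sub>R snd \<delta>)"
      by (metis add_diff_cancel_left' norm_triangle_ineq3)+
    moreover have "norm (fst p) = 1" "norm (snd p) = 1" using p by (auto simp: sphere2_iff)
    ultimately show ?thesis
      unfolding K_def mem_Collect_eq fst_add snd_add fst_scaleR snd_scaleR by (intro conjI) linarith+
  qed
  have segS: "p + t *\<^sub>R \<delta> \<in> dom2" if "p \<in> sphere2" "norm \<delta> \<le> 1/2" "0 \<le> t" "t \<le> 1" for p \<delta> :: "'a \<times> 'b" and t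
    using seg[OF that] KS by blast
  have T0: "norm (D1 F (p + \<delta>) u - D1 F p u) \<le> M * norm u * norm \<delta>" if p: "p \<in> sphere2" and d: "norm \<delta> \<le> 1/2" for p \<delta> u
  proof -
    have "norm (D1 F (p + 1 *\<^sub>R \<delta>) u - D1 F (p + 0 *\<^sub>R \<delta>) u) \<le> M * norm u * norm \<delta>"
    proof (rule mean_value_bound)
      fix t :: real assume t: "0 \<le> t" "t \<le> 1"
      show "((\<lambda>t. D1 F (p + t *\<^sub>R \<delta>) u) has_vector_derivative D2 F (p + t *\<^sub>R \<delta>) u \<delta>) (at t)"
        by (rule D1_curve[OF smooth_on_derivative[OF F] segS[OF p d t] line_derivative])
      show "norm (D2 F (p + t *\<^sub>R \<delta>) u \<delta>) \<le> M * norm u * norm \<delta>"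
        by (rule order_trans[OF M2(2)[OF seg[OF p d t]]]) (intro mult_right_mono M(3) norm_ge_zero)
    qed
    thus ?thesis by simp
  qed
  have T0': "norm (D2 F (p + \<delta>) u v - D2 F p u v) \<le> M * norm u * norm v * norm \<delta>" if p: "p \<in> sphere2" and d: "norm \<delta> \<le> 1/2" for p \<delta> u v
  proof -
    have "norm (D2 F (p + 1 *\<^sub>R \<delta>) u v - D2 F (p + 0 *\<^sub>R \<delta>) u v) \<le> M * norm u * norm v * norm \<delta>"
    proof (rule mean_value_bound)
      fix t :: real assume t: "0 \<le> t" "t \<le> 1"
      show "((\<lambda>t. D2 F (p + t *\<^sub>R \<delta>) u v) has_vector_derivative D2 (\<lambda>r. D1 F r u) (p + t *\<^sub>R \<delta>) v \<delta>) (at t)"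
        by (rule D1_curve[OF smooth_on_derivative[OF smooth_on_derivative[OF F]] segS[OF p d t] line_derivative])
      show "norm (D2 (\<lambda>r. D1 F r u) (p + t *\<^sub>R \<delta>) v \<delta>) \<le> M * norm u * norm v * norm \<delta>"
        by (rule order_trans[OF M3(2)[OF seg[OF p d t]]]) (intro mult_right_mono M(4) norm_ge_zero)
    qed
    thus ?thesis by simp
  qed
  have small: "norm (t *\<^sub>R \<delta>) \<le> 1/2" "norm (t *\<^sub>R \<delta>) \<le> norm \<delta>" if d: "norm \<delta> \<le> 1/2" and t: "0 \<le> t" "t \<le> 1" for t and \<delta> :: "'a \<times> 'b"
  proof -
    show "norm (t *\<^sub>R \<delta>) \<le> norm \<delta>" using t mult_right_mono[of t 1 "norm \<delta>"] by simp
    thus "norm (t *\<^sub>R \<delta>) \<le> 1/2" using d by linarith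
  qed
  have T1: "norm (D1 F (p + \<delta>) u - D1 F p u - D2 F p u \<delta>) \<le> M * norm u * (norm \<delta>)\<^sup>2" if p: "p \<in> sphere2" and d: "norm \<delta> \<le> 1/2" for p \<delta> u
  proof -
    have "norm ((D1 F (p + 1 *\<^sub>R \<delta>) u - 1 *\<^sub>R D2 F p u \<delta>) - (D1 F (p + 0 *\<^sub>R \<delta>) u - 0 *\<^sub>R D2 F p u \<delta>)) \<le> M * norm u * (norm \<delta>)\<^sup>2"
    proof (rule mean_value_bound)
      fix t :: real assume t: "0 \<le> t" "t \<le> 1"
      have "((\<lambda>t. D1 F (p + t *\<^sub>R \<delta>) u) has_vector_derivative D2 F (p + t *\<^sub>R \<delta>) u \<delta>) (at t)"
        by (rule D1_curve[OF smooth_on_derivative[OF F] segS[OF p d t] line_derivative])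
      thus "((\<lambda>t. D1 F (p + t *\<^sub>R \<delta>) u - t *\<^sub>R D2 F p u \<delta>) has_vector_derivative D2 F (p + t *\<^sub>R \<delta>) u \<delta> - D2 F p u \<delta>) (at t)"
        by (auto intro!: derivative_eq_intros)
      have "norm (D2 F (p + t *\<^sub>R \<delta>) u \<delta> - D2 F p u \<delta>) \<le> M * norm u * norm \<delta> * norm (t *\<^sub>R \<delta>)"
        by (rule T0'[OF p small(1)[OF d t]])
      also have "\<dots> \<le> M * norm u * norm \<delta> * norm \<delta>"
        using M(1) by (intro mult_left_mono small(2)[OF d t]) auto
      finally show "norm (D2 F (p + t *\<^sub>R \<delta>) u \<delta> - D2 F p u \<delta>) \<le> M * norm u * (norm \<delta>)\<^sup>2"
        by (simp add: power2_eq_square mult.assoc)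
    qed
    thus ?thesis by (simp add: algebra_simps)
  qed
  show thesis
  proof (rule that[OF M(1)])
    fix p :: "'a \<times> 'b" assume p: "p \<in> sphere2"
    have pK: "p \<in> K" using seg[OF p, of 0 0] by simp
    show "norm (D1 F p u) \<le> M * norm u" for u
      by (rule order_trans[OF M1(2)[OF pK]]) (intro mult_right_mono M(2) norm_ge_zero)
    fix \<delta> :: "'a \<times> 'b" assume d: "norm \<delta> \<le> 1/2"
    show "norm (D1 F (p + \<delta>) u - D1 F p u) \<le> M * norm u * norm \<delta>" for u by (rule T0[OF p d])
    show "norm (D1 F (p + \<delta>) u - D1 F p u - D2 F p u \<delta>) \<le> M * norm u * (norm \<delta>)\<^sup>2" for u by (rule T1[OF p d])
    have Fd: "((\<lambda>t. F (p + t *\<^sub>R \<delta>)) has_vector_derivative D1 F (p + t *\<^sub>R \<delta>) \<delta>) (at t)" if "0 \<le> t" "t \<le> 1" for t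
      by (rule D1_curve[OF F segS[OF p d that] line_derivative])
    have "norm (F (p + 1 *\<^sub>R \<delta>) - F (p + 0 *\<^sub>R \<delta>)) \<le> M * norm \<delta>"
      by (rule mean_value_bound[OF Fd])
         (auto intro!: order_trans[OF M1(2)[OF seg[OF p d]]] mult_right_mono M(2))
    thus "norm (F (p + \<delta>) - F p) \<le> M * norm \<delta>" by simp
    have "norm ((F (p + 1 *\<^sub>R \<delta>) - 1 *\<^sub>R D1 F p \<delta>) - (F (p + 0 *\<^sub>R \<delta>) - 0 *\<^sub>R D1 F p \<delta>)) \<le> M * (norm \<delta>)\<^sup>2"
    proof (rule mean_value_bound)
      fix t :: real assume t: "0 \<le> t" "t \<le> 1"
      show "((\<lambda>t. F (p + t *\<^sub>R \<delta>) - t *\<^sub>R D1 F p \<delta>) has_vector_derivative D1 F (p + t *\<^sub>R \<delta>) \<delta> - D1 F p \<delta>) (at t)"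
        using Fd[OF t] by (auto intro!: derivative_eq_intros)
      have "norm (D1 F (p + t *\<^sub>R \<delta>) \<delta> - D1 F p \<delta>) \<le> M * norm \<delta> * norm (t *\<^sub>R \<delta>)"
        by (rule T0[OF p small(1)[OF d t]])
      also have "\<dots> \<le> M * norm \<delta> * norm \<delta>"
        using M(1) by (intro mult_left_mono small(2)[OF d t]) auto
      finally show "norm (D1 F (p + t *\<^sub>R \<delta>) \<delta> - D1 F p \<delta>) \<le> M * (norm \<delta>)\<^sup>2"
        by (simp add: power2_eq_square mult.assoc)
    qed
    thus "norm (F (p + \<delta>) - F p - D1 F p \<delta>) \<le> M * (norm \<delta>)\<^sup>2" by (simp add: algebra_simps)
    have "norm ((F (p + 1 *\<^sub>R \<delta>) - 1 *\<^sub>R D1 F p \<delta> - (1\<^sup>2 / 2) *\<^sub>R D2 F p \<delta> \<delta>) - (F (p + 0 *\<^sub>R \<delta>) - 0 *\<^sub>R D1 F p \<delta> - (0\<^sup>2 / 2) *\<^sub>R D2 F p \<delta> \<delta>)) \<le> M * norm \<delta> ^ 3"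
    proof (rule mean_value_bound)
      fix t :: real assume t: "0 \<le> t" "t \<le> 1"
      show "((\<lambda>t. F (p + t *\<^sub>R \<delta>) - t *\<^sub>R D1 F p \<delta> - (t\<^sup>2 / 2) *\<^sub>R D2 F p \<delta> \<delta>) has_vector_derivative D1 F (p + t *\<^sub>R \<delta>) \<delta> - D1 F p \<delta> - t *\<^sub>R D2 F p \<delta> \<delta>) (at t)"
        using Fd[OF t] by (auto intro!: derivative_eq_intros)
      have "norm (D1 F (p + t *\<^sub>R \<delta>) \<delta> - D1 F p \<delta> - D2 F p \<delta> (t *\<^sub>R \<delta>)) \<le> M * norm \<delta> * (norm (t *\<^sub>R \<delta>))\<^sup>2"
        by (rule T1[OF p small(1)[OF d t]])
      also have "\<dots> \<le> M * norm \<delta> * (norm \<delta>)\<^sup>2"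
        using M(1) by (intro mult_left_mono power_mono small(2)[OF d t]) auto
      finally show "norm (D1 F (p + t *\<^sub>R \<delta>) \<delta> - D1 F p \<delta> - t *\<^sub>R D2 F p \<delta> \<delta>) \<le> M * norm \<delta> ^ 3"
        by (simp add: power2_eq_square power3_eq_cube mult.assoc linear_scale[OF lin2(2)[OF in_dom2[OF p]]])
    qed
    thus "norm (F (p + \<delta>) - F p - D1 F p \<delta> - (1/2) *\<^sub>R D2 F p \<delta> \<delta>) \<le> M * norm \<delta> ^ 3" by (simp add: algebra_simps)
  qed
qed

text \<open>For unit vectors the radial part of a chord is
  \<open>x \<bullet> (x' - x) = - |x' - x|\<^sup>2 / 2\<close>, hence quadratically small.\<close>

lemma radial_small:
  fixes p p' :: "'a \<times> 'b"
  assumes p: "p \<in> sphere2" and p': "p' \<in> sphere2"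
  shows "norm (p' - p) - (norm (p' - p))\<^sup>2 \<le> norm (tang p (p' - p))"
proof -
  have half: "x \<bullet> (x' - x) = - (norm (x' - x))\<^sup>2 / 2" if "norm x = 1" "norm x' = 1" for x x' :: "'c::euclidean_space"
  proof -
    have "x \<bullet> x = 1" "x' \<bullet> x' = 1" using that by (auto simp: norm_eq_1)
    thus ?thesis unfolding power2_norm_eq_inner by (simp add: inner_simps inner_commute field_simps)
  qed
  define \<delta> where "\<delta> = p' - p"
  have pp: "norm (fst p) = 1" "norm (snd p) = 1" "norm (fst p') = 1" "norm (snd p') = 1"
    using p p' by (auto simp: sphere2_iff)
  define \<rho> where "\<rho> = ((fst p \<bullet> fst \<delta>) *\<^sub>R fst p, (snd p \<bullet> snd \<delta>) *\<^sub>R snd p)"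
  have "norm \<rho> \<le> norm ((fst p \<bullet> fst \<delta>) *\<^sub>R fst p) + norm ((snd p \<bullet> snd \<delta>) *\<^sub>R snd p)"
    unfolding \<rho>_def by (rule norm_Pair_le)
  also have "\<dots> = (norm (fst \<delta>))\<^sup>2 / 2 + (norm (snd \<delta>))\<^sup>2 / 2"
    using half[OF pp(1,3)] half[OF pp(2,4)] pp by (simp add: \<delta>_def)
  also have "\<dots> = (norm \<delta>)\<^sup>2 / 2" by (simp add: norm_prod_def)
  finally have 1: "norm \<rho> \<le> (norm \<delta>)\<^sup>2 / 2" .
  have "norm \<delta> = norm (tang p \<delta> + \<rho>)" by (simp add: tang_def \<rho>_def)
  also have "\<dots> \<le> norm (tang p \<delta>) + norm \<rho>" by (rule norm_triangle_ineq)
  finally show ?thesis using 1 zero_le_power2[of "norm \<delta>"] unfolding \<delta>_def by linarith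
qed

text \<open>Taylor expansion bounds the errors by powers of \<open>|p' - p|\<close>; the lower bound
  with \<open>m\<close> converts them into powers of the chord length \<open>|F p' - F p|\<close>,
  the only quantity visible to the chain argument. Normal parts of second derivatives become
  \<open>Af\<close> of the chord by \<open>Nr_D2\<close>.\<close>

lemma local_geometry:
  obtains \<epsilon> m C where "\<epsilon> > 0" "m > 0" "C > 0"
    "\<And>p p'. p \<in> sphere2 \<Longrightarrow> p' \<in> sphere2 \<Longrightarrow> norm (p' - p) \<le> \<epsilon> \<Longrightarrow> m * norm (p' - p) \<le> norm (F p' - F p)"
    "\<And>p p'. p \<in> sphere2 \<Longrightarrow> p' \<in> sphere2 \<Longrightarrow> norm (p' - p) \<le> \<epsilon> \<Longrightarrow> norm (F p' - F p) \<le> C * norm (p' - p)"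
    "\<And>p p'. p \<in> sphere2 \<Longrightarrow> p' \<in> sphere2 \<Longrightarrow> norm (p' - p) \<le> \<epsilon> \<Longrightarrow>
       norm (F p' - F p - Pr p (F p' - F p) - (1/2) *\<^sub>R Af p (F p' - F p) (F p' - F p)) \<le> C * norm (F p' - F p) ^ 3"
    "\<And>p p' v. p \<in> sphere2 \<Longrightarrow> p' \<in> sphere2 \<Longrightarrow> norm (p' - p) \<le> \<epsilon> \<Longrightarrow> Pr p' v = v \<Longrightarrow>
       norm (v - Pr p v - Af p (F p' - F p) v) \<le> C * (norm (F p' - F p))\<^sup>2 * norm v"
proof -
  obtain M where M: "M > 0"
    and b1: "\<And>p u. p \<in> sphere2 \<Longrightarrow> norm (D1 F p u) \<le> M * norm u"
    and t0: "\<And>p \<delta> u. p \<in> sphere2 \<Longrightarrow> norm \<delta> \<le> 1/2 \<Longrightarrow> norm (D1 F (p + \<delta>) u - D1 F p u) \<le> M * norm u * norm \<delta>"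
    and t1: "\<And>p \<delta> u. p \<in> sphere2 \<Longrightarrow> norm \<delta> \<le> 1/2 \<Longrightarrow> norm (D1 F (p + \<delta>) u - D1 F p u - D2 F p u \<delta>) \<le> M * norm u * (norm \<delta>)\<^sup>2"
    and f0: "\<And>p \<delta>. p \<in> sphere2 \<Longrightarrow> norm \<delta> \<le> 1/2 \<Longrightarrow> norm (F (p + \<delta>) - F p) \<le> M * norm \<delta>"
    and f1: "\<And>p \<delta>. p \<in> sphere2 \<Longrightarrow> norm \<delta> \<le> 1/2 \<Longrightarrow> norm (F (p + \<delta>) - F p - D1 F p \<delta>) \<le> M * (norm \<delta>)\<^sup>2"
    and f2: "\<And>p \<delta>. p \<in> sphere2 \<Longrightarrow> norm \<delta> \<le> 1/2 \<Longrightarrow> norm (F (p + \<delta>) - F p - D1 F p \<delta> - (1/2) *\<^sub>R D2 F p \<delta> \<delta>) \<le> M * norm \<delta> ^ 3"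
    by (rule taylor, rule that)
  obtain m0 where m0: "m0 > 0" "\<And>p u. p \<in> sphere2 \<Longrightarrow> u \<in> tangent_space sphere2 p \<Longrightarrow> m0 * norm u \<le> norm (D1 F p u)"
    using D1_lower by blast
  \<comment> \<open>Small enough that the radial loss and the Taylor remainder, together at most
    \<open>(m0 + M) |\<delta>|\<^sup>2\<close>, use up no more than half of
    \<open>m0 |\<delta>|\<close>.\<close>
  define \<epsilon> where "\<epsilon> = min (1/2) (m0 / (2 * (m0 + M)))"
  define m where "m = m0 / 2"
  have e: "\<epsilon> > 0" "\<epsilon> \<le> 1/2" "\<epsilon> * (m0 + M) \<le> m0 / 2"
  proof -
    show "\<epsilon> > 0" "\<epsilon> \<le> 1/2" using m0(1) M by (auto simp: \<epsilon>_def)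
    have "\<epsilon> * (m0 + M) \<le> m0 / (2 * (m0 + M)) * (m0 + M)"
      using m0(1) M by (intro mult_right_mono) (auto simp: \<epsilon>_def)
    also have "\<dots> = m0 / 2" using m0(1) M by (simp add: field_simps add_pos_pos)
    finally show "\<epsilon> * (m0 + M) \<le> m0 / 2" .
  qed
  have m: "m > 0" using m0 by (simp add: m_def)
  have lower: "m * norm (p' - p) \<le> norm (F p' - F p)" if p: "p \<in> sphere2" and p': "p' \<in> sphere2" and d: "norm (p' - p) \<le> \<epsilon>" for p p'
  proof -
    define \<delta> where "\<delta> = p' - p"
    have d': "norm \<delta> \<le> 1/2" "norm \<delta> \<le> \<epsilon>" using d e by (auto simp: \<delta>_def)
    have "m0 * (norm \<delta> - (norm \<delta>)\<^sup>2) \<le> m0 * norm (tang p \<delta>)"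
      using radial_small[OF p p'] m0(1) by (intro mult_left_mono) (auto simp: \<delta>_def)
    also have "\<dots> \<le> norm (D1 F p \<delta>)"
      using m0(2)[OF p tang_in[OF p, of \<delta>]] F_tang[OF in_dom2[OF p]] by simp
    also have "\<dots> \<le> norm (F (p + \<delta>) - F p) + norm (F (p + \<delta>) - F p - D1 F p \<delta>)"
      using norm_triangle_ineq4[of "F (p + \<delta>) - F p" "F (p + \<delta>) - F p - D1 F p \<delta>"] by simp
    also have "\<dots> \<le> norm (F (p + \<delta>) - F p) + M * (norm \<delta>)\<^sup>2" using f1[OF p d'(1)] by simp
    finally have "m0 * norm \<delta> - (norm \<delta> * (m0 + M)) * norm \<delta> \<le> norm (F (p + \<delta>) - F p)"
      by (simp add: algebra_simps power2_eq_square)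
    moreover have "(norm \<delta> * (m0 + M)) * norm \<delta> \<le> (m0 / 2) * norm \<delta>"
    proof (rule mult_right_mono)
      have "norm \<delta> * (m0 + M) \<le> \<epsilon> * (m0 + M)" using d' m0 M by (intro mult_right_mono) auto
      thus "norm \<delta> * (m0 + M) \<le> m0 / 2" using e(3) by linarith
    qed simp
    ultimately show ?thesis by (simp add: m_def \<delta>_def)
  qed
  define C1 where "C1 = \<kappa> * M * (2 * M) + M"
  define C where "C = M + (C1 + M) / m ^ 3 + (M / m0 + \<kappa> * M + \<kappa> * M * (M / m0)) / m\<^sup>2"
  have C1: "C1 > 0" using M \<kappa>(1) by (simp add: C1_def add_nonneg_pos)
  have C3: "0 \<le> M / m0 + \<kappa> * M + \<kappa> * M * (M / m0)" using M m0 \<kappa>(1) by simp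
  have C: "C > 0" "M \<le> C" "(C1 + M) / m ^ 3 \<le> C" "(M / m0 + \<kappa> * M + \<kappa> * M * (M / m0)) / m\<^sup>2 \<le> C"
  proof -
    have "0 \<le> (C1 + M) / m ^ 3" "0 \<le> (M / m0 + \<kappa> * M + \<kappa> * M * (M / m0)) / m\<^sup>2"
      using M C1 C3 m by auto
    thus "C > 0" "M \<le> C" "(C1 + M) / m ^ 3 \<le> C" "(M / m0 + \<kappa> * M + \<kappa> * M * (M / m0)) / m\<^sup>2 \<le> C"
      using M by (auto simp: C_def)
  qed
  show thesis
  proof (rule that[OF e(1) m C(1) lower])
    fix p p' :: "'a \<times> 'b" assume p: "p \<in> sphere2" and p': "p' \<in> sphere2" and d: "norm (p' - p) \<le> \<epsilon>"
    define \<delta> where "\<delta> = p' - p"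
    have p'_eq: "p' = p + \<delta>" by (simp add: \<delta>_def)
    have d': "norm \<delta> \<le> 1/2" using d e by (auto simp: \<delta>_def)
    define \<Delta> where "\<Delta> = F p' - F p"
    have low: "m * norm \<delta> \<le> norm \<Delta>" using lower[OF p p' d] by (simp add: \<delta>_def \<Delta>_def)
    have \<Delta>: "norm \<Delta> \<le> M * norm \<delta>" using f0[OF p d'] by (simp add: \<Delta>_def p'_eq)
    note P = Pr[OF in_dom2[OF p]] and A = Af_normal_form[OF p]
    note As = normal_form_simps[OF A P \<kappa>(1)]
    note Ale = normal_form_norm_le[OF A P \<kappa>(1)]
    note Nl = Nr_linear[OF in_dom2[OF p]]
    have Nle: "norm (Nr p w) \<le> norm w" for w
      unfolding Nr_def by (rule orth_proj_compl_norm_le[OF P])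
    have ND1: "Nr p (D1 F p u) = 0" for u by (simp add: Nr_def Pr_D1[OF in_dom2[OF p]])
    define e1 where "e1 = \<Delta> - D1 F p \<delta>"
    have e1: "norm e1 \<le> M * (norm \<delta>)\<^sup>2" using f1[OF p d'] by (simp add: e1_def \<Delta>_def p'_eq)
    show "norm (F p' - F p) \<le> C * norm (p' - p)"
      using \<Delta> mult_right_mono[OF C(2), of "norm \<delta>"] by (simp add: \<Delta>_def \<delta>_def)
    have "norm (\<Delta> - Pr p \<Delta> - (1/2) *\<^sub>R Af p \<Delta> \<Delta>) \<le> C * norm \<Delta> ^ 3"
    proof -
      define R where "R = \<Delta> - D1 F p \<delta> - (1/2) *\<^sub>R D2 F p \<delta> \<delta>"
      have R: "norm R \<le> M * norm \<delta> ^ 3" using f2[OF p d'] by (simp add: R_def \<Delta>_def p'_eq)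
      have "Nr p \<Delta> = Nr p (D1 F p \<delta> + (1/2) *\<^sub>R D2 F p \<delta> \<delta> + R)" by (simp add: R_def)
      also have "\<dots> = (1/2) *\<^sub>R Af p (D1 F p \<delta>) (D1 F p \<delta>) + Nr p R"
        by (simp only: linear_add[OF Nl] linear_scale[OF Nl] ND1 Nr_D2[OF p]) simp
      finally have "\<Delta> - Pr p \<Delta> - (1/2) *\<^sub>R Af p \<Delta> \<Delta> = (1/2) *\<^sub>R (Af p (D1 F p \<delta>) (D1 F p \<delta>) - Af p \<Delta> \<Delta>) + Nr p R"
        unfolding Nr_def by (simp add: algebra_simps)
      also have "Af p (D1 F p \<delta>) (D1 F p \<delta>) - Af p \<Delta> \<Delta> = - (Af p e1 (D1 F p \<delta>) + Af p \<Delta> e1)"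
        unfolding e1_def As by simp
      finally have eq: "\<Delta> - Pr p \<Delta> - (1/2) *\<^sub>R Af p \<Delta> \<Delta> = (1/2) *\<^sub>R (- (Af p e1 (D1 F p \<delta>) + Af p \<Delta> e1)) + Nr p R" .
      have "norm (\<Delta> - Pr p \<Delta> - (1/2) *\<^sub>R Af p \<Delta> \<Delta>) \<le> (1/2) * norm (Af p e1 (D1 F p \<delta>) + Af p \<Delta> e1) + norm (Nr p R)"
      proof -
        have "norm ((1/2) *\<^sub>R (- X) + Y) \<le> (1/2) * norm X + norm Y" for X Y :: 'v
          by (rule order_trans[OF norm_triangle_ineq]) simp
        thus ?thesis unfolding eq .
      qed
      also have "norm (Nr p R) \<le> M * norm \<delta> ^ 3" using Nle R order_trans by blast
      also have "norm (Af p e1 (D1 F p \<delta>) + Af p \<Delta> e1) \<le> \<kappa> * norm e1 * norm (D1 F p \<delta>) + \<kappa> * norm \<Delta> * norm e1"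
        by (rule norm_triangle_le) (intro add_mono Ale)
      also have "\<dots> \<le> \<kappa> * (M * (norm \<delta>)\<^sup>2) * (M * norm \<delta>) + \<kappa> * (M * norm \<delta>) * (M * (norm \<delta>)\<^sup>2)"
        using \<kappa>(1) M by (intro add_mono mult_mono e1 b1[OF p] \<Delta> mult_nonneg_nonneg) auto
      also have "\<dots> = \<kappa> * M * (2 * M) * norm \<delta> ^ 3" by (simp add: power2_eq_square power3_eq_cube)
      finally have "norm (\<Delta> - Pr p \<Delta> - (1/2) *\<^sub>R Af p \<Delta> \<Delta>) \<le> (1/2) * (\<kappa> * M * (2 * M) * norm \<delta> ^ 3) + M * norm \<delta> ^ 3" by simp
      also have "\<dots> \<le> (C1 + M) * norm \<delta> ^ 3"
      proof -
        have "0 \<le> \<kappa> * M * (2 * M) * norm \<delta> ^ 3" "0 \<le> M * norm \<delta> ^ 3" using \<kappa>(1) M by auto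
        moreover have "(C1 + M) * norm \<delta> ^ 3 = \<kappa> * M * (2 * M) * norm \<delta> ^ 3 + M * norm \<delta> ^ 3 + M * norm \<delta> ^ 3"
          by (simp add: C1_def algebra_simps)
        ultimately show ?thesis by linarith
      qed
      also have "\<dots> = (C1 + M) / m ^ 3 * (m * norm \<delta>) ^ 3" using m by (simp add: power_mult_distrib)
      also have "\<dots> \<le> C * norm \<Delta> ^ 3"
        using C C1 M m low by (intro mult_mono power_mono) auto
      finally show ?thesis .
    qed
    thus "norm (F p' - F p - Pr p (F p' - F p) - (1/2) *\<^sub>R Af p (F p' - F p) (F p' - F p)) \<le> C * norm (F p' - F p) ^ 3"
      by (simp add: \<Delta>_def)
    fix v assume v: "Pr p' v = v"
    define \<eta> where "\<eta> = Lf p' v"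
    have \<eta>: "D1 F p' \<eta> = v" unfolding \<eta>_def D1_Lf[OF p'] by (rule v)
    have "m0 * norm \<eta> \<le> norm v" using m0(2)[OF p' Lf_tangent[OF p', of v]] \<eta> by (simp add: \<eta>_def)
    hence \<eta>_le: "norm \<eta> \<le> norm v / m0" using m0(1) by (simp add: field_simps)
    have "norm (v - Pr p v - Af p \<Delta> v) \<le> C * (norm \<Delta>)\<^sup>2 * norm v"
    proof -
      define R where "R = v - D1 F p \<eta> - D2 F p \<eta> \<delta>"
      have R: "norm R \<le> M * norm \<eta> * (norm \<delta>)\<^sup>2" using t1[OF p d', of \<eta>] \<eta> by (simp add: R_def p'_eq)
      define w where "w = v - D1 F p \<eta>"
      have w: "norm w \<le> M * norm \<eta> * norm \<delta>" using t0[OF p d', of \<eta>] \<eta> by (simp add: w_def p'_eq)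
      have "Nr p v = Nr p (D1 F p \<eta> + D2 F p \<eta> \<delta> + R)" by (simp add: R_def)
      also have "\<dots> = Af p (D1 F p \<eta>) (D1 F p \<delta>) + Nr p R"
        by (simp only: linear_add[OF Nl] ND1 Nr_D2[OF p]) simp
      finally have "v - Pr p v - Af p \<Delta> v = Af p (D1 F p \<delta>) (D1 F p \<eta>) - Af p \<Delta> v + Nr p R"
        unfolding Nr_def normal_form_sym[OF A P \<kappa>(1), of "D1 F p \<eta>"] by simp
      also have "Af p (D1 F p \<delta>) (D1 F p \<eta>) - Af p \<Delta> v = - (Af p e1 v + Af p (D1 F p \<delta>) w)"
        unfolding e1_def w_def As by simp
      finally have eq: "v - Pr p v - Af p \<Delta> v = - (Af p e1 v + Af p (D1 F p \<delta>) w) + Nr p R" .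
      have "norm (v - Pr p v - Af p \<Delta> v) \<le> norm (Af p e1 v + Af p (D1 F p \<delta>) w) + norm (Nr p R)"
        unfolding eq by (rule order_trans[OF norm_triangle_ineq]) (simp only: norm_minus_cancel)
      also have "norm (Nr p R) \<le> M * norm \<eta> * (norm \<delta>)\<^sup>2" using Nle R order_trans by blast
      also have "norm (Af p e1 v + Af p (D1 F p \<delta>) w) \<le> \<kappa> * norm e1 * norm v + \<kappa> * norm (D1 F p \<delta>) * norm w"
        by (rule norm_triangle_le) (intro add_mono Ale)
      also have "\<dots> \<le> \<kappa> * (M * (norm \<delta>)\<^sup>2) * norm v + \<kappa> * (M * norm \<delta>) * (M * norm \<eta> * norm \<delta>)"
        using \<kappa>(1) M by (intro add_mono mult_mono e1 b1[OF p] w mult_nonneg_nonneg) auto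
      also have "\<dots> \<le> \<kappa> * (M * (norm \<delta>)\<^sup>2) * norm v + \<kappa> * (M * norm \<delta>) * (M * (norm v / m0) * norm \<delta>)"
        using \<kappa>(1) M by (intro add_mono mult_left_mono mult_right_mono \<eta>_le mult_nonneg_nonneg) auto
      also have "M * norm \<eta> * (norm \<delta>)\<^sup>2 \<le> M * (norm v / m0) * (norm \<delta>)\<^sup>2"
        using M by (intro mult_left_mono mult_right_mono \<eta>_le) auto
      finally have "norm (v - Pr p v - Af p \<Delta> v) \<le> (M / m0 + \<kappa> * M + \<kappa> * M * (M / m0)) * (norm \<delta>)\<^sup>2 * norm v"
        by (simp add: power2_eq_square algebra_simps)
      also have "\<dots> = (M / m0 + \<kappa> * M + \<kappa> * M * (M / m0)) / m\<^sup>2 * (m * norm \<delta>)\<^sup>2 * norm v"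
        using m by (simp add: power_mult_distrib)
      also have "\<dots> \<le> C * (norm \<Delta>)\<^sup>2 * norm v"
        using C C3 M m low by (intro mult_right_mono mult_mono power_mono) auto
      finally show ?thesis .
    qed
    thus "norm (v - Pr p v - Af p (F p' - F p) v) \<le> C * (norm (F p' - F p))\<^sup>2 * norm v" by (simp add: \<Delta>_def)
  qed
qed

end

section \<open>Minimising chains\<close>

lemma second_derivative_test:
  fixes h :: "real \<Rightarrow> real"
  assumes e: "e > 0" and h1: "\<And>s. \<bar>s\<bar> < e \<Longrightarrow> (h has_real_derivative h1 s) (at s)"
    and h2: "(h1 has_real_derivative d) (at 0)" and min: "\<And>s. \<bar>s\<bar> < e \<Longrightarrow> h 0 \<le> h s"
  shows "h1 0 = 0" "d \<ge> 0"
proof -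
  show z: "h1 0 = 0"
    by (rule DERIV_local_min[OF h1 e]) (use e min in auto)
  show "d \<ge> 0"
  proof (rule ccontr)
    assume "\<not> d \<ge> 0"
    then obtain r where r: "r > 0" "\<And>t. 0 < t \<Longrightarrow> t < r \<Longrightarrow> h1 (0 + t) < h1 0"
      using DERIV_neg_dec_right[OF h2] by auto
    define s where "s = min e r / 2"
    have s: "0 < s" "s < e" "s < r" using e r by (auto simp: s_def)
    have "\<exists>t. 0 < t \<and> t < s \<and> h s - h 0 = (s - 0) * h1 t"
      by (rule MVT2[OF s(1)]) (use s h1 in auto)
    then obtain t where t: "0 < t" "t < s" "h s - h 0 = s * h1 t" by auto
    have "h1 t < 0" using r(2)[of t] t s z by simp
    hence "s * h1 t < 0" using s by (simp add: mult_pos_neg)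
    thus False using min[of s] s t by simp
  qed
qed

section \<open>First and second variation of the discrete energy\<close>

definition edge_energy :: "'v::euclidean_space \<Rightarrow> 'v \<Rightarrow> real" where
  "edge_energy y z = conf_weight y z * (norm (z - y))\<^sup>2"

text \<open>The first variation of \<open>edge_energy\<close> when the ends move with velocities
  \<open>V\<close> and \<open>W\<close>.\<close>

definition edge_linear :: "'v::euclidean_space \<Rightarrow> 'v \<Rightarrow> 'v \<Rightarrow> 'v \<Rightarrow> real" where
  "edge_linear y z V W = conf_weight y z * (2 * ((z - y) \<bullet> (W - V)) - 3 * (y \<bullet> V + z \<bullet> W) * (norm (z - y))\<^sup>2)"

lemma inner_has_real_derivative:
  fixes a b :: "real \<Rightarrow> 'v::euclidean_space"
  assumes "(a has_vector_derivative a') (at s)" "(b has_vector_derivative b') (at s)"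
  shows "((\<lambda>s. a s \<bullet> b s) has_real_derivative (a s \<bullet> b' + a' \<bullet> b s)) (at s)"
  using bounded_bilinear.has_vector_derivative[OF bounded_bilinear_inner assms]
  by (simp add: has_real_derivative_iff_has_vector_derivative)

lemma edge_energy_derivative:
  fixes Y Z :: "real \<Rightarrow> 'v::euclidean_space"
  assumes "(Y has_vector_derivative Y1) (at s)" "(Z has_vector_derivative Z1) (at s)"
  shows "((\<lambda>s. edge_energy (Y s) (Z s)) has_real_derivative edge_linear (Y s) (Z s) Y1 Z1) (at s)"
proof -
  note d = inner_has_real_derivative[OF assms(1) assms(1)] inner_has_real_derivative[OF assms(2) assms(2)]
    inner_has_real_derivative[OF has_vector_derivative_diff[OF assms(2,1)] has_vector_derivative_diff[OF assms(2,1)]]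
  have "((\<lambda>s. exp (- (3/2) * (Y s \<bullet> Y s + Z s \<bullet> Z s)) * ((Z s - Y s) \<bullet> (Z s - Y s))) has_real_derivative
      exp (- (3/2) * (Y s \<bullet> Y s + Z s \<bullet> Z s)) * (- (3/2) * ((Y s \<bullet> Y1 + Y1 \<bullet> Y s) + (Z s \<bullet> Z1 + Z1 \<bullet> Z s))) * ((Z s - Y s) \<bullet> (Z s - Y s))
      + ((Z s - Y s) \<bullet> (Z1 - Y1) + (Z1 - Y1) \<bullet> (Z s - Y s)) * exp (- (3/2) * (Y s \<bullet> Y s + Z s \<bullet> Z s))) (at s)"
    by (intro DERIV_mult DERIV_fun_exp DERIV_cmult DERIV_add d)
  moreover have "exp (- (3/2) * (Y s \<bullet> Y s + Z s \<bullet> Z s)) * (- (3/2) * ((Y s \<bullet> Y1 + Y1 \<bullet> Y s) + (Z s \<bullet> Z1 + Z1 \<bullet> Z s))) * ((Z s - Y s) \<bullet> (Z s - Y s))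
      + ((Z s - Y s) \<bullet> (Z1 - Y1) + (Z1 - Y1) \<bullet> (Z s - Y s)) * exp (- (3/2) * (Y s \<bullet> Y s + Z s \<bullet> Z s)) = edge_linear (Y s) (Z s) Y1 Z1"
    unfolding edge_linear_def conf_weight_def power2_norm_eq_inner inner_commute[of Y1] inner_commute[of Z1] inner_commute[of "Z1 - Y1"]
    by (simp add: algebra_simps)
  ultimately show ?thesis by (simp add: edge_energy_def conf_weight_def power2_norm_eq_inner)
qed

lemma edge_linear_derivative:
  fixes Y Z :: "real \<Rightarrow> 'v::euclidean_space"
  assumes Y: "(Y has_vector_derivative Y1 s) (at s)" "(Y1 has_vector_derivative Y2) (at s)"
    and Z: "(Z has_vector_derivative Z1 s) (at s)" "(Z1 has_vector_derivative Z2) (at s)"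
  shows "((\<lambda>s. edge_linear (Y s) (Z s) (Y1 s) (Z1 s)) has_real_derivative
      2 * edge_form (Y s) (Z s) (Y1 s) (Z1 s) + edge_linear (Y s) (Z s) Y2 Z2) (at s)"
proof -
  let ?D = "\<lambda>s. Z s - Y s" and ?D1 = "\<lambda>s. Z1 s - Y1 s"
  note D = has_vector_derivative_diff[OF Z(1) Y(1)] and D1 = has_vector_derivative_diff[OF Z(2) Y(2)]
  let ?g = "\<lambda>s. exp (- (3/2) * (Y s \<bullet> Y s + Z s \<bullet> Z s))"
  let ?b = "\<lambda>s. Y s \<bullet> Y1 s + Z s \<bullet> Z1 s"
  let ?b' = "(Y s \<bullet> Y2 + Y1 s \<bullet> Y1 s) + (Z s \<bullet> Z2 + Z1 s \<bullet> Z1 s)"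
  have "((\<lambda>s. ?g s * (2 * (?D s \<bullet> ?D1 s) - 3 * (?b s * (?D s \<bullet> ?D s)))) has_real_derivative
     ?g s * (- (3/2) * ((Y s \<bullet> Y1 s + Y1 s \<bullet> Y s) + (Z s \<bullet> Z1 s + Z1 s \<bullet> Z s))) * (2 * (?D s \<bullet> ?D1 s) - 3 * (?b s * (?D s \<bullet> ?D s)))
     + (2 * (?D s \<bullet> (Z2 - Y2) + ?D1 s \<bullet> ?D1 s) - 3 * (?b' * (?D s \<bullet> ?D s) + (?D s \<bullet> ?D1 s + ?D1 s \<bullet> ?D s) * ?b s)) * ?g s) (at s)"
    by (intro DERIV_mult DERIV_fun_exp DERIV_cmult DERIV_add DERIV_diff inner_has_real_derivative D D1 Y Z)
  moreover have "?g s * (- (3/2) * ((Y s \<bullet> Y1 s + Y1 s \<bullet> Y s) + (Z s \<bullet> Z1 s + Z1 s \<bullet> Z s))) * (2 * (?D s \<bullet> ?D1 s) - 3 * (?b s * (?D s \<bullet> ?D s)))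
     + (2 * (?D s \<bullet> (Z2 - Y2) + ?D1 s \<bullet> ?D1 s) - 3 * (?b' * (?D s \<bullet> ?D s) + (?D s \<bullet> ?D1 s + ?D1 s \<bullet> ?D s) * ?b s)) * ?g s
     = 2 * edge_form (Y s) (Z s) (Y1 s) (Z1 s) + edge_linear (Y s) (Z s) Y2 Z2"
    unfolding edge_form_def edge_linear_def conf_weight_def power2_norm_eq_inner
      inner_commute[of "Y1 s" "Y s"] inner_commute[of "Z1 s" "Z s"] inner_commute[of "Z1 s - Y1 s" "Z s - Y s"]
    by (simp add: algebra_simps power2_eq_square)
  ultimately have d: "((\<lambda>s. ?g s * (2 * (?D s \<bullet> ?D1 s) - 3 * (?b s * (?D s \<bullet> ?D s)))) has_real_derivative
     2 * edge_form (Y s) (Z s) (Y1 s) (Z1 s) + edge_linear (Y s) (Z s) Y2 Z2) (at s)" by (simp only:)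
  have "(\<lambda>s. edge_linear (Y s) (Z s) (Y1 s) (Z1 s)) = (\<lambda>s. ?g s * (2 * (?D s \<bullet> ?D1 s) - 3 * (?b s * (?D s \<bullet> ?D s))))"
    unfolding edge_linear_def conf_weight_def power2_norm_eq_inner by (simp only: mult.assoc)
  thus ?thesis using d by (simp only:)
qed

text \<open>Discrete integration by parts: each interior vertex collects the contributions of its
  two edges. It is applied once to velocities, for the Euler--Lagrange equation, and once to
  accelerations, in the second variation.\<close>

lemma edge_linear_sum:
  fixes y B :: "nat \<Rightarrow> 'v::euclidean_space"
  shows "(\<Sum>i<Suc n. edge_linear (y i) (y (Suc i)) (B i) (B (Suc i))) =
    edge_linear (y 0) (y 1) (B 0) 0 + edge_linear (y n) (y (Suc n)) 0 (B (Suc n))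
      - 2 * (\<Sum>i<n. B (Suc i) \<bullet> el_vector (y i) (y (Suc i)) (y (Suc (Suc i))))"
proof (induction n)
  case 0
  show ?case by (simp add: edge_linear_def inner_simps algebra_simps)
next
  case (Suc n)
  have "edge_linear (y n) (y (Suc n)) 0 (B (Suc n)) + edge_linear (y (Suc n)) (y (Suc (Suc n))) (B (Suc n)) (B (Suc (Suc n)))
     = edge_linear (y (Suc n)) (y (Suc (Suc n))) 0 (B (Suc (Suc n))) - 2 * (B (Suc n) \<bullet> el_vector (y n) (y (Suc n)) (y (Suc (Suc n))))"
    unfolding edge_linear_def el_vector_def
    by (simp add: inner_simps inner_commute algebra_simps)
  thus ?case using Suc.IH by (simp only: sum.lessThan_Suc[of _ "Suc n"] sum.lessThan_Suc[of _ n]) (simp add: algebra_simps)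
qed

section \<open>The circle, its universal cover, and compactness of chains\<close>

definition circ :: "real \<Rightarrow> real ^ 2" where
  "circ \<theta> = cos \<theta> *\<^sub>R axis 1 1 + sin \<theta> *\<^sub>R axis 2 1"

definition circ' :: "real \<Rightarrow> real ^ 2" where
  "circ' \<theta> = - sin \<theta> *\<^sub>R axis 1 1 + cos \<theta> *\<^sub>R axis 2 1"

lemma circ_nth: "circ \<theta> $ 1 = cos \<theta>" "circ \<theta> $ 2 = sin \<theta>" "circ' \<theta> $ 1 = - sin \<theta>" "circ' \<theta> $ 2 = cos \<theta>"
  by (simp_all add: circ_def circ'_def axis_def)

lemma norm_circ: "norm (circ \<theta>) = 1"
  by (simp add: norm_eq_1 inner_vec2 circ_nth flip: power2_eq_square)

lemma vec2_eqI: "v $ 1 = w $ 1 \<Longrightarrow> v $ 2 = w $ 2 \<Longrightarrow> v = (w :: real ^ 2)"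
  by (simp add: vec_eq_iff forall_2)

lemma tangent_circ:
  assumes "circ \<theta> \<bullet> w = 0"
  shows "w = (w \<bullet> circ' \<theta>) *\<^sub>R circ' \<theta>"
proof -
  have e: "cos \<theta> * w $ 1 + sin \<theta> * w $ 2 = 0" using assms by (simp add: inner_vec2 circ_nth)
  have s: "sin \<theta> * sin \<theta> + cos \<theta> * cos \<theta> = 1" using sin_cos_squared_add[of \<theta>] by (simp add: power2_eq_square)
  have "w $ 1 = (w $ 1 * - sin \<theta> + w $ 2 * cos \<theta>) * - sin \<theta>" using e s by algebra
  moreover have "w $ 2 = (w $ 1 * - sin \<theta> + w $ 2 * cos \<theta>) * cos \<theta>" using e s by algebra
  ultimately show ?thesis by (intro vec2_eqI) (simp_all add: inner_vec2 circ_nth)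
qed

lemma circ_arctan:
  "(circ \<theta> + b *\<^sub>R circ' \<theta>) /\<^sub>R norm (circ \<theta> + b *\<^sub>R circ' \<theta>) = circ (\<theta> + arctan b)"
proof -
  have s: "sin \<theta> * sin \<theta> + cos \<theta> * cos \<theta> = 1" using sin_cos_squared_add[of \<theta>] by (simp add: power2_eq_square)
  have "(circ \<theta> + b *\<^sub>R circ' \<theta>) \<bullet> (circ \<theta> + b *\<^sub>R circ' \<theta>) = 1 + b\<^sup>2"
    unfolding inner_vec2 using s by (simp add: circ_nth power2_eq_square) algebra
  hence n: "norm (circ \<theta> + b *\<^sub>R circ' \<theta>) = sqrt (1 + b\<^sup>2)" by (simp add: norm_eq_sqrt_inner)
  show ?thesis unfolding n
    by (rule vec2_eqI) (simp_all add: circ_nth cos_add sin_add cos_arctan sin_arctan field_simps)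
qed

lemma circ_diff_sq: "(norm (circ a - circ b))\<^sup>2 = 4 * (sin ((a - b) / 2))\<^sup>2"
proof -
  have "(norm (circ a - circ b))\<^sup>2 = (cos a - cos b)\<^sup>2 + (sin a - sin b)\<^sup>2"
    unfolding norm_vec2 by (simp add: circ_nth)
  also have "\<dots> = 2 - 2 * cos (a - b)"
    using sin_cos_squared_add[of a] sin_cos_squared_add[of b] by (simp add: cos_diff power2_eq_square algebra_simps)
  also have "cos (a - b) = 1 - 2 * (sin ((a - b) / 2))\<^sup>2" 
  proof -
    have "2 * ((a - b) / 2) = a - b" by simp
    from cos_double_sin[of "(a - b) / 2", unfolded this] show ?thesis .
  qed
  finally show ?thesis by simp
qed

lemma circ_diff_upper: "norm (circ a - circ b) \<le> \<bar>a - b\<bar>"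
proof (rule power2_le_imp_le)
  have "\<bar>sin ((a - b) / 2)\<bar> \<le> \<bar>(a - b) / 2\<bar>" by (rule abs_sin_x_le_abs_x)
  hence "(sin ((a - b) / 2))\<^sup>2 \<le> ((a - b) / 2)\<^sup>2" by (rule abs_le_square_iff[THEN iffD1])
  thus "(norm (circ a - circ b))\<^sup>2 \<le> \<bar>a - b\<bar>\<^sup>2" unfolding circ_diff_sq by (simp add: power2_eq_square)
qed simp

lemma circ_diff_lower:
  assumes "\<bar>a - b\<bar> \<le> 1"
  shows "\<bar>a - b\<bar> / 2 \<le> norm (circ a - circ b)"
proof (rule power2_le_imp_le)
  define t where "t = \<bar>a - b\<bar> / 2"
  have t: "0 \<le> t" "t \<le> 1" using assms by (auto simp: t_def)
  have "t / 2 \<le> sin t"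
  proof (cases "t = 0")
    case False
    hence "t > 0" using t by simp
    have "\<exists>x. 0 < x \<and> x < t \<and> sin t - sin 0 = (t - 0) * cos x"
      by (rule MVT2[OF \<open>t > 0\<close>]) (auto intro!: derivative_eq_intros)
    then obtain x where x: "0 < x" "x < t" "sin t = t * cos x" by auto
    have "cos (pi / 3) \<le> cos x"
      using x t pi_gt3 by (intro cos_monotone_0_pi_le) auto
    hence "1 / 2 \<le> cos x" by (simp add: cos_60)
    thus ?thesis using x(3) t mult_left_mono[of "1/2" "cos x" t] by simp
  qed simp
  hence "(t / 2)\<^sup>2 \<le> (sin t)\<^sup>2" using t by (intro power_mono) auto
  moreover have "(sin t)\<^sup>2 = (sin ((a - b) / 2))\<^sup>2"
  proof (cases "a \<ge> b")
    case False
    hence "t = - ((a - b) / 2)" unfolding t_def by linarith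
    thus ?thesis by (simp only: sin_minus power2_minus)
  qed (simp add: t_def)
  ultimately show "(\<bar>a - b\<bar> / 2)\<^sup>2 \<le> (norm (circ a - circ b))\<^sup>2"
    unfolding circ_diff_sq t_def by (simp add: power2_eq_square)
qed simp

lemma compact_function_space:
  fixes K :: "'a::topological_space set"
  assumes "compact K"
  shows "compact {c :: nat \<Rightarrow> 'a. \<forall>i. c i \<in> K}"
proof -
  have "compactin (product_topology (\<lambda>i::nat. euclidean :: 'a topology) UNIV) (PiE UNIV (\<lambda>i. K))"
    using assms by (simp add: compactin_PiE)
  moreover have "PiE UNIV (\<lambda>i::nat. K) = {c. \<forall>i. c i \<in> K}" by (auto simp: PiE_def)
  ultimately show ?thesis by (simp add: euclidean_product_topology)
qed

text \<open>The covering map of the product: the circle component is lifted to a real angle, so that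
  a chain can be forced to wind around many times.\<close>

definition chi :: "'a::euclidean_space \<times> real \<Rightarrow> 'a \<times> (real ^ 2)" where
  "chi q = (fst q, circ (snd q))"

definition step_ok :: "real \<Rightarrow> 'a::euclidean_space \<times> real \<Rightarrow> 'a \<times> real \<Rightarrow> bool" where
  "step_ok \<epsilon> q r \<longleftrightarrow> norm (fst r - fst q) \<le> \<epsilon> \<and> \<bar>snd r - snd q\<bar> \<le> \<epsilon>"

text \<open>Chains are continued constantly beyond index \<open>k\<close>, so that the set is a
  closed part of a product of compact sets. The angle difference \<open>w\<close> between the ends
  forces length, and the bound on the steps keeps consecutive vertices within reach of the local
  estimates.\<close>

definition admissible :: "nat \<Rightarrow> real \<Rightarrow> 'a::euclidean_space \<Rightarrow> real \<Rightarrow> (nat \<Rightarrow> 'a \<times> real) set" where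
  "admissible k \<epsilon> x0 w = {c. c 0 = (x0, 0) \<and> (\<forall>i\<ge>k. c i = (x0, w)) \<and> (\<forall>i. norm (fst (c i)) = 1)
     \<and> (\<forall>i<k. step_ok \<epsilon> (c i) (c (Suc i)))}"

lemma chi_sphere2: "norm (fst q) = 1 \<Longrightarrow> chi q \<in> sphere2"
  by (simp add: chi_def sphere2_iff norm_circ)

lemma chi_diff_upper: "norm (chi r - chi q) \<le> norm (fst r - fst q) + \<bar>snd r - snd q\<bar>"
proof -
  have "chi r - chi q = (fst r - fst q, circ (snd r) - circ (snd q))" by (simp add: chi_def)
  hence "norm (chi r - chi q) \<le> norm (fst r - fst q) + norm (circ (snd r) - circ (snd q))"
    by (simp only: norm_Pair_le)
  thus ?thesis using circ_diff_upper[of "snd r" "snd q"] by linarith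
qed

lemma chi_diff_lower:
  assumes "\<bar>snd r - snd q\<bar> \<le> 1"
  shows "norm (fst r - fst q) \<le> norm (chi r - chi q)" "\<bar>snd r - snd q\<bar> / 2 \<le> norm (chi r - chi q)"
proof -
  have eq: "chi r - chi q = (fst r - fst q, circ (snd r) - circ (snd q))" by (simp add: chi_def)
  show "norm (fst r - fst q) \<le> norm (chi r - chi q)" unfolding eq by (rule norm_fst_le)
  have "norm (circ (snd r) - circ (snd q)) \<le> norm (chi r - chi q)" unfolding eq by (rule norm_snd_le)
  thus "\<bar>snd r - snd q\<bar> / 2 \<le> norm (chi r - chi q)" using circ_diff_lower[OF assms] by linarith
qed

lemma compact_admissible:
  assumes \<epsilon>: "\<epsilon> \<ge> 0"
  shows "compact (admissible k \<epsilon> x0 w)"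
proof -
  \<comment> \<open>The first summand bounds the angles accumulated in \<open>k\<close> steps, the
    second the constant tail.\<close>
  define R where "R = real k * \<epsilon> + \<bar>w\<bar>"
  define K where "K = sphere (0 :: 'a) 1 \<times> cball (0 :: real) R"
  have coord: "continuous_on UNIV (\<lambda>c :: nat \<Rightarrow> 'a \<times> real. c i)" for i by (rule continuous_on_product_coordinates)
  have closed: "closed (admissible k \<epsilon> x0 w)"
  proof -
    have "admissible k \<epsilon> x0 w = {c. c 0 = (x0, 0)} \<inter> (\<Inter>i\<in>{k..}. {c. c i = (x0, w)}) \<inter> (\<Inter>i. {c. norm (fst (c i)) = 1})
      \<inter> (\<Inter>i\<in>{..<k}. {c. norm (fst (c (Suc i)) - fst (c i)) \<le> \<epsilon> \<and> \<bar>snd (c (Suc i)) - snd (c i)\<bar> \<le> \<epsilon>})"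
      by (auto simp: admissible_def step_ok_def)
    thus ?thesis
      by (simp only:) (intro closed_Int closed_INT ballI closed_Collect_eq closed_Collect_le closed_Collect_conj
          continuous_on_norm continuous_on_diff continuous_on_fst continuous_on_snd continuous_on_rabs continuous_on_const coord)
  qed
  have "admissible k \<epsilon> x0 w \<subseteq> {c. \<forall>i. c i \<in> K}"
  proof (intro subsetI CollectI allI)
    fix c i assume c: "c \<in> admissible k \<epsilon> x0 w"
    have "\<bar>snd (c j)\<bar> \<le> real j * \<epsilon>" if "j \<le> k" for j
      using that
    proof (induction j)
      case 0
      thus ?case using c by (simp add: admissible_def)
    next
      case (Suc j)
      have "\<bar>snd (c (Suc j)) - snd (c j)\<bar> \<le> \<epsilon>" using c Suc.prems by (auto simp: admissible_def step_ok_def)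
      thus ?case using Suc by (simp add: algebra_simps)
    qed
    note bound = this
    have "\<bar>snd (c i)\<bar> \<le> R"
    proof (cases "i \<le> k")
      case True
      have "real i * \<epsilon> \<le> real k * \<epsilon>" using True \<epsilon> by (intro mult_right_mono) auto
      thus ?thesis using bound[OF True] by (simp add: R_def)
    next
      case False
      hence "c i = (x0, w)" using c by (auto simp: admissible_def)
      thus ?thesis using \<epsilon> by (simp add: R_def)
    qed
    moreover have "norm (fst (c i)) = 1" using c by (auto simp: admissible_def)
    ultimately show "c i \<in> K" by (cases "c i") (simp add: K_def)
  qed
  moreover have "compact {c :: nat \<Rightarrow> 'a \<times> real. \<forall>i. c i \<in> K}"
    by (rule compact_function_space) (auto simp: K_def intro: compact_Times)
  ultimately show ?thesis using closed by (metis compact_Int_closed inf.absorb_iff2)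
qed

section \<open>Minimisers of the energy and the contradiction\<close>

locale core_circle = core f \<kappa> F for f :: "'a::euclidean_space \<times> (real ^ 2) \<Rightarrow> 'v::euclidean_space" and \<kappa> F
begin

definition "energy k c = (\<Sum>i<k. edge_energy (F (chi (c i))) (F (chi (c (Suc i)))))"

lemma isCont_chi: "isCont chi q"
proof -
  have "continuous_on UNIV (\<lambda>q :: 'a \<times> real. (fst q, cos (snd q) *\<^sub>R axis 1 1 + sin (snd q) *\<^sub>R axis 2 1 :: real ^ 2))"
    by (intro continuous_intros)
  thus ?thesis by (simp add: chi_def[abs_def] circ_def continuous_on_eq_continuous_at)
qed

lemma continuous_energy: "continuous_on (admissible k \<epsilon> x0 w) (energy k)"
proof -
  have Y: "continuous_on (admissible k \<epsilon> x0 w) (\<lambda>c. F (chi (c i)))" for i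
  proof (rule continuous_on_compose2[OF smooth_on_continuous[OF F]])
    have "continuous_on UNIV (\<lambda>c :: nat \<Rightarrow> 'a \<times> real. c i)" by (rule continuous_on_product_coordinates)
    hence "continuous_on (admissible k \<epsilon> x0 w) (\<lambda>c :: nat \<Rightarrow> 'a \<times> real. c i)" by (rule continuous_on_subset) simp
    note 1 = this
    have 2: "continuous_on UNIV (chi :: 'a \<times> real \<Rightarrow> _)"
      by (simp add: continuous_on_eq_continuous_at isCont_chi)
    show "continuous_on (admissible k \<epsilon> x0 w) (\<lambda>c. chi (c i))"
      by (rule continuous_on_compose2[OF 2 1]) simp
    show "(\<lambda>c. chi (c i)) ` admissible k \<epsilon> x0 w \<subseteq> dom2"
    proof (rule image_subsetI)
      fix c assume "c \<in> admissible k \<epsilon> x0 w"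
      hence "norm (fst (c i)) = 1" by (simp add: admissible_def)
      thus "chi (c i) \<in> dom2" by (intro in_dom2 chi_sphere2)
    qed
  qed
  show ?thesis unfolding energy_def edge_energy_def conf_weight_def by (intro continuous_intros Y)
qed

text \<open>The arctangent is chosen so that, under \<open>chi\<close>, the variation becomes the radial retraction of the
  straight line \<open>chi (c i) + s *\<^sub>R \<eta> i\<close>.\<close>

definition vary :: "(nat \<Rightarrow> 'a \<times> real) \<Rightarrow> (nat \<Rightarrow> 'a \<times> (real ^ 2)) \<Rightarrow> real \<Rightarrow> nat \<Rightarrow> 'a \<times> real" where
  "vary c \<eta> s i = ((fst (c i) + s *\<^sub>R fst (\<eta> i)) /\<^sub>R norm (fst (c i) + s *\<^sub>R fst (\<eta> i)),
     snd (c i) + arctan (s * (snd (\<eta> i) \<bullet> circ' (snd (c i)))))"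

lemma perturb_nonzero:
  fixes x u :: "'c::euclidean_space"
  assumes "norm x = 1" "x \<bullet> u = 0"
  shows "x + s *\<^sub>R u \<noteq> 0"
proof
  assume "x + s *\<^sub>R u = 0"
  hence "x \<bullet> (x + s *\<^sub>R u) = 0" by simp
  thus False using assms by (simp add: inner_simps norm_eq_1)
qed

context
  fixes c :: "nat \<Rightarrow> 'a \<times> real" and \<eta> :: "nat \<Rightarrow> 'a \<times> (real ^ 2)"
  assumes unit: "\<And>i. norm (fst (c i)) = 1"
    and tan: "\<And>i. \<eta> i \<in> tangent_space sphere2 (chi (c i))"
begin

lemma tan_inner: "fst (c i) \<bullet> fst (\<eta> i) = 0" "circ (snd (c i)) \<bullet> snd (\<eta> i) = 0"
  using tan[of i] unfolding tangent_space_sphere2[OF chi_sphere2[OF unit]] by (auto simp: chi_def)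

lemma chi_perturb_dom2: "chi (c i) + s *\<^sub>R \<eta> i \<in> dom2"
  using perturb_nonzero[OF unit tan_inner(1)] perturb_nonzero[OF norm_circ tan_inner(2)]
  by (simp add: dom2_def chi_def)

lemma chi_vary: "chi (vary c \<eta> s i) = retr (chi (c i) + s *\<^sub>R \<eta> i)"
proof -
  define b where "b = snd (\<eta> i) \<bullet> circ' (snd (c i))"
  have "snd (\<eta> i) = b *\<^sub>R circ' (snd (c i))" unfolding b_def by (rule tangent_circ[OF tan_inner(2)])
  hence "circ (snd (c i)) + s *\<^sub>R snd (\<eta> i) = circ (snd (c i)) + (s * b) *\<^sub>R circ' (snd (c i))" by simp
  hence "(circ (snd (c i)) + s *\<^sub>R snd (\<eta> i)) /\<^sub>R norm (circ (snd (c i)) + s *\<^sub>R snd (\<eta> i)) = circ (snd (c i) + arctan (s * b))"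
    using circ_arctan by metis
  thus ?thesis by (simp add: chi_def vary_def retr_def b_def)
qed

lemma F_vary: "F (chi (vary c \<eta> s i)) = F (chi (c i) + s *\<^sub>R \<eta> i)"
proof -
  have "retr (retr (chi (c i) + s *\<^sub>R \<eta> i)) = retr (chi (c i) + s *\<^sub>R \<eta> i)"
    by (rule retr_id[OF retr_in[OF chi_perturb_dom2]])
  thus ?thesis unfolding chi_vary F_def hom_ext_def by simp
qed

lemma isCont_vary: "isCont (\<lambda>s. vary c \<eta> s i) 0"
proof -
  have "continuous_on UNIV (\<lambda>s. vary c \<eta> s i)"
    unfolding vary_def using perturb_nonzero[OF unit tan_inner(1)]
    by (intro continuous_intros) (auto intro!: continuous_intros)
  thus ?thesis by (simp add: continuous_on_eq_continuous_at)
qed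

lemma vary_0: "vary c \<eta> 0 i = c i"
  by (simp add: vary_def unit prod_eq_iff)

lemma vary_unit: "norm (fst (vary c \<eta> s i)) = 1"
  using perturb_nonzero[OF unit tan_inner(1), of i s] by (simp add: vary_def)

lemma vary_fixed: "\<eta> i = 0 \<Longrightarrow> vary c \<eta> s i = c i"
  by (simp add: vary_def unit prod_eq_iff)

end

text \<open>Strict step inequalities make the constraint inactive, so small variations of either
  sign stay admissible.\<close>

lemma vary_admissible:
  assumes c: "c \<in> admissible k \<epsilon> x0 w" and tan: "\<And>i. \<eta> i \<in> tangent_space sphere2 (chi (c i))"
    and ends: "\<eta> 0 = 0" "\<And>i. i \<ge> k \<Longrightarrow> \<eta> i = 0"
    and strict: "\<And>i. i < k \<Longrightarrow> norm (fst (c (Suc i)) - fst (c i)) < \<epsilon> \<and> \<bar>snd (c (Suc i)) - snd (c i)\<bar> < \<epsilon>"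
  shows "\<exists>e>0. \<forall>s. \<bar>s\<bar> < e \<longrightarrow> vary c \<eta> s \<in> admissible k \<epsilon> x0 w"
proof -
  have unit: "\<And>i. norm (fst (c i)) = 1" using c by (simp add: admissible_def)
  note lem = unit tan
  have "\<forall>\<^sub>F s in nhds 0. step_ok \<epsilon> (vary c \<eta> s i) (vary c \<eta> s (Suc i))" if i: "i < k" for i
  proof -
    have t: "((\<lambda>s. vary c \<eta> s j) \<longlongrightarrow> c j) (nhds 0)" for j
      using isCont_vary[of c \<eta> j, OF lem] tendsto_at_iff_tendsto_nhds[of "\<lambda>s. vary c \<eta> s j" 0] vary_0[of c \<eta> j, OF lem]
      by (simp add: isCont_def)
    have "((\<lambda>s. norm (fst (vary c \<eta> s (Suc i)) - fst (vary c \<eta> s i))) \<longlongrightarrow> norm (fst (c (Suc i)) - fst (c i))) (nhds 0)"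
      "((\<lambda>s. \<bar>snd (vary c \<eta> s (Suc i)) - snd (vary c \<eta> s i)\<bar>) \<longlongrightarrow> \<bar>snd (c (Suc i)) - snd (c i)\<bar>) (nhds 0)"
      by (intro tendsto_intros t)+
    from order_tendstoD(2)[OF this(1), of \<epsilon>] order_tendstoD(2)[OF this(2), of \<epsilon>] strict[OF i]
    have "\<forall>\<^sub>F s in nhds 0. norm (fst (vary c \<eta> s (Suc i)) - fst (vary c \<eta> s i)) < \<epsilon>"
      "\<forall>\<^sub>F s in nhds 0. \<bar>snd (vary c \<eta> s (Suc i)) - snd (vary c \<eta> s i)\<bar> < \<epsilon>" by auto
    thus ?thesis by eventually_elim (simp add: step_ok_def)
  qed
  hence "\<forall>\<^sub>F s in nhds 0. \<forall>i\<in>{..<k}. step_ok \<epsilon> (vary c \<eta> s i) (vary c \<eta> s (Suc i))"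
    by (intro eventually_ball_finite) auto
  then obtain e where e: "e > 0" "\<And>s. dist s 0 < e \<Longrightarrow> \<forall>i\<in>{..<k}. step_ok \<epsilon> (vary c \<eta> s i) (vary c \<eta> s (Suc i))"
    unfolding eventually_nhds_metric by blast
  show ?thesis
  proof (intro exI[of _ e] conjI allI impI e(1))
    fix s assume s: "\<bar>s\<bar> < e"
    have "vary c \<eta> s 0 = (x0, 0)"
      using vary_fixed[of c \<eta> 0 s, OF lem] ends c by (simp add: admissible_def)
    moreover have "vary c \<eta> s i = (x0, w)" if "i \<ge> k" for i
      using vary_fixed[of c \<eta> i s, OF lem] ends(2)[OF that] c that by (simp add: admissible_def)
    moreover have "norm (fst (vary c \<eta> s i)) = 1" for i by (rule vary_unit[OF lem])
    ultimately show "vary c \<eta> s \<in> admissible k \<epsilon> x0 w"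
      using e(2)[of s] s by (auto simp: admissible_def dist_real_def)
  qed
qed

text \<open>As \<open>F\<close> is constant along rays, the varied vertices are mapped to
  \<open>F (p i + s \<eta> i)\<close>. In the domain these are straight lines, so the image curves
  have acceleration \<open>D2 F (p i) (\<eta> i) (\<eta> i)\<close>.\<close>

lemma minimizer_variations:
  assumes c: "c \<in> admissible k \<epsilon> x0 w" and min: "\<And>c'. c' \<in> admissible k \<epsilon> x0 w \<Longrightarrow> energy k c \<le> energy k c'"
    and strict: "\<And>i. i < k \<Longrightarrow> norm (fst (c (Suc i)) - fst (c i)) < \<epsilon> \<and> \<bar>snd (c (Suc i)) - snd (c i)\<bar> < \<epsilon>"
    and tan: "\<And>i. \<eta> i \<in> tangent_space sphere2 (chi (c i))"
    and ends: "\<eta> 0 = 0" "\<And>i. i \<ge> k \<Longrightarrow> \<eta> i = 0"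
  defines "p \<equiv> \<lambda>i. chi (c i)"
  shows "(\<Sum>i<k. edge_linear (F (p i)) (F (p (Suc i))) (D1 F (p i) (\<eta> i)) (D1 F (p (Suc i)) (\<eta> (Suc i)))) = 0"
    and "0 \<le> (\<Sum>i<k. 2 * edge_form (F (p i)) (F (p (Suc i))) (D1 F (p i) (\<eta> i)) (D1 F (p (Suc i)) (\<eta> (Suc i)))
       + edge_linear (F (p i)) (F (p (Suc i))) (D2 F (p i) (\<eta> i) (\<eta> i)) (D2 F (p (Suc i)) (\<eta> (Suc i)) (\<eta> (Suc i))))"
proof -
  have unit: "\<And>i. norm (fst (c i)) = 1" using c by (simp add: admissible_def)
  note lem = unit tan
  obtain e where e: "e > 0" "\<And>s. \<bar>s\<bar> < e \<Longrightarrow> vary c \<eta> s \<in> admissible k \<epsilon> x0 w"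
    using vary_admissible[OF c tan ends strict] by blast
  define Y where "Y = (\<lambda>i s. F (p i + s *\<^sub>R \<eta> i))"
  define Y1 where "Y1 = (\<lambda>i s. D1 F (p i + s *\<^sub>R \<eta> i) (\<eta> i))"
  have dom: "p i + s *\<^sub>R \<eta> i \<in> dom2" for i s unfolding p_def by (rule chi_perturb_dom2[OF lem])
  have dY: "(Y i has_vector_derivative Y1 i s) (at s)" for i s
    unfolding Y_def Y1_def by (rule D1_curve[OF F dom line_derivative])
  have dY1: "(Y1 i has_vector_derivative D2 F (p i) (\<eta> i) (\<eta> i)) (at 0)" for i
    unfolding Y1_def
    using D1_curve[where c = "\<lambda>s. p i + s *\<^sub>R \<eta> i" and s = 0, OF smooth_on_derivative[OF F, of "\<eta> i"] dom line_derivative]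
    by simp
  define h where "h = (\<lambda>s. \<Sum>i<k. edge_energy (Y i s) (Y (Suc i) s))"
  define h1 where "h1 = (\<lambda>s. \<Sum>i<k. edge_linear (Y i s) (Y (Suc i) s) (Y1 i s) (Y1 (Suc i) s))"
  have h: "h s = energy k (vary c \<eta> s)" for s
    unfolding h_def energy_def Y_def p_def by (simp add: F_vary[OF lem])
  have v0: "vary c \<eta> 0 = c" by (rule ext) (rule vary_0[OF lem])
  have h1: "(h has_real_derivative h1 s) (at s)" for s
    unfolding h_def h1_def by (intro DERIV_sum edge_energy_derivative dY)
  have h2: "(h1 has_real_derivative (\<Sum>i<k. 2 * edge_form (Y i 0) (Y (Suc i) 0) (Y1 i 0) (Y1 (Suc i) 0)
       + edge_linear (Y i 0) (Y (Suc i) 0) (D2 F (p i) (\<eta> i) (\<eta> i)) (D2 F (p (Suc i)) (\<eta> (Suc i)) (\<eta> (Suc i))))) (at 0)"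
    unfolding h1_def by (intro DERIV_sum edge_linear_derivative dY dY1)
  have "h 0 \<le> h s" if "\<bar>s\<bar> < e" for s
    unfolding h v0 by (rule min[OF e(2)[OF that]])
  note test = second_derivative_test[OF e(1) h1 h2 this]
  show "(\<Sum>i<k. edge_linear (F (p i)) (F (p (Suc i))) (D1 F (p i) (\<eta> i)) (D1 F (p (Suc i)) (\<eta> (Suc i)))) = 0"
    using test(1) by (simp add: h1_def Y_def Y1_def)
  show "0 \<le> (\<Sum>i<k. 2 * edge_form (F (p i)) (F (p (Suc i))) (D1 F (p i) (\<eta> i)) (D1 F (p (Suc i)) (\<eta> (Suc i)))
       + edge_linear (F (p i)) (F (p (Suc i))) (D2 F (p i) (\<eta> i) (\<eta> i)) (D2 F (p (Suc i)) (\<eta> (Suc i)) (\<eta> (Suc i))))"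
    using test(2) by (simp add: Y_def Y1_def)
qed

definition "critical_chain \<epsilon> E L k c \<longleftrightarrow> (\<forall>i. norm (fst (c i)) = 1)
     \<and> (\<forall>i<k. norm (chi (c (Suc i)) - chi (c i)) \<le> \<epsilon>)
     \<and> (\<Sum>i<k. conf_weight (F (chi (c i))) (F (chi (c (Suc i)))) * (norm (F (chi (c (Suc i))) - F (chi (c i))))\<^sup>2) \<le> E / real k
     \<and> L \<le> (\<Sum>i<k. norm (F (chi (c (Suc i))) - F (chi (c i))))
     \<and> (\<forall>\<eta>. (\<forall>i. \<eta> i \<in> tangent_space sphere2 (chi (c i))) \<longrightarrow> \<eta> 0 = 0 \<longrightarrow> (\<forall>i\<ge>k. \<eta> i = 0) \<longrightarrow>
         (\<Sum>i<k. edge_linear (F (chi (c i))) (F (chi (c (Suc i)))) (D1 F (chi (c i)) (\<eta> i)) (D1 F (chi (c (Suc i))) (\<eta> (Suc i)))) = 0 \<and>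
         0 \<le> (\<Sum>i<k. 2 * edge_form (F (chi (c i))) (F (chi (c (Suc i)))) (D1 F (chi (c i)) (\<eta> i)) (D1 F (chi (c (Suc i))) (\<eta> (Suc i)))
           + edge_linear (F (chi (c i))) (F (chi (c (Suc i)))) (D2 F (chi (c i)) (\<eta> i) (\<eta> i)) (D2 F (chi (c (Suc i))) (\<eta> (Suc i)) (\<eta> (Suc i)))))"

text \<open>The uniformly rotating chain \<open>cr\<close> shows that the minimal energy is O(1/k).
  Hence every edge of a minimiser has length O(1/sqrt k), and for large \<open>k\<close> the step
  constraint is inactive. The angle still has to travel the distance \<open>w\<close>, which bounds
  the length from below.\<close>

lemma minimizing_chain:
  fixes x0 :: 'a
  assumes x0: "norm x0 = 1" and w: "w > 0"
    and \<epsilon>: "\<epsilon> > 0" and m: "m > 0" and C: "C > 0"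
    and low: "\<And>p p'. p \<in> sphere2 \<Longrightarrow> p' \<in> sphere2 \<Longrightarrow> norm (p' - p) \<le> \<epsilon> \<Longrightarrow> m * norm (p' - p) \<le> norm (F p' - F p)"
    and up: "\<And>p p'. p \<in> sphere2 \<Longrightarrow> p' \<in> sphere2 \<Longrightarrow> norm (p' - p) \<le> \<epsilon> \<Longrightarrow> norm (F p' - F p) \<le> C * norm (p' - p)"
  shows "\<exists>l0>0. \<forall>l\<ge>l0. \<exists>c. critical_chain \<epsilon> ((C * w)\<^sup>2) (m * w / 2) (8 * l) c"
proof -
  \<comment> \<open>Half of \<open>\<epsilon>\<close>, because sphere step and angle step add up; at
    most 1, as required by \<open>chi_diff_lower\<close>.\<close>
  define \<epsilon>1 where "\<epsilon>1 = min 1 (\<epsilon> / 2)"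
  have e1: "\<epsilon>1 > 0" "\<epsilon>1 \<le> 1" "2 * \<epsilon>1 \<le> \<epsilon>" using \<epsilon> by (auto simp: \<epsilon>1_def)
  define M where "M = (C * w)\<^sup>2"
  have M: "M \<ge> 0" by (simp add: M_def)
  obtain l1 :: nat where l1: "w / \<epsilon>1 \<le> real l1" using real_arch_simple by blast
  obtain l2 :: nat where l2: "exp 3 * M / (m * \<epsilon>1 / 2)\<^sup>2 < real l2" using reals_Archimedean2 by blast
  define l0 where "l0 = Suc (max l1 l2)"
  show ?thesis
  proof (intro exI[of _ l0] conjI allI impI)
    show "l0 > 0" by (simp add: l0_def)
    fix l assume l: "l \<ge> l0"
    define k where "k = 8 * l"
    have l': "l > 0" "k > 0" "l1 \<le> k" "l2 \<le> k" using l by (auto simp: l0_def k_def)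
    define cr where "cr = (\<lambda>i. (x0, w * real (min i k) / real k))"
    have step_cr: "\<bar>snd (cr (Suc i)) - snd (cr i)\<bar> = w / real k" if "i < k" for i
    proof -
      have "snd (cr (Suc i)) - snd (cr i) = w / real k"
        using that l' by (simp add: cr_def min_def field_simps)
      thus ?thesis using w l' by simp
    qed
    have wk: "w / real k \<le> \<epsilon>1"
    proof -
      have "w / \<epsilon>1 \<le> real k" using l1 l'(3) by (meson of_nat_le_iff order_trans)
      thus ?thesis using e1 l' by (simp add: field_simps)
    qed
    have cr: "cr \<in> admissible k \<epsilon>1 x0 w"
      unfolding admissible_def step_ok_def
      using step_cr wk l' x0 e1 by (auto simp: cr_def)
    obtain c where c: "c \<in> admissible k \<epsilon>1 x0 w" and min: "\<And>c'. c' \<in> admissible k \<epsilon>1 x0 w \<Longrightarrow> energy k c \<le> energy k c'"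
      using continuous_attains_inf[OF compact_admissible _ continuous_energy] cr e1 by (metis empty_iff less_imp_le)
    have unit: "\<And>i. norm (fst (c i)) = 1" using c by (simp add: admissible_def)
    have dist_le: "norm (chi (c' (Suc i)) - chi (c' i)) \<le> \<epsilon>" if "c' \<in> admissible k \<epsilon>1 x0 w" "i < k" for c' :: "nat \<Rightarrow> 'a \<times> real" and i
    proof -
      have "step_ok \<epsilon>1 (c' i) (c' (Suc i))" using that by (simp add: admissible_def)
      thus ?thesis using chi_diff_upper[of "c' (Suc i)" "c' i"] e1 unfolding step_ok_def by linarith
    qed
    have ball': "norm (F (chi (c' i))) \<le> 1" if "c' \<in> admissible k \<epsilon>1 x0 w" for c' :: "nat \<Rightarrow> 'a \<times> real" and i
      using that by (intro ball chi_sphere2) (simp add: admissible_def)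
    have wt: "exp (- 3) \<le> conf_weight a b" "conf_weight a b \<le> 1" if "norm a \<le> 1" "norm b \<le> 1" for a b :: 'v
    proof -
      have "(norm a)\<^sup>2 \<le> 1" "(norm b)\<^sup>2 \<le> 1" using that by (auto intro: power_le_one)
      thus "exp (- 3) \<le> conf_weight a b" "conf_weight a b \<le> 1"
        unfolding conf_weight_def by (auto intro: add_nonneg_nonneg)
    qed
    have "energy k cr \<le> (\<Sum>i<k. (C * (w / real k))\<^sup>2)"
      unfolding energy_def
    proof (rule sum_mono)
      fix i assume "i \<in> {..<k}"
      hence i: "i < k" by simp
      have s: "chi (cr j) \<in> sphere2" for j using x0 by (intro chi_sphere2) (simp add: cr_def)
      have "norm (F (chi (cr (Suc i))) - F (chi (cr i))) \<le> C * norm (chi (cr (Suc i)) - chi (cr i))"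
        by (rule up[OF s s dist_le[OF cr i]])
      also have "\<dots> \<le> C * (w / real k)"
        using chi_diff_upper[of "cr (Suc i)" "cr i"] step_cr[OF i] C by (intro mult_left_mono) (auto simp: cr_def)
      finally have "(norm (F (chi (cr (Suc i))) - F (chi (cr i))))\<^sup>2 \<le> (C * (w / real k))\<^sup>2" by (intro power_mono) auto
      moreover have "edge_energy (F (chi (cr i))) (F (chi (cr (Suc i)))) \<le> 1 * (norm (F (chi (cr (Suc i))) - F (chi (cr i))))\<^sup>2"
        unfolding edge_energy_def by (intro mult_right_mono wt ball'[OF cr]) auto
      ultimately show "edge_energy (F (chi (cr i))) (F (chi (cr (Suc i)))) \<le> (C * (w / real k))\<^sup>2" by simp
    qed
    also have "\<dots> = M / real k" using l' by (simp add: M_def power2_eq_square)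
    finally have en: "energy k c \<le> M / real k" using min[OF cr] by linarith
    have strict: "norm (fst (c (Suc i)) - fst (c i)) < \<epsilon>1 \<and> \<bar>snd (c (Suc i)) - snd (c i)\<bar> < \<epsilon>1" if i: "i < k" for i
    proof -
      let ?\<Delta> = "norm (F (chi (c (Suc i))) - F (chi (c i)))" and ?\<delta> = "norm (chi (c (Suc i)) - chi (c i))"
      have "exp (- 3) * ?\<Delta>\<^sup>2 \<le> edge_energy (F (chi (c i))) (F (chi (c (Suc i))))"
        unfolding edge_energy_def by (intro mult_right_mono wt ball'[OF c]) auto
      also have "\<dots> \<le> energy k c"
        unfolding energy_def
        by (rule member_le_sum) (use i in \<open>auto simp: edge_energy_def conf_weight_pos less_imp_le\<close>)
      finally have "exp (- 3) * ?\<Delta>\<^sup>2 \<le> M / real k" using en by linarith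
      hence "exp 3 * (exp (- 3) * ?\<Delta>\<^sup>2) \<le> exp 3 * (M / real k)" by (rule mult_left_mono) simp
      hence "?\<Delta>\<^sup>2 \<le> exp 3 * (M / real k)" by (simp only: mult.assoc[symmetric] exp_minus_inverse mult_1_left)
      also have "\<dots> < (m * \<epsilon>1 / 2)\<^sup>2"
      proof -
        have pos: "(m * \<epsilon>1 / 2)\<^sup>2 > 0" using m e1 by simp
        have "exp 3 * M / (m * \<epsilon>1 / 2)\<^sup>2 < real k" using l2 l'(4) by (meson of_nat_le_iff order_less_le_trans)
        hence "exp 3 * M < real k * (m * \<epsilon>1 / 2)\<^sup>2" using pos by (simp only: pos_divide_less_eq)
        thus ?thesis using l' by (simp add: field_simps)
      qed
      finally have "?\<Delta> < m * \<epsilon>1 / 2" by (rule power_less_imp_less_base) (use m e1 in simp)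
      moreover have "m * ?\<delta> \<le> ?\<Delta>" by (rule low[OF chi_sphere2[OF unit] chi_sphere2[OF unit] dist_le[OF c i]])
      ultimately have "m * ?\<delta> < m * (\<epsilon>1 / 2)" by simp
      hence d: "?\<delta> < \<epsilon>1 / 2" using m by (simp add: mult_less_cancel_left_pos)
      have "\<bar>snd (c (Suc i)) - snd (c i)\<bar> \<le> 1" using c i e1 by (auto simp: admissible_def step_ok_def)
      note low' = chi_diff_lower[OF this]
      have "norm (fst (c (Suc i)) - fst (c i)) < \<epsilon>1" using low'(1) d e1 by linarith
      moreover have "\<bar>snd (c (Suc i)) - snd (c i)\<bar> < \<epsilon>1" using order.strict_trans1[OF low'(2) d] by simp
      ultimately show ?thesis ..
    qed
    show "\<exists>c. critical_chain \<epsilon> ((C * w)\<^sup>2) (m * w / 2) (8 * l) c"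
      unfolding k_def[symmetric] critical_chain_def
    proof (intro exI[of _ c] conjI[OF _ conjI[OF _ conjI[OF _ conjI]]] allI impI unit dist_le[OF c])
      show "(\<Sum>i<k. conf_weight (F (chi (c i))) (F (chi (c (Suc i)))) * (norm (F (chi (c (Suc i))) - F (chi (c i))))\<^sup>2) \<le> (C * w)\<^sup>2 / real k"
        using en by (simp add: energy_def edge_energy_def M_def)
      have "w = \<bar>snd (c k) - snd (c 0)\<bar>" using c w by (simp add: admissible_def)
      also have "snd (c k) - snd (c 0) = (\<Sum>i<k. snd (c (Suc i)) - snd (c i))" by (rule sum_lessThan_telescope[of "\<lambda>i. snd (c i)" k, symmetric])
      also have "\<bar>\<dots>\<bar> \<le> (\<Sum>i<k. \<bar>snd (c (Suc i)) - snd (c i)\<bar>)" by (rule sum_abs)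
      finally have "m * w / 2 \<le> (\<Sum>i<k. m * (\<bar>snd (c (Suc i)) - snd (c i)\<bar> / 2))"
        using m by (simp add: sum_distrib_left[symmetric] sum_divide_distrib[symmetric])
      also have "\<dots> \<le> (\<Sum>i<k. norm (F (chi (c (Suc i))) - F (chi (c i))))"
      proof (rule sum_mono)
        fix i assume "i \<in> {..<k}"
        hence i: "i < k" by simp
        have "\<bar>snd (c (Suc i)) - snd (c i)\<bar> \<le> 1" using strict[OF i] e1 by linarith
        from mult_left_mono[OF chi_diff_lower(2)[OF this], of m] m
        have "m * (\<bar>snd (c (Suc i)) - snd (c i)\<bar> / 2) \<le> m * norm (chi (c (Suc i)) - chi (c i))" by simp
        also have "\<dots> \<le> norm (F (chi (c (Suc i))) - F (chi (c i)))"
          by (rule low[OF chi_sphere2[OF unit] chi_sphere2[OF unit] dist_le[OF c i]])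
        finally show "m * (\<bar>snd (c (Suc i)) - snd (c i)\<bar> / 2) \<le> norm (F (chi (c (Suc i))) - F (chi (c i)))" .
      qed
      finally show "m * w / 2 \<le> (\<Sum>i<k. norm (F (chi (c (Suc i))) - F (chi (c i))))" .
      fix \<eta> :: "nat \<Rightarrow> 'a \<times> (real ^ 2)"
      assume \<eta>: "\<forall>i. \<eta> i \<in> tangent_space sphere2 (chi (c i))" "\<eta> 0 = 0" "\<forall>i\<ge>k. \<eta> i = 0"
      show "(\<Sum>i<k. edge_linear (F (chi (c i))) (F (chi (c (Suc i)))) (D1 F (chi (c i)) (\<eta> i)) (D1 F (chi (c (Suc i))) (\<eta> (Suc i)))) = 0 \<and>
         0 \<le> (\<Sum>i<k. 2 * edge_form (F (chi (c i))) (F (chi (c (Suc i)))) (D1 F (chi (c i)) (\<eta> i)) (D1 F (chi (c (Suc i))) (\<eta> (Suc i)))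
           + edge_linear (F (chi (c i))) (F (chi (c (Suc i)))) (D2 F (chi (c i)) (\<eta> i) (\<eta> i)) (D2 F (chi (c (Suc i))) (\<eta> (Suc i)) (\<eta> (Suc i))))"
        using minimizer_variations[OF c min strict, of \<eta>] \<eta> by blast
    qed
  qed
qed

text \<open>One direction in each factor gives a two-dimensional space of tangent vectors, in which
  one linear condition leaves a nonzero solution.\<close>

lemma tangent_image_perp:
  assumes p: "p \<in> sphere2" and dim: "DIM('a) \<ge> 2"
  shows "\<exists>e. Pr p e = e \<and> norm e = 1 \<and> e \<bullet> a = 0"
proof -
  note p' = in_dom2[OF p]
  obtain u0 :: 'a where u0: "u0 \<noteq> 0" "orthogonal (fst p) u0"
    using orthogonal_to_vector_exists[OF dim, of "fst p"] by blast
  obtain w0 :: "real ^ 2" where w0: "w0 \<noteq> 0" "orthogonal (snd p) w0"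
    using orthogonal_to_vector_exists[of "snd p"] by auto
  define u where "u = (u0, 0 :: real ^ 2)"
  define w where "w = (0 :: 'a, w0)"
  have tan: "u \<in> tangent_space sphere2 p" "w \<in> tangent_space sphere2 p"
    using u0 w0 by (auto simp: tangent_space_sphere2[OF p] u_def w_def orthogonal_def)
  define b where "b = (if D1 F p u \<bullet> a = 0 \<and> D1 F p w \<bullet> a = 0 then u else (D1 F p w \<bullet> a) *\<^sub>R u - (D1 F p u \<bullet> a) *\<^sub>R w)"
  have bt: "b \<in> tangent_space sphere2 p"
    unfolding b_def by (auto intro!: subspace_diff[OF tangent_subspace[OF p]] subspace_scale[OF tangent_subspace[OF p]] tan)
  have b0: "b \<noteq> 0" using u0 w0 by (auto simp: b_def u_def w_def prod_eq_iff zero_prod_def)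
  have ba: "D1 F p b \<bullet> a = 0"
    by (auto simp: b_def linear_diff[OF lin1[OF p']] linear_scale[OF lin1[OF p']] inner_diff_left)
  define v where "v = D1 F p b"
  have v0: "v \<noteq> 0" using inj[OF p bt] b0 by (auto simp: v_def)
  have "Pr p ((1 / norm v) *\<^sub>R v) = (1 / norm v) *\<^sub>R v"
    using Pr_D1[OF p', of b] by (simp add: linear_scale[OF orth_proj_linear[OF Pr[OF p']]] v_def)
  thus ?thesis using v0 ba by (intro exI[of _ "(1 / norm v) *\<^sub>R v"]) (simp add: v_def)
qed

lemma curvature_not_small:
  assumes dim: "DIM('a) \<ge> 2"
  shows False
proof -
  obtain \<epsilon> m C where \<epsilon>: "\<epsilon> > 0" and m: "m > 0" and C: "C > 0"
    and low: "\<And>p p'. p \<in> sphere2 \<Longrightarrow> p' \<in> sphere2 \<Longrightarrow> norm (p' - p) \<le> \<epsilon> \<Longrightarrow> m * norm (p' - p) \<le> norm (F p' - F p)"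
    and up: "\<And>p p'. p \<in> sphere2 \<Longrightarrow> p' \<in> sphere2 \<Longrightarrow> norm (p' - p) \<le> \<epsilon> \<Longrightarrow> norm (F p' - F p) \<le> C * norm (p' - p)"
    and N: "\<And>p p'. p \<in> sphere2 \<Longrightarrow> p' \<in> sphere2 \<Longrightarrow> norm (p' - p) \<le> \<epsilon> \<Longrightarrow>
       norm (F p' - F p - Pr p (F p' - F p) - (1/2) *\<^sub>R Af p (F p' - F p) (F p' - F p)) \<le> C * norm (F p' - F p) ^ 3"
    and T: "\<And>p p' v. p \<in> sphere2 \<Longrightarrow> p' \<in> sphere2 \<Longrightarrow> norm (p' - p) \<le> \<epsilon> \<Longrightarrow> Pr p' v = v \<Longrightarrow>
       norm (v - Pr p v - Af p (F p' - F p) v) \<le> C * (norm (F p' - F p))\<^sup>2 * norm v"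
    by (rule local_geometry, rule that)
  obtain x0 :: 'a where x0: "norm x0 = 1" using vector_choose_size[of 1] by auto
  \<comment> \<open>The length needed for a contradiction. Since \<open>\<Lambda> \<ge> 1\<close>,
    the linear inequality implies the one with \<open>\<Lambda>\<^sup>2\<close>; the angle
    \<open>w\<close> below is chosen so that the guaranteed length \<open>m * w / 2\<close> is
    \<open>\<Lambda>\<close>.\<close>
  define \<Lambda> where "\<Lambda> = 256 * exp 3 / (3 - 2 * \<kappa>\<^sup>2) + 1"
  have k3: "3 - 2 * \<kappa>\<^sup>2 > 0" using \<kappa>(2) by simp
  have "(3 - 2 * \<kappa>\<^sup>2) * \<Lambda> = 256 * exp 3 + (3 - 2 * \<kappa>\<^sup>2)"
    using k3 by (simp only: \<Lambda>_def distrib_left nonzero_mult_div_cancel_left times_divide_eq_right mult_1_right less_irrefl)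
  moreover have "\<Lambda> \<ge> 1" using k3 by (simp add: \<Lambda>_def)
  ultimately have \<Lambda>: "\<Lambda> \<ge> 1" "256 * exp 3 < (3 - 2 * \<kappa>\<^sup>2) * \<Lambda>"
    using k3 by (simp_all only: less_add_same_cancel1)
  define w where "w = 2 * \<Lambda> / m"
  have w: "w > 0" "m * w / 2 = \<Lambda>" using \<Lambda> m by (auto simp: w_def)
  have "\<exists>l0>0. \<forall>l\<ge>l0. \<exists>c. critical_chain \<epsilon> ((C * w)\<^sup>2) (m * w / 2) (8 * l) c"
    by (rule minimizing_chain[OF x0 w(1) \<epsilon> m C]) (fact low up)+
  then obtain l0 where l0: "l0 > 0" and ex: "\<forall>l\<ge>l0. \<exists>c. critical_chain \<epsilon> ((C * w)\<^sup>2) (m * w / 2) (8 * l) c"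
    by (elim exE conjE) (rule that)
  from ex have "\<forall>l. \<exists>c. l \<ge> l0 \<longrightarrow> critical_chain \<epsilon> ((C * w)\<^sup>2) (m * w / 2) (8 * l) c" by meson
  from choice[OF this] obtain c where "\<forall>l. l \<ge> l0 \<longrightarrow> critical_chain \<epsilon> ((C * w)\<^sup>2) (m * w / 2) (8 * l) (c l)" ..
  hence c: "critical_chain \<epsilon> ((C * w)\<^sup>2) (m * w / 2) (8 * l) (c l)" if "l \<ge> l0" for l using that by blast
  define p where "p = (\<lambda>l i. chi (c l i))"
  have p: "p l i \<in> sphere2" if "l0 \<le> l" for l i
    unfolding p_def using c[OF that] by (intro chi_sphere2) (simp add: critical_chain_def)
  have step: "norm (p l (Suc i) - p l i) \<le> \<epsilon>" "norm (p l i - p l (Suc i)) \<le> \<epsilon>" if "l0 \<le> l" "i < 8 * l" for l i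
    unfolding p_def using c[OF that(1)] that(2) by (simp_all add: critical_chain_def norm_minus_commute)
  have energy: "(\<Sum>i<8 * l. conf_weight (F (p l i)) (F (p l (Suc i))) * (norm (F (p l (Suc i)) - F (p l i)))\<^sup>2) \<le> (C * w)\<^sup>2 / real (8 * l)" if "l0 \<le> l" for l
    using c[OF that] unfolding p_def critical_chain_def by (elim conjE)
  have length: "\<Lambda> \<le> (\<Sum>i<8 * l. norm (F (p l (Suc i)) - F (p l i)))" if "l0 \<le> l" for l
    using c[OF that] unfolding p_def critical_chain_def w(2) by (elim conjE)
  have vars: "(\<Sum>i<8 * l. edge_linear (F (p l i)) (F (p l (Suc i))) (D1 F (p l i) (\<eta> i)) (D1 F (p l (Suc i)) (\<eta> (Suc i)))) = 0 \<and>
         0 \<le> (\<Sum>i<8 * l. 2 * edge_form (F (p l i)) (F (p l (Suc i))) (D1 F (p l i) (\<eta> i)) (D1 F (p l (Suc i)) (\<eta> (Suc i)))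
           + edge_linear (F (p l i)) (F (p l (Suc i))) (D2 F (p l i) (\<eta> i) (\<eta> i)) (D2 F (p l (Suc i)) (\<eta> (Suc i)) (\<eta> (Suc i))))"
    if "l0 \<le> l" "\<And>i. \<eta> i \<in> tangent_space sphere2 (p l i)" "\<eta> 0 = 0" "\<And>i. i \<ge> 8 * l \<Longrightarrow> \<eta> i = 0" for l \<eta>
    proof -
    from c[OF that(1)] have "(\<forall>i. \<eta> i \<in> tangent_space sphere2 (p l i)) \<longrightarrow> \<eta> 0 = 0 \<longrightarrow> (\<forall>i\<ge>8 * l. \<eta> i = 0) \<longrightarrow> ?thesis"
      unfolding critical_chain_def p_def by (elim conjE) (erule spec)
    thus ?thesis using that(2-4) by simp
  qed
  have zero: "D1 F (p l i) 0 = 0" "D2 F (p l i) 0 0 = 0" if "l0 \<le> l" for l i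
    using linear_0[OF lin1[OF in_dom2[OF p[OF that]]]] linear_0[OF lin2(1)[OF in_dom2[OF p[OF that]]]] by auto
  have el_perp: "D1 F (p l (Suc i)) u \<bullet> el_vector (F (p l i)) (F (p l (Suc i))) (F (p l (Suc (Suc i)))) = 0"
    if l: "l0 \<le> l" and i: "Suc i < 8 * l" for l i u
  proof -
    obtain n where n: "8 * l = Suc n" using i by (cases "8 * l") auto
    \<comment> \<open>A variation of a single vertex isolates one Euler--Lagrange equation.\<close>
    define \<eta> where "\<eta> = (\<lambda>j. if j = Suc i then tang (p l (Suc i)) u else 0)"
    have "(\<Sum>j<8 * l. edge_linear (F (p l j)) (F (p l (Suc j))) (D1 F (p l j) (\<eta> j)) (D1 F (p l (Suc j)) (\<eta> (Suc j)))) = 0"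
      using vars[OF l, of \<eta>] i tang_in[OF p[OF l]] subspace_0[OF tangent_subspace[OF p[OF l]]]
      by (auto simp: \<eta>_def)
    moreover have "D1 F (p l 0) (\<eta> 0) = 0" "D1 F (p l (Suc n)) (\<eta> (Suc n)) = 0"
      using i n by (auto simp: \<eta>_def zero[OF l])
    ultimately have "(\<Sum>j<n. D1 F (p l (Suc j)) (\<eta> (Suc j)) \<bullet> el_vector (F (p l j)) (F (p l (Suc j))) (F (p l (Suc (Suc j))))) = 0"
      unfolding n edge_linear_sum[where y = "\<lambda>j. F (p l j)" and B = "\<lambda>j. D1 F (p l j) (\<eta> j)"]
      by (simp add: edge_linear_def)
    also have "(\<Sum>j<n. D1 F (p l (Suc j)) (\<eta> (Suc j)) \<bullet> el_vector (F (p l j)) (F (p l (Suc j))) (F (p l (Suc (Suc j)))))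
       = (\<Sum>j<n. if j = i then D1 F (p l (Suc i)) u \<bullet> el_vector (F (p l i)) (F (p l (Suc i))) (F (p l (Suc (Suc i)))) else 0)"
      by (rule sum.cong) (auto simp: \<eta>_def zero[OF l] F_tang[OF in_dom2[OF p[OF l]]])
    finally show ?thesis using i n by simp
  qed
  interpret chains \<kappa> C "(C * w)\<^sup>2" \<Lambda> "\<lambda>l i. F (p l i)" "\<lambda>l i. Pr (p l i)" "\<lambda>l i. Af (p l i)" "\<lambda>l i. F (p l (Suc i)) - F (p l i)" l0
  proof unfold_locales
    show "0 \<le> \<kappa>" "2 * \<kappa>\<^sup>2 < 3" "0 \<le> C" "0 < \<Lambda>" "0 < l0" using \<kappa> C \<Lambda> l0 by auto
    have "\<Lambda> * 1 \<le> \<Lambda> * \<Lambda>" using \<Lambda> by (intro mult_left_mono) auto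
    hence "(3 - 2 * \<kappa>\<^sup>2) * \<Lambda> \<le> (3 - 2 * \<kappa>\<^sup>2) * \<Lambda>\<^sup>2" using k3 by (intro mult_left_mono) (auto simp: power2_eq_square)
    thus "256 * exp 3 < (3 - 2 * \<kappa>\<^sup>2) * \<Lambda>\<^sup>2" using \<Lambda>(2) by linarith
    show "(\<lambda>l i. F (p l (Suc i)) - F (p l i)) = (\<lambda>l i. F (p l (Suc i)) - F (p l i))" ..
    fix l assume l: "l0 \<le> l"
    show "\<exists>e. Pr (p l 0) e = e \<and> norm e = 1 \<and> e \<bullet> a = 0" for a by (rule tangent_image_perp[OF p[OF l] dim])
    show "(\<Sum>i<8 * l. conf_weight (F (p l i)) (F (p l (Suc i))) * (norm (F (p l (Suc i)) - F (p l i)))\<^sup>2) \<le> (C * w)\<^sup>2 / real (8 * l)"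
      by (rule energy[OF l])
    show "\<Lambda> \<le> (\<Sum>i<8 * l. norm (F (p l (Suc i)) - F (p l i)))" by (rule length[OF l])
    show "orth_proj (Pr (p l i))" for i by (rule Pr[OF in_dom2[OF p[OF l]]])
    show "normal_form \<kappa> (Pr (p l i)) (Af (p l i))" for i by (rule Af_normal_form[OF p[OF l]])
    show "norm (F (p l i)) \<le> 1" for i by (rule ball[OF p[OF l]])
    show "(norm (Pr (p l i) (F (p l i))))\<^sup>2 \<le> (1 - (norm (F (p l i)))\<^sup>2) / 2" for i by (rule tangential_part_bound[OF p[OF l]])
    show "Pr (p l (Suc i)) (el_vector (F (p l i)) (F (p l (Suc i))) (F (p l (Suc (Suc i))))) = 0" if i: "Suc i < 8 * l" for i
    proof (rule sub_proj_unique[OF sub[OF in_dom2[OF p[OF l]]]])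
      show "0 \<in> tangent_image F (p l (Suc i))" by (rule subspace_0[OF sub[OF in_dom2[OF p[OF l]]]])
      fix z assume "z \<in> tangent_image F (p l (Suc i))"
      thus "z \<bullet> (el_vector (F (p l i)) (F (p l (Suc i))) (F (p l (Suc (Suc i)))) - 0) = 0"
        using el_perp[OF l i] by (auto simp: tangent_image_def)
    qed
    fix i assume i: "i < 8 * l"
    note q = p[OF l, of i] and q' = p[OF l, of "Suc i"]
    have mn: "F (p l i) - F (p l (Suc i)) = - (F (p l (Suc i)) - F (p l i))" by simp
    note As = normal_form_simps[OF Af_normal_form[OF q'] Pr[OF in_dom2[OF q']] \<kappa>(1)]
    show "norm (F (p l (Suc i)) - F (p l i) - Pr (p l i) (F (p l (Suc i)) - F (p l i)) - (1/2) *\<^sub>R Af (p l i) (F (p l (Suc i)) - F (p l i)) (F (p l (Suc i)) - F (p l i)))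
      \<le> C * norm (F (p l (Suc i)) - F (p l i)) ^ 3"
      by (rule N[OF q q' step(1)[OF l i]])
    show "norm (F (p l (Suc i)) - F (p l i) - Pr (p l (Suc i)) (F (p l (Suc i)) - F (p l i)) + (1/2) *\<^sub>R Af (p l (Suc i)) (F (p l (Suc i)) - F (p l i)) (F (p l (Suc i)) - F (p l i)))
      \<le> C * norm (F (p l (Suc i)) - F (p l i)) ^ 3"
    proof -
      define d where "d = F (p l (Suc i)) - F (p l i)"
      have "norm (- d - Pr (p l (Suc i)) (- d) - (1/2) *\<^sub>R Af (p l (Suc i)) (- d) (- d)) \<le> C * norm (- d) ^ 3"
        using N[OF q' q step(2)[OF l i]] unfolding mn d_def[symmetric] .
      moreover have "- d - Pr (p l (Suc i)) (- d) - (1/2) *\<^sub>R Af (p l (Suc i)) (- d) (- d) = - (d - Pr (p l (Suc i)) d + (1/2) *\<^sub>R Af (p l (Suc i)) d d)"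
        by (simp add: As linear_neg[OF orth_proj_linear[OF Pr[OF in_dom2[OF q']]]])
      ultimately show ?thesis unfolding d_def[symmetric] by (simp only: norm_minus_cancel)
    qed
    fix a
    show "norm (a - Pr (p l (Suc i)) a - Af (p l (Suc i)) (- (F (p l (Suc i)) - F (p l i))) a) \<le> C * (norm (F (p l (Suc i)) - F (p l i)))\<^sup>2 * norm a"
      if "Pr (p l i) a = a"
      using T[OF q' q step(2)[OF l i] that] unfolding mn norm_minus_cancel .
    show "norm (a - Pr (p l i) a - Af (p l i) (F (p l (Suc i)) - F (p l i)) a) \<le> C * (norm (F (p l (Suc i)) - F (p l i)))\<^sup>2 * norm a"
      if "Pr (p l (Suc i)) a = a"
      by (rule T[OF q q' step(1)[OF l i] that])
  next
    fix l V assume l: "l0 \<le> l" and V: "\<And>i. i \<le> 8 * l \<Longrightarrow> Pr (p l i) (V i) = V i" and V0: "V 0 = 0" "V (8 * l) = 0"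
    obtain n where n: "8 * l = Suc n" using l l0 by (cases "8 * l") auto
    define \<eta> where "\<eta> = (\<lambda>i. if i \<le> 8 * l then Lf (p l i) (V i) else 0)"
    have L0: "Lf (p l i) 0 = 0" for i by (rule linear_0[OF Lf_linear[OF p[OF l]]])
    have D\<eta>: "D1 F (p l i) (\<eta> i) = V i" if "i \<le> 8 * l" for i
      using that by (simp add: \<eta>_def D1_Lf[OF p[OF l]] V)
    have tan: "\<eta> i \<in> tangent_space sphere2 (p l i)" for i
      unfolding \<eta>_def using Lf_tangent[OF p[OF l]] subspace_0[OF tangent_subspace[OF p[OF l]]] by simp
    have e0: "\<eta> 0 = 0" "\<And>i. i \<ge> 8 * l \<Longrightarrow> \<eta> i = 0"
      using V0 L0 by (auto simp: \<eta>_def le_less)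
    define B where "B = (\<lambda>i. D2 F (p l i) (\<eta> i) (\<eta> i))"
    have B0: "B 0 = 0" "B (Suc n) = 0" using e0 n by (auto simp: B_def zero[OF l])
    have "0 \<le> (\<Sum>i<8 * l. 2 * edge_form (F (p l i)) (F (p l (Suc i))) (D1 F (p l i) (\<eta> i)) (D1 F (p l (Suc i)) (\<eta> (Suc i))))
        + (\<Sum>i<8 * l. edge_linear (F (p l i)) (F (p l (Suc i))) (B i) (B (Suc i)))"
      using vars[OF l tan e0] unfolding B_def sum.distrib by blast
    also have "(\<Sum>i<8 * l. 2 * edge_form (F (p l i)) (F (p l (Suc i))) (D1 F (p l i) (\<eta> i)) (D1 F (p l (Suc i)) (\<eta> (Suc i))))
       = 2 * (\<Sum>i<8 * l. edge_form (F (p l i)) (F (p l (Suc i))) (V i) (V (Suc i)))"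
      unfolding sum_distrib_left by (rule sum.cong) (auto simp: D\<eta>)
    also have "(\<Sum>i<8 * l. edge_linear (F (p l i)) (F (p l (Suc i))) (B i) (B (Suc i))) =
       - 2 * (\<Sum>i<n. B (Suc i) \<bullet> el_vector (F (p l i)) (F (p l (Suc i))) (F (p l (Suc (Suc i)))))"
      unfolding n edge_linear_sum[where y = "\<lambda>i. F (p l i)"] B0 by (simp add: edge_linear_def)
    also have "(\<Sum>i<n. B (Suc i) \<bullet> el_vector (F (p l i)) (F (p l (Suc i))) (F (p l (Suc (Suc i))))) =
       (\<Sum>i<n. Af (p l (Suc i)) (V (Suc i)) (V (Suc i)) \<bullet> el_vector (F (p l i)) (F (p l (Suc i))) (F (p l (Suc (Suc i)))))"
    proof (rule sum.cong)
      fix i assume "i \<in> {..<n}"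
      hence i: "Suc i < 8 * l" using n by simp
      note q' = in_dom2[OF p[OF l, of "Suc i"]]
      let ?S = "el_vector (F (p l i)) (F (p l (Suc i))) (F (p l (Suc (Suc i))))"
      \<comment> \<open>The acceleration \<open>B\<close> depends on the extension of the immersion,
        but its tangential part is annihilated by the Euler--Lagrange vector; what remains is the
        second fundamental form.\<close>
      have "Pr (p l (Suc i)) (B (Suc i)) \<in> tangent_image F (p l (Suc i))" by (rule sub_proj_in[OF sub[OF q']])
      hence "Pr (p l (Suc i)) (B (Suc i)) \<bullet> ?S = 0" using el_perp[OF l i] by (auto simp: tangent_image_def)
      hence "B (Suc i) \<bullet> ?S = Nr (p l (Suc i)) (B (Suc i)) \<bullet> ?S" by (simp add: Nr_def inner_diff_left)
      also have "Nr (p l (Suc i)) (B (Suc i)) = Af (p l (Suc i)) (V (Suc i)) (V (Suc i))"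
        unfolding B_def using Nr_D2[OF p[OF l]] D\<eta>[of "Suc i"] i by simp
      finally show "B (Suc i) \<bullet> ?S = Af (p l (Suc i)) (V (Suc i)) (V (Suc i)) \<bullet> ?S" .
    qed simp
    finally show "0 \<le> (\<Sum>i<8 * l. edge_form (F (p l i)) (F (p l (Suc i))) (V i) (V (Suc i)))
        - (\<Sum>i<8 * l - 1. Af (p l (Suc i)) (V (Suc i)) (V (Suc i)) \<bullet> el_vector (F (p l i)) (F (p l (Suc i))) (F (p l (Suc (Suc i)))))"
      using n by simp
  qed
  show False by (rule no_long_critical_chains)
qed

end

text \<open>An infimum below the threshold gives an immersion with a bound \<open>\<kappa>\<close>
  strictly below \<open>sqrt (3/2)\<close>, hence the positive constant
  \<open>3 - 2 \<kappa>\<^sup>2\<close> needed for the argument of Bonnet and Myers.\<close>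

lemma minimal_curvature_ge:
  assumes "DIM('a::euclidean_space) \<ge> 2"
  shows "ereal (sqrt (3/2)) \<le> minimal_curvature TYPE('v::euclidean_space) (sphere (0::'a) 1 \<times> sphere (0::real ^ 2) 1)"
proof (rule ccontr)
  assume "\<not> ?thesis"
  hence "minimal_curvature TYPE('v) (sphere2 :: ('a \<times> (real ^ 2)) set) < ereal (sqrt (3/2))" by (simp add: sphere2_def)
  then obtain f :: "'a \<times> (real ^ 2) \<Rightarrow> 'v" where f: "smooth_immersion_on sphere2 f" "f ` sphere2 \<subseteq> cball 0 1"
      "max_normal_curvature sphere2 f < ereal (sqrt (3/2))"
    unfolding minimal_curvature_def INF_less_iff by auto
  obtain \<kappa>' where \<kappa>': "max_normal_curvature sphere2 f < ereal \<kappa>'" "ereal \<kappa>' < ereal (sqrt (3/2))"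
    using ereal_dense2[OF f(3)] by auto
  \<comment> \<open>A bound obtained by density need not be known to be nonnegative; the maximum
    with 0 is still below \<open>sqrt (3/2)\<close>.\<close>
  define \<kappa> where "\<kappa> = max 0 \<kappa>'"
  have \<kappa>: "\<kappa> \<ge> 0" "\<kappa> < sqrt (3/2)" "\<kappa>' \<le> \<kappa>" using \<kappa>'(2) by (auto simp: \<kappa>_def)
  have smooth: "smooth_map_on sphere2 f" using f(1) by (simp add: smooth_immersion_on_def)
  define F where "F = hom_ext f"
  have F: "smooth_on dom2 F" unfolding F_def by (rule smooth_hom_ext[OF smooth])
  have lin: "linear (D1 F p)" if "p \<in> sphere2" for p
    by (rule D1_linear[OF F]) (use that sphere2_subset in blast)
  have diff: "differential sphere2 f p u = D1 F p u" if "p \<in> sphere2" "u \<in> tangent_space sphere2 p" for p u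
    unfolding F_def by (rule differential_sphere2[OF smooth that])
  have tsub: "subspace (tangent_space sphere2 p)" if "p \<in> sphere2" for p :: "'a \<times> (real ^ 2)"
    unfolding subspace_def tangent_space_sphere2[OF that] by (auto simp: inner_add_right)
  interpret core_circle f \<kappa> F
  proof unfold_locales
    show "F = hom_ext f" by (rule F_def)
    show "smooth_on dom2 F" by (rule F)
    show "0 \<le> \<kappa>" by (rule \<kappa>)
    have "\<kappa>\<^sup>2 < (sqrt (3/2))\<^sup>2" using \<kappa> by (intro power_strict_mono) auto
    thus "2 * \<kappa>\<^sup>2 < 3" by simp
    fix p :: "'a \<times> (real ^ 2)" assume p: "p \<in> sphere2"
    show "norm (F p) \<le> 1" using f(2) p by (auto simp: F_def hom_ext_eq)
    fix u assume u: "u \<in> tangent_space sphere2 p"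
    have inj0: "u = 0" if "D1 F p u = 0"
    proof -
      have inj: "inj_on (differential sphere2 f p) (tangent_space sphere2 p)"
        using f(1) p by (auto simp: smooth_immersion_on_def)
      have z: "0 \<in> tangent_space sphere2 p" by (rule subspace_0[OF tsub[OF p]])
      show ?thesis
        by (rule inj_onD[OF inj _ u z]) (simp add: diff[OF p u] diff[OF p z] that linear_0[OF lin[OF p]])
    qed
    show "u = 0" if "D1 F p u = 0" by (rule inj0[OF that])
    have pd: "p \<in> dom2" by (rule subsetD[OF sphere2_subset p])
    show "norm (D2 F p u u - sub_proj (tangent_image F p) (D2 F p u u)) \<le> \<kappa> * (norm (D1 F p u))\<^sup>2"
    proof (cases "D1 F p u = 0")
      case True
      have "u = 0" by (rule inj0[OF True])
      moreover have "D2 F p 0 0 = 0" by (rule linear_0[OF D2_linear1[OF open_dom2 F pd]])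
      moreover have "sub_proj (tangent_image F p) 0 = 0"
        by (rule linear_0[OF sub_proj_linear[OF subspace_tangent_image[OF F pd]]])
      ultimately show ?thesis using \<kappa> by simp
    next
      case False
      define n where "n = norm (D1 F p u)"
      have n: "n > 0" using False by (simp add: n_def)
      define v where "v = (1 / n) *\<^sub>R u"
      have v: "v \<in> tangent_space sphere2 p" unfolding v_def by (rule subspace_scale[OF tsub[OF p] u])
      have "D1 F p v = (1 / n) *\<^sub>R D1 F p u" unfolding v_def by (rule linear_scale[OF lin[OF p]])
      hence "norm (differential sphere2 f p v) = 1" using n by (simp add: diff[OF p v] n_def)
      hence "ereal (norm (second_fundamental_form sphere2 f p v v)) \<le> max_normal_curvature sphere2 f"
        unfolding max_normal_curvature_def using p v
        by (intro SUP_upper2[of "(p, v)"]) auto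
      hence "ereal (norm (second_fundamental_form sphere2 f p v v)) < ereal \<kappa>'"
        using \<kappa>'(1) by (rule order.strict_trans1)
      hence "norm (second_fundamental_form sphere2 f p v v) \<le> \<kappa>"
        using \<kappa>(3) by simp
      hence le: "norm (D2 F p v v - sub_proj (tangent_image F p) (D2 F p v v)) \<le> \<kappa>"
        unfolding second_fundamental_form_eq[OF smooth p v v] F_def[symmetric] .
      have u_eq: "u = n *\<^sub>R v" using n by (simp add: v_def)
      have "D2 F p u u = n\<^sup>2 *\<^sub>R D2 F p v v"
        unfolding u_eq linear_scale[OF D2_linear1[OF open_dom2 F pd]] linear_scale[OF D2_linear2[OF F pd]]
        by (simp add: power2_eq_square)
      hence "D2 F p u u - sub_proj (tangent_image F p) (D2 F p u u) = n\<^sup>2 *\<^sub>R (D2 F p v v - sub_proj (tangent_image F p) (D2 F p v v))"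
        by (simp add: linear_scale[OF sub_proj_linear[OF subspace_tangent_image[OF F pd]]] scaleR_diff_right)
      hence "norm (D2 F p u u - sub_proj (tangent_image F p) (D2 F p u u)) = n\<^sup>2 * norm (D2 F p v v - sub_proj (tangent_image F p) (D2 F p v v))"
        by simp
      also have "\<dots> \<le> n\<^sup>2 * \<kappa>" by (intro mult_left_mono le) simp
      finally show ?thesis by (simp add: n_def mult.commute)
    qed
  qed
  show False by (rule curvature_not_small[OF assms])
qed

theorem theorem1:
  fixes n N :: nat
  assumes "n \<ge> 2"
    and "N \<ge> 2 * n + 4"
    and "CARD('m::finite) = n + 1"
    and "CARD('k::finite) = N"
  shows "minimal_curvature TYPE(real ^ 'k)
           (sphere (0 :: real ^ 'm) 1 \<times> sphere (0 :: real ^ 2) 1) = ereal (sqrt (3 / 2))"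
proof (rule antisym)
  show "minimal_curvature TYPE(real ^ 'k) (sphere (0 :: real ^ 'm) 1 \<times> sphere (0 :: real ^ 2) 1) \<le> ereal (sqrt (3 / 2))"
    by (rule minimal_curvature_le) (use assms in simp)
  show "ereal (sqrt (3 / 2)) \<le> minimal_curvature TYPE(real ^ 'k) (sphere (0 :: real ^ 'm) 1 \<times> sphere (0 :: real ^ 2) 1)"
    by (rule minimal_curvature_ge) (use assms in simp)
qed

end
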